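(* Let $K\ge 1$ and let $g:\mathbb{C}\to\mathbb{C}$ be a $K$-quasiconformal map (a homeomorphism of $\mathbb{C}$ onto $\mathbb{C}$) which is conformal on the upper half-plane $\mathbb{H}=\{z\in\mathbb{C}:\operatorname{Im} z>0\}$. Then the domain $\Omega=g(\mathbb{H})$ satisfies $$\frac{K+1}{2K}\le h(\Omega)\le\frac{K+1}{2}.$$ Both bounds are sharp: for every $K\ge1$, within the class of all such $g$, the lower bound $\frac{K+1}{2K}$ cannot be replaced by a larger number and the upper bound $\frac{K+1}{2}$ cannot be replaced by a smaller number.
   Context: For a domain $\Omega\subset\mathbb{C}$, the Hardy number $h(\Omega)\in[0,+\infty]$ is $$h(\Omega)=\sup\{p>0:\ |z|^p \text{ has a harmonic majorant on } \Omega\},$$ with $\sup\emptyset=0$; here a harmonic majorant of $|z|^p$ on $\Omega$ is a harmonic function $u$ on $\Omega$ with $|z|^p\le u(z)$ for all $z\in\Omega$. Let $K\ge1$ and $k=(K-1)/(K+1)$. A homeomorphism $g$ of a subdomain $D$ of the Riemann sphere $\widehat{\mathbb{C}}=\mathbb{C}\cup\{\infty\}$ onto another subdomain $D'$ is called $K$-quasiconformal if $g$ has locally square integrable partial derivatives (in the sense of distributions) on $D\setminus\{\infty,g^{-1}(\infty)\}$ such that $|g_{\bar z}|\le k|g_z|$ almost everywhere on $D$. *)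

theory Defs
  imports "HOL-Analysis.Analysis"
begin

definition dir_deriv :: "'a::real_normed_vector \<Rightarrow> ('a \<Rightarrow> 'b::real_normed_vector) \<Rightarrow> 'a \<Rightarrow> 'b"
  where "dir_deriv v f x = frechet_derivative f (at x) v"

text \<open>Intended for open \<open>S\<close> in a finite-dimensional space, where this is the usual class
  \<open>C\<^sup>n(S)\<close>.\<close>

primrec Ck_on :: "nat \<Rightarrow> ('a::real_normed_vector \<Rightarrow> 'b::real_normed_vector) \<Rightarrow> 'a set \<Rightarrow> bool"
  where
    "Ck_on 0 f S \<longleftrightarrow> continuous_on S f"
  | "Ck_on (Suc n) f S \<longleftrightarrow>
       (\<forall>x\<in>S. f differentiable (at x)) \<and> (\<forall>v. Ck_on n (dir_deriv v f) S)"

definition planar_domain :: "complex set \<Rightarrow> bool"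
  where "planar_domain D \<longleftrightarrow> open D \<and> connected D \<and> D \<noteq> {}"

definition harmonic_on :: "(complex \<Rightarrow> real) \<Rightarrow> complex set \<Rightarrow> bool"
  where "harmonic_on u \<Omega> \<longleftrightarrow> Ck_on 2 u \<Omega> \<and>
    (\<forall>z\<in>\<Omega>. dir_deriv 1 (dir_deriv 1 u) z + dir_deriv \<i> (dir_deriv \<i> u) z = 0)"

definition harmonic_majorant :: "(complex \<Rightarrow> real) \<Rightarrow> (complex \<Rightarrow> real) \<Rightarrow> complex set \<Rightarrow> bool"
  where "harmonic_majorant u f \<Omega> \<longleftrightarrow> harmonic_on u \<Omega> \<and> (\<forall>z\<in>\<Omega>. f z \<le> u z)"

text \<open>In \<^typ>\<open>ennreal\<close> the supremum of the empty set is \<open>0\<close>, as required.\<close>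

definition hardy_number :: "complex set \<Rightarrow> ennreal"
  where "hardy_number \<Omega> =
    Sup {ennreal p | p. p > 0 \<and> (\<exists>u. harmonic_majorant u (\<lambda>z. norm z powr p) \<Omega>)}"

definition test_function_on :: "complex set \<Rightarrow> (complex \<Rightarrow> real) \<Rightarrow> bool"
  where "test_function_on D \<phi> \<longleftrightarrow>
    (\<forall>n. Ck_on n \<phi> UNIV) \<and> compact (closure {z. \<phi> z \<noteq> 0}) \<and> closure {z. \<phi> z \<noteq> 0} \<subseteq> D"

definition locally_square_integrable_on :: "(complex \<Rightarrow> complex) \<Rightarrow> complex set \<Rightarrow> bool"
  where "locally_square_integrable_on f D \<longleftrightarrow>
    set_borel_measurable lebesgue D f \<and>
    (\<forall>C. compact C \<and> C \<subseteq> D \<longrightarrow> set_integrable lebesgue C (\<lambda>z. (norm (f z))\<^sup>2))"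

text \<open>\<open>w\<close> is the distributional derivative of \<open>f\<close> on \<open>D\<close> in the direction \<open>v\<close>; meaningful for
  \<open>f\<close> and \<open>w\<close> locally integrable on \<open>D\<close>.\<close>

definition distr_deriv_on ::
    "complex set \<Rightarrow> complex \<Rightarrow> (complex \<Rightarrow> complex) \<Rightarrow> (complex \<Rightarrow> complex) \<Rightarrow> bool"
  where "distr_deriv_on D v f w \<longleftrightarrow>
    (\<forall>\<phi>. test_function_on D \<phi> \<longrightarrow>
      (LINT z:D|lebesgue. dir_deriv v \<phi> z *\<^sub>R f z) = - (LINT z:D|lebesgue. \<phi> z *\<^sub>R w z))"

text \<open>Quasiconformal maps between domains of the finite plane, so that the exceptional points
  \<open>\<infinity>\<close> and \<open>g\<^sup>-\<^sup>1(\<infinity>)\<close> of the definition on the sphere do not occur. The functions \<open>gx\<close>, \<open>gy\<close> are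
  the distributional partial derivatives of \<open>g\<close> (unique almost everywhere), and
  \<open>(gx + \<i> gy)/2\<close>, \<open>(gx - \<i> gy)/2\<close> are the derivatives of \<open>g\<close> with respect to the conjugate
  of \<open>z\<close> and to \<open>z\<close>.\<close>

definition quasiconformal ::
    "real \<Rightarrow> complex set \<Rightarrow> complex set \<Rightarrow> (complex \<Rightarrow> complex) \<Rightarrow> bool"
  where "quasiconformal K D D' g \<longleftrightarrow>
    planar_domain D \<and> planar_domain D' \<and> (\<exists>h. homeomorphism D D' g h) \<and>
    (\<exists>gx gy.
      locally_square_integrable_on gx D \<and> locally_square_integrable_on gy D \<and>
      distr_deriv_on D 1 g gx \<and> distr_deriv_on D \<i> g gy \<and>
      (AE z in lebesgue. z \<in> D \<longrightarrow>
        norm ((gx z + \<i> * gy z) / 2) \<le> (K - 1) / (K + 1) * norm ((gx z - \<i> * gy z) / 2)))"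

definition conformal_on :: "(complex \<Rightarrow> complex) \<Rightarrow> complex set \<Rightarrow> bool"
  where "conformal_on g D \<longleftrightarrow> g holomorphic_on D \<and> inj_on g D"

definition upper_half_plane :: "complex set"
  where "upper_half_plane = {z. Im z > 0}"

definition qc_conformal_maps :: "real \<Rightarrow> (complex \<Rightarrow> complex) set"
  where "qc_conformal_maps K =
    {g. quasiconformal K UNIV UNIV g \<and> conformal_on g upper_half_plane}"

end

theory Submission
  imports Defs "HOL-Complex_Analysis.Complex_Analysis"
begin

text \<open>
  Put \<open>k = (K - 1) / (K + 1)\<close> and \<open>G z = g z - g 0\<close>. The two bounds for
  the Hardy number are \<open>1 / (1 + k)\<close> and \<open>1 / (1 - k)\<close>, and they come
  from the growth estimate \<open>c |z| powr (1 - k) \<le> |G z| \<le> C |z| powr (1 + k)\<close>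
  for large \<open>z\<close> (\<open>qc_growth\<close>). A general \<open>K\<close>-quasiconformal
  map of the plane only satisfies this with exponents \<open>1 / K\<close> and \<open>K\<close>;
  the gain is due to conformality on the upper half-plane, where the distortion is
  \<open>1\<close> instead of \<open>K\<close>.

  The growth estimate is proved by the length-area method, with the annuli replaced by logarithmic
  cut-offs. Let \<open>Phi A B w\<close> be a trapezoidal function of \<open>ln |w|\<close> which
  equals \<open>1\<close> on \<open>[A, B]\<close>, and write \<open>c = B - A + 1\<close> for its
  integral. Three integrals are known exactly, because they are integrals of exact forms
  \<open>d (X d arg)\<close>: the logarithmic area \<open>Phi (G) d ln |G| \<and> d arg G\<close>
  over the plane has absolute value \<open>2 \<pi> c\<close> (\<open>area_bound\<close>); so has
  \<open>Phi (z) d ln |z| \<and> d arg G\<close> (\<open>angle_limit\<close>), as the image of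
  every circle winds once around \<open>0\<close>; and
  \<open>Phi (G) d ln |G| \<and> d arg z\<close> over each of the two half-planes is
  \<open>\<pi> c\<close> (\<open>half_square_limit\<close>), as every ray runs from
  \<open>0\<close> to infinity. If the domain cut-off with parameters \<open>A', B'\<close> and
  the image cut-off with parameters \<open>A, B\<close> are nested, the arithmetic-geometric mean
  inequality bounds the second and third integrand pointwise by the two area densities, with the
  distortion \<open>1\<close> above and \<open>K\<close> below the real axis. The best weights
  give \<open>(1 + 1 / K) c \<le> 2 c'\<close> and \<open>2 c' \<le> (1 + K) c\<close>
  (\<open>annulus_width_upper\<close>, \<open>annulus_width_lower\<close>), which are the two
  growth exponents. That the cut-offs can be nested with a loss of only a bounded additive amount
  is the weak quasi-symmetry \<open>|G z| \<le> C |G w|\<close> for \<open>|w| \<ge> 5 |z|\<close>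
  (\<open>quasi_symmetry\<close>), itself a length-area estimate: if it failed badly,
  \<open>ln |G|\<close> would oscillate too much on all squares between \<open>z\<close> and
  \<open>w\<close> for the bound on the logarithmic area.

  As \<open>g\<close> has only distributional derivatives, the identities are proved for
  mollifications of \<open>g\<close>, which converge locally uniformly with derivatives converging
  in \<open>L2\<close> on compact sets (\<open>smooth_approximation\<close>). Squares with sides
  parallel to the axes are used instead of discs, so that Stokes's theorem is Fubini's theorem
  with the fundamental theorem of calculus (\<open>stokes_log\<close>).

  From growth to Hardy numbers: if \<open>|g z| \<le> M (1 + |z|) powr e\<close> and
  \<open>p e < 1\<close>, a multiple of \<open>Re ((1 - i z) powr (p e))\<close> transported by
  \<open>g\<close> is a harmonic majorant of \<open>|w| powr p\<close>
  (\<open>hardy_number_lower\<close>). Conversely a positive harmonic function in the upper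
  half-plane grows at most linearly along the imaginary axis, by the Schwarz lemma, so
  \<open>|g (i y)| \<ge> c y powr e\<close> forces \<open>p e \<le> 1\<close>
  (\<open>hardy_number_upper\<close>). Both bounds are attained by \<open>sector_map\<close>,
  which is \<open>z powr (1 + \<kappa>)\<close> with \<open>\<kappa> = k\<close> or
  \<open>\<kappa> = -k\<close> on the upper half-plane, extended to the lower one with constant
  dilatation \<open>|\<kappa>|\<close>.
\<close>

section \<open>Closure properties of $C^n$ functions and a smooth bump\<close>

lemma dir_deriv_eq:
  assumes "(f has_derivative f') (at x)"
  shows "dir_deriv v f x = f' v"
  using frechet_derivative_at[OF assms] by (simp add: dir_deriv_def)

lemma has_derivative_dir_deriv:
  assumes "f differentiable (at x)"
  shows "(f has_derivative (\<lambda>v. dir_deriv v f x)) (at x)"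
  using frechet_derivative_works[of f "at x"] assms by (simp add: dir_deriv_def)

text \<open>The derivatives of two functions that agree on an open set agree there too, so membership in
  \<open>Ck_on\<close> can be transferred along the induction on the order.\<close>

lemma Ck_on_cong:
  assumes "open S" "\<And>x. x \<in> S \<Longrightarrow> f x = g x" "Ck_on n f S"
  shows "Ck_on n g S"
  using assms(2,3)
proof (induction n arbitrary: f g)
  case 0
  then show ?case by (simp cong: continuous_on_cong)
next
  case (Suc n)
  have d: "(g has_derivative (\<lambda>v. dir_deriv v f x)) (at x)" if x: "x \<in> S" for x
    using has_derivative_transform_within_open[OF has_derivative_dir_deriv \<open>open S\<close> x, of f g] Suc.prems x
    by auto
  have "Ck_on n (dir_deriv v g) S" for v
    using Suc.IH[of "dir_deriv v f" "dir_deriv v g"] dir_deriv_eq[OF d] Suc.prems by auto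
  with d show ?case by (auto simp: differentiable_def)
qed

lemma Ck_on_Suc_imp: "Ck_on (Suc n) f S \<Longrightarrow> Ck_on n f S"
proof (induction n arbitrary: f)
  case 0
  then show ?case
    by (auto intro!: continuous_at_imp_continuous_on differentiable_imp_continuous_within)
next
  case (Suc n)
  show ?case unfolding Ck_on.simps
  proof (intro conjI allI)
    show "\<forall>x\<in>S. f differentiable (at x)" using Suc.prems by simp
    fix v
    have "Ck_on (Suc n) (dir_deriv v f) S" using Suc.prems unfolding Ck_on.simps by blast
    then show "Ck_on n (dir_deriv v f) S" by (rule Suc.IH)
  qed
qed

lemma Ck_on_const: "Ck_on n (\<lambda>x. c) S"
proof (induction n arbitrary: c)
  case (Suc n)
  have "dir_deriv v (\<lambda>x. c) = (\<lambda>x. 0)" for v :: 'a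
    by (rule ext, subst dir_deriv_eq[OF has_derivative_const], simp)
  with Suc show ?case by simp
qed simp

lemma Ck_on_add:
  assumes "open S" "Ck_on n f S" "Ck_on n g S"
  shows "Ck_on n (\<lambda>x. f x + g x) S"
  using assms(2,3)
proof (induction n arbitrary: f g)
  case 0
  then show ?case by (auto intro: continuous_on_add)
next
  case (Suc n)
  have d: "((\<lambda>x. f x + g x) has_derivative (\<lambda>v. dir_deriv v f x + dir_deriv v g x)) (at x)"
    if x: "x \<in> S" for x
    using Suc.prems x by (auto intro!: has_derivative_add has_derivative_dir_deriv)
  have "Ck_on n (dir_deriv v (\<lambda>x. f x + g x)) S" for v
    using dir_deriv_eq[OF d] Suc.prems
    by (rule_tac Ck_on_cong[OF \<open>open S\<close> _ Suc.IH[of "dir_deriv v f" "dir_deriv v g"]]) simp_all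
  with d show ?case by (auto simp: differentiable_def)
qed

lemma Ck_on_mult:
  fixes f g :: "'a::real_normed_vector \<Rightarrow> real"
  assumes "open S" "Ck_on n f S" "Ck_on n g S"
  shows "Ck_on n (\<lambda>x. f x * g x) S"
  using assms(2,3)
proof (induction n arbitrary: f g)
  case 0
  then show ?case by (auto intro: continuous_on_mult)
next
  case (Suc n)
  have d: "((\<lambda>x. f x * g x) has_derivative (\<lambda>v. f x * dir_deriv v g x + dir_deriv v f x * g x)) (at x)"
    if x: "x \<in> S" for x
    using Suc.prems x by (auto intro!: has_derivative_mult has_derivative_dir_deriv)
  have fg: "Ck_on n f S" "Ck_on n g S" using Suc.prems Ck_on_Suc_imp by blast+
  have "Ck_on n (dir_deriv v (\<lambda>x. f x * g x)) S" for v
    using dir_deriv_eq[OF d] Suc.prems fg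
    by (rule_tac Ck_on_cong[OF \<open>open S\<close> _ Ck_on_add[OF \<open>open S\<close>
          Suc.IH[of f "dir_deriv v g"] Suc.IH[of "dir_deriv v f" g]]]) simp_all
  with d show ?case by (auto simp: differentiable_def)
qed

lemma Ck_on_affine:
  fixes f :: "'b::real_normed_vector \<Rightarrow> 'c::real_normed_vector"
  assumes "bounded_linear L" "Ck_on n f UNIV"
  shows "Ck_on n (\<lambda>x. f (L x + c)) UNIV"
  using assms(2)
proof (induction n arbitrary: f)
  case 0
  then show ?case
    using linear_continuous_on[OF assms(1), of UNIV]
    by (intro Ck_on.simps(1)[THEN iffD2] continuous_on_compose2[of UNIV f UNIV "\<lambda>x. L x + c"] continuous_on_add
        continuous_on_const) simp_all
next
  case (Suc n)
  have d: "((\<lambda>x. f (L x + c)) has_derivative (\<lambda>v. dir_deriv (L v) f (L x + c))) (at x)" for x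
  proof -
    have 1: "((\<lambda>x. L x + c) has_derivative L) (at x)"
      using has_derivative_add_const[OF bounded_linear_imp_has_derivative[OF assms(1)]] by simp
    have 2: "(f has_derivative (\<lambda>v. dir_deriv v f (L x + c))) (at (L x + c))"
      using Suc.prems by (intro has_derivative_dir_deriv) auto
    show ?thesis using has_derivative_compose[OF 1 2] by simp
  qed
  have "Ck_on n (dir_deriv v (\<lambda>x. f (L x + c))) UNIV" for v
    using dir_deriv_eq[OF d] Suc.prems
    by (rule_tac Ck_on_cong[OF open_UNIV _ Suc.IH[of "dir_deriv (L v) f"]]) simp_all
  with d show ?case by (auto simp: differentiable_def)
qed

text \<open>The functions \<open>exp (- 1 / x) / x ^ k\<close>, extended by \<open>0\<close>: this family is
  closed under differentiation up to linear combinations, which makes the induction in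
  \<open>flat_exp_Ck\<close> work.\<close>

definition flat_exp :: "nat \<Rightarrow> real \<Rightarrow> real"
  where "flat_exp k x = (if x > 0 then exp (- 1 / x) / x ^ k else 0)"

lemma flat_exp_tendsto_0: "(flat_exp k \<longlongrightarrow> 0) (at 0)"
proof -
  have "((\<lambda>t::real. t ^ k / exp t) \<longlongrightarrow> 0) at_top" by (rule tendsto_power_div_exp_0)
  from filterlim_compose[OF this filterlim_inverse_at_top_right]
  have "((\<lambda>x::real. inverse x ^ k / exp (inverse x)) \<longlongrightarrow> 0) (at_right 0)" .
  then have r: "(flat_exp k \<longlongrightarrow> 0) (at_right 0)"
    by (rule Lim_transform_eventually)
       (auto simp: eventually_at_filter flat_exp_def field_simps exp_minus power_inverse)
  have l: "(flat_exp k \<longlongrightarrow> 0) (at_left 0)"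
    by (rule Lim_transform_eventually[of "\<lambda>_. 0"]) (auto simp: eventually_at_filter flat_exp_def)
  show ?thesis using l r by (simp add: filterlim_split_at)
qed

lemma flat_exp_deriv:
  "(flat_exp k has_real_derivative (flat_exp (k+2) x - real k * flat_exp (k+1) x)) (at x)"
proof -
  consider "x > 0" | "x < 0" | "x = 0" by linarith
  then show ?thesis
  proof cases
    case 1
    have p: "((\<lambda>x. x ^ k) has_real_derivative real k * x ^ k / x) (at x)"
      using DERIV_pow[of k x] 1 by (cases k) auto
    have e: "((\<lambda>x. exp (- 1 / x)) has_real_derivative exp (- 1 / x) / x ^ 2) (at x)"
      using 1 by (auto intro!: derivative_eq_intros simp: power2_eq_square)
    have "((\<lambda>x. exp (- 1 / x) / x ^ k) has_real_derivative
        (exp (- 1/x) / x^(k+2) - real k * (exp (- 1/x) / x^(k+1)))) (at x)"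
      by (rule DERIV_cong[OF DERIV_divide[OF e p]]) (use 1 in \<open>auto simp: field_simps power_add power2_eq_square\<close>)
    then have "(flat_exp k has_real_derivative
        (exp (- 1/x) / x^(k+2) - real k * (exp (- 1/x) / x^(k+1)))) (at x)"
      by (rule has_field_derivative_transform_within_open[where S="{0<..}"]) (use 1 in \<open>auto simp: flat_exp_def\<close>)
    then show ?thesis using 1 by (simp add: flat_exp_def)
  next
    case 2
    have "((\<lambda>x::real. 0::real) has_real_derivative 0) (at x)" by simp
    then have "(flat_exp k has_real_derivative 0) (at x)"
      by (rule has_field_derivative_transform_within_open[where S="{..<0}"]) (use 2 in \<open>auto simp: flat_exp_def\<close>)
    then show ?thesis using 2 by (simp add: flat_exp_def)
  next
    case 3
    have "((\<lambda>h. (flat_exp k (0 + h) - flat_exp k 0) / h) \<longlongrightarrow> 0) (at 0)"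
      by (rule Lim_transform_eventually[OF flat_exp_tendsto_0[of "k+1"]])
         (auto simp: eventually_at_filter flat_exp_def)
    then show ?thesis using 3 by (simp add: DERIV_def flat_exp_def)
  qed
qed

lemma flat_exp_Ck: "Ck_on n (flat_exp k) UNIV"
proof (induction n arbitrary: k)
  case 0
  have "isCont (flat_exp k) x" for x using DERIV_isCont[OF flat_exp_deriv] .
  then show ?case by (simp add: continuous_at_imp_continuous_on)
next
  case (Suc n)
  have d: "(flat_exp k has_derivative (\<lambda>v. (flat_exp (k+2) x - real k * flat_exp (k+1) x) * v)) (at x)" for x
    using flat_exp_deriv[of k x] by (simp add: has_field_derivative_def)
  have "Ck_on n (\<lambda>x. (flat_exp (k+2) x + (- real k) * flat_exp (k+1) x) * v) UNIV" for v
    by (intro Ck_on_mult Ck_on_add Ck_on_const open_UNIV Suc.IH)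
  then have "Ck_on n (dir_deriv v (flat_exp k)) UNIV" for v
    by (rule Ck_on_cong[rotated 2]) (auto simp: dir_deriv_eq[OF d])
  with d show ?case by (auto simp: differentiable_def)
qed

lemma bump_exists:
  obtains b :: "real \<Rightarrow> real" and b' where
    "\<And>n. Ck_on n b UNIV" "\<And>x. b x \<ge> 0" "\<And>x. \<bar>x\<bar> \<ge> 1 \<Longrightarrow> b x = 0"
    "\<And>x. (b has_real_derivative b' x) (at x)" "continuous_on UNIV b'"
    "integrable lborel b" "(LINT x|lborel. b x) = 1"
proof -
  define e where "e = flat_exp 0"
  (* The product is positive exactly on the open interval from -1 to 1. *)
  define u where "u x = e (x + 1) * e (- x + 1)" for x
  have u0: "u x \<ge> 0" for x by (simp add: u_def e_def flat_exp_def)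
  have us: "u x = 0" if "\<bar>x\<bar> \<ge> 1" for x using that by (auto simp: u_def e_def flat_exp_def)
  have uC: "Ck_on n u UNIV" for n
    unfolding u_def e_def
    by (intro Ck_on_mult open_UNIV Ck_on_affine[of "\<lambda>x. x"] Ck_on_affine[of "\<lambda>x. - x"] flat_exp_Ck
        bounded_linear_ident bounded_linear_minus)
  have ucont: "continuous_on UNIV u" using uC[of 0] by simp
  have uint: "integrable lborel u"
  proof -
    have "integrable lborel (\<lambda>x. indicator {-1..1} x *\<^sub>R u x)"
      by (rule borel_integrable_compact) (auto intro: continuous_on_subset[OF ucont])
    moreover have "(\<lambda>x. indicator {-1..1} x *\<^sub>R u x) = u"
    proof
      fix x show "indicator {-1..1} x *\<^sub>R u x = u x"
        using us[of x] by (cases "x \<in> {-1..1}") auto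
    qed
    ultimately show ?thesis by simp
  qed
  define c where "c = (LINT x|lborel. u x)"
  have "c > 0"
  proof (rule ccontr)
    assume "\<not> c > 0"
    moreover have "c \<ge> 0" unfolding c_def by (intro integral_nonneg_AE) (auto simp: u0)
    ultimately have "c = 0" by simp
    then have "AE x in lborel. u x = 0"
      using integral_nonneg_eq_0_iff_AE[OF uint] u0 by (auto simp: c_def)
    then have "AE x in lborel. x \<notin> {-1<..<1::real}"
      by (rule AE_mp) (rule AE_I2, auto simp: u_def e_def flat_exp_def)
    then have "emeasure lborel {-1<..<1::real} = 0"
      by (intro AE_iff_null_sets[THEN iffD2, THEN null_setsD1]) auto
    then show False by simp
  qed
  define b where "b x = u x * (1 / c)" for x
  have bC: "Ck_on n b UNIV" for n unfolding b_def by (intro Ck_on_mult open_UNIV uC Ck_on_const)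
  have "Ck_on 1 b UNIV" by (rule bC)
  then have bd: "\<And>x. b differentiable (at x)" and bcont: "\<And>v. continuous_on UNIV (dir_deriv v b)"
    by auto
  have D: "(b has_real_derivative dir_deriv 1 b x) (at x)" for x
  proof -
    have d: "(b has_derivative (\<lambda>v. dir_deriv v b x)) (at x)"
      using has_derivative_dir_deriv[OF bd] .
    have "bounded_linear (\<lambda>v. dir_deriv v b x)" using d has_derivative_bounded_linear by blast
    then have "dir_deriv v b x = dir_deriv 1 b x * v" for v
      using linear_scale[OF bounded_linear.linear, of "\<lambda>v. dir_deriv v b x" v 1] by (simp add: mult.commute)
    then have "(\<lambda>v. dir_deriv v b x) = (*) (dir_deriv 1 b x)" by (rule ext)
    then show ?thesis using d by (simp only: has_field_derivative_def)
  qed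
  show thesis
  proof (rule that[OF bC _ _ D])
    show "b x \<ge> 0" for x using u0 \<open>c > 0\<close> by (simp add: b_def)
    show "b x = 0" if "\<bar>x\<bar> \<ge> 1" for x using us[OF that] by (simp add: b_def)
    show "integrable lborel b" unfolding b_def by (intro integrable_mult_left uint)
    show "(LINT x|lborel. b x) = 1" unfolding b_def using \<open>c > 0\<close> by (simp add: c_def[symmetric])
    show "continuous_on UNIV (dir_deriv 1 b)" by (rule bcont)
  qed
qed

section \<open>Plane integrals and mollification\<close>

text \<open>Fubini on \<open>complex\<close>: the Lebesgue measure is determined by its values on boxes, and
  there it is a product.\<close>

lemma lborel_complex:
  "(lborel :: complex measure) = distr (lborel \<Otimes>\<^sub>M lborel) borel (\<lambda>(x, y). Complex x y)"
proof (rule lborel_eqI)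
  fix l u :: complex
  assume le: "\<And>b. b \<in> Basis \<Longrightarrow> l \<bullet> b \<le> u \<bullet> b"
  have le': "Re l \<le> Re u" "Im l \<le> Im u"
    using le[of 1] le[of \<i>] by (auto simp: Basis_complex_def)
  have m: "(\<lambda>(x, y). Complex x y) \<in> borel_measurable (lborel \<Otimes>\<^sub>M lborel)"
    by (simp add: Complex_eq)
  have eq: "(\<lambda>(x, y). Complex x y) -` box l u \<inter> space (lborel \<Otimes>\<^sub>M lborel)
      = {Re l<..<Re u} \<times> {Im l<..<Im u}"
    by (auto simp: in_box_complex_iff space_pair_measure)
  show "emeasure (distr (lborel \<Otimes>\<^sub>M lborel) borel (\<lambda>(x, y). Complex x y)) (box l u)
      = (\<Prod>b\<in>Basis. (u - l) \<bullet> b)"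
    using le' by (subst emeasure_distr[OF m])
      (auto simp: eq lborel.emeasure_pair_measure_Times Basis_complex_def ennreal_mult'')
qed simp

lemma measurable_Complex [measurable]:
  "f \<in> borel_measurable M \<Longrightarrow> g \<in> borel_measurable M \<Longrightarrow> (\<lambda>x. Complex (f x) (g x)) \<in> borel_measurable M"
  by (simp add: Complex_eq)

lemma
  fixes f :: "complex \<Rightarrow> 'b::{banach, second_countable_topology}"
  assumes "integrable lborel f"
  shows complex_integral_iterated_xy: "(LINT z|lborel. f z) = (LINT x|lborel. LINT y|lborel. f (Complex x y))"
    and complex_integral_iterated_yx: "(LINT z|lborel. f z) = (LINT y|lborel. LINT x|lborel. f (Complex x y))"
proof -
  have fm [measurable]: "f \<in> borel_measurable borel" using assms by auto
  have i: "integrable (lborel \<Otimes>\<^sub>M lborel) (\<lambda>(x, y). f (Complex x y))"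
    using assms by (subst (asm) lborel_complex, subst (asm) integrable_distr_eq) (auto simp: case_prod_unfold)
  have e: "(LINT z|lborel. f z) = (\<integral>(x, y). f (Complex x y) \<partial>(lborel \<Otimes>\<^sub>M lborel))"
    by (subst lborel_complex, subst integral_distr) (auto simp: case_prod_unfold)
  show "(LINT z|lborel. f z) = (LINT x|lborel. LINT y|lborel. f (Complex x y))"
    unfolding e using lborel_pair.integral_fst[OF i] by simp
  show "(LINT z|lborel. f z) = (LINT y|lborel. LINT x|lborel. f (Complex x y))"
    unfolding e using lborel_pair.integral_snd[OF i] by simp
qed

lemma integrable_cont_cbox:
  fixes f :: "complex \<Rightarrow> 'b::{banach, second_countable_topology}"
  assumes "continuous_on (cbox a b) f"
  shows "set_integrable lborel (cbox a b) f"
  unfolding set_integrable_def by (rule borel_integrable_compact[OF compact_cbox assms])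

lemma integrable_cont_supp:
  fixes f :: "complex \<Rightarrow> 'b::{banach, second_countable_topology}"
  assumes "continuous_on UNIV f" "compact S" "\<And>z. z \<notin> S \<Longrightarrow> f z = 0"
  shows "integrable lborel f"
proof -
  have "integrable lborel (\<lambda>z. indicator S z *\<^sub>R f z)"
    by (rule borel_integrable_compact[OF assms(2) continuous_on_subset[OF assms(1)]]) simp
  moreover have "(\<lambda>z. indicator S z *\<^sub>R f z) = f"
    using assms(3) by (auto simp: indicator_def)
  ultimately show ?thesis by simp
qed

text \<open>Convolution with a product kernel. The two factors are kept separate because each partial
  derivative falls on one factor only: the derivatives of \<open>mol a b f\<close> are
  \<open>mol a' b f\<close> and \<open>mol a b' f\<close>.\<close>

definition mol :: "(real \<Rightarrow> real) \<Rightarrow> (real \<Rightarrow> real) \<Rightarrow> (complex \<Rightarrow> complex) \<Rightarrow> complex \<Rightarrow> complex"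
  where "mol a b f z = (LINT w|lborel. (a (Re z - Re w) * b (Im z - Im w)) *\<^sub>R f w)"

text \<open>For bounded \<open>z\<close> the integration can be restricted to a fixed box, as the
  parameter-integral theorems of the gauge integral require.\<close>

lemma mol_eq_integral:
  assumes f: "continuous_on UNIV f" and a: "continuous_on UNIV a" "\<And>x. \<bar>x\<bar> \<ge> d \<Longrightarrow> a x = 0"
    and b: "continuous_on UNIV b" "\<And>x. \<bar>x\<bar> \<ge> d \<Longrightarrow> b x = 0"
    and z: "\<bar>Re z\<bar> \<le> R" "\<bar>Im z\<bar> \<le> R"
  shows "mol a b f z = integral (cbox (Complex (-(R+d)) (-(R+d))) (Complex (R+d) (R+d)))
            (\<lambda>w. (a (Re z - Re w) * b (Im z - Im w)) *\<^sub>R f w)" (is "_ = integral ?B ?h")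
proof -
  have c: "continuous_on S ?h" for S
    by (intro continuous_intros continuous_on_compose2[OF a(1)] continuous_on_compose2[OF b(1)]
        continuous_on_compose2[OF f]) auto
  have "mol a b f z = (LINT w:?B|lborel. ?h w)"
    unfolding mol_def set_lebesgue_integral_def
  proof (rule Bochner_Integration.integral_cong)
    fix w
    have "?h w = 0" if "w \<notin> ?B"
    proof -
      have "\<bar>Re z - Re w\<bar> \<ge> d \<or> \<bar>Im z - Im w\<bar> \<ge> d"
        using that z by (auto simp: in_cbox_complex_iff)
      then show ?thesis using a b by auto
    qed
    then show "?h w = indicat_real ?B w *\<^sub>R ?h w" by (auto simp: indicator_def)
  qed simp
  also have "\<dots> = integral ?B ?h"
    by (rule set_borel_integral_eq_integral(2)[OF integrable_cont_cbox[OF c]])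
  finally show ?thesis .
qed

lemma mol_continuous:
  assumes f: "continuous_on UNIV f" and a: "continuous_on UNIV a" "\<And>x. \<bar>x\<bar> \<ge> d \<Longrightarrow> a x = 0"
    and b: "continuous_on UNIV b" "\<And>x. \<bar>x\<bar> \<ge> d \<Longrightarrow> b x = 0"
  shows "continuous_on UNIV (mol a b f)"
proof -
  have "isCont (mol a b f) z" for z
  proof -
    define R where "R = norm z + 1"
    define B where "B = cbox (Complex (-(R+d)) (-(R+d))) (Complex (R+d) (R+d))"
    have eq: "mol a b f w = integral B (\<lambda>t. (a (Re w - Re t) * b (Im w - Im t)) *\<^sub>R f t)" if "w \<in> ball 0 R" for w
      unfolding B_def
      by (rule mol_eq_integral[OF f a b])
         (use that abs_Re_le_cmod[of w] abs_Im_le_cmod[of w] in \<open>auto simp: R_def\<close>)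
    have "continuous_on (ball 0 R) (\<lambda>w. integral B (\<lambda>t. (a (Re w - Re t) * b (Im w - Im t)) *\<^sub>R f t))"
      unfolding B_def
    proof (rule integral_continuous_on_param)
      show "continuous_on (ball 0 R \<times> cbox (Complex (-(R+d)) (-(R+d))) (Complex (R+d) (R+d)))
        (\<lambda>(w, t). (a (Re w - Re t) * b (Im w - Im t)) *\<^sub>R f t)"
        unfolding case_prod_unfold
        by (intro continuous_intros continuous_on_compose2[OF a(1)] continuous_on_compose2[OF b(1)]
          continuous_on_compose2[OF f]) auto
    qed
    then have "continuous_on (ball 0 R) (mol a b f)"
      by (subst continuous_on_cong[OF refl eq])
    then show ?thesis by (rule continuous_on_interior) (auto simp: R_def)
  qed
  then show ?thesis by (simp add: continuous_at_imp_continuous_on)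
qed

lemma mol_deriv_x:
  assumes f: "continuous_on UNIV f" and a: "\<And>x. (a has_real_derivative a' x) (at x)" "continuous_on UNIV a'"
    "\<And>x. \<bar>x\<bar> \<ge> d \<Longrightarrow> a x = 0" "\<And>x. \<bar>x\<bar> \<ge> d \<Longrightarrow> a' x = 0"
    and b: "continuous_on UNIV b" "\<And>x. \<bar>x\<bar> \<ge> d \<Longrightarrow> b x = 0"
  shows "((\<lambda>s. mol a b f (Complex s y)) has_vector_derivative mol a' b f (Complex x y)) (at x)"
proof -
  have ac: "continuous_on UNIV a" using a(1) by (meson DERIV_isCont continuous_at_imp_continuous_on)
  define R where "R = \<bar>x\<bar> + \<bar>y\<bar> + 1"
  define l where "l = Complex (-(R+d)) (-(R+d))"
  define u where "u = Complex (R+d) (R+d)"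
  define U where "U = {x-1<..<x+1}"
  have U: "x \<in> U" "open U" "convex U" by (auto simp: U_def)
  have eq: "mol a b f (Complex s y) = integral (cbox l u) (\<lambda>w. (a (s - Re w) * b (y - Im w)) *\<^sub>R f w)"
    if "s \<in> U" for s
    unfolding l_def u_def
    by (rule trans[OF mol_eq_integral[OF f ac a(3) b, where R=R]]) (use that in \<open>auto simp: R_def U_def\<close>)
  have eq': "mol a' b f (Complex x y) = integral (cbox l u) (\<lambda>w. (a' (x - Re w) * b (y - Im w)) *\<^sub>R f w)"
    unfolding l_def u_def by (rule trans[OF mol_eq_integral[OF f a(2,4) b, where R=R]]) (auto simp: R_def)
  have "((\<lambda>s. integral (cbox l u) (\<lambda>w. (a (s - Re w) * b (y - Im w)) *\<^sub>R f w))
      has_vector_derivative integral (cbox l u) (\<lambda>w. (a' (x - Re w) * b (y - Im w)) *\<^sub>R f w)) (at x within U)"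
  proof (rule leibniz_rule_vector_derivative[OF _ _ _ U(1,3)])
    fix s t
    show "((\<lambda>s. (a (s - Re t) * b (y - Im t)) *\<^sub>R f t) has_vector_derivative
      (a' (s - Re t) * b (y - Im t)) *\<^sub>R f t) (at s within U)"
    proof -
      have "((\<lambda>s. a (s - Re t)) has_real_derivative a' (s - Re t)) (at s within U)"
        using DERIV_chain2[OF a(1) DERIV_diff[OF DERIV_ident DERIV_const]] by simp
      then have "((\<lambda>s. a (s - Re t) * b (y - Im t)) has_real_derivative a' (s - Re t) * b (y - Im t)) (at s within U)"
        by (rule DERIV_cmult_right)
      then show ?thesis
        using has_vector_derivative_scaleR[OF _ has_vector_derivative_const] by fastforce
    qed
  next
    fix s
    show "(\<lambda>w. (a (s - Re w) * b (y - Im w)) *\<^sub>R f w) integrable_on cbox l u"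
      by (intro integrable_continuous continuous_intros continuous_on_compose2[OF ac] continuous_on_compose2[OF b(1)]
          continuous_on_compose2[OF f]) auto
  next
    show "continuous_on (U \<times> cbox l u) (\<lambda>(s, w). (a' (s - Re w) * b (y - Im w)) *\<^sub>R f w)"
      unfolding case_prod_unfold
      by (intro continuous_intros continuous_on_compose2[OF a(2)] continuous_on_compose2[OF b(1)]
          continuous_on_compose2[OF f]) auto
  qed
  then have "((\<lambda>s. integral (cbox l u) (\<lambda>w. (a (s - Re w) * b (y - Im w)) *\<^sub>R f w))
      has_vector_derivative mol a' b f (Complex x y)) (at x)"
    using U by (simp add: eq' at_within_open[OF U(1,2)])
  then show ?thesis
    by (rule has_vector_derivative_transform_within_open[OF _ U(2,1)]) (simp add: eq)
qed

lemma lborel_complex_reflect: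
  "(lborel :: complex measure) = distr lborel borel (\<lambda>w. t - w)"
proof -
  have "(\<lambda>x. t + - 1 *\<^sub>R x) = (\<lambda>w. t - w)" by auto
  then show ?thesis using lborel_affine[of "-1" t] by (simp add: density_1)
qed

definition swapc :: "complex \<Rightarrow> complex" where "swapc z = Complex (Im z) (Re z)"

lemma lborel_swapc: "(lborel :: complex measure) = distr lborel borel swapc"
proof (rule lborel_eqI)
  fix l u :: complex
  assume le: "\<And>b. b \<in> Basis \<Longrightarrow> l \<bullet> b \<le> u \<bullet> b"
  have m: "swapc \<in> borel_measurable lborel" unfolding swapc_def by measurable
  have "swapc -` box l u = box (swapc l) (swapc u)"
    by (auto simp: in_box_complex_iff swapc_def)
  moreover have "emeasure lborel (box (swapc l) (swapc u)) = (\<Prod>b\<in>Basis. (u - l) \<bullet> b)"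
    using le[of 1] le[of \<i>]
    by (subst emeasure_lborel_box) (auto simp: Basis_complex_def swapc_def mult.commute)
  ultimately show "emeasure (distr lborel borel swapc) (box l u) = (\<Prod>b\<in>Basis. (u - l) \<bullet> b)"
    by (simp add: emeasure_distr[OF m])
qed simp

lemma mol_swap:
  assumes [measurable]: "f \<in> borel_measurable borel" "a \<in> borel_measurable borel" "b \<in> borel_measurable borel"
  shows "mol a b f z = mol b a (f \<circ> swapc) (swapc z)"
proof -
  have m [measurable]: "swapc \<in> borel_measurable lborel" unfolding swapc_def by measurable
  show ?thesis
    unfolding mol_def
    by (subst lborel_swapc, subst integral_distr) (auto simp: swapc_def mult.commute)
qed

text \<open>Follows from the derivative in the other direction by swapping the coordinates.\<close>

lemma mol_deriv_y:
  assumes f: "continuous_on UNIV f" and a: "\<And>x. (a has_real_derivative a' x) (at x)" "continuous_on UNIV a'"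
    "\<And>x. \<bar>x\<bar> \<ge> d \<Longrightarrow> a x = 0" "\<And>x. \<bar>x\<bar> \<ge> d \<Longrightarrow> a' x = 0"
    and b: "continuous_on UNIV b" "\<And>x. \<bar>x\<bar> \<ge> d \<Longrightarrow> b x = 0"
  shows "((\<lambda>s. mol b a f (Complex x s)) has_vector_derivative mol b a' f (Complex x y)) (at y)"
proof -
  have ac: "continuous_on UNIV a" using a(1) by (meson DERIV_isCont continuous_at_imp_continuous_on)
  have m: "f \<in> borel_measurable borel" "a \<in> borel_measurable borel" "a' \<in> borel_measurable borel" "b \<in> borel_measurable borel"
    using f a(2) ac b by (auto intro: borel_measurable_continuous_onI)
  have fs: "continuous_on UNIV (f \<circ> swapc)" unfolding swapc_def o_def
    by (intro continuous_on_compose2[OF f] continuous_intros) auto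
  show ?thesis
    using mol_deriv_x[OF fs a b, where x=y and y=x]
    by (simp add: mol_swap[OF m(1,4,2)] mol_swap[OF m(1,4,3)] swapc_def)
qed

text \<open>The kernel with its centre at \<open>z\<close> is a test function, so the defining identity of
  the distributional derivative says that the derivative of the mollified map is the mollified
  distributional derivative. The sign cancels, because \<open>w\<close> enters the kernel as
  \<open>z - w\<close>.\<close>

lemma mol_distr_deriv:
  fixes g p :: "complex \<Rightarrow> complex"
  assumes D: "\<And>\<phi>. test_function_on UNIV \<phi> \<Longrightarrow>
      (LINT z|lborel. dir_deriv v \<phi> z *\<^sub>R g z) = - (LINT z|lborel. \<phi> z *\<^sub>R p z)"
    and a: "\<And>n. Ck_on n a UNIV" "\<And>x. (a has_real_derivative a' x) (at x)" "\<And>x. \<bar>x\<bar> \<ge> d \<Longrightarrow> a x = 0"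
    and b: "\<And>n. Ck_on n b UNIV" "\<And>x. (b has_real_derivative b' x) (at x)" "\<And>x. \<bar>x\<bar> \<ge> d \<Longrightarrow> b x = 0"
  shows "v = 1 \<Longrightarrow> mol a' b g z = mol a b p z" "v = \<i> \<Longrightarrow> mol a b' g z = mol a b p z"
proof -
  (* Written as affine functions of w, so that smoothness is immediate. *)
  define \<phi> where "\<phi> w = a (- Re w + Re z) * b (- Im w + Im z)" for w
  have "closure {w. \<phi> w \<noteq> 0} \<subseteq> cbox (z - Complex d d) (z + Complex d d)" (is "_ \<subseteq> ?B")
  proof (rule closure_minimal)
    show "{w. \<phi> w \<noteq> 0} \<subseteq> ?B"
    proof
      fix w assume "w \<in> {w. \<phi> w \<noteq> 0}"
      then have "\<not> \<bar>- Re w + Re z\<bar> \<ge> d" "\<not> \<bar>- Im w + Im z\<bar> \<ge> d"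
        using a(3) b(3) by (auto simp: \<phi>_def)
      then show "w \<in> ?B" by (auto simp: in_cbox_complex_iff)
    qed
  qed (rule closed_cbox)
  then have "compact (closure {w. \<phi> w \<noteq> 0})"
    by (meson bounded_cbox bounded_subset closed_closure compact_eq_bounded_closed)
  moreover have "Ck_on n \<phi> UNIV" for n
    unfolding \<phi>_def
    by (intro Ck_on_mult open_UNIV Ck_on_affine a(1) b(1) bounded_linear_minus bounded_linear_Re bounded_linear_Im)
  ultimately have t: "test_function_on UNIV \<phi>" by (simp add: test_function_on_def)
  have d: "(\<phi> has_derivative (\<lambda>h. - (Re h * a' (Re z - Re w) * b (Im z - Im w))
      - Im h * a (Re z - Re w) * b' (Im z - Im w))) (at w)" for w
  proof -
    have 1: "((\<lambda>w. a (- Re w + Re z)) has_derivative (\<lambda>h. - Re h * a' (- Re w + Re z))) (at w)"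
      by (rule DERIV_compose_FDERIV[OF a(2)]) (auto intro!: derivative_eq_intros)
    have 2: "((\<lambda>w. b (- Im w + Im z)) has_derivative (\<lambda>h. - Im h * b' (- Im w + Im z))) (at w)"
      by (rule DERIV_compose_FDERIV[OF b(2)]) (auto intro!: derivative_eq_intros)
    show ?thesis
      unfolding \<phi>_def by (rule has_derivative_eq_rhs[OF has_derivative_mult[OF 1 2]]) (auto simp: algebra_simps)
  qed
  have pz: "mol a b p z = (LINT w|lborel. \<phi> w *\<^sub>R p w)" by (simp add: mol_def \<phi>_def)
  {
    assume v: "v = 1"
    have "dir_deriv v \<phi> w = - (a' (Re z - Re w) * b (Im z - Im w))" for w
      using dir_deriv_eq[OF d] by (simp add: v)
    then show "mol a' b g z = mol a b p z" using D[OF t] by (simp add: mol_def \<phi>_def)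
  next
    assume v: "v = \<i>"
    have "dir_deriv v \<phi> w = - (a (Re z - Re w) * b' (Im z - Im w))" for w
      using dir_deriv_eq[OF d] by (simp add: v)
    then show "mol a b' g z = mol a b p z" using D[OF t] by (simp add: mol_def \<phi>_def)
  }
qed

section \<open>Density of continuous functions in $L^2$\<close>

text \<open>The continuous retraction onto the disc of radius \<open>N\<close>.\<close>

definition clip :: "real \<Rightarrow> complex \<Rightarrow> complex"
  where "clip N w = w / complex_of_real (max 1 (norm w / N))"

lemma clip_cont: "N > 0 \<Longrightarrow> continuous_on UNIV (clip N)"
  unfolding clip_def by (intro continuous_intros) (auto simp: max_def)

lemma clip_norm: "N > 0 \<Longrightarrow> norm (clip N w) \<le> N"
  by (auto simp: clip_def norm_divide field_simps max_def norm_of_real simp del: of_real_divide)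

lemma clip_id: "N > 0 \<Longrightarrow> norm w \<le> N \<Longrightarrow> clip N w = w"
  by (auto simp: clip_def max_def field_simps)

lemma clip_diff: "N > 0 \<Longrightarrow> norm (w - clip N w) \<le> norm w"
proof -
  assume N: "N > 0"
  define t where "t = 1 / max 1 (norm w / N)"
  have t: "0 \<le> t" "t \<le> 1" by (auto simp: t_def)
  have "w - clip N w = (1 - t) *\<^sub>R w"
    by (simp add: clip_def t_def scaleR_conv_of_real algebra_simps)
  then have "norm (w - clip N w) = (1 - t) * norm w" using t by simp
  also have "\<dots> \<le> norm w" using t by (simp add: mult_left_le_one_le)
  finally show ?thesis .
qed

lemma norm_sq_add2: "(norm (x + y :: complex))\<^sup>2 \<le> 2 * (norm x)\<^sup>2 + 2 * (norm y)\<^sup>2"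
proof -
  have "(norm (x + y))\<^sup>2 \<le> (norm x + norm y)\<^sup>2" by (simp add: norm_triangle_ineq power_mono)
  also have "\<dots> \<le> 2 * (norm x)\<^sup>2 + 2 * (norm y)\<^sup>2"
    using zero_le_power2[of "norm x - norm y"] by (simp add: power2_eq_square algebra_simps)
  finally show ?thesis .
qed

lemma norm_sq_add3: "(norm (x + y + z :: complex))\<^sup>2 \<le> 4 * (norm x)\<^sup>2 + 4 * (norm y)\<^sup>2 + 2 * (norm z)\<^sup>2"
  using norm_sq_add2[of "x+y" z] norm_sq_add2[of x y] by linarith

text \<open>Truncation reduces the claim to bounded \<open>h\<close>. A measurable function is the pointwise
  limit almost everywhere of continuous ones; clipping these and cutting them off outside the
  support provides an integrable dominating function.\<close>

lemma L2_density:
  fixes h :: "complex \<Rightarrow> complex"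
  assumes hm [measurable]: "h \<in> borel_measurable borel"
    and hi: "integrable lborel (\<lambda>z. (norm (h z))\<^sup>2)"
    and h0: "\<And>z. norm z > R \<Longrightarrow> h z = 0" and e: "e > 0" and R: "R > 0"
  obtains \<phi> where "continuous_on UNIV \<phi>" "\<And>z. norm z > R + 1 \<Longrightarrow> \<phi> z = 0"
    "integrable lborel (\<lambda>z. (norm (h z - \<phi> z))\<^sup>2)" "(LINT z|lborel. (norm (h z - \<phi> z))\<^sup>2) < e"
proof -
  have cm [measurable]: "clip N \<in> borel_measurable borel" if "N > 0" for N
    using clip_cont[OF that] by (rule borel_measurable_continuous_onI)
  define hN where "hN n = (\<lambda>z. clip (real (Suc n)) (h z))" for n
  have hNm [measurable]: "hN n \<in> borel_measurable borel" for n unfolding hN_def by measurable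
  have "(\<lambda>n. LINT z|lborel. (norm (h z - hN n z))\<^sup>2) \<longlonglongrightarrow> (LINT (z::complex)|lborel. (0::real))"
  proof (rule integral_dominated_convergence[where w = "\<lambda>z. (norm (h z))\<^sup>2"])
    show "AE z in lborel. (\<lambda>n. (norm (h z - hN n z))\<^sup>2) \<longlonglongrightarrow> 0"
    proof (rule AE_I2)
      fix z
      obtain m where m: "norm (h z) \<le> real m" using real_arch_simple by blast
      have "\<forall>\<^sub>F n in sequentially. 0 = (norm (h z - hN n z))\<^sup>2"
        using eventually_ge_at_top[of m]
      proof eventually_elim
        case (elim n)
        then have "norm (h z) \<le> real (Suc n)" using m by linarith
        then show ?case by (simp add: hN_def clip_id)
      qed
      then show "(\<lambda>n. (norm (h z - hN n z))\<^sup>2) \<longlonglongrightarrow> 0"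
        by (rule Lim_transform_eventually[OF tendsto_const])
    qed
    show "AE z in lborel. norm ((norm (h z - hN n z))\<^sup>2) \<le> (norm (h z))\<^sup>2" for n
      unfolding hN_def using clip_diff[of "real (Suc n)"] by (intro AE_I2) (simp add: power_mono)
  qed (use hi in auto)
  then have "(\<lambda>n. LINT z|lborel. (norm (h z - hN n z))\<^sup>2) \<longlonglongrightarrow> 0" by simp
  then have "\<forall>\<^sub>F n in sequentially. (LINT z|lborel. (norm (h z - hN n z))\<^sup>2) < e / 4"
    using e by (intro order_tendstoD) auto
  then obtain n where n: "(LINT z|lborel. (norm (h z - hN n z))\<^sup>2) < e / 4"
    by (auto simp: eventually_sequentially)
  define N where "N = real (Suc n)"
  have N: "N > 0" by (simp add: N_def)
  define f where "f = hN n"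
  have fm [measurable]: "f \<in> borel_measurable borel" by (simp add: f_def)
  have fN: "norm (f z) \<le> N" for z using clip_norm[OF N] by (simp add: f_def hN_def N_def)
  have f0: "f z = 0" if "norm z > R" for z using h0[OF that] by (simp add: f_def hN_def clip_def)
  have "f \<in> borel_measurable lebesgue" by (rule measurable_completion) simp
  then have "f measurable_on UNIV"
    by (simp add: measurable_on_iff_borel_measurable lebesgue_on_UNIV_eq)
  then obtain Z g where Z: "negligible Z" and gc: "\<And>m. continuous_on UNIV (g m)"
    and gl: "\<And>x. x \<notin> Z \<Longrightarrow> (\<lambda>m. g m x) \<longlonglongrightarrow> f x"
    unfolding measurable_on_def by auto
  define ctf where "ctf z = max 0 (min 1 (R + 1 - norm z))" for z :: complex
  define \<phi> where "\<phi> m z = ctf z *\<^sub>R clip N (g m z)" for m z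
  have ctf: "0 \<le> ctf z" "ctf z \<le> 1" for z by (auto simp: ctf_def)
  have \<phi>c: "continuous_on UNIV (\<phi> m)" for m
    unfolding \<phi>_def ctf_def
    by (intro continuous_intros continuous_on_compose2[OF clip_cont[OF N]] gc) auto
  have \<phi>0: "\<phi> m z = 0" if "norm z > R + 1" for m z using that by (auto simp: \<phi>_def ctf_def)
  have \<phi>N: "norm (\<phi> m z) \<le> N" for m z
    using clip_norm[OF N, of "g m z"] ctf[of z] mult_mono[of "ctf z" 1 "norm (clip N (g m z))" N]
    by (simp add: \<phi>_def)
  have [measurable]: "\<phi> m \<in> borel_measurable borel" for m
    by (rule borel_measurable_continuous_onI[OF \<phi>c])
  define D where "D z = indicator (cball 0 (R+1)) z *\<^sub>R (2 * N)\<^sup>2" for z :: complex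
  have Di: "integrable lborel D"
    unfolding D_def by (rule borel_integrable_compact) auto
  have dom: "norm ((norm (f z - \<phi> m z))\<^sup>2) \<le> D z" for m z
  proof (cases "norm z \<le> R + 1")
    case True
    have "norm (f z - \<phi> m z) \<le> 2 * N" using norm_triangle_ineq4[of "f z" "\<phi> m z"] fN[of z] \<phi>N[of m z] by linarith
    from power_mono[OF this, of 2] show ?thesis using True by (simp add: D_def)
  next
    case False
    then show ?thesis by (simp add: f0 \<phi>0 D_def)
  qed
  have "(\<lambda>m. LINT z|lborel. (norm (f z - \<phi> m z))\<^sup>2) \<longlonglongrightarrow> (LINT (z::complex)|lborel. (0::real))"
  proof (rule integral_dominated_convergence[where w = D])
    have lim: "(\<lambda>m. (norm (f z - \<phi> m z))\<^sup>2) \<longlonglongrightarrow> 0" if z: "z \<notin> Z" for z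
    proof -
      have "(\<lambda>m. clip N (g m z)) \<longlonglongrightarrow> clip N (f z)"
        using continuous_on_tendsto_compose[OF clip_cont[OF N] gl[OF z]] by auto
      then have "(\<lambda>m. \<phi> m z) \<longlonglongrightarrow> ctf z *\<^sub>R f z"
        unfolding \<phi>_def clip_id[OF N fN] by (intro tendsto_intros)
      moreover have "ctf z *\<^sub>R f z = f z" using f0[of z] by (cases "norm z > R") (auto simp: ctf_def)
      ultimately have "(\<lambda>m. (norm (f z - \<phi> m z))\<^sup>2) \<longlonglongrightarrow> (norm (f z - f z))\<^sup>2" by (intro tendsto_intros) auto
      then show ?thesis by simp
    qed
    have "AE z in lebesgue. z \<notin> Z" using Z by (simp add: negligible_iff_null_sets AE_not_in)
    then have "AE z in lebesgue. (\<lambda>m. (norm (f z - \<phi> m z))\<^sup>2) \<longlonglongrightarrow> 0"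
      by (rule AE_mp) (intro AE_I2 impI lim)
    then show "AE z in lborel. (\<lambda>m. (norm (f z - \<phi> m z))\<^sup>2) \<longlonglongrightarrow> 0"
      by (subst (asm) AE_completion_iff) simp_all
    show "AE z in lborel. norm ((norm (f z - \<phi> m z))\<^sup>2) \<le> D z" for m using dom by auto
  qed (use Di in auto)
  then have "(\<lambda>m. LINT z|lborel. (norm (f z - \<phi> m z))\<^sup>2) \<longlonglongrightarrow> 0" by simp
  then have "\<forall>\<^sub>F m in sequentially. (LINT z|lborel. (norm (f z - \<phi> m z))\<^sup>2) < e / 4"
    using e by (intro order_tendstoD) auto
  then obtain m where m: "(LINT z|lborel. (norm (f z - \<phi> m z))\<^sup>2) < e / 4"
    by (auto simp: eventually_sequentially)
  have i1: "integrable lborel (\<lambda>z. (norm (h z - f z))\<^sup>2)"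
    by (rule Bochner_Integration.integrable_bound[OF hi])
       (auto simp: f_def hN_def intro!: AE_I2 power_mono clip_diff)
  have i2: "integrable lborel (\<lambda>z. (norm (f z - \<phi> m z))\<^sup>2)"
    by (rule Bochner_Integration.integrable_bound[OF Di]) (auto intro!: AE_I2 order_trans[OF dom, simplified])
  have le: "(norm (h z - \<phi> m z))\<^sup>2 \<le> 2 * (norm (h z - f z))\<^sup>2 + 2 * (norm (f z - \<phi> m z))\<^sup>2" for z
    using norm_sq_add2[of "h z - f z" "f z - \<phi> m z"] by simp
  have i3: "integrable lborel (\<lambda>z. (norm (h z - \<phi> m z))\<^sup>2)"
    by (rule Bochner_Integration.integrable_bound[OF Bochner_Integration.integrable_add[OF
          integrable_mult_right[OF i1, of 2] integrable_mult_right[OF i2, of 2]]])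
       (use le in \<open>auto intro!: AE_I2 order_trans[OF _ abs_ge_self]\<close>)
  have "(LINT z|lborel. (norm (h z - \<phi> m z))\<^sup>2)
      \<le> (LINT z|lborel. 2 * (norm (h z - f z))\<^sup>2 + 2 * (norm (f z - \<phi> m z))\<^sup>2)"
    by (intro integral_mono i3 Bochner_Integration.integrable_add integrable_mult_right i1 i2 le)
  also have "\<dots> = 2 * (LINT z|lborel. (norm (h z - f z))\<^sup>2) + 2 * (LINT z|lborel. (norm (f z - \<phi> m z))\<^sup>2)"
    using i1 i2 by simp
  also have "\<dots> < e" using n m by (simp add: f_def)
  finally show thesis using that[OF \<phi>c \<phi>0 i3] by blast
qed

section \<open>Mollification contracts $L^2$ and preserves holomorphy\<close>

locale mollifier =
  fixes a b :: "real \<Rightarrow> real" and d :: real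
  assumes acont: "continuous_on UNIV a" and bcont: "continuous_on UNIV b"
    and anonneg: "\<And>x. a x \<ge> 0" and bnonneg: "\<And>x. b x \<ge> 0"
    and asupp: "\<And>x. \<bar>x\<bar> \<ge> d \<Longrightarrow> a x = 0" and bsupp: "\<And>x. \<bar>x\<bar> \<ge> d \<Longrightarrow> b x = 0"
    and aint: "(LINT x|lborel. a x) = 1" and bint: "(LINT x|lborel. b x) = 1"
begin

definition ker :: "complex \<Rightarrow> real" where "ker u = a (Re u) * b (Im u)"

lemma am [measurable]: "a \<in> borel_measurable borel" and bm [measurable]: "b \<in> borel_measurable borel"
  using acont bcont by (auto intro: borel_measurable_continuous_onI)

lemma ker_measurable [measurable]: "ker \<in> borel_measurable borel"
  unfolding ker_def by measurable

lemma ker_nonneg: "ker u \<ge> 0"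
  by (simp add: ker_def anonneg bnonneg)

lemma ker_cont: "continuous_on UNIV ker"
  unfolding ker_def
  by (intro continuous_intros continuous_on_compose2[OF acont] continuous_on_compose2[OF bcont]) auto

lemma ker_supp: "u \<notin> cbox (Complex (-d) (-d)) (Complex d d) \<Longrightarrow> ker u = 0"
proof -
  assume "u \<notin> cbox (Complex (-d) (-d)) (Complex d d)"
  then have "d \<le> \<bar>Re u\<bar> \<or> d \<le> \<bar>Im u\<bar>" by (auto simp: in_cbox_complex_iff)
  then show ?thesis using asupp[of "Re u"] bsupp[of "Im u"] by (auto simp: ker_def)
qed

lemma ker_integrable: "integrable lborel ker"
  by (rule integrable_cont_supp[OF ker_cont compact_cbox ker_supp])

lemma ker_integral: "(LINT u|lborel. ker u) = 1"
  using complex_integral_iterated_xy[OF ker_integrable] by (simp add: ker_def bint aint)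

lemma ker_bounded: obtains B where "B > 0" "\<And>u. ker u \<le> B"
proof -
  obtain C where C: "\<forall>x\<in>ker ` cbox (Complex (-d) (-d)) (Complex d d). norm x \<le> C"
    using compact_imp_bounded[OF compact_continuous_image[OF continuous_on_subset[OF ker_cont] compact_cbox[of "Complex (-d) (-d)" "Complex d d"]]]
    by (auto simp: bounded_iff)
  have "ker u \<le> max C 1" for u
    using C ker_supp[of u] by (cases "u \<in> cbox (Complex (-d) (-d)) (Complex d d)") (auto simp: max_def)
  then show thesis using that[of "max C 1"] by simp
qed

lemma mol_ker: "mol a b f z = (LINT w|lborel. ker (z - w) *\<^sub>R f w)"
  by (simp add: mol_def ker_def)

lemma ker_shift_nn: "(\<integral>\<^sup>+z. ennreal (ker (z - w)) \<partial>lborel) = 1"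
proof -
  have "(\<integral>\<^sup>+z. ennreal (ker (z - w)) \<partial>lborel) = (\<integral>\<^sup>+z. ennreal (ker z) \<partial>distr lborel borel ((+) (- w)))"
    by (subst nn_integral_distr) auto
  also have "\<dots> = (\<integral>\<^sup>+z. ennreal (ker z) \<partial>lborel)" by (simp add: lborel_distr_plus)
  also have "\<dots> = ennreal 1"
    using nn_integral_eq_integral[OF ker_integrable] ker_nonneg ker_integral by auto
  finally show ?thesis by simp
qed

lemma ker_reflect_integral:
  fixes f :: "complex \<Rightarrow> 'b::{banach, second_countable_topology}"
  assumes "f \<in> borel_measurable borel"
  shows "(LINT w|lborel. f (z - w)) = (LINT w|lborel. f w)"
  by (subst (2) lborel_complex_reflect[of z], subst integral_distr) (use assms in auto)

lemma ker_reflect_integrable: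
  fixes f :: "complex \<Rightarrow> 'b::{banach, second_countable_topology}"
  assumes "integrable lborel f"
  shows "integrable lborel (\<lambda>w. f (z - w))"
proof -
  have "integrable (distr lborel borel (\<lambda>w. z - w)) f"
    using assms lborel_complex_reflect[of z] by simp
  then show ?thesis by (subst (asm) integrable_distr_eq) (use assms in auto)
qed

text \<open>Jensen's inequality for the probability density \<open>ker (z - w)\<close>: the variance of
  \<open>h\<close> under this density is nonnegative.\<close>

lemma mol_jensen:
  assumes [measurable]: "h \<in> borel_measurable borel" and h: "integrable lborel h"
    "integrable lborel (\<lambda>w. (norm (h w))\<^sup>2)"
  shows "integrable lborel (\<lambda>w. ker (z - w) * (norm (h w))\<^sup>2)"
    and "(norm (mol a b h z))\<^sup>2 \<le> (LINT w|lborel. ker (z - w) * (norm (h w))\<^sup>2)"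
proof -
  obtain B where B: "B > 0" "\<And>u. ker u \<le> B" using ker_bounded by blast
  show i2: "integrable lborel (\<lambda>w. ker (z - w) * (norm (h w))\<^sup>2)"
    by (rule Bochner_Integration.integrable_bound[OF integrable_mult_right[OF h(2), of B]])
       (auto intro!: AE_I2 mult_right_mono simp: ker_nonneg abs_mult B less_imp_le)
  have i1: "integrable lborel (\<lambda>w. ker (z - w) *\<^sub>R h w)"
    by (rule Bochner_Integration.integrable_bound[OF integrable_mult_right[OF integrable_norm[OF h(1)], of B]])
       (auto intro!: AE_I2 mult_right_mono simp: ker_nonneg abs_mult B less_imp_le)
  have i0: "integrable lborel (\<lambda>w. ker (z - w))" by (rule ker_reflect_integrable[OF ker_integrable])
  have k1: "(LINT w|lborel. ker (z - w)) = 1" by (subst ker_reflect_integral) (auto simp: ker_integral)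
  define m where "m = mol a b h z"
  have i3: "integrable lborel (\<lambda>w. m \<bullet> (ker (z - w) *\<^sub>R h w))" by (intro integrable_inner_right i1)
  have "0 \<le> (LINT w|lborel. ker (z - w) * (norm (h w - m))\<^sup>2)"
    by (intro integral_nonneg_AE AE_I2) (simp add: ker_nonneg)
  also have "(\<lambda>w. ker (z - w) * (norm (h w - m))\<^sup>2) = (\<lambda>w. ker (z - w) * (norm (h w))\<^sup>2
      - 2 * (m \<bullet> (ker (z - w) *\<^sub>R h w)) + ker (z - w) * (norm m)\<^sup>2)"
    by (auto simp: power2_norm_eq_inner inner_diff_left inner_diff_right inner_commute algebra_simps)
  also have "(LINT w|lborel. ker (z - w) * (norm (h w))\<^sup>2
      - 2 * (m \<bullet> (ker (z - w) *\<^sub>R h w)) + ker (z - w) * (norm m)\<^sup>2)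
     = (LINT w|lborel. ker (z - w) * (norm (h w))\<^sup>2) - 2 * (LINT w|lborel. m \<bullet> (ker (z - w) *\<^sub>R h w))
       + (LINT w|lborel. ker (z - w)) * (norm m)\<^sup>2"
    using i0 i2 i3 by simp
  also have "(LINT w|lborel. m \<bullet> (ker (z - w) *\<^sub>R h w)) = m \<bullet> m"
    unfolding integral_inner_right[OF i1] by (simp add: m_def mol_ker)
  finally show "(norm (mol a b h z))\<^sup>2 \<le> (LINT w|lborel. ker (z - w) * (norm (h w))\<^sup>2)"
    by (simp add: k1 m_def power2_norm_eq_inner)
qed

lemma mol_measurable [measurable]:
  assumes [measurable]: "h \<in> borel_measurable borel"
  shows "mol a b h \<in> borel_measurable borel"
  unfolding mol_ker[abs_def] by measurable

text \<open>Integrate Jensen's inequality over \<open>z\<close> and exchange the integrals; the kernel has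
  total mass \<open>1\<close> in \<open>z\<close> as well.\<close>

lemma mol_contract:
  assumes hm [measurable]: "h \<in> borel_measurable borel" and h: "integrable lborel h"
    "integrable lborel (\<lambda>w. (norm (h w))\<^sup>2)"
  shows "integrable lborel (\<lambda>z. (norm (mol a b h z))\<^sup>2)"
    and "(LINT z|lborel. (norm (mol a b h z))\<^sup>2) \<le> (LINT z|lborel. (norm (h z))\<^sup>2)"
proof -
  have "(\<integral>\<^sup>+z. ennreal ((norm (mol a b h z))\<^sup>2) \<partial>lborel)
      \<le> (\<integral>\<^sup>+z. \<integral>\<^sup>+w. ennreal (ker (z - w) * (norm (h w))\<^sup>2) \<partial>lborel \<partial>lborel)"
  proof (rule nn_integral_mono)
    fix z
    have "ennreal ((norm (mol a b h z))\<^sup>2) \<le> ennreal (LINT w|lborel. ker (z - w) * (norm (h w))\<^sup>2)"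
      using mol_jensen(2)[OF hm h] by (rule ennreal_leI)
    also have "\<dots> = (\<integral>\<^sup>+w. ennreal (ker (z - w) * (norm (h w))\<^sup>2) \<partial>lborel)"
      using nn_integral_eq_integral[OF mol_jensen(1)[OF hm h]] by (simp add: ker_nonneg)
    finally show "ennreal ((norm (mol a b h z))\<^sup>2) \<le> (\<integral>\<^sup>+w. ennreal (ker (z - w) * (norm (h w))\<^sup>2) \<partial>lborel)" .
  qed
  also have "\<dots> = (\<integral>\<^sup>+w. \<integral>\<^sup>+z. ennreal (ker (z - w) * (norm (h w))\<^sup>2) \<partial>lborel \<partial>lborel)"
    by (rule lborel_pair.Fubini') measurable
  also have "\<dots> = (\<integral>\<^sup>+w. ennreal ((norm (h w))\<^sup>2) \<partial>lborel)"
    by (rule nn_integral_cong) (simp add: ennreal_mult' ker_nonneg nn_integral_multc ker_shift_nn)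
  also have "\<dots> = ennreal (LINT w|lborel. (norm (h w))\<^sup>2)"
    by (rule nn_integral_eq_integral[OF h(2)]) simp
  finally have le: "(\<integral>\<^sup>+z. ennreal ((norm (mol a b h z))\<^sup>2) \<partial>lborel) \<le> ennreal (LINT w|lborel. (norm (h w))\<^sup>2)" .
  show i: "integrable lborel (\<lambda>z. (norm (mol a b h z))\<^sup>2)"
    by (rule integrableI_bounded) (use le in \<open>auto simp: less_top[symmetric] top_unique\<close>)
  show "(LINT z|lborel. (norm (mol a b h z))\<^sup>2) \<le> (LINT z|lborel. (norm (h z))\<^sup>2)"
    using le nn_integral_eq_integral[OF i] by (simp add: ennreal_le_iff)
qed

lemma ker_mult_integrable:
  assumes c: "continuous_on UNIV (f :: complex \<Rightarrow> complex)"
  shows "integrable lborel (\<lambda>w. ker (z - w) *\<^sub>R f w)"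
proof (rule integrable_cont_supp[where S = "cbox (z - Complex d d) (z + Complex d d)"])
  show "continuous_on UNIV (\<lambda>w. ker (z - w) *\<^sub>R f w)"
    by (intro continuous_intros continuous_on_compose2[OF ker_cont] c) auto
  show "ker (z - w) *\<^sub>R f w = 0" if "w \<notin> cbox (z - Complex d d) (z + Complex d d)" for w
  proof -
    have "z - w \<notin> cbox (Complex (-d) (-d)) (Complex d d)" using that by (auto simp: in_cbox_complex_iff)
    then show ?thesis by (simp add: ker_supp)
  qed
qed simp

text \<open>The mollified value is an average of the values of \<open>f\<close> at distance less than
  \<open>d\<close> in each coordinate.\<close>

lemma mol_approx:
  assumes c: "continuous_on UNIV (f :: complex \<Rightarrow> complex)"
    and e: "\<And>w. \<bar>Re z - Re w\<bar> < d \<Longrightarrow> \<bar>Im z - Im w\<bar> < d \<Longrightarrow> norm (f w - f z) \<le> e"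
  shows "norm (mol a b f z - f z) \<le> e"
proof -
  have i0: "integrable lborel (\<lambda>w. ker (z - w))" by (rule ker_reflect_integrable[OF ker_integrable])
  have k1: "(LINT w|lborel. ker (z - w)) = 1" by (subst ker_reflect_integral) (auto simp: ker_integral)
  have cd: "continuous_on UNIV (\<lambda>w. f w - f z)" by (intro continuous_intros c)
  have "mol a b f z - f z = (LINT w|lborel. ker (z - w) *\<^sub>R (f w - f z))"
    using ker_mult_integrable[OF c] i0 k1 by (simp add: mol_ker scaleR_diff_right)
  also have "norm \<dots> \<le> (LINT w|lborel. norm (ker (z - w) *\<^sub>R (f w - f z)))"
    by (rule integral_norm_bound)
  also have "\<dots> \<le> (LINT w|lborel. ker (z - w) * e)"
  proof (rule integral_mono[OF integrable_norm[OF ker_mult_integrable[OF cd]] integrable_mult_left[OF i0]])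
    fix w
    show "norm (ker (z - w) *\<^sub>R (f w - f z)) \<le> ker (z - w) * e"
    proof (cases "ker (z - w) = 0")
      case False
      then have "\<not> \<bar>Re z - Re w\<bar> \<ge> d" "\<not> \<bar>Im z - Im w\<bar> \<ge> d"
        using asupp[of "Re z - Re w"] bsupp[of "Im z - Im w"] by (auto simp: ker_def)
      then show ?thesis using e[of w] by (auto simp: ker_nonneg intro!: mult_left_mono)
    qed simp
  qed
  also have "\<dots> = e" using i0 k1 by simp
  finally show ?thesis .
qed

end

text \<open>The convolution can also be differentiated under the integral with the derivative on
  \<open>g\<close>. As long as the support of the kernel around \<open>z\<close> stays in the
  half-plane, this gives a complex derivative, and its two real directions are the two
  mollifications with differentiated kernels.\<close>

lemma mol_holomorphic:
  assumes g: "continuous_on UNIV g" "g holomorphic_on {z. Im z > 0}"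
    and a: "\<And>x. (a has_real_derivative a' x) (at x)" "continuous_on UNIV a'"
    "\<And>x. \<bar>x\<bar> \<ge> d \<Longrightarrow> a x = 0" "\<And>x. \<bar>x\<bar> \<ge> d \<Longrightarrow> a' x = 0"
    and b: "\<And>x. (b has_real_derivative b' x) (at x)" "continuous_on UNIV b'"
    "\<And>x. \<bar>x\<bar> \<ge> d \<Longrightarrow> b x = 0" "\<And>x. \<bar>x\<bar> \<ge> d \<Longrightarrow> b' x = 0"
    and z: "Im z > d"
  shows "mol a' b g z + \<i> * mol a b' g z = 0"
proof -
  have ac: "continuous_on UNIV a" using a(1) by (meson DERIV_isCont continuous_at_imp_continuous_on)
  have bc: "continuous_on UNIV b" using b(1) by (meson DERIV_isCont continuous_at_imp_continuous_on)
  have [measurable]: "a \<in> borel_measurable borel" "b \<in> borel_measurable borel" "g \<in> borel_measurable borel"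
    using ac bc g(1) by (auto intro: borel_measurable_continuous_onI)
  define k where "k u = a (Re u) * b (Im u)" for u
  define B where "B = cbox (Complex (-d) (-d)) (Complex d d)"
  define U where "U = {z. Im z > d}"
  have U: "open U" "convex U" "z \<in> U" using z by (auto simp: U_def open_halfspace_Im_gt convex_halfspace_Im_gt)
  have kc: "continuous_on S k" for S unfolding k_def
    by (intro continuous_intros continuous_on_compose2[OF ac] continuous_on_compose2[OF bc]) auto
  have eq: "mol a b g w = integral B (\<lambda>t. of_real (k t) * g (w - t))" for w
  proof -
    have c: "continuous_on B (\<lambda>t. of_real (k t) * g (w - t))"
      by (intro continuous_intros kc continuous_on_compose2[OF g(1)]) auto
    have "mol a b g w = (LINT t|lborel. k (w - t) *\<^sub>R g t)"
      by (simp add: mol_def k_def)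
    also have "\<dots> = (LINT t|lborel. k t *\<^sub>R g (w - t))"
    proof -
      have "(LINT t|lborel. k t *\<^sub>R g (w - t)) = (LINT t|distr lborel borel (\<lambda>t. w - t). k t *\<^sub>R g (w - t))"
        using lborel_complex_reflect[of w] by simp
      also have "\<dots> = (LINT t|lborel. k (w - t) *\<^sub>R g t)"
        by (subst integral_distr) (auto simp: k_def)
      finally show ?thesis by simp
    qed
    also have "\<dots> = (LINT t:B|lborel. of_real (k t) * g (w - t))"
      unfolding set_lebesgue_integral_def
    proof (rule Bochner_Integration.integral_cong)
      fix t
      show "k t *\<^sub>R g (w - t) = indicat_real B t *\<^sub>R (of_real (k t) * g (w - t))"
      proof (cases "t \<in> B")
        case False
        then have "d \<le> \<bar>Re t\<bar> \<or> d \<le> \<bar>Im t\<bar>" by (auto simp: B_def in_cbox_complex_iff)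
        then show ?thesis using a(3)[of "Re t"] b(3)[of "Im t"] False by (auto simp: k_def)
      qed (simp add: scaleR_conv_of_real)
    qed simp
    also have "\<dots> = integral B (\<lambda>t. of_real (k t) * g (w - t))"
      unfolding B_def by (rule set_borel_integral_eq_integral(2)[OF integrable_cont_cbox]) (use c in \<open>simp add: B_def\<close>)
    finally show ?thesis .
  qed
  have im: "Im (w - t) > 0" if "w \<in> U" "t \<in> B" for w t
    using that by (auto simp: U_def B_def in_cbox_complex_iff)
  have op: "open {z. Im z > 0}" by (rule open_halfspace_Im_gt)
  have gd: "(g has_field_derivative deriv g w) (at w)" if "Im w > 0" for w
    using holomorphic_derivI[OF g(2) op, of w] that by simp
  have gdc: "continuous_on {z. Im z > 0} (deriv g)"
    by (rule holomorphic_on_imp_continuous_on[OF holomorphic_deriv[OF g(2) op]])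
  define G' where "G' = integral B (\<lambda>t. of_real (k t) * deriv g (z - t))"
  have "((\<lambda>w. integral B (\<lambda>t. of_real (k t) * g (w - t))) has_field_derivative G') (at z within U)"
    unfolding G'_def B_def
  proof (rule leibniz_rule_field_derivative[OF _ _ _ U(3,2)])
    fix w t assume wt: "w \<in> U" "t \<in> cbox (Complex (-d) (-d)) (Complex d d)"
    show "((\<lambda>w. of_real (k t) * g (w - t)) has_field_derivative of_real (k t) * deriv g (w - t)) (at w within U)"
      using DERIV_cmult[OF DERIV_chain2[OF gd[OF im] DERIV_diff[OF DERIV_ident DERIV_const]]] wt
      by (simp add: B_def)
  next
    fix w
    show "(\<lambda>t. of_real (k t) * g (w - t)) integrable_on cbox (Complex (-d) (-d)) (Complex d d)"
      by (intro integrable_continuous continuous_intros kc continuous_on_compose2[OF g(1)]) auto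
  next
    show "continuous_on (U \<times> cbox (Complex (-d) (-d)) (Complex d d))
        (\<lambda>(w, t). of_real (k t) * deriv g (w - t))"
      unfolding case_prod_unfold
      using im by (intro continuous_intros continuous_on_compose2[OF kc[of UNIV]] continuous_on_compose2[OF gdc])
         (auto simp: B_def)
  qed
  then have D: "(mol a b g has_field_derivative G') (at z)"
    using at_within_open[OF U(3,1)] by (simp add: eq[abs_def])
  have D': "(mol a b g has_derivative (\<lambda>h. G' * h)) (at (Complex (Re z) (Im z)))"
    using D by (simp add: has_field_derivative_def)
  have x: "((\<lambda>s. mol a b g (Complex s (Im z))) has_vector_derivative G') (at (Re z))"
  proof -
    have "((\<lambda>s. Complex s (Im z)) has_derivative (\<lambda>h. complex_of_real h)) (at (Re z))"
      unfolding Complex_eq by (auto intro!: derivative_eq_intros)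
    from has_derivative_compose[OF this D']
    show ?thesis by (simp add: has_vector_derivative_def scaleR_conv_of_real mult.commute)
  qed
  have y: "((\<lambda>s. mol a b g (Complex (Re z) s)) has_vector_derivative \<i> * G') (at (Im z))"
  proof -
    have "((\<lambda>s. Complex (Re z) s) has_derivative (\<lambda>h. \<i> * complex_of_real h)) (at (Im z))"
      unfolding Complex_eq by (auto intro!: derivative_eq_intros)
    from has_derivative_compose[OF this D']
    show ?thesis by (simp add: has_vector_derivative_def scaleR_conv_of_real mult_ac)
  qed
  have "mol a' b g z = G'"
    using vector_derivative_unique_at[OF x mol_deriv_x[OF g(1) a bc b(3)]] by simp
  moreover have "mol a b' g z = \<i> * G'"
    using vector_derivative_unique_at[OF y mol_deriv_y[OF g(1) b ac a(3)]] by simp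
  ultimately show ?thesis by (simp add: mult.assoc[symmetric])
qed

section \<open>Smooth approximation of the quasiconformal map\<close>

text \<open>The elementary inequality \<open>t \<le> 1 + t\<^sup>2\<close> replaces the Cauchy-Schwarz
  inequality.\<close>

lemma L2_bounded_support_integrable:
  fixes h :: "complex \<Rightarrow> complex"
  assumes hm [measurable]: "h \<in> borel_measurable borel"
    and hi: "integrable lborel (\<lambda>z. (norm (h z))\<^sup>2)"
    and h0: "\<And>z. norm z > R \<Longrightarrow> h z = 0"
  shows "integrable lborel h"
proof (rule Bochner_Integration.integrable_bound)
  show "integrable lborel (\<lambda>z. indicator (cball 0 R) z *\<^sub>R (1::real) + (norm (h z))\<^sup>2)"
    by (intro Bochner_Integration.integrable_add hi borel_integrable_compact) auto
  have "x \<le> 1 + x\<^sup>2" for x :: real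
    using zero_le_power2[of "x - 1 / 2"] by (simp add: power2_eq_square algebra_simps)
  then have "norm (h z) \<le> indicator (cball 0 R) z *\<^sub>R (1::real) + (norm (h z))\<^sup>2" for z
    using h0[of z] by (cases "norm z \<le> R") auto
  then show "AE z in lborel. norm (h z) \<le> norm (indicator (cball 0 R) z *\<^sub>R (1::real) + (norm (h z))\<^sup>2)"
    by (auto intro!: AE_I2 order_trans[OF _ abs_ge_self])
qed simp

context mollifier
begin

lemma ker_mult_integrable':
  assumes h: "integrable lborel (h :: complex \<Rightarrow> complex)"
  shows "integrable lborel (\<lambda>w. ker (z - w) *\<^sub>R h w)"
proof -
  obtain B where B: "B > 0" "\<And>u. ker u \<le> B" using ker_bounded by blast
  have [measurable]: "h \<in> borel_measurable borel" using h by simp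
  show ?thesis
    by (rule Bochner_Integration.integrable_bound[OF integrable_mult_right[OF integrable_norm[OF h], of B]])
       (auto intro!: AE_I2 mult_right_mono simp: ker_nonneg abs_mult B less_imp_le)
qed

lemma mol_diff:
  assumes "integrable lborel h" "integrable lborel k"
  shows "mol a b (\<lambda>z. h z - k z) z = mol a b h z - mol a b k z"
  using ker_mult_integrable'[OF assms(1)] ker_mult_integrable'[OF assms(2)]
  by (simp add: mol_ker scaleR_diff_right)

lemma mol_local:
  assumes "\<And>w. \<bar>Re z - Re w\<bar> < d \<Longrightarrow> \<bar>Im z - Im w\<bar> < d \<Longrightarrow> h w = k w"
  shows "mol a b h z = mol a b k z"
  unfolding mol_ker
proof (rule Bochner_Integration.integral_cong[OF refl])
  fix w
  show "ker (z - w) *\<^sub>R h w = ker (z - w) *\<^sub>R k w"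
  proof (cases "\<bar>Re z - Re w\<bar> < d \<and> \<bar>Im z - Im w\<bar> < d")
    case False
    then have "ker (z - w) = 0" using asupp[of "Re z - Re w"] bsupp[of "Im z - Im w"] by (auto simp: ker_def)
    then show ?thesis by simp
  qed (simp add: assms)
qed

end

lemma norm_le_Re_Im_less:
  assumes "\<bar>Re z - Re w\<bar> < d" "\<bar>Im z - Im w\<bar> < d"
  shows "norm (w - z) < 2 * d"
  using cmod_le[of "w - z"] assms by simp

text \<open>Contractivity allows replacing \<open>p\<close> by a continuous function at a small cost in
  \<open>L2\<close>, and for continuous functions the convergence is uniform. Only values of
  \<open>p\<close> in a slightly larger disc matter, so \<open>p\<close> may be cut off.\<close>

lemma mol_L2_tendsto:
  fixes b :: "nat \<Rightarrow> real \<Rightarrow> real" and p :: "complex \<Rightarrow> complex"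
  assumes M: "\<And>n. mollifier (b n) (b n) (1 / real (Suc n))"
    and pm [measurable]: "p \<in> borel_measurable borel"
    and p2: "\<And>R. set_integrable lborel (cball 0 R) (\<lambda>z. (norm (p z))\<^sup>2)"
  shows "set_integrable lborel (cball 0 R) (\<lambda>z. (norm (mol (b n) (b n) p z - p z))\<^sup>2)"
    and "(\<lambda>n. LINT z:cball 0 R|lborel. (norm (mol (b n) (b n) p z - p z))\<^sup>2) \<longlonglongrightarrow> 0"
proof -
  (* The kernels only see points at distance less than 2 from the centre. *)
  define R' where "R' = max R 0 + 2"
  define h where "h z = indicator (cball 0 R') z *\<^sub>R p z" for z
  have [measurable]: "h \<in> borel_measurable borel" unfolding h_def
    by (intro borel_measurable_scaleR borel_measurable_indicator pm) simp
  have h0: "h z = 0" if "norm z > R'" for z using that by (simp add: h_def)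
  have h2: "integrable lborel (\<lambda>z. (norm (h z))\<^sup>2)"
  proof -
    have "(\<lambda>z. (norm (h z))\<^sup>2) = (\<lambda>z. indicat_real (cball 0 R') z *\<^sub>R (norm (p z))\<^sup>2)"
      by (auto simp: h_def indicator_def)
    then show ?thesis using p2[of R'] by (simp add: set_integrable_def)
  qed
  have h1: "integrable lborel h" by (rule L2_bounded_support_integrable[OF _ h2 h0]) auto
  have hp: "h z = p z" if "norm z \<le> R" for z using that by (auto simp: h_def R'_def)
  have mhp: "mol (b n) (b n) p z = mol (b n) (b n) h z" if z: "norm z \<le> R" for n z
  proof (rule mollifier.mol_local[OF M])
    fix w assume w: "\<bar>Re z - Re w\<bar> < 1 / real (Suc n)" "\<bar>Im z - Im w\<bar> < 1 / real (Suc n)"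
    have "1 / real (Suc n) \<le> 1" by simp
    then have "norm (w - z) < 2" using norm_le_Re_Im_less[OF w] by linarith
    then have "norm w \<le> R'" using z norm_triangle_ineq2[of w z] by (auto simp: R'_def)
    then show "p w = h w" by (simp add: h_def)
  qed
  have rewr: "indicat_real (cball 0 R) z *\<^sub>R (norm (mol (b n) (b n) p z - p z))\<^sup>2
      = indicat_real (cball 0 R) z *\<^sub>R (norm (mol (b n) (b n) h z - h z))\<^sup>2" for n z
    by (auto simp: indicator_def hp mhp)
  have mh2: "integrable lborel (\<lambda>z. (norm (mol (b n) (b n) h z))\<^sup>2)" for n
    by (rule mollifier.mol_contract(1)[OF M _ h1 h2]) simp
  have [measurable]: "mol (b n) (b n) h \<in> borel_measurable borel" for n
    by (rule mollifier.mol_measurable[OF M]) simp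
  have full: "integrable lborel (\<lambda>z. (norm (mol (b n) (b n) h z - h z))\<^sup>2)" for n
  proof (rule Bochner_Integration.integrable_bound)
    show "integrable lborel (\<lambda>z. 2 * (norm (mol (b n) (b n) h z))\<^sup>2 + 2 * (norm (h z))\<^sup>2)"
      by (intro Bochner_Integration.integrable_add integrable_mult_right mh2 h2)
    show "AE z in lborel. norm ((norm (mol (b n) (b n) h z - h z))\<^sup>2)
        \<le> norm (2 * (norm (mol (b n) (b n) h z))\<^sup>2 + 2 * (norm (h z))\<^sup>2)"
      using norm_sq_add2[of "mol (b n) (b n) h z" "- h z" for z]
      by (auto intro!: AE_I2)
  qed measurable
  show int: "set_integrable lborel (cball 0 R) (\<lambda>z. (norm (mol (b n) (b n) p z - p z))\<^sup>2)" for n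
    unfolding set_integrable_def rewr
    using integrable_mult_indicator[OF _ full[of n], of "cball 0 R"] by simp
  show "(\<lambda>n. LINT z:cball 0 R|lborel. (norm (mol (b n) (b n) p z - p z))\<^sup>2) \<longlonglongrightarrow> 0"
  proof (rule LIMSEQ_I)
    fix e :: real assume e: "e > 0"
    have e12: "e / 12 > 0" and Rp: "R' > 0" using e by (auto simp: R'_def)
    obtain \<phi> where \<phi>c: "continuous_on UNIV \<phi>" and \<phi>0: "\<And>z. norm z > R' + 1 \<Longrightarrow> \<phi> z = 0"
      and d2: "integrable lborel (\<lambda>z. (norm (h z - \<phi> z))\<^sup>2)" and de: "(LINT z|lborel. (norm (h z - \<phi> z))\<^sup>2) < e / 12"
      using L2_density[OF _ h2 h0 e12 Rp] by auto
    have [measurable]: "\<phi> \<in> borel_measurable borel" using \<phi>c by (rule borel_measurable_continuous_onI)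
    have \<phi>1: "integrable lborel \<phi>"
      by (rule integrable_cont_supp[OF \<phi>c compact_cball[of 0 "R'+1"]]) (auto intro: \<phi>0)
    have d1: "integrable lborel (\<lambda>z. h z - \<phi> z)" using h1 \<phi>1 by simp
    define A where "A = measure lborel (cball (0::complex) R)"
    (* Chosen such that the term with the uniform error contributes at most e/4; the other two
       terms contribute 4e/12 and 2e/12. *)
    define \<eta> where "\<eta> = sqrt (e / (16 * (A + 1)))"
    have A: "A \<ge> 0" by (simp add: A_def)
    have \<eta>: "\<eta> > 0" using e A by (simp add: \<eta>_def)
    have \<eta>A: "4 * (\<eta>\<^sup>2 * A) \<le> e / 4"
    proof -
      have "\<eta>\<^sup>2 = e / (16 * (A + 1))" using e A by (simp add: \<eta>_def)
      then have "4 * (\<eta>\<^sup>2 * A) = e / 4 * (A / (A + 1))" using A by (simp add: field_simps)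
      also have "\<dots> \<le> e / 4 * 1" using e A by (intro mult_left_mono) auto
      finally show ?thesis by simp
    qed
    have "uniformly_continuous_on (cball 0 R') \<phi>"
      by (rule compact_uniformly_continuous[OF continuous_on_subset[OF \<phi>c]]) auto
    then obtain \<delta> where \<delta>: "\<delta> > 0" "\<And>w z. norm z \<le> R' \<Longrightarrow> norm w \<le> R' \<Longrightarrow> dist w z < \<delta> \<Longrightarrow> dist (\<phi> w) (\<phi> z) < \<eta>"
      unfolding uniformly_continuous_on_def using \<eta> by (metis mem_cball_0)
    obtain n0 where n0: "2 / \<delta> < real n0" using reals_Archimedean2 by blast
    show "\<exists>no. \<forall>n\<ge>no. norm ((LINT z:cball 0 R|lborel. (norm (mol (b n) (b n) p z - p z))\<^sup>2) - 0) < e"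
    proof (intro exI allI impI)
      fix n assume n: "n \<ge> n0"
      interpret mollifier "b n" "b n" "1 / real (Suc n)" by (rule M)
      let ?T = "mol (b n) (b n)"
      have sm: "2 * (1 / real (Suc n)) < \<delta>"
      proof -
        have "2 / \<delta> < real (Suc n)" using n0 n by linarith
        then show ?thesis using \<delta>(1) by (simp add: field_simps)
      qed
      have ap: "norm (?T \<phi> z - \<phi> z) \<le> \<eta>" if z: "norm z \<le> R" for z
      proof (rule mol_approx[OF \<phi>c])
        fix w assume w: "\<bar>Re z - Re w\<bar> < 1 / real (Suc n)" "\<bar>Im z - Im w\<bar> < 1 / real (Suc n)"
        have "norm (w - z) < 2 * (1 / real (Suc n))" by (rule norm_le_Re_Im_less[OF w])
        moreover have "1 / real (Suc n) \<le> 1" by simp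
        ultimately have "norm (w - z) < 2" by linarith
        moreover have "dist w z < \<delta>" using sm norm_le_Re_Im_less[OF w] by (simp add: dist_norm)
        moreover have "norm w \<le> R'" "norm z \<le> R'" using z \<open>norm (w - z) < 2\<close> norm_triangle_ineq2[of w z] by (auto simp: R'_def)
        ultimately show "norm (\<phi> w - \<phi> z) \<le> \<eta>" using \<delta>(2)[of z w] by (simp add: dist_norm)
      qed
      have c1: "integrable lborel (\<lambda>z. (norm (?T (\<lambda>z. h z - \<phi> z) z))\<^sup>2)"
        and c2: "(LINT z|lborel. (norm (?T (\<lambda>z. h z - \<phi> z) z))\<^sup>2) \<le> (LINT z|lborel. (norm (h z - \<phi> z))\<^sup>2)"
        using mol_contract[OF _ d1 d2] by auto
      define D where "D z = 4 * (norm (?T (\<lambda>z. h z - \<phi> z) z))\<^sup>2 + 4 * (indicat_real (cball 0 R) z *\<^sub>R \<eta>\<^sup>2)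
          + 2 * (norm (h z - \<phi> z))\<^sup>2" for z
      have i\<eta>: "integrable lborel (\<lambda>z::complex. indicat_real (cball 0 R) z *\<^sub>R \<eta>\<^sup>2)"
        by (rule borel_integrable_compact) auto
      have Di: "integrable lborel D"
        unfolding D_def by (intro Bochner_Integration.integrable_add integrable_mult_right c1 i\<eta> d2)
      have le: "indicat_real (cball 0 R) z *\<^sub>R (norm (?T p z - p z))\<^sup>2 \<le> D z" for z
      proof (cases "norm z \<le> R")
        case True
        have "(norm (?T p z - p z))\<^sup>2 = (norm (?T (\<lambda>z. h z - \<phi> z) z + (?T \<phi> z - \<phi> z) + (\<phi> z - h z)))\<^sup>2"
          using True by (simp add: mol_diff[OF h1 \<phi>1] hp mhp)
        also have "\<dots> \<le> 4 * (norm (?T (\<lambda>z. h z - \<phi> z) z))\<^sup>2 + 4 * (norm (?T \<phi> z - \<phi> z))\<^sup>2 + 2 * (norm (\<phi> z - h z))\<^sup>2"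
          by (rule norm_sq_add3)
        also have "\<dots> \<le> D z"
          using True power_mono[OF ap[OF True] norm_ge_zero, of 2] by (simp add: D_def norm_minus_commute)
        finally show ?thesis using True by simp
      qed (simp add: D_def)
      have "(LINT z:cball 0 R|lborel. (norm (?T p z - p z))\<^sup>2) \<le> (LINT z|lborel. D z)"
        unfolding set_lebesgue_integral_def
        by (rule integral_mono[OF int[unfolded set_integrable_def] Di le])
      also have "\<dots> = 4 * (LINT z|lborel. (norm (?T (\<lambda>z. h z - \<phi> z) z))\<^sup>2) + 4 * (\<eta>\<^sup>2 * A)
          + 2 * (LINT z|lborel. (norm (h z - \<phi> z))\<^sup>2)"
        using c1 i\<eta> d2 unfolding D_def by (simp add: A_def)
      also have "\<dots> < e" using c2 de \<eta>A e by linarith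
      finally have "(LINT z:cball 0 R|lborel. (norm (?T p z - p z))\<^sup>2) < e" .
      moreover have "(LINT z:cball 0 R|lborel. (norm (?T p z - p z))\<^sup>2) \<ge> 0"
        unfolding set_lebesgue_integral_def by (intro integral_nonneg_AE AE_I2) auto
      ultimately show "norm ((LINT z:cball 0 R|lborel. (norm (?T p z - p z))\<^sup>2) - 0) < e" by simp
    qed
  qed
qed

lemma mollifier_sequence:
  obtains b b' :: "nat \<Rightarrow> real \<Rightarrow> real" where
    "\<And>n k. Ck_on k (b n) UNIV" "\<And>n x. \<bar>x\<bar> \<ge> 1 / real (Suc n) \<Longrightarrow> b n x = 0"
    "\<And>n x. \<bar>x\<bar> \<ge> 1 / real (Suc n) \<Longrightarrow> b' n x = 0"
    "\<And>n x. (b n has_real_derivative b' n x) (at x)" "\<And>n. continuous_on UNIV (b' n)"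
    "\<And>n. mollifier (b n) (b n) (1 / real (Suc n))"
proof -
  obtain c :: "real \<Rightarrow> real" and c' where c: "\<And>n. Ck_on n c UNIV" "\<And>x. c x \<ge> 0" "\<And>x. \<bar>x\<bar> \<ge> 1 \<Longrightarrow> c x = 0"
    "\<And>x. (c has_real_derivative c' x) (at x)" "continuous_on UNIV c'"
    "integrable lborel c" "(LINT x|lborel. c x) = 1"
    using bump_exists by blast
  (* The summand 0 puts the argument into affine form. *)
  define b where "b n x = real (Suc n) * c (real (Suc n) * x + 0)" for n x
  define b' where "b' n x = real (Suc n) * (real (Suc n) * c' (real (Suc n) * x))" for n x
  have 1: "Ck_on k (b n) UNIV" for n k
    unfolding b_def by (intro Ck_on_mult Ck_on_const open_UNIV Ck_on_affine[OF bounded_linear_mult_right] c)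
  have 2: "b n x = 0" if "\<bar>x\<bar> \<ge> 1 / real (Suc n)" for n x
  proof -
    have "\<bar>real (Suc n) * x + 0\<bar> \<ge> 1" using that by (simp add: abs_mult field_simps)
    then show ?thesis using c(3) by (simp add: b_def)
  qed
  have 3: "(b n has_real_derivative b' n x) (at x)" for n x
    unfolding b_def b'_def
    by (intro DERIV_cmult) (use DERIV_chain2[OF c(4) DERIV_cmult_Id[of "real (Suc n)"]] in \<open>simp add: mult.commute\<close>)
  have nn: "b n x \<ge> 0" for n x by (simp add: b_def c)
  have 4: "b' n x = 0" if "\<bar>x\<bar> \<ge> 1 / real (Suc n)" for n x
    by (rule DERIV_local_min[OF 3, of 1]) (use nn 2[OF that] in auto)
  have 5: "continuous_on UNIV (b' n)" for n
    unfolding b'_def by (intro continuous_intros continuous_on_compose2[OF c(5)]) auto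
  have bc: "continuous_on UNIV (b n)" for n using 1[of 0 n] by simp
  have 6: "(LINT x|lborel. b n x) = 1" for n
    using lborel_integral_real_affine[of "real (Suc n)" c 0] c(7) by (simp add: b_def)
  have "mollifier (b n) (b n) (1 / real (Suc n))" for n
    by unfold_locales (use bc nn 2 6 in auto)
  with 1 2 3 4 5 show thesis using that by blast
qed

text \<open>All the regularity that the length-area argument uses. The derivative \<open>fx n\<close> has
  two descriptions: as the convolution of \<open>g\<close> with a differentiated kernel it is a
  classical derivative, and as the mollification of \<open>p\<close> it converges to
  \<open>p\<close>. The common mixed derivative \<open>fxy\<close> is what Stokes's theorem needs,
  and the last property keeps the Cauchy-Riemann equations away from the real axis.\<close>

lemma smooth_approximation:
  fixes g p q :: "complex \<Rightarrow> complex"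
  assumes g: "continuous_on UNIV g"
    and [measurable]: "p \<in> borel_measurable borel" "q \<in> borel_measurable borel"
    and p2: "\<And>R. set_integrable lborel (cball 0 R) (\<lambda>z. (norm (p z))\<^sup>2)"
    and q2: "\<And>R. set_integrable lborel (cball 0 R) (\<lambda>z. (norm (q z))\<^sup>2)"
    and Dx: "\<And>\<phi>. test_function_on UNIV \<phi> \<Longrightarrow>
      (LINT z|lborel. dir_deriv 1 \<phi> z *\<^sub>R g z) = - (LINT z|lborel. \<phi> z *\<^sub>R p z)"
    and Dy: "\<And>\<phi>. test_function_on UNIV \<phi> \<Longrightarrow>
      (LINT z|lborel. dir_deriv \<i> \<phi> z *\<^sub>R g z) = - (LINT z|lborel. \<phi> z *\<^sub>R q z)"
    and hol: "g holomorphic_on {z. Im z > 0}"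
  obtains f fx fy fxy :: "nat \<Rightarrow> complex \<Rightarrow> complex" where
    "\<And>n. continuous_on UNIV (f n)" "\<And>n. continuous_on UNIV (fx n)" "\<And>n. continuous_on UNIV (fy n)"
    "\<And>n. continuous_on UNIV (fxy n)"
    "\<And>n x y. ((\<lambda>s. f n (Complex s y)) has_vector_derivative fx n (Complex x y)) (at x)"
    "\<And>n x y. ((\<lambda>s. f n (Complex x s)) has_vector_derivative fy n (Complex x y)) (at y)"
    "\<And>n x y. ((\<lambda>s. fy n (Complex s y)) has_vector_derivative fxy n (Complex x y)) (at x)"
    "\<And>n x y. ((\<lambda>s. fx n (Complex x s)) has_vector_derivative fxy n (Complex x y)) (at y)"
    "\<And>R. uniform_limit (cball 0 R) f g sequentially"
    "\<And>R n. set_integrable lborel (cball 0 R) (\<lambda>z. (norm (fx n z - p z))\<^sup>2)"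
    "\<And>R. (\<lambda>n. LINT z:cball 0 R|lborel. (norm (fx n z - p z))\<^sup>2) \<longlonglongrightarrow> 0"
    "\<And>R n. set_integrable lborel (cball 0 R) (\<lambda>z. (norm (fy n z - q z))\<^sup>2)"
    "\<And>R. (\<lambda>n. LINT z:cball 0 R|lborel. (norm (fy n z - q z))\<^sup>2) \<longlonglongrightarrow> 0"
    "\<And>n z. Im z > 1 / real (Suc n) \<Longrightarrow> fx n z + \<i> * fy n z = 0"
proof -
  obtain b b' :: "nat \<Rightarrow> real \<Rightarrow> real" where
    b: "\<And>n k. Ck_on k (b n) UNIV" "\<And>n x. \<bar>x\<bar> \<ge> 1 / real (Suc n) \<Longrightarrow> b n x = 0"
    "\<And>n x. \<bar>x\<bar> \<ge> 1 / real (Suc n) \<Longrightarrow> b' n x = 0"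
    "\<And>n x. (b n has_real_derivative b' n x) (at x)" "\<And>n. continuous_on UNIV (b' n)"
    and M: "\<And>n. mollifier (b n) (b n) (1 / real (Suc n))" using mollifier_sequence by blast
  have bc: "continuous_on UNIV (b n)" for n using b(1)[of 0 n] by simp
  define f where "f n = mol (b n) (b n) g" for n
  define fx where "fx n = mol (b' n) (b n) g" for n
  define fy where "fy n = mol (b n) (b' n) g" for n
  define fxy where "fxy n = mol (b' n) (b' n) g" for n
  have fxp: "fx n = mol (b n) (b n) p" for n
    unfolding fx_def using mol_distr_deriv(1)[OF Dx b(1,4,2) b(1,4,2)] by auto
  have fyq: "fy n = mol (b n) (b n) q" for n
    unfolding fy_def using mol_distr_deriv(2)[OF Dy b(1,4,2) b(1,4,2)] by auto
  show thesis
  proof (rule that[of f fx fy fxy])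
    fix n
    show "continuous_on UNIV (f n)" "continuous_on UNIV (fx n)" "continuous_on UNIV (fy n)" "continuous_on UNIV (fxy n)"
      unfolding f_def fx_def fy_def fxy_def
      by (rule mol_continuous[OF g, where d = "1 / real (Suc n)"]; (rule bc b; assumption?))+
    fix x y
    show "((\<lambda>s. f n (Complex s y)) has_vector_derivative fx n (Complex x y)) (at x)"
      unfolding f_def fx_def by (rule mol_deriv_x[OF g b(4,5,2,3) bc b(2)])
    show "((\<lambda>s. f n (Complex x s)) has_vector_derivative fy n (Complex x y)) (at y)"
      unfolding f_def fy_def by (rule mol_deriv_y[OF g b(4,5,2,3) bc b(2)])
    show "((\<lambda>s. fy n (Complex s y)) has_vector_derivative fxy n (Complex x y)) (at x)"
      unfolding fy_def fxy_def by (rule mol_deriv_x[OF g b(4,5,2,3) b(5,3)])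
    show "((\<lambda>s. fx n (Complex x s)) has_vector_derivative fxy n (Complex x y)) (at y)"
      unfolding fx_def fxy_def by (rule mol_deriv_y[OF g b(4,5,2,3) b(5,3)])
  next
    fix R
    show "uniform_limit (cball 0 R) f g sequentially"
    proof (rule uniform_limitI)
      fix e :: real assume e: "e > 0"
      have "uniformly_continuous_on (cball 0 (R+2)) g"
        by (rule compact_uniformly_continuous[OF continuous_on_subset[OF g]]) auto
      moreover have "e / 2 > 0" using e by simp
      ultimately obtain \<delta> where \<delta>: "\<delta> > 0" "\<And>w z. norm z \<le> R+2 \<Longrightarrow> norm w \<le> R+2 \<Longrightarrow> dist w z < \<delta> \<Longrightarrow> dist (g w) (g z) < e / 2"
        unfolding uniformly_continuous_on_def by (metis mem_cball_0)
      obtain n0 where n0: "2 / \<delta> < real n0" using reals_Archimedean2 by blast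
      show "\<forall>\<^sub>F n in sequentially. \<forall>z\<in>cball 0 R. dist (f n z) (g z) < e"
        using eventually_ge_at_top[of n0]
      proof (eventually_elim, intro ballI)
        fix n and z :: complex assume n: "n \<ge> n0" and z: "z \<in> cball 0 R"
        interpret mollifier "b n" "b n" "1 / real (Suc n)" by (rule M)
        have sm: "2 * (1 / real (Suc n)) < \<delta>"
        proof -
          have "2 / \<delta> < real (Suc n)" using n0 n by linarith
          then show ?thesis using \<delta>(1) by (simp add: field_simps)
        qed
        have "norm (f n z - g z) \<le> e / 2"
          unfolding f_def
        proof (rule mol_approx[OF g])
          fix w assume w: "\<bar>Re z - Re w\<bar> < 1 / real (Suc n)" "\<bar>Im z - Im w\<bar> < 1 / real (Suc n)"
          have "norm (w - z) < 2 * (1 / real (Suc n))" by (rule norm_le_Re_Im_less[OF w])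
          moreover have "1 / real (Suc n) \<le> 1" by simp
          ultimately have "norm (w - z) < 2" by linarith
          moreover have "dist w z < \<delta>" using sm norm_le_Re_Im_less[OF w] by (simp add: dist_norm)
          ultimately have *: "norm (w - z) < 2" "dist w z < \<delta>" by auto
          have "norm w \<le> R + 2" "norm z \<le> R + 2" using z * norm_triangle_ineq2[of w z] by auto
          with * show "norm (g w - g z) \<le> e / 2" using \<delta>(2)[of z w] by (simp add: dist_norm)
        qed
        then show "dist (f n z) (g z) < e" using e by (simp add: dist_norm)
      qed
    qed
  next
    fix R n
    show "set_integrable lborel (cball 0 R) (\<lambda>z. (norm (fx n z - p z))\<^sup>2)"
      unfolding fxp by (rule mol_L2_tendsto(1)[OF M _ p2]) simp
    show "set_integrable lborel (cball 0 R) (\<lambda>z. (norm (fy n z - q z))\<^sup>2)"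
      unfolding fyq by (rule mol_L2_tendsto(1)[OF M _ q2]) simp
  next
    fix R
    show "(\<lambda>n. LINT z:cball 0 R|lborel. (norm (fx n z - p z))\<^sup>2) \<longlonglongrightarrow> 0"
      unfolding fxp by (rule mol_L2_tendsto(2)[OF M _ p2]) simp
    show "(\<lambda>n. LINT z:cball 0 R|lborel. (norm (fy n z - q z))\<^sup>2) \<longlonglongrightarrow> 0"
      unfolding fyq by (rule mol_L2_tendsto(2)[OF M _ q2]) simp
  next
    fix n z assume z: "Im z > 1 / real (Suc n)"
    show "fx n z + \<i> * fy n z = 0"
      unfolding fx_def fy_def by (rule mol_holomorphic[OF g hol b(4,5,2,3) b(4,5,2,3) z])
  qed
qed

section \<open>Stokes for logarithmic forms, and winding numbers\<close>

lemma indicator_cbox_Complex: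
  "indicat_real (cbox (Complex x0 y0) (Complex x1 y1)) (Complex x y) = indicat_real {x0..x1} x * indicat_real {y0..y1} y"
  by (auto simp: indicator_def in_cbox_complex_iff)

lemma LINT_rect:
  fixes D :: "complex \<Rightarrow> real"
  assumes c: "continuous_on (cbox (Complex x0 y0) (Complex x1 y1)) D"
  shows "(LINT z:cbox (Complex x0 y0) (Complex x1 y1)|lborel. D z)
      = (LINT y:{y0..y1}|lborel. LINT x:{x0..x1}|lborel. D (Complex x y))"
    and "(LINT z:cbox (Complex x0 y0) (Complex x1 y1)|lborel. D z)
      = (LINT x:{x0..x1}|lborel. LINT y:{y0..y1}|lborel. D (Complex x y))"
proof -
  note i = integrable_cont_cbox[OF c, unfolded set_integrable_def]
  have 1: "(LINT x|lborel. (indicat_real {x0..x1} x * indicat_real {y0..y1} y) *\<^sub>R D (Complex x y))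
      = indicat_real {y0..y1} y *\<^sub>R (LINT x|lborel. indicat_real {x0..x1} x *\<^sub>R D (Complex x y))" for y
    by (cases "y \<in> {y0..y1}") auto
  have 2: "(LINT y|lborel. (indicat_real {x0..x1} x * indicat_real {y0..y1} y) *\<^sub>R D (Complex x y))
      = indicat_real {x0..x1} x *\<^sub>R (LINT y|lborel. indicat_real {y0..y1} y *\<^sub>R D (Complex x y))" for x
    by (cases "x \<in> {x0..x1}") auto
  show "(LINT z:cbox (Complex x0 y0) (Complex x1 y1)|lborel. D z)
      = (LINT y:{y0..y1}|lborel. LINT x:{x0..x1}|lborel. D (Complex x y))"
    unfolding set_lebesgue_integral_def complex_integral_iterated_yx[OF i] indicator_cbox_Complex 1 ..
  show "(LINT z:cbox (Complex x0 y0) (Complex x1 y1)|lborel. D z)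
      = (LINT x:{x0..x1}|lborel. LINT y:{y0..y1}|lborel. D (Complex x y))"
    unfolding set_lebesgue_integral_def complex_integral_iterated_xy[OF i] indicator_cbox_Complex 2 ..
qed

lemma LINT_rect_dx:
  fixes Q D :: "complex \<Rightarrow> real"
  assumes c: "continuous_on (cbox (Complex x0 y0) (Complex x1 y1)) D" and le: "x0 \<le> x1"
    and d: "\<And>x y. x \<in> {x0..x1} \<Longrightarrow> y \<in> {y0..y1} \<Longrightarrow>
      ((\<lambda>s. Q (Complex s y)) has_real_derivative D (Complex x y)) (at x)"
  shows "(LINT z:cbox (Complex x0 y0) (Complex x1 y1)|lborel. D z)
      = (LINT y:{y0..y1}|lborel. Q (Complex x1 y) - Q (Complex x0 y))"
proof -
  have "(LINT x:{x0..x1}|lborel. D (Complex x y)) = Q (Complex x1 y) - Q (Complex x0 y)" if y: "y \<in> {y0..y1}" for y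
    unfolding set_lebesgue_integral_def
  proof (rule integral_FTC_Icc[OF le])
    show "((\<lambda>s. Q (Complex s y)) has_vector_derivative D (Complex x y)) (at x within {x0..x1})" if "x0 \<le> x" "x \<le> x1" for x
      using d[OF _ y, of x] that
      by (auto intro: has_vector_derivative_at_within simp: has_real_derivative_iff_has_vector_derivative)
    show "continuous_on {x0..x1} (\<lambda>x. D (Complex x y))"
      by (rule continuous_on_compose2[OF c]) (use y in \<open>auto simp: in_cbox_complex_iff Complex_eq intro!: continuous_intros\<close>)
  qed
  then show ?thesis
    unfolding LINT_rect(1)[OF c] by (intro set_lebesgue_integral_cong) auto
qed

lemma LINT_rect_dy:
  fixes Q D :: "complex \<Rightarrow> real"
  assumes c: "continuous_on (cbox (Complex x0 y0) (Complex x1 y1)) D" and le: "y0 \<le> y1"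
    and d: "\<And>x y. x \<in> {x0..x1} \<Longrightarrow> y \<in> {y0..y1} \<Longrightarrow>
      ((\<lambda>s. Q (Complex x s)) has_real_derivative D (Complex x y)) (at y)"
  shows "(LINT z:cbox (Complex x0 y0) (Complex x1 y1)|lborel. D z)
      = (LINT x:{x0..x1}|lborel. Q (Complex x y1) - Q (Complex x y0))"
proof -
  have "(LINT y:{y0..y1}|lborel. D (Complex x y)) = Q (Complex x y1) - Q (Complex x y0)" if x: "x \<in> {x0..x1}" for x
    unfolding set_lebesgue_integral_def
  proof (rule integral_FTC_Icc[OF le])
    show "((\<lambda>s. Q (Complex x s)) has_vector_derivative D (Complex x y)) (at y within {y0..y1})" if "y0 \<le> y" "y \<le> y1" for y
      using d[OF x, of y] that
      by (auto intro: has_vector_derivative_at_within simp: has_real_derivative_iff_has_vector_derivative)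
    show "continuous_on {y0..y1} (\<lambda>y. D (Complex x y))"
      by (rule continuous_on_compose2[OF c]) (use x in \<open>auto simp: in_cbox_complex_iff Complex_eq intro!: continuous_intros\<close>)
  qed
  then show ?thesis
    unfolding LINT_rect(2)[OF c] by (intro set_lebesgue_integral_cong) auto
qed

lemma isCont_locally_zero:
  fixes D :: "complex \<Rightarrow> real"
  assumes "open N" "z \<in> N" "\<And>w. w \<in> N \<Longrightarrow> D w = 0"
  shows "isCont D z"
proof -
  have "isCont (\<lambda>w. 0::real) z" by simp
  moreover have "eventually (\<lambda>w. D w = 0) (nhds z)"
    using assms eventually_nhds by blast
  ultimately show ?thesis by (subst isCont_cong)
qed

lemma has_real_derivative_Im_divide:
  assumes u: "(u has_vector_derivative u') (at s)" and v: "(v has_vector_derivative v') (at s)"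
    and nz: "v s \<noteq> 0"
  shows "((\<lambda>s. Im (u s / v s)) has_real_derivative Im ((u' * v s - u s * v') / (v s)\<^sup>2)) (at s)"
proof -
  have "((\<lambda>s. u s / v s) has_derivative (\<lambda>h. h *\<^sub>R ((u' * v s - u s * v') / (v s)\<^sup>2))) (at s)"
    by (rule has_derivative_eq_rhs[OF has_derivative_divide'[OF u[unfolded has_vector_derivative_def] v[unfolded has_vector_derivative_def] nz]])
       (auto simp: fun_eq_iff power2_eq_square scaleR_conv_of_real algebra_simps)
  from has_derivative_Im[OF this]
  show ?thesis by (simp add: has_field_derivative_def mult.commute[of _ "Im _"])
qed

text \<open>The form \<open>X Im (df / f)\<close> has exterior derivative
  \<open>dX \<and> Im (df / f)\<close>, since \<open>df / f\<close> is closed. On a rectangle the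
  boundary integral results from integrating each of the two terms along its own coordinate, and
  the contributions of the mixed derivative cancel. Zeros of \<open>f\<close> are harmless,
  because \<open>X\<close> vanishes near them.\<close>

lemma stokes_log:
  fixes X Xx Xy :: "complex \<Rightarrow> real" and f fx fy fxy :: "complex \<Rightarrow> complex"
  defines "R x0 x1 y0 y1 \<equiv> cbox (Complex x0 y0) (Complex x1 y1)"
  assumes le: "x0 \<le> x1" "y0 \<le> y1"
    and cX: "continuous_on UNIV X" "continuous_on UNIV Xx" "continuous_on UNIV Xy"
    and cf: "continuous_on UNIV f" "continuous_on UNIV fx" "continuous_on UNIV fy" "continuous_on UNIV fxy"
    and dX: "\<And>x y. ((\<lambda>s. X (Complex s y)) has_real_derivative Xx (Complex x y)) (at x)"
      "\<And>x y. ((\<lambda>s. X (Complex x s)) has_real_derivative Xy (Complex x y)) (at y)"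
    and df: "\<And>x y. ((\<lambda>s. f (Complex s y)) has_vector_derivative fx (Complex x y)) (at x)"
      "\<And>x y. ((\<lambda>s. f (Complex x s)) has_vector_derivative fy (Complex x y)) (at y)"
      "\<And>x y. ((\<lambda>s. fy (Complex s y)) has_vector_derivative fxy (Complex x y)) (at x)"
      "\<And>x y. ((\<lambda>s. fx (Complex x s)) has_vector_derivative fxy (Complex x y)) (at y)"
    and N: "open N" "\<And>z. z \<in> R x0 x1 y0 y1 \<Longrightarrow> f z = 0 \<Longrightarrow> z \<in> N"
      "\<And>z. z \<in> N \<Longrightarrow> X z = 0" "\<And>z. z \<in> N \<Longrightarrow> Xx z = 0" "\<And>z. z \<in> N \<Longrightarrow> Xy z = 0"
  shows "(LINT z:R x0 x1 y0 y1|lborel. Xx z * Im (fy z / f z) - Xy z * Im (fx z / f z))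
    = (LINT y:{y0..y1}|lborel. X (Complex x1 y) * Im (fy (Complex x1 y) / f (Complex x1 y))
          - X (Complex x0 y) * Im (fy (Complex x0 y) / f (Complex x0 y)))
    - (LINT x:{x0..x1}|lborel. X (Complex x y1) * Im (fx (Complex x y1) / f (Complex x y1))
          - X (Complex x y0) * Im (fx (Complex x y0) / f (Complex x y0)))"
proof -
  define D1 where "D1 z = Xx z * Im (fy z / f z) + X z * Im ((fxy z * f z - fy z * fx z) / (f z)\<^sup>2)" for z
  define D2 where "D2 z = Xy z * Im (fx z / f z) + X z * Im ((fxy z * f z - fx z * fy z) / (f z)\<^sup>2)" for z
  have ic: "isCont X z" "isCont Xx z" "isCont Xy z" "isCont f z" "isCont fx z" "isCont fy z" "isCont fxy z" for z
    using cX cf by (auto simp: continuous_on_eq_continuous_at)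
  have c1: "continuous_on (R x0 x1 y0 y1) D1"
  proof (rule continuous_at_imp_continuous_on, rule ballI)
    fix z assume z: "z \<in> R x0 x1 y0 y1"
    show "isCont D1 z"
    proof (cases "f z = 0")
      case True
      show ?thesis by (rule isCont_locally_zero[OF N(1) N(2)[OF z True]]) (simp add: D1_def N)
    next
      case False
      then show ?thesis unfolding D1_def by (intro continuous_intros ic isCont_Im) auto
    qed
  qed
  have c2: "continuous_on (R x0 x1 y0 y1) D2"
  proof (rule continuous_at_imp_continuous_on, rule ballI)
    fix z assume z: "z \<in> R x0 x1 y0 y1"
    show "isCont D2 z"
    proof (cases "f z = 0")
      case True
      show ?thesis by (rule isCont_locally_zero[OF N(1) N(2)[OF z True]]) (simp add: D2_def N)
    next
      case False
      then show ?thesis unfolding D2_def by (intro continuous_intros ic isCont_Im) auto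
    qed
  qed
  have cxl: "continuous_on UNIV (\<lambda>s. Complex s y)" and cyl: "continuous_on UNIV (\<lambda>s. Complex y s)" for y
    by (auto simp: Complex_eq intro!: continuous_intros)
  have d1: "((\<lambda>s. X (Complex s y) * Im (fy (Complex s y) / f (Complex s y))) has_real_derivative D1 (Complex x y)) (at x)"
    if "x \<in> {x0..x1}" "y \<in> {y0..y1}" for x y
  proof (cases "f (Complex x y) = 0")
    case True
    have N': "Complex x y \<in> N" by (rule N(2)) (use that True in \<open>auto simp: R_def in_cbox_complex_iff\<close>)
    have op: "open ((\<lambda>s. Complex s y) -` N)" using cxl N(1) by (simp add: open_vimage)
    have "((\<lambda>s. 0) has_real_derivative D1 (Complex x y)) (at x)" using N' by (simp add: D1_def N)
    then show ?thesis
      by (rule has_field_derivative_transform_within_open[OF _ op]) (use N' in \<open>auto simp: N\<close>)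
  next
    case False
    show ?thesis unfolding D1_def
      by (rule DERIV_cong[OF DERIV_mult[OF dX(1) has_real_derivative_Im_divide[OF df(3) df(1) False]]]) simp
  qed
  have d2: "((\<lambda>s. X (Complex x s) * Im (fx (Complex x s) / f (Complex x s))) has_real_derivative D2 (Complex x y)) (at y)"
    if "x \<in> {x0..x1}" "y \<in> {y0..y1}" for x y
  proof (cases "f (Complex x y) = 0")
    case True
    have N': "Complex x y \<in> N" by (rule N(2)) (use that True in \<open>auto simp: R_def in_cbox_complex_iff\<close>)
    have op: "open ((\<lambda>s. Complex x s) -` N)" using cyl N(1) by (simp add: open_vimage)
    have "((\<lambda>s. 0) has_real_derivative D2 (Complex x y)) (at y)" using N' by (simp add: D2_def N)
    then show ?thesis
      by (rule has_field_derivative_transform_within_open[OF _ op]) (use N' in \<open>auto simp: N\<close>)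
  next
    case False
    show ?thesis unfolding D2_def
      by (rule DERIV_cong[OF DERIV_mult[OF dX(2) has_real_derivative_Im_divide[OF df(4) df(2) False]]]) simp
  qed
  have "(LINT z:R x0 x1 y0 y1|lborel. Xx z * Im (fy z / f z) - Xy z * Im (fx z / f z))
      = (LINT z:R x0 x1 y0 y1|lborel. D1 z - D2 z)"
    by (simp add: D1_def D2_def mult.commute[of "fy _"])
  also have "\<dots> = (LINT z:R x0 x1 y0 y1|lborel. D1 z) - (LINT z:R x0 x1 y0 y1|lborel. D2 z)"
    using c1 c2 unfolding R_def by (intro set_integral_diff integrable_cont_cbox)
  also have "(LINT z:R x0 x1 y0 y1|lborel. D1 z) = (LINT y:{y0..y1}|lborel. X (Complex x1 y) * Im (fy (Complex x1 y) / f (Complex x1 y))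
          - X (Complex x0 y) * Im (fy (Complex x0 y) / f (Complex x0 y)))"
    unfolding R_def using d1
    by (rule LINT_rect_dx[OF c1[unfolded R_def] le(1), where Q = "\<lambda>z. X z * Im (fy z / f z)"])
  also have "(LINT z:R x0 x1 y0 y1|lborel. D2 z) = (LINT x:{x0..x1}|lborel. X (Complex x y1) * Im (fx (Complex x y1) / f (Complex x y1))
          - X (Complex x y0) * Im (fx (Complex x y0) / f (Complex x y0)))"
    unfolding R_def using d2
    by (rule LINT_rect_dy[OF c2[unfolded R_def] le(2), where Q = "\<lambda>z. X z * Im (fx z / f z)"])
  finally show ?thesis .
qed

lemma log_side:
  fixes F F' :: "real \<Rightarrow> complex" and \<gamma> :: "real \<Rightarrow> complex"
  assumes d: "\<And>x. (F has_vector_derivative F' x) (at x)" and cF': "continuous_on UNIV F'"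
    and nz: "\<And>x. x \<in> {u..v} \<Longrightarrow> F x \<noteq> 0" and le: "u \<le> v"
    and \<gamma>: "\<And>t. \<gamma> t = F (u + t * (v - u))"
  shows "valid_path \<gamma>"
    and "((\<lambda>w. 1 / w) has_contour_integral (integral {u..v} (\<lambda>x. F' x / F x))) \<gamma>"
proof -
  define l where "l t = u + t * (v - u)" for t
  have \<gamma>l: "\<gamma> = (\<lambda>t. F (l t))" by (simp add: \<gamma> l_def fun_eq_iff)
  have dl: "(l has_real_derivative (v - u)) (at t within T)" for t T
    unfolding l_def by (auto intro!: derivative_eq_intros)
  have cl: "continuous_on S l" for S unfolding l_def by (intro continuous_intros)
  have cF: "continuous_on S F" for S
    using d by (meson continuous_at_imp_continuous_on has_vector_derivative_continuous)
  have d\<gamma>: "(\<gamma> has_vector_derivative (v - u) *\<^sub>R F' (l t)) (at t)" for t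
    unfolding \<gamma>l using vector_diff_chain_at[OF _ d, of l "v - u" t] dl[of t UNIV]
    by (simp add: has_real_derivative_iff_has_vector_derivative o_def)
  have c\<gamma>: "continuous_on S \<gamma>" for S
    unfolding \<gamma>l by (intro continuous_on_compose2[OF cF[of UNIV]] cl) auto
  have "\<gamma> C1_differentiable_on {0..1}" unfolding C1_differentiable_on_def
    using d\<gamma> by (intro exI[of _ "\<lambda>t. (v - u) *\<^sub>R F' (l t)"] conjI ballI)
      (auto intro!: continuous_intros continuous_on_compose2[OF cF'] cl)
  then show "valid_path \<gamma>" unfolding valid_path_def piecewise_C1_differentiable_on_def
    using c\<gamma> by (intro conjI exI[of _ "{}"]) auto
  have vd: "vector_derivative \<gamma> (at t within {0..1}) = (v - u) *\<^sub>R F' (l t)" if "t \<in> {0..1}" for t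
    using vector_derivative_within_cbox[of 0 1 t \<gamma> "(v - u) *\<^sub>R F' (l t)"] that
      has_vector_derivative_at_within[OF d\<gamma>] by simp
  have "((\<lambda>t. (v - u) *\<^sub>R (\<lambda>x. F' x / F x) (l t)) has_integral
      integral {l 0..l 1} (\<lambda>x. F' x / F x)) {0..1}"
  proof (rule has_integral_substitution[where c = u and d = v])
    show "l ` {0..1} \<subseteq> {u..v}"
    proof (clarsimp simp: l_def le)
      fix t :: real assume "0 \<le> t" "t \<le> 1"
      then have "t * (v - u) \<le> 1 * (v - u)" using le by (intro mult_right_mono) auto
      then show "u + t * (v - u) \<le> v" by simp
    qed
    show "continuous_on {u..v} (\<lambda>x. F' x / F x)"
      using nz by (intro continuous_intros continuous_on_subset[OF cF'] cF) auto
    show "(l has_real_derivative (v - u)) (at t within {0..1})" for t by (rule dl)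
  qed (use le in \<open>auto simp: l_def\<close>)
  then have I: "((\<lambda>t. (v - u) *\<^sub>R (F' (l t) / F (l t))) has_integral integral {u..v} (\<lambda>x. F' x / F x)) {0..1}"
    by (simp add: l_def)
  have "((\<lambda>t. 1 / \<gamma> t * vector_derivative \<gamma> (at t within {0..1})) has_integral
      integral {u..v} (\<lambda>x. F' x / F x)) {0..1}"
    by (rule has_integral_eq[OF _ I], subst vd) (auto simp: \<gamma>l scaleR_conv_of_real)
  then show "((\<lambda>w. 1 / w) has_contour_integral (integral {u..v} (\<lambda>x. F' x / F x))) \<gamma>"
    by (simp add: has_contour_integral_def)
qed

lemma LINT_Im_diff:
  fixes u v :: "real \<Rightarrow> complex"
  assumes "continuous_on {a..b} u" "continuous_on {a..b} v"
  shows "(LINT x:{a..b}|lborel. Im (u x) - Im (v x)) = Im (integral {a..b} u - integral {a..b} v)"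
proof -
  have s: "set_integrable lborel {a..b} (\<lambda>x. Im (u x) - Im (v x))"
    unfolding set_integrable_def using assms
    by (intro borel_integrable_compact continuous_intros) auto
  have "((\<lambda>x. u x - v x) has_integral (integral {a..b} u - integral {a..b} v)) {a..b}"
    using assms by (intro has_integral_diff integrable_integral integrable_continuous_interval)
  from has_integral_linear[OF this bounded_linear_Im]
  have "integral {a..b} (\<lambda>x. Im (u x) - Im (v x)) = Im (integral {a..b} u - integral {a..b} v)"
    by (intro integral_unique) (simp add: o_def)
  then show ?thesis using set_borel_integral_eq_integral(2)[OF s] by simp
qed

lemma rect_boundary_in:
  assumes "x0 \<le> x1" "y0 \<le> y1"
  shows "x \<in> {x0..x1} \<Longrightarrow> Complex x y0 \<in> path_image (rectpath (Complex x0 y0) (Complex x1 y1))"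
    "x \<in> {x0..x1} \<Longrightarrow> Complex x y1 \<in> path_image (rectpath (Complex x0 y0) (Complex x1 y1))"
    "y \<in> {y0..y1} \<Longrightarrow> Complex x0 y \<in> path_image (rectpath (Complex x0 y0) (Complex x1 y1))"
    "y \<in> {y0..y1} \<Longrightarrow> Complex x1 y \<in> path_image (rectpath (Complex x0 y0) (Complex x1 y1))"
  using assms by (auto simp: path_image_rectpath_cbox_minus_box in_cbox_complex_iff in_box_complex_iff)

text \<open>The boundary term of Stokes's theorem with \<open>X = 1\<close>, identified with the winding
  number by splitting the boundary of the rectangle into its four sides.\<close>

lemma winding_number_rect:
  fixes f fx fy :: "complex \<Rightarrow> complex"
  assumes le: "x0 \<le> x1" "y0 \<le> y1"
    and cf: "continuous_on UNIV f" "continuous_on UNIV fx" "continuous_on UNIV fy"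
    and df: "\<And>x y. ((\<lambda>s. f (Complex s y)) has_vector_derivative fx (Complex x y)) (at x)"
      "\<And>x y. ((\<lambda>s. f (Complex x s)) has_vector_derivative fy (Complex x y)) (at y)"
    and nz: "\<And>z. z \<in> path_image (rectpath (Complex x0 y0) (Complex x1 y1)) \<Longrightarrow> f z \<noteq> 0"
  shows "(LINT y:{y0..y1}|lborel. Im (fy (Complex x1 y) / f (Complex x1 y)) - Im (fy (Complex x0 y) / f (Complex x0 y)))
    - (LINT x:{x0..x1}|lborel. Im (fx (Complex x y1) / f (Complex x y1)) - Im (fx (Complex x y0) / f (Complex x y0)))
    = 2 * pi * Re (winding_number (f \<circ> rectpath (Complex x0 y0) (Complex x1 y1)) 0)"
proof -
  note bd = rect_boundary_in[OF le]
  have cx: "continuous_on S (\<lambda>s. Complex s y)" and cy: "continuous_on S (\<lambda>s. Complex y s)" for y S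
    by (auto simp: Complex_eq intro!: continuous_intros)
  have cc: "continuous_on S (\<lambda>s. f (Complex s y))" "continuous_on S (\<lambda>s. fx (Complex s y))"
    "continuous_on S (\<lambda>s. f (Complex y s))" "continuous_on S (\<lambda>s. fy (Complex y s))" for y S
    by (auto intro!: continuous_on_compose2[OF cf(1)] continuous_on_compose2[OF cf(2)]
        continuous_on_compose2[OF cf(3)] cx cy)
  define H where "H y = integral {x0..x1} (\<lambda>x. fx (Complex x y) / f (Complex x y))" for y
  define V where "V x = integral {y0..y1} (\<lambda>y. fy (Complex x y) / f (Complex x y))" for x
  have h: "valid_path (f \<circ> linepath (Complex x0 y) (Complex x1 y))"
    "((\<lambda>w. 1 / w) has_contour_integral H y) (f \<circ> linepath (Complex x0 y) (Complex x1 y))"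
    if y: "y = y0 \<or> y = y1" for y
  proof -
    have nz': "f (Complex x y) \<noteq> 0" if "x \<in> {x0..x1}" for x using y that bd nz by blast
    have e: "(f \<circ> linepath (Complex x0 y) (Complex x1 y)) t = f (Complex (x0 + t * (x1 - x0)) y)" for t
    proof -
      have "linepath (Complex x0 y) (Complex x1 y) t = Complex (x0 + t * (x1 - x0)) y"
        by (simp add: linepath_def complex_eq_iff algebra_simps)
      then show ?thesis by simp
    qed
    show "valid_path (f \<circ> linepath (Complex x0 y) (Complex x1 y))"
      "((\<lambda>w. 1 / w) has_contour_integral H y) (f \<circ> linepath (Complex x0 y) (Complex x1 y))"
      unfolding H_def by (rule log_side[where F = "\<lambda>s. f (Complex s y)", OF df(1) cc(2) nz' le(1) e]; assumption)+
  qed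
  have v: "valid_path (f \<circ> linepath (Complex x y0) (Complex x y1))"
    "((\<lambda>w. 1 / w) has_contour_integral V x) (f \<circ> linepath (Complex x y0) (Complex x y1))"
    if x: "x = x0 \<or> x = x1" for x
  proof -
    have nz': "f (Complex x y) \<noteq> 0" if "y \<in> {y0..y1}" for y using x that bd nz by blast
    have e: "(f \<circ> linepath (Complex x y0) (Complex x y1)) t = f (Complex x (y0 + t * (y1 - y0)))" for t
    proof -
      have "linepath (Complex x y0) (Complex x y1) t = Complex x (y0 + t * (y1 - y0))"
        by (simp add: linepath_def complex_eq_iff algebra_simps)
      then show ?thesis by simp
    qed
    show "valid_path (f \<circ> linepath (Complex x y0) (Complex x y1))"
      "((\<lambda>w. 1 / w) has_contour_integral V x) (f \<circ> linepath (Complex x y0) (Complex x y1))"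
      unfolding V_def by (rule log_side[where F = "\<lambda>s. f (Complex x s)", OF df(2) cc(4) nz' le(2) e]; assumption)+
  qed
  define p1 where "p1 = f \<circ> linepath (Complex x0 y0) (Complex x1 y0)"
  define p2 where "p2 = f \<circ> linepath (Complex x1 y0) (Complex x1 y1)"
  define p3 where "p3 = reversepath (f \<circ> linepath (Complex x0 y1) (Complex x1 y1))"
  define p4 where "p4 = reversepath (f \<circ> linepath (Complex x0 y0) (Complex x0 y1))"
  have eq: "f \<circ> rectpath (Complex x0 y0) (Complex x1 y1) = p1 +++ p2 +++ p3 +++ p4"
    by (simp add: rectpath_def Let_def path_compose_join p1_def p2_def p3_def p4_def
        path_compose_reversepath[symmetric])
  have vp: "valid_path p1" "valid_path p2" "valid_path p3" "valid_path p4"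
    unfolding p1_def p2_def p3_def p4_def valid_path_reversepath using h(1) v(1) by blast+
  have ci: "((\<lambda>w. 1 / w) has_contour_integral H y0) p1" "((\<lambda>w. 1 / w) has_contour_integral V x1) p2"
    "((\<lambda>w. 1 / w) has_contour_integral - H y1) p3" "((\<lambda>w. 1 / w) has_contour_integral - V x0) p4"
    unfolding p1_def p2_def p3_def p4_def
    using h v by (auto intro!: has_contour_integral_reversepath)
  have ends: "pathfinish p1 = pathstart p2" "pathfinish p2 = pathstart p3" "pathfinish p3 = pathstart p4"
    by (simp_all add: p1_def p2_def p3_def p4_def pathfinish_compose pathstart_compose)
  have C: "((\<lambda>w. 1 / w) has_contour_integral (H y0 + (V x1 + (- H y1 + - V x0)))) (f \<circ> rectpath (Complex x0 y0) (Complex x1 y1))"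
    unfolding eq by (intro has_contour_integral_join ci valid_path_join vp) (simp_all add: ends)
  have vr: "valid_path (f \<circ> rectpath (Complex x0 y0) (Complex x1 y1))"
    unfolding eq by (intro valid_path_join vp) (simp_all add: ends)
  have "0 \<notin> path_image (f \<circ> rectpath (Complex x0 y0) (Complex x1 y1))"
    using nz by (force simp: path_image_compose)
  then have "winding_number (f \<circ> rectpath (Complex x0 y0) (Complex x1 y1)) 0
      = 1 / (2 * pi * \<i>) * (H y0 + (V x1 + (- H y1 + - V x0)))"
    using winding_number_valid_path[OF vr] contour_integral_unique[OF C] by simp
  then have "2 * pi * \<i> * winding_number (f \<circ> rectpath (Complex x0 y0) (Complex x1 y1)) 0
      = H y0 + (V x1 + (- H y1 + - V x0))" by simp
  from arg_cong[OF this, of Im]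
  have w: "2 * pi * Re (winding_number (f \<circ> rectpath (Complex x0 y0) (Complex x1 y1)) 0)
     = Im (V x1 - V x0) - Im (H y1 - H y0)" by simp
  have nz1: "\<And>y. y \<in> {y0..y1} \<Longrightarrow> f (Complex x0 y) \<noteq> 0" "\<And>y. y \<in> {y0..y1} \<Longrightarrow> f (Complex x1 y) \<noteq> 0"
    "\<And>x. x \<in> {x0..x1} \<Longrightarrow> f (Complex x y0) \<noteq> 0" "\<And>x. x \<in> {x0..x1} \<Longrightarrow> f (Complex x y1) \<noteq> 0"
    using nz bd by blast+
  have 1: "(LINT y:{y0..y1}|lborel. Im (fy (Complex x1 y) / f (Complex x1 y)) - Im (fy (Complex x0 y) / f (Complex x0 y)))
      = Im (V x1 - V x0)"
    unfolding V_def using nz1 by (intro LINT_Im_diff continuous_intros cc) auto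
  have 2: "(LINT x:{x0..x1}|lborel. Im (fx (Complex x y1) / f (Complex x y1)) - Im (fx (Complex x y0) / f (Complex x y0)))
      = Im (H y1 - H y0)"
    unfolding H_def using nz1 by (intro LINT_Im_diff continuous_intros cc) auto
  show ?thesis unfolding w 1 2 ..
qed

definition sq :: "real \<Rightarrow> complex set" where "sq R = cbox (Complex (-R) (-R)) (Complex R R)"
definition sqpath :: "real \<Rightarrow> real \<Rightarrow> complex" where "sqpath R = rectpath (Complex (-R) (-R)) (Complex R R)"

lemma path_image_sqpath: "R \<ge> 0 \<Longrightarrow> path_image (sqpath R) = sq R - interior (sq R)"
  by (simp add: sqpath_def sq_def path_image_rectpath_cbox_minus_box interior_cbox)

lemma frontier_sq: "R \<ge> 0 \<Longrightarrow> frontier (sq R) = path_image (sqpath R)"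
  by (simp add: path_image_sqpath frontier_def closure_closed sq_def)

lemma in_sq: "z \<in> sq R \<longleftrightarrow> \<bar>Re z\<bar> \<le> R \<and> \<bar>Im z\<bar> \<le> R"
  by (auto simp: sq_def in_cbox_complex_iff)

lemma in_sqpath: "R > 0 \<Longrightarrow> z \<in> path_image (sqpath R) \<longleftrightarrow> (\<bar>Re z\<bar> = R \<and> \<bar>Im z\<bar> \<le> R \<or> \<bar>Re z\<bar> \<le> R \<and> \<bar>Im z\<bar> = R)"
  by (auto simp: path_image_sqpath sq_def interior_cbox in_cbox_complex_iff in_box_complex_iff)

text \<open>The image of the square's boundary is a Jordan curve, so its winding number around an inside
  point is \<open>1\<close> or \<open>-1\<close>. The point \<open>0\<close> is inside: a
  connected set that avoids the curve and contains \<open>0\<close> pulls back to a connected set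
  that never meets the boundary of the square, hence its component lies in the bounded image of
  the square.\<close>

lemma winding_number_homeo_square:
  fixes G :: "complex \<Rightarrow> complex"
  assumes G: "homeomorphism UNIV UNIV G h" and G0: "G 0 = 0" and R: "R > 0"
  shows "winding_number (G \<circ> sqpath R) 0 = 1 \<or> winding_number (G \<circ> sqpath R) 0 = -1"
proof -
  have Gc: "continuous_on S G" and hc: "continuous_on S h" and hG: "h (G z) = z" and Gh: "G (h z) = z" for z S
    using G continuous_on_subset by (auto simp: homeomorphism_def)
  have sp: "simple_path (G \<circ> sqpath R)"
    unfolding sqpath_def
    by (rule simple_path_continuous_image[OF simple_path_rectpath Gc])
       (use R hG in \<open>auto intro: inj_on_inverseI[of _ h]\<close>)
  let ?S = "path_image (G \<circ> sqpath R)"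
  have S: "?S = G ` path_image (sqpath R)" by (rule path_image_compose)
  have nS: "0 \<notin> ?S"
  proof
    assume "0 \<in> ?S"
    then obtain z where z: "z \<in> path_image (sqpath R)" "G z = 0" unfolding S by force
    then have "z = 0" using hG[of z] hG[of 0] G0 by simp
    then show False using z(1) R by (simp add: in_sqpath)
  qed
  have sub: "connected_component_set (- ?S) 0 \<subseteq> G ` sq R"
  proof
    fix w assume "w \<in> connected_component_set (- ?S) 0"
    then obtain T where T: "connected T" "T \<subseteq> - ?S" "0 \<in> T" "w \<in> T" by (auto simp: connected_component_def)
    have cT: "connected (h ` T)" using T(1) hc by (rule connected_continuous_image[rotated])
    have "h 0 = 0" using hG[of 0] G0 by simp
    then have 0: "0 \<in> h ` T \<inter> sq R" using T(3) R by (force simp: in_sq)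
    have "h ` T \<inter> frontier (sq R) = {}"
    proof (rule ccontr)
      assume "h ` T \<inter> frontier (sq R) \<noteq> {}"
      then obtain t where "t \<in> T" "h t \<in> path_image (sqpath R)" using R by (auto simp: frontier_sq)
      then have "t \<in> ?S" unfolding S using Gh[of t] by force
      then show False using T(2) \<open>t \<in> T\<close> by blast
    qed
    then have "h ` T - sq R = {}" using connected_Int_frontier[OF cT, of "sq R"] 0 by blast
    then show "w \<in> G ` sq R" using T(4) Gh[of w] by force
  qed
  have "bounded (G ` sq R)"
    by (intro compact_imp_bounded compact_continuous_image Gc) (simp add: sq_def)
  then have "bounded (connected_component_set (- ?S) 0)" using sub bounded_subset by blast
  then have "0 \<in> inside ?S" using nS by (simp add: inside_def)
  then show ?thesis using simple_closed_path_winding_number_inside[OF sp] by metis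
qed

section \<open>Logarithmic cut-offs and the exact length-area identities\<close>

text \<open>The trapezoid that is \<open>1\<close> on \<open>[A, B]\<close> and \<open>0\<close> outside
  \<open>[A - 1, B + 1]\<close>, written with ramps so that continuity is automatic and
  \<open>trapI\<close> is an explicit primitive. Its integral is \<open>B - A + 1\<close>.\<close>

definition trap :: "real \<Rightarrow> real \<Rightarrow> real \<Rightarrow> real"
  where "trap A B x = max 0 (x - A + 1) - max 0 (x - A) - max 0 (x - B) + max 0 (x - B - 1)"

definition trapI :: "real \<Rightarrow> real \<Rightarrow> real \<Rightarrow> real"
  where "trapI A B x = ((max 0 (x - A + 1))\<^sup>2 - (max 0 (x - A))\<^sup>2 - (max 0 (x - B))\<^sup>2 + (max 0 (x - B - 1))\<^sup>2) / 2"

lemma ramp_sq_deriv: "((\<lambda>x::real. (max 0 x)\<^sup>2) has_real_derivative 2 * max 0 x) (at x)"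
proof -
  consider "x > 0" | "x < 0" | "x = 0" by linarith
  then show ?thesis
  proof cases
    case 1
    have "((\<lambda>x::real. x\<^sup>2) has_real_derivative 2 * x) (at x)" by (auto intro!: derivative_eq_intros)
    then have "((\<lambda>x::real. (max 0 x)\<^sup>2) has_real_derivative 2 * x) (at x)"
      by (rule has_field_derivative_transform_within_open[where S="{0<..}"]) (use 1 in auto)
    then show ?thesis using 1 by simp
  next
    case 2
    have "((\<lambda>x::real. 0) has_real_derivative 0) (at x)" by simp
    then have "((\<lambda>x::real. (max 0 x)\<^sup>2) has_real_derivative 0) (at x)"
      by (rule has_field_derivative_transform_within_open[where S="{..<0}"]) (use 2 in auto)
    then show ?thesis using 2 by simp
  next
    case 3
    have c: "((\<lambda>h::real. max 0 h) \<longlongrightarrow> max 0 0) (at 0)" by (intro tendsto_intros)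
    have "((\<lambda>h. ((max 0 (0 + h))\<^sup>2 - (max 0 0)\<^sup>2) / h) \<longlongrightarrow> 0) (at (0::real))"
    proof (rule Lim_transform_eventually[OF c[simplified]])
      have "max 0 h = ((max 0 (0 + h))\<^sup>2 - (max 0 0)\<^sup>2) / h" if "h \<noteq> 0" for h :: real
        using that by (cases "h > 0") (simp_all add: power2_eq_square)
      then show "\<forall>\<^sub>F h in at 0. max 0 h = ((max 0 (0 + h))\<^sup>2 - (max 0 0)\<^sup>2) / (h::real)"
        by (simp add: eventually_at_filter)
    qed
    then show ?thesis using 3 by (simp add: DERIV_def)
  qed
qed

lemma trapI_deriv: "(trapI A B has_real_derivative trap A B x) (at x)"
proof -
  have r: "((\<lambda>x. (max 0 (x + a))\<^sup>2) has_real_derivative 2 * max 0 (x + a)) (at x)" for a :: real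
    using DERIV_chain2[of "\<lambda>x. (max 0 x)\<^sup>2" _ "\<lambda>x. x + a" x 1 UNIV, OF ramp_sq_deriv]
      DERIV_add[OF DERIV_ident[of "at x"] DERIV_const[of a]] by simp
  have "((\<lambda>x. ((max 0 (x + (1 - A)))\<^sup>2 - (max 0 (x + - A))\<^sup>2 - (max 0 (x + - B))\<^sup>2 + (max 0 (x + (- B - 1)))\<^sup>2) / 2)
      has_real_derivative (2 * max 0 (x + (1 - A)) - 2 * max 0 (x + - A) - 2 * max 0 (x + - B) + 2 * max 0 (x + (- B - 1))) / 2) (at x)"
    by (intro DERIV_cdivide DERIV_add DERIV_diff r)
  moreover have "(\<lambda>x. ((max 0 (x + (1 - A)))\<^sup>2 - (max 0 (x + - A))\<^sup>2 - (max 0 (x + - B))\<^sup>2 + (max 0 (x + (- B - 1)))\<^sup>2) / 2) = trapI A B"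
    by (rule ext) (simp add: trapI_def algebra_simps)
  moreover have "(2 * max 0 (x + (1 - A)) - 2 * max 0 (x + - A) - 2 * max 0 (x + - B) + 2 * max 0 (x + (- B - 1))) / 2 = trap A B x"
  proof -
    have "x + (1 - A) = x - A + 1" "x + - A = x - A" "x + - B = x - B" "x + (- B - 1) = x - B - 1" by simp_all
    then show ?thesis unfolding trap_def by (simp only: field_sum_of_halves diff_divide_distrib add_divide_distrib) simp
  qed
  ultimately show ?thesis by simp
qed

lemma trap_cont: "continuous_on S (trap A B)"
  unfolding trap_def by (intro continuous_intros)

lemma trap_bounds: "A \<le> B \<Longrightarrow> 0 \<le> trap A B x" "A \<le> B \<Longrightarrow> trap A B x \<le> 1"
  by (auto simp: trap_def max_def)

lemma trap_one: "A \<le> x \<Longrightarrow> x \<le> B \<Longrightarrow> trap A B x = 1"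
  by (auto simp: trap_def max_def)

lemma trap_zero: "A \<le> B \<Longrightarrow> x \<le> A - 1 \<or> x \<ge> B + 1 \<Longrightarrow> trap A B x = 0"
  by (auto simp: trap_def max_def)

lemma trapI_left: "A \<le> B \<Longrightarrow> x \<le> A - 1 \<Longrightarrow> trapI A B x = 0"
  by (auto simp: trapI_def max_def)

lemma trapI_right: "A \<le> B \<Longrightarrow> x \<ge> B + 1 \<Longrightarrow> trapI A B x = B - A + 1"
  by (auto simp: trapI_def max_def power2_eq_square field_simps)

lemma trapI_mono: "A \<le> B \<Longrightarrow> x \<le> y \<Longrightarrow> trapI A B x \<le> trapI A B y"
  using DERIV_nonneg_imp_nondecreasing[of x y "trapI A B"] trapI_deriv trap_bounds(1) by blast

lemma trapI_A: "A \<le> B \<Longrightarrow> x \<le> A \<Longrightarrow> trapI A B x \<le> 1 / 2"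
  using trapI_mono[of A B x A] by (auto simp: trapI_def)

lemma trapI_B: "A \<le> B \<Longrightarrow> x \<ge> B \<Longrightarrow> trapI A B x \<ge> B - A + 1 / 2"
proof -
  assume a: "A \<le> B" "x \<ge> B"
  have "trapI A B B = B - A + 1 / 2"
    using a by (auto simp: trapI_def max_def power2_eq_square field_simps)
  then show ?thesis using trapI_mono[OF a] by simp
qed

text \<open>\<open>Phi\<close> cuts off to a logarithmic annulus around \<open>0\<close>, and
  \<open>Theta\<close> is the corresponding truncated version of \<open>ln |w|\<close>:
  \<open>d Theta = Phi d ln |w|\<close>. Both are defined at \<open>0\<close> by their constant
  value nearby; since \<open>ln 0 = 0\<close> in HOL, the case distinction is needed.\<close>

definition Phi :: "real \<Rightarrow> real \<Rightarrow> complex \<Rightarrow> real"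
  where "Phi A B w = (if w = 0 then 0 else trap A B (ln (norm w)))"

definition Theta :: "real \<Rightarrow> real \<Rightarrow> complex \<Rightarrow> real"
  where "Theta A B w = (if w = 0 then 0 else trapI A B (ln (norm w)))"

lemma Phi_bounds: "A \<le> B \<Longrightarrow> 0 \<le> Phi A B w" "A \<le> B \<Longrightarrow> Phi A B w \<le> 1"
  by (auto simp: Phi_def trap_bounds)

lemma ln_norm_le_iff: "w \<noteq> 0 \<Longrightarrow> ln (norm w) \<le> x \<longleftrightarrow> norm w \<le> exp x"
  by (metis exp_le_cancel_iff exp_ln zero_less_norm_iff)

lemma ln_norm_ge_iff: "w \<noteq> 0 \<Longrightarrow> x \<le> ln (norm w) \<longleftrightarrow> exp x \<le> norm w"
  by (metis exp_le_cancel_iff exp_ln zero_less_norm_iff)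

lemma Phi_small: "A \<le> B \<Longrightarrow> norm w \<le> exp (A - 1) \<Longrightarrow> Phi A B w = 0"
  by (auto simp: Phi_def ln_norm_le_iff intro!: trap_zero)

lemma Phi_large: "A \<le> B \<Longrightarrow> norm w \<ge> exp (B + 1) \<Longrightarrow> Phi A B w = 0"
  by (auto simp: Phi_def ln_norm_ge_iff intro!: trap_zero)

lemma Phi_one: "exp A \<le> norm w \<Longrightarrow> norm w \<le> exp B \<Longrightarrow> Phi A B w = 1"
proof -
  assume a: "exp A \<le> norm w" "norm w \<le> exp B"
  have "w \<noteq> 0" using a(1) exp_gt_zero[of A] by auto
  then show ?thesis using a by (auto simp: Phi_def ln_norm_le_iff ln_norm_ge_iff intro!: trap_one)
qed

lemma Theta_small: "A \<le> B \<Longrightarrow> norm w \<le> exp (A - 1) \<Longrightarrow> Theta A B w = 0"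
  by (auto simp: Theta_def ln_norm_le_iff intro!: trapI_left)

lemma Theta_large: "A \<le> B \<Longrightarrow> norm w \<ge> exp (B + 1) \<Longrightarrow> Theta A B w = B - A + 1"
proof -
  assume a: "A \<le> B" "norm w \<ge> exp (B + 1)"
  have "w \<noteq> 0" using a(2) exp_gt_zero[of "B+1"] by auto
  then show ?thesis using a by (auto simp: Theta_def ln_norm_ge_iff intro!: trapI_right)
qed

lemma Theta_A: "A \<le> B \<Longrightarrow> norm w \<le> exp A \<Longrightarrow> Theta A B w \<le> 1 / 2"
  using trapI_A[of A B "ln (norm w)"] by (cases "w = 0") (simp_all add: Theta_def ln_norm_le_iff)

lemma Theta_B: "A \<le> B \<Longrightarrow> norm w \<ge> exp B \<Longrightarrow> Theta A B w \<ge> B - A + 1 / 2"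
proof -
  assume a: "A \<le> B" "norm w \<ge> exp B"
  have "w \<noteq> 0" using a(2) exp_gt_zero[of B] by auto
  then show ?thesis using a by (auto simp: Theta_def ln_norm_ge_iff intro!: trapI_B)
qed

lemma Phi_cont: assumes "A \<le> B" shows "continuous_on S (Phi A B)"
proof (rule continuous_at_imp_continuous_on, rule ballI)
  fix w :: complex
  show "isCont (Phi A B) w"
  proof (cases "w = 0")
    case True
    show ?thesis
      by (rule isCont_locally_zero[of "ball 0 (exp (A - 1))"]) (use True assms in \<open>auto intro!: Phi_small\<close>)
  next
    case False
    have "isCont (\<lambda>w. trap A B (ln (norm w))) w"
    proof -
      have 1: "isCont (\<lambda>w. ln (norm w)) w" using False by (intro continuous_intros) auto
      have 2: "isCont (trap A B) (ln (norm w))" using trap_cont[of UNIV A B] by (simp add: continuous_on_eq_continuous_at)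
      show ?thesis by (rule isCont_o2[OF 1 2])
    qed
    moreover have "eventually (\<lambda>w. w \<noteq> 0) (nhds w)" using False by (rule t1_space_nhds)
    then have "eventually (\<lambda>w. Phi A B w = trap A B (ln (norm w))) (nhds w)"
      by eventually_elim (simp add: Phi_def)
    ultimately show ?thesis by (subst isCont_cong)
  qed
qed

lemma Theta_deriv:
  assumes "A \<le> B"
  shows "(Theta A B has_derivative (\<lambda>h. Phi A B w * Re (h / w))) (at w)"
proof (cases "w = 0")
  case True
  have "((\<lambda>w::complex. 0::real) has_derivative (\<lambda>h. 0)) (at w)" by simp
  then have "(Theta A B has_derivative (\<lambda>h. 0)) (at w)"
    by (rule has_derivative_transform_within_open[OF _ open_ball[of 0 "exp (A - 1)"]])
       (use True assms Theta_small in auto)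
  then show ?thesis using True by simp
next
  case False
  have 1: "((\<lambda>w. ln (norm w)) has_derivative (\<lambda>h. Re (h / w))) (at w)"
  proof -
    have "((\<lambda>w. ln (norm w)) has_derivative (\<lambda>h. inverse (norm w) * inner h (sgn w))) (at w)"
      using False
      by (intro has_derivative_eq_rhs[OF has_derivative_ln[OF _ has_derivative_norm]]) (auto simp: fun_eq_iff)
    moreover have "inverse (norm w) * inner h (sgn w) = Re (h / w)" for h
      using False cmod_power2[of w, unfolded power2_eq_square]
      by (simp add: sgn_div_norm Re_divide inner_complex_def cmod_power2[symmetric] power2_eq_square field_simps)
    ultimately show ?thesis by simp
  qed
  have 2: "(trapI A B has_derivative (\<lambda>h. trap A B (ln (norm w)) * h)) (at (ln (norm w)))"
    using trapI_deriv by (simp add: has_field_derivative_def)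
  have "((\<lambda>w. trapI A B (ln (norm w))) has_derivative (\<lambda>h. trap A B (ln (norm w)) * Re (h / w))) (at w)"
    by (rule has_derivative_compose[OF 1 2])
  then have "(Theta A B has_derivative (\<lambda>h. trap A B (ln (norm w)) * Re (h / w))) (at w)"
    by (rule has_derivative_transform_within_open[of _ _ _ _ "- {0}"]) (use False in \<open>auto simp: Theta_def\<close>)
  then show ?thesis using False by (simp add: Phi_def)
qed

lemma Theta_cont: assumes "A \<le> B" shows "continuous_on S (Theta A B)"
  by (rule continuous_at_imp_continuous_on) (use has_derivative_continuous[OF Theta_deriv[OF assms]] in blast)

lemma Phi_div_bound: assumes "A \<le> B" shows "\<bar>Phi A B w\<bar> * (1 / norm w) \<le> exp (1 - A)"
proof (cases "norm w \<le> exp (A - 1)")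
  case True
  then show ?thesis using Phi_small[OF assms True] by simp
next
  case False
  then have "0 < norm w" using exp_gt_zero[of "A - 1"] by linarith
  with False have "1 / norm w \<le> 1 / exp (A - 1)" by (intro divide_left_mono) auto
  also have "\<dots> = exp (1 - A)" by (simp add: exp_diff field_simps)
  finally have "\<bar>Phi A B w\<bar> * (1 / norm w) \<le> 1 * exp (1 - A)"
    using Phi_bounds[OF assms, of w] by (intro mult_mono) auto
  then show ?thesis by simp
qed

lemma Theta_Lipschitz:
  assumes "A \<le> B" shows "\<bar>Theta A B u - Theta A B v\<bar> \<le> exp (1 - A) * norm (u - v)"
proof -
  have "norm (Theta A B u - Theta A B v) \<le> exp (1 - A) * norm (u - v)"
  proof (rule differentiable_bound[of UNIV "Theta A B" "\<lambda>w h. Phi A B w * Re (h / w)"])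
    fix w :: complex
    show "(Theta A B has_derivative (\<lambda>h. Phi A B w * Re (h / w))) (at w within UNIV)"
      by (rule Theta_deriv[OF assms])
    show "onorm (\<lambda>h. Phi A B w * Re (h / w)) \<le> exp (1 - A)"
    proof (rule onorm_bound)
      fix h
      have "norm (Phi A B w * Re (h / w)) \<le> \<bar>Phi A B w\<bar> * norm (h / w)"
        by (simp add: abs_mult mult_left_mono abs_Re_le_cmod)
      also have "\<dots> = (\<bar>Phi A B w\<bar> * (1 / norm w)) * norm h" by (simp add: norm_divide)
      also have "\<dots> \<le> exp (1 - A) * norm h" by (intro mult_right_mono Phi_div_bound assms) auto
      finally show "norm (Phi A B w * Re (h / w)) \<le> exp (1 - A) * norm h" .
    qed simp
  qed auto
  then show ?thesis by simp
qed

lemma Re_Im_cross: "Re u * Im v - Re v * Im u = Im (cnj u * v)"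
  by simp

text \<open>The regularity of the mollified maps: continuous first partial derivatives and a common
  continuous mixed one.\<close>

locale c2map =
  fixes f fx fy fxy :: "complex \<Rightarrow> complex"
  assumes cf: "continuous_on UNIV f" "continuous_on UNIV fx" "continuous_on UNIV fy" "continuous_on UNIV fxy"
    and df: "\<And>x y. ((\<lambda>s. f (Complex s y)) has_vector_derivative fx (Complex x y)) (at x)"
      "\<And>x y. ((\<lambda>s. f (Complex x s)) has_vector_derivative fy (Complex x y)) (at y)"
      "\<And>x y. ((\<lambda>s. fy (Complex s y)) has_vector_derivative fxy (Complex x y)) (at x)"
      "\<And>x y. ((\<lambda>s. fx (Complex x s)) has_vector_derivative fxy (Complex x y)) (at y)"
begin

text \<open>The partial derivatives of \<open>Theta A B (f z)\<close>.\<close>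

definition Xx :: "real \<Rightarrow> real \<Rightarrow> complex \<Rightarrow> real" where "Xx A B z = Phi A B (f z) * Re (fx z / f z)"
definition Xy :: "real \<Rightarrow> real \<Rightarrow> complex \<Rightarrow> real" where "Xy A B z = Phi A B (f z) * Re (fy z / f z)"

lemma open_small: "open {z. norm (f z) < e}"
  using cf(1) by (intro open_Collect_less continuous_intros)

lemma Phi_quot_cont:
  assumes AB: "A \<le> B" and c: "continuous_on UNIV (k :: complex \<Rightarrow> complex)"
  shows "continuous_on S (\<lambda>z. Phi A B (f z) * Re (k z / f z))"
    and "continuous_on S (\<lambda>z. Phi A B (f z) * (norm (k z) / norm (f z)))"
proof -
  have ic: "isCont f z" "isCont k z" for z using cf(1) c by (auto simp: continuous_on_eq_continuous_at)
  have ip: "isCont (\<lambda>z. Phi A B (f z)) z" for z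
    using continuous_on_compose2[OF Phi_cont[OF AB, of UNIV] cf(1)] by (simp add: continuous_on_eq_continuous_at)
  have "isCont (\<lambda>z. Phi A B (f z) * Re (k z / f z)) z \<and> isCont (\<lambda>z. Phi A B (f z) * (norm (k z) / norm (f z))) z" for z
  proof (cases "f z = 0")
    case True
    then show ?thesis
      using Phi_small[OF AB] by (auto intro!: isCont_locally_zero[OF open_small[of "exp (A - 1)"], of z])
  next
    case False
    have 1: "isCont (\<lambda>z. Re (k z / f z)) z" by (rule isCont_Re[OF isCont_divide[OF ic(2) ic(1) False]])
    have 2: "isCont (\<lambda>z. norm (k z) / norm (f z)) z"
      by (rule isCont_divide[OF isCont_norm[OF ic(2)] isCont_norm[OF ic(1)]]) (use False in simp)
    show ?thesis by (intro conjI isCont_mult[OF ip 1] isCont_mult[OF ip 2])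
  qed
  then have c1: "isCont (\<lambda>z. Phi A B (f z) * Re (k z / f z)) z"
    and c2: "isCont (\<lambda>z. Phi A B (f z) * (norm (k z) / norm (f z))) z" for z by simp_all
  show "continuous_on S (\<lambda>z. Phi A B (f z) * Re (k z / f z))"
    by (rule continuous_at_imp_continuous_on, rule ballI, rule c1)
  show "continuous_on S (\<lambda>z. Phi A B (f z) * (norm (k z) / norm (f z)))"
    by (rule continuous_at_imp_continuous_on, rule ballI, rule c2)
qed

lemma Xx_cont: "A \<le> B \<Longrightarrow> continuous_on S (Xx A B)" and Xy_cont: "A \<le> B \<Longrightarrow> continuous_on S (Xy A B)"
  unfolding Xx_def Xy_def using Phi_quot_cont(1) cf by auto

lemma X_cont: "A \<le> B \<Longrightarrow> continuous_on S (\<lambda>z. Theta A B (f z))"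
  by (rule continuous_on_compose2[OF Theta_cont[of A B UNIV]]) (use cf(1) continuous_on_subset in auto)

lemma dX:
  assumes "A \<le> B"
  shows "((\<lambda>s. Theta A B (f (Complex s y))) has_real_derivative Xx A B (Complex x y)) (at x)"
    "((\<lambda>s. Theta A B (f (Complex x s))) has_real_derivative Xy A B (Complex x y)) (at y)"
proof -
  have s: "Phi A B w * Re ((t *\<^sub>R v) / w) = (Phi A B w * Re (v / w)) * t" for w v t
    by (simp add: scaleR_conv_of_real mult.assoc flip: times_divide_eq_right)
  show "((\<lambda>s. Theta A B (f (Complex s y))) has_real_derivative Xx A B (Complex x y)) (at x)"
    using has_derivative_compose[OF df(1)[unfolded has_vector_derivative_def] Theta_deriv[OF assms]]
    unfolding has_field_derivative_def s Xx_def .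
  show "((\<lambda>s. Theta A B (f (Complex x s))) has_real_derivative Xy A B (Complex x y)) (at y)"
    using has_derivative_compose[OF df(2)[unfolded has_vector_derivative_def] Theta_deriv[OF assms]]
    unfolding has_field_derivative_def s Xy_def .
qed

end

text \<open>The identity map is used for the forms \<open>d ln |z|\<close> and \<open>d arg z\<close> of the
  domain.\<close>

interpretation idm: c2map "\<lambda>z. z" "\<lambda>z. 1" "\<lambda>z. \<i>" "\<lambda>z. 0"
proof unfold_locales
  fix x y
  show "((\<lambda>s. Complex s y) has_vector_derivative 1) (at x)"
    unfolding Complex_eq has_vector_derivative_def by (auto intro!: derivative_eq_intros simp: scaleR_conv_of_real)
  show "((\<lambda>s. Complex x s) has_vector_derivative \<i>) (at y)"
    unfolding Complex_eq has_vector_derivative_def by (auto intro!: derivative_eq_intros simp: scaleR_conv_of_real)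
qed (auto intro!: continuous_intros)

context c2map
begin

text \<open>Stokes's theorem for an \<open>X\<close> that is constant on the boundary of a square, where
  only the winding number remains.\<close>

lemma stokes_winding:
  assumes R: "R > 0"
    and cX: "continuous_on UNIV X" "continuous_on UNIV Ux" "continuous_on UNIV Uy"
    and dX: "\<And>x y. ((\<lambda>s. X (Complex s y)) has_real_derivative Ux (Complex x y)) (at x)"
      "\<And>x y. ((\<lambda>s. X (Complex x s)) has_real_derivative Uy (Complex x y)) (at y)"
    and N: "open N" "\<And>z. z \<in> sq R \<Longrightarrow> f z = 0 \<Longrightarrow> z \<in> N"
      "\<And>z. z \<in> N \<Longrightarrow> X z = 0" "\<And>z. z \<in> N \<Longrightarrow> Ux z = 0" "\<And>z. z \<in> N \<Longrightarrow> Uy z = 0"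
    and c: "\<And>z. z \<in> path_image (sqpath R) \<Longrightarrow> X z = c"
    and nz: "\<And>z. z \<in> path_image (sqpath R) \<Longrightarrow> f z \<noteq> 0"
  shows "(LINT z:sq R|lborel. Ux z * Im (fy z / f z) - Uy z * Im (fx z / f z))
    = c * (2 * pi * Re (winding_number (f \<circ> sqpath R) 0))"
proof -
  have le: "-R \<le> R" using R by simp
  note bd = rect_boundary_in[OF le le, folded sqpath_def]
  have "(LINT z:sq R|lborel. Ux z * Im (fy z / f z) - Uy z * Im (fx z / f z))
    = (LINT y:{-R..R}|lborel. X (Complex R y) * Im (fy (Complex R y) / f (Complex R y))
          - X (Complex (-R) y) * Im (fy (Complex (-R) y) / f (Complex (-R) y)))
    - (LINT x:{-R..R}|lborel. X (Complex x R) * Im (fx (Complex x R) / f (Complex x R))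
          - X (Complex x (-R)) * Im (fx (Complex x (-R)) / f (Complex x (-R))))"
    unfolding sq_def by (rule stokes_log[OF le le cX cf dX df N(1) _ N(3,4,5)]) (use N(2) in \<open>auto simp: sq_def\<close>)
  also have "(LINT y:{-R..R}|lborel. X (Complex R y) * Im (fy (Complex R y) / f (Complex R y))
          - X (Complex (-R) y) * Im (fy (Complex (-R) y) / f (Complex (-R) y)))
      = (LINT y:{-R..R}|lborel. c * (Im (fy (Complex R y) / f (Complex R y))
          - Im (fy (Complex (-R) y) / f (Complex (-R) y))))"
    by (rule set_lebesgue_integral_cong) (auto simp: bd c algebra_simps)
  also have "(LINT x:{-R..R}|lborel. X (Complex x R) * Im (fx (Complex x R) / f (Complex x R))
          - X (Complex x (-R)) * Im (fx (Complex x (-R)) / f (Complex x (-R))))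
      = (LINT x:{-R..R}|lborel. c * (Im (fx (Complex x R) / f (Complex x R))
          - Im (fx (Complex x (-R)) / f (Complex x (-R)))))"
    by (rule set_lebesgue_integral_cong) (auto simp: bd c algebra_simps)
  finally show ?thesis
    using winding_number_rect[OF le le cf(1,2,3) df(1,2), folded sqpath_def, OF nz]
    by (simp add: right_diff_distrib[symmetric])
qed

text \<open>With \<open>X = Theta (f)\<close> the integrand \<open>d ln |f| \<and> d arg f\<close> is the
  Jacobian of \<open>f\<close> divided by \<open>|f|\<^sup>2\<close>, so this computes the
  logarithmic area of an annulus in the image.\<close>

lemma stokes_area:
  assumes AB: "A \<le> B" and R: "R > 0"
    and large: "\<And>z. z \<in> path_image (sqpath R) \<Longrightarrow> norm (f z) \<ge> exp (B + 1)"
  shows "(LINT z:sq R|lborel. Phi A B (f z) / (norm (f z))\<^sup>2 * Im (cnj (fx z) * fy z))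
    = (B - A + 1) * (2 * pi * Re (winding_number (f \<circ> sqpath R) 0))"
proof -
  have "Phi A B (f z) / (norm (f z))\<^sup>2 * Im (cnj (fx z) * fy z)
      = Xx A B z * Im (fy z / f z) - Xy A B z * Im (fx z / f z)" for z
  proof -
    have "Xx A B z * Im (fy z / f z) - Xy A B z * Im (fx z / f z)
        = Phi A B (f z) * (Re (fx z / f z) * Im (fy z / f z) - Re (fy z / f z) * Im (fx z / f z))"
      by (simp add: Xx_def Xy_def algebra_simps)
    also have "\<dots> = Phi A B (f z) * Im (cnj (fx z / f z) * (fy z / f z))" by (simp only: Re_Im_cross)
    also have "cnj (fx z / f z) * (fy z / f z) = (cnj (fx z) * fy z) / of_real ((norm (f z))\<^sup>2)"
      by (simp add: complex_norm_square mult.commute del: of_real_power)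
    finally show ?thesis by (simp only: Im_divide_of_real)  (simp add: field_simps)
  qed
  then have "(LINT z:sq R|lborel. Phi A B (f z) / (norm (f z))\<^sup>2 * Im (cnj (fx z) * fy z))
      = (LINT z:sq R|lborel. Xx A B z * Im (fy z / f z) - Xy A B z * Im (fx z / f z))" by presburger
  also have "\<dots> = (B - A + 1) * (2 * pi * Re (winding_number (f \<circ> sqpath R) 0))"
    by (rule stokes_winding[OF R X_cont[OF AB] Xx_cont[OF AB] Xy_cont[OF AB] dX[OF AB] open_small[of "exp (A - 1)"]])
       (use AB large large[THEN order.strict_trans2[OF exp_gt_zero]] in
          \<open>auto simp: Theta_small Xx_def Xy_def Phi_small Theta_large\<close>)
  finally show ?thesis .
qed

text \<open>The choice \<open>X = Theta z\<close>: the total increase of \<open>arg f\<close> along closed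
  curves around \<open>0\<close>, averaged logarithmically over the annulus of the domain.\<close>

lemma stokes_angle:
  assumes AB: "A \<le> B" and R: "R \<ge> exp (B + 1)"
    and nz: "\<And>z. z \<in> sq R \<Longrightarrow> norm z \<ge> exp (A - 1) \<Longrightarrow> f z \<noteq> 0"
  shows "(LINT z:sq R|lborel. Phi A B z * (Re (1 / z) * Im (fy z / f z) - Re (\<i> / z) * Im (fx z / f z)))
    = (B - A + 1) * (2 * pi * Re (winding_number (f \<circ> sqpath R) 0))"
proof -
  have R0: "R > 0" using R exp_gt_zero[of "B+1"] by linarith
  have bd: "norm z \<ge> exp (B + 1)" "z \<in> sq R" if "z \<in> path_image (sqpath R)" for z
    using that R0 R abs_Re_le_cmod[of z] abs_Im_le_cmod[of z] by (auto simp: in_sqpath in_sq)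
  have e: "exp (A - 1) \<le> exp (B + 1)" using AB by simp
  have "(LINT z:sq R|lborel. Phi A B z * (Re (1 / z) * Im (fy z / f z) - Re (\<i> / z) * Im (fx z / f z)))
      = (LINT z:sq R|lborel. idm.Xx A B z * Im (fy z / f z) - idm.Xy A B z * Im (fx z / f z))"
    by (simp add: idm.Xx_def idm.Xy_def right_diff_distrib mult.assoc)
  also have "\<dots> = (B - A + 1) * (2 * pi * Re (winding_number (f \<circ> sqpath R) 0))"
  proof (rule stokes_winding[OF R0 idm.X_cont[OF AB] idm.Xx_cont[OF AB] idm.Xy_cont[OF AB] idm.dX[OF AB] idm.open_small[of "exp (A - 1)"]])
    fix z assume "z \<in> sq R" "f z = 0"
    then show "z \<in> {z. norm z < exp (A - 1)}" using nz[of z] not_le[of "exp (A - 1)" "norm z"] by blast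
  next
    fix z assume z: "z \<in> path_image (sqpath R)"
    show "Theta A B z = B - A + 1" by (rule Theta_large[OF AB bd(1)[OF z]])
    show "f z \<noteq> 0" using nz[of z] bd[OF z] e by linarith
  qed (use AB in \<open>auto simp: Theta_small idm.Xx_def idm.Xy_def Phi_small\<close>)
  finally show ?thesis .
qed

end

lemma LINT_arctan:
  assumes "R > 0" "a \<le> b"
  shows "(LINT x:{a..b}|lborel. R / (x\<^sup>2 + R\<^sup>2)) = arctan (b / R) - arctan (a / R)"
  unfolding set_lebesgue_integral_def
proof (rule integral_FTC_Icc[OF assms(2)])
  show "((\<lambda>x. arctan (x / R)) has_vector_derivative R / (x\<^sup>2 + R\<^sup>2)) (at x within {a..b})" for x
  proof -
    have "1 + (x / R)\<^sup>2 \<noteq> 0" by (smt (verit) zero_le_power2)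
    then have "((\<lambda>x. arctan (x / R)) has_real_derivative R / (x\<^sup>2 + R\<^sup>2)) (at x within {a..b})"
      using assms(1) by (auto intro!: derivative_eq_intros simp: field_simps power2_eq_square)
    then show ?thesis by (simp add: has_real_derivative_iff_has_vector_derivative)
  qed
  show "continuous_on {a..b} (\<lambda>x. R / (x\<^sup>2 + R\<^sup>2))"
    using assms(1) by (intro continuous_intros) (auto simp: add_nonneg_eq_0_iff)
qed

lemma Im_div_Complex:
  "Im (\<i> / Complex x y) = x / (x\<^sup>2 + y\<^sup>2)" "Im (1 / Complex x y) = - y / (x\<^sup>2 + y\<^sup>2)"
  by (simp_all add: Im_divide)

context c2map
begin

text \<open>The form \<open>d Theta (f) \<and> d arg z\<close> on the upper or lower half of a square: along
  each ray \<open>Theta (f)\<close> goes from \<open>0\<close> to \<open>B - A + 1\<close>, and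
  the rays fill an angle \<open>\<pi>\<close>. In coordinates, the boundary integral consists of
  the angles under which the three outer sides are seen from \<open>0\<close>; the fourth side
  lies on the real axis, where \<open>d arg z = 0\<close>.\<close>

lemma stokes_half_square:
  assumes AB: "A \<le> B" and R: "R > 0" and y: "y0 = 0 \<and> y1 = R \<or> y0 = -R \<and> y1 = 0"
    and large: "\<And>z. z \<in> path_image (sqpath R) \<Longrightarrow> norm (f z) \<ge> exp (B + 1)"
    and small: "\<delta> > 0" "\<And>z. norm z < \<delta> \<Longrightarrow> norm (f z) < exp (A - 1)"
  shows "(LINT z:cbox (Complex (-R) y0) (Complex R y1)|lborel.
      Phi A B (f z) * (Re (fx z / f z) * Im (\<i> / z) - Re (fy z / f z) * Im (1 / z))) = (B - A + 1) * pi"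
proof -
  define c where "c = B - A + 1"
  have le: "-R \<le> R" "y0 \<le> y1" using R y by auto
  have X: "Theta A B (f z) = c" if "z \<in> path_image (sqpath R)" for z
    using Theta_large[OF AB large[OF that]] by (simp add: c_def)
  have "(LINT z:cbox (Complex (-R) y0) (Complex R y1)|lborel.
      Phi A B (f z) * (Re (fx z / f z) * Im (\<i> / z) - Re (fy z / f z) * Im (1 / z)))
    = (LINT z:cbox (Complex (-R) y0) (Complex R y1)|lborel. Xx A B z * Im (\<i> / z) - Xy A B z * Im (1 / z))"
    by (simp add: Xx_def Xy_def right_diff_distrib mult.assoc)
  also have "\<dots> = (LINT y:{y0..y1}|lborel. Theta A B (f (Complex R y)) * Im (\<i> / Complex R y)
          - Theta A B (f (Complex (-R) y)) * Im (\<i> / Complex (-R) y))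
    - (LINT x:{-R..R}|lborel. Theta A B (f (Complex x y1)) * Im (1 / Complex x y1)
          - Theta A B (f (Complex x y0)) * Im (1 / Complex x y0))"
  proof (rule stokes_log[OF le X_cont[OF AB] Xx_cont[OF AB] Xy_cont[OF AB] idm.cf dX[OF AB] idm.df open_ball[of 0 \<delta>]])
    fix z :: complex assume "z \<in> ball 0 \<delta>"
    then have "norm (f z) \<le> exp (A - 1)" using small(2)[of z] by auto
    then show "Theta A B (f z) = 0" "Xx A B z = 0" "Xy A B z = 0"
      using AB by (simp_all add: Theta_small Phi_small Xx_def Xy_def)
  qed (use small(1) in auto)
  also have "(LINT y:{y0..y1}|lborel. Theta A B (f (Complex R y)) * Im (\<i> / Complex R y)
          - Theta A B (f (Complex (-R) y)) * Im (\<i> / Complex (-R) y))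
      = (LINT y:{y0..y1}|lborel. (2 * c) * (R / (y\<^sup>2 + R\<^sup>2)))"
  proof (rule set_lebesgue_integral_cong; safe?)
    fix y assume "y \<in> {y0..y1}"
    then have "Complex R y \<in> path_image (sqpath R)" "Complex (-R) y \<in> path_image (sqpath R)"
      using R \<open>y0 = 0 \<and> y1 = R \<or> y0 = -R \<and> y1 = 0\<close> by (auto simp: in_sqpath)
    then show "Theta A B (f (Complex R y)) * Im (\<i> / Complex R y)
          - Theta A B (f (Complex (-R) y)) * Im (\<i> / Complex (-R) y) = (2 * c) * (R / (y\<^sup>2 + R\<^sup>2))"
      by (simp add: X Im_div_Complex add.commute)
  qed simp
  also have "\<dots> = c * (pi / 2)"
    unfolding set_integral_mult_right using y R by (auto simp: LINT_arctan arctan_minus arctan_one)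
  also have "(LINT x:{-R..R}|lborel. Theta A B (f (Complex x y1)) * Im (1 / Complex x y1)
          - Theta A B (f (Complex x y0)) * Im (1 / Complex x y0))
      = (LINT x:{-R..R}|lborel. (- c) * (R / (x\<^sup>2 + R\<^sup>2)))"
  proof (rule set_lebesgue_integral_cong; safe?)
    fix x assume "x \<in> {-R..R}"
    then have "Complex x R \<in> path_image (sqpath R)" "Complex x (-R) \<in> path_image (sqpath R)"
      using R by (auto simp: in_sqpath)
    then show "Theta A B (f (Complex x y1)) * Im (1 / Complex x y1)
          - Theta A B (f (Complex x y0)) * Im (1 / Complex x y0) = (- c) * (R / (x\<^sup>2 + R\<^sup>2))"
      using y by (auto simp: X Im_div_Complex)
  qed simp
  also have "\<dots> = - c * (pi / 2)"
    unfolding set_integral_mult_right using R by (auto simp: LINT_arctan arctan_minus arctan_one)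
  finally show ?thesis by (simp add: c_def field_simps)
qed

text \<open>A majorant of both partial derivatives of \<open>Theta A B (f z)\<close>.\<close>

definition log_gradient :: "real \<Rightarrow> real \<Rightarrow> complex \<Rightarrow> real"
  where "log_gradient A B z = Phi A B (f z) * (norm (fx z) / norm (f z)) + Phi A B (f z) * (norm (fy z) / norm (f z))"

lemma log_gradient_cont: "A \<le> B \<Longrightarrow> continuous_on S (log_gradient A B)"
  unfolding log_gradient_def by (intro continuous_intros Phi_quot_cont(2) cf)

lemma log_gradient_bounds:
  assumes "A \<le> B"
  shows "0 \<le> log_gradient A B z" "\<bar>Xx A B z\<bar> \<le> log_gradient A B z" "\<bar>Xy A B z\<bar> \<le> log_gradient A B z"
proof -
  have P: "0 \<le> Phi A B (f z)" by (rule Phi_bounds(1)[OF assms])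
  have b: "\<bar>Phi A B (f z) * Re (k / f z)\<bar> \<le> Phi A B (f z) * (norm k / norm (f z))" for k
    using mult_left_mono[OF abs_Re_le_cmod[of "k / f z"] P] P by (simp add: abs_mult norm_divide)
  show "0 \<le> log_gradient A B z" "\<bar>Xx A B z\<bar> \<le> log_gradient A B z" "\<bar>Xy A B z\<bar> \<le> log_gradient A B z"
    using b[of "fx z"] b[of "fy z"] P by (auto simp: log_gradient_def Xx_def Xy_def intro: add_nonneg_nonneg add_increasing add_increasing2)
qed

end

lemma segment_oscillation:
  fixes u u' e :: "real \<Rightarrow> real"
  assumes d: "\<And>x. (u has_real_derivative u' x) (at x)" and c: "continuous_on UNIV u'" "continuous_on UNIV e"
    and le: "\<And>x. \<bar>u' x\<bar> \<le> e x" and s: "s \<in> {a..b}" "t \<in> {a..b}"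
  shows "\<bar>u s - u t\<bar> \<le> (LINT x:{a..b}|lborel. e x)"
proof -
  have *: "\<bar>u s - u t\<bar> \<le> (LINT x:{a..b}|lborel. e x)" if "a \<le> s" "s \<le> t" "t \<le> b" for s t
  proof -
    have i: "set_integrable lborel {p..q} h" if "continuous_on UNIV h" for p q and h :: "real \<Rightarrow> real"
      unfolding set_integrable_def
      by (rule borel_integrable_compact[OF _ continuous_on_subset[OF that]]) auto
    have "u t - u s = (LINT x:{s..t}|lborel. u' x)"
      unfolding set_lebesgue_integral_def
      by (rule integral_FTC_Icc[symmetric])
        (use that d c in \<open>auto intro: has_vector_derivative_at_within continuous_on_subset
          simp: has_real_derivative_iff_has_vector_derivative\<close>)
    then have "\<bar>u s - u t\<bar> = norm (LINT x:{s..t}|lborel. u' x)" by (simp add: abs_minus_commute)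
    also have "\<dots> \<le> (LINT x:{s..t}|lborel. norm (u' x))"
      by (rule set_integral_norm_bound[OF i[OF c(1)]])
    also have "\<dots> \<le> (LINT x:{a..b}|lborel. e x)"
      unfolding set_lebesgue_integral_def
    proof (rule integral_mono)
      show "integrable lborel (\<lambda>x. indicat_real {s..t} x *\<^sub>R norm (u' x))"
        using i[of "\<lambda>x. norm (u' x)" s t] c(1) by (auto simp: set_integrable_def intro: continuous_intros)
      show "integrable lborel (\<lambda>x. indicat_real {a..b} x *\<^sub>R e x)"
        using i[OF c(2), of a b] by (simp add: set_integrable_def)
      show "indicat_real {s..t} x *\<^sub>R norm (u' x) \<le> indicat_real {a..b} x *\<^sub>R e x" for x
        using le[of x] order_trans[OF abs_ge_zero le[of x]] that by (auto simp: indicator_def)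
    qed
    finally show ?thesis .
  qed
  show ?thesis
    using *[of s t] *[of t s] s by (cases "s \<le> t") (auto simp: abs_minus_commute)
qed

context c2map
begin

text \<open>Two points on the boundary of a square are both joined to one corner along the boundary. The
  four sides are extended to length \<open>2 L\<close>, so that the bound can be integrated over
  \<open>r\<close> with a fixed range of integration.\<close>

lemma square_oscillation:
  assumes AB: "A \<le> B" and r: "0 < r" "r \<le> L" and p: "p \<in> path_image (sqpath r)" and q: "q \<in> path_image (sqpath r)"
  shows "\<bar>Theta A B (f q) - Theta A B (f p)\<bar> \<le> 2 * ((LINT y:{-L..L}|lborel. log_gradient A B (Complex r y))
    + (LINT y:{-L..L}|lborel. log_gradient A B (Complex (-r) y)) + (LINT x:{-L..L}|lborel. log_gradient A B (Complex x r))
    + (LINT x:{-L..L}|lborel. log_gradient A B (Complex x (-r))))"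
proof -
  let ?u = "\<lambda>z. Theta A B (f z)"
  have cx: "continuous_on UNIV (\<lambda>s. Complex s y)" and cy: "continuous_on UNIV (\<lambda>s. Complex y s)" for y
    by (auto simp: Complex_eq intro!: continuous_intros)
  have v: "\<bar>?u (Complex x s) - ?u (Complex x t)\<bar> \<le> (LINT y:{-L..L}|lborel. log_gradient A B (Complex x y))"
    if "\<bar>s\<bar> \<le> L" "\<bar>t\<bar> \<le> L" for x s t
    by (rule segment_oscillation[OF dX(2)[OF AB] continuous_on_compose2[OF Xy_cont[OF AB, of UNIV] cy]
          continuous_on_compose2[OF log_gradient_cont[OF AB, of UNIV] cy] log_gradient_bounds(3)[OF AB]]) (use that in auto)
  have h: "\<bar>?u (Complex s y) - ?u (Complex t y)\<bar> \<le> (LINT x:{-L..L}|lborel. log_gradient A B (Complex x y))"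
    if "\<bar>s\<bar> \<le> L" "\<bar>t\<bar> \<le> L" for y s t
    by (rule segment_oscillation[OF dX(1)[OF AB] continuous_on_compose2[OF Xx_cont[OF AB, of UNIV] cx]
          continuous_on_compose2[OF log_gradient_cont[OF AB, of UNIV] cx] log_gradient_bounds(2)[OF AB]]) (use that in auto)
  define S1 where "S1 = (LINT y:{-L..L}|lborel. log_gradient A B (Complex r y))"
  define S2 where "S2 = (LINT y:{-L..L}|lborel. log_gradient A B (Complex (-r) y))"
  define S3 where "S3 = (LINT x:{-L..L}|lborel. log_gradient A B (Complex x r))"
  define S4 where "S4 = (LINT x:{-L..L}|lborel. log_gradient A B (Complex x (-r)))"
  have nn: "S1 \<ge> 0" "S2 \<ge> 0" "S3 \<ge> 0" "S4 \<ge> 0"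
    unfolding S1_def S2_def S3_def S4_def set_lebesgue_integral_def
    by (auto intro!: integral_nonneg_AE AE_I2 log_gradient_bounds(1)[OF AB] mult_nonneg_nonneg)
  define S where "S = S1 + S2 + S3 + S4"
  have key: "\<bar>?u z - ?u (Complex r r)\<bar> \<le> S" if z: "z \<in> path_image (sqpath r)" for z
  proof -
    have zz: "z = Complex (Re z) (Im z)" by simp
    consider "Re z = r" "\<bar>Im z\<bar> \<le> r" | "Re z = -r" "\<bar>Im z\<bar> \<le> r" | "Im z = r" "\<bar>Re z\<bar> \<le> r" | "Im z = -r" "\<bar>Re z\<bar> \<le> r"
      using z r(1) by (auto simp: in_sqpath abs_if split: if_splits)
    then show ?thesis
    proof cases
      case 1
      have "\<bar>?u z - ?u (Complex r r)\<bar> \<le> S1"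
        using v[of "Im z" r r] 1 r by (subst zz, subst 1) (simp add: S1_def)
      then show ?thesis using nn by (simp add: S_def)
    next
      case 2
      have "\<bar>?u z - ?u (Complex (-r) r)\<bar> \<le> S2"
        using v[of "Im z" r "-r"] 2 r by (subst zz, subst 2) (simp add: S2_def)
      moreover have "\<bar>?u (Complex (-r) r) - ?u (Complex r r)\<bar> \<le> S3"
        using h[of "-r" r r] r by (simp add: S3_def)
      ultimately show ?thesis using nn by (simp add: S_def)
    next
      case 3
      have "\<bar>?u z - ?u (Complex r r)\<bar> \<le> S3"
        using h[of "Re z" r r] 3 r by (subst zz, subst 3) (simp add: S3_def)
      then show ?thesis using nn by (simp add: S_def)
    next
      case 4
      have "\<bar>?u z - ?u (Complex r (-r))\<bar> \<le> S4"
        using h[of "Re z" r "-r"] 4 r by (subst zz, subst 4) (simp add: S4_def)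
      moreover have "\<bar>?u (Complex r (-r)) - ?u (Complex r r)\<bar> \<le> S1"
        using v[of "-r" r r] r by (simp add: S1_def)
      ultimately show ?thesis using nn by (simp add: S_def)
    qed
  qed
  have "\<bar>?u q - ?u p\<bar> \<le> 2 * S" using key[OF p] key[OF q] by linarith
  then show ?thesis by (simp only: S_def S1_def S2_def S3_def S4_def)
qed

text \<open>Integrate the previous bound over \<open>r\<close> from \<open>R\<close> to \<open>2 R\<close>:
  each of the four families of sides sweeps out a part of the square of size \<open>2 R\<close>.\<close>

lemma crossing:
  assumes AB: "A \<le> B" and R: "R > 0"
    and cr: "\<And>r. R \<le> r \<Longrightarrow> r \<le> 2 * R \<Longrightarrow> \<exists>p\<in>path_image (sqpath r). \<exists>q\<in>path_image (sqpath r).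
        m \<le> Theta A B (f q) - Theta A B (f p)"
  shows "m * R \<le> 8 * (LINT z:sq (2 * R)|lborel. log_gradient A B z)"
proof -
  let ?L = "2 * R"
  define J where "J = (LINT z:sq ?L|lborel. log_gradient A B z)"
  have Ec: "continuous_on S (log_gradient A B)" for S by (rule log_gradient_cont[OF AB])
  have E0: "log_gradient A B z \<ge> 0" for z by (rule log_gradient_bounds(1)[OF AB])
  have sub: "(LINT z:cbox a b|lborel. log_gradient A B z) \<le> J" if "cbox a b \<subseteq> sq ?L" for a b
    unfolding J_def set_lebesgue_integral_def
  proof (rule integral_mono)
    show "integrable lborel (\<lambda>z. indicat_real (cbox a b) z *\<^sub>R log_gradient A B z)"
      using integrable_cont_cbox[OF Ec] by (simp add: set_integrable_def)
    show "integrable lborel (\<lambda>z. indicat_real (sq ?L) z *\<^sub>R log_gradient A B z)"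
      using integrable_cont_cbox[OF Ec] by (simp add: set_integrable_def sq_def)
    show "indicat_real (cbox a b) z *\<^sub>R log_gradient A B z \<le> indicat_real (sq ?L) z *\<^sub>R log_gradient A B z" for z
      using that E0 by (auto simp: indicator_def)
  qed
  have cI: "continuous_on {R..?L} (\<lambda>r. LINT t:{-?L..?L}|lborel. log_gradient A B (k r t))"
    if k: "continuous_on UNIV (\<lambda>(r, t). k r t)" for k :: "real \<Rightarrow> real \<Rightarrow> complex"
  proof -
    have c2: "continuous_on S (\<lambda>t. log_gradient A B (k r t))" for r S
    proof -
      have "continuous_on S (\<lambda>t. (r, t))" by (intro continuous_intros)
      from continuous_on_compose2[OF k this] have "continuous_on S (k r)" by simp
      then show ?thesis by (intro continuous_on_compose2[OF Ec[of UNIV]]) auto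
    qed
    have "(LINT t:{-?L..?L}|lborel. log_gradient A B (k r t)) = integral (cbox (-?L) ?L) (\<lambda>t. log_gradient A B (k r t))" for r
      using set_borel_integral_eq_integral(2)[of "{-?L..?L}" "\<lambda>t. log_gradient A B (k r t)"]
        borel_integrable_compact[OF _ c2, of "{-?L..?L}" r] by (simp add: set_integrable_def)
    moreover have "continuous_on {R..?L} (\<lambda>r. integral (cbox (-?L) ?L) (\<lambda>t. log_gradient A B (k r t)))"
    proof (rule integral_continuous_on_param)
      show "continuous_on ({R..?L} \<times> cbox (-?L) ?L) (\<lambda>(r, t). log_gradient A B (k r t))"
        unfolding case_prod_unfold
        by (rule continuous_on_compose2[OF Ec[of UNIV]])
           (use continuous_on_subset[OF k] in \<open>auto simp: case_prod_unfold\<close>)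
    qed
    ultimately show ?thesis by simp
  qed
  have iI: "set_integrable lborel {R..?L} g" if "continuous_on {R..?L} g" for g :: "real \<Rightarrow> real"
    unfolding set_integrable_def by (rule borel_integrable_compact[OF _ that]) simp
  define S1 where "S1 r = (LINT y:{-?L..?L}|lborel. log_gradient A B (Complex r y))" for r
  define S3 where "S3 r = (LINT x:{-?L..?L}|lborel. log_gradient A B (Complex x r))" for r
  have c1: "continuous_on {R..?L} S1" "continuous_on {R..?L} (\<lambda>r. S1 (-r))"
    "continuous_on {R..?L} S3" "continuous_on {R..?L} (\<lambda>r. S3 (-r))"
  proof -
    have "continuous_on UNIV (\<lambda>(r, y). Complex r y)" "continuous_on UNIV (\<lambda>(r, y). Complex (-r) y)"
      "continuous_on UNIV (\<lambda>(r, x). Complex x r)" "continuous_on UNIV (\<lambda>(r, x). Complex x (-r))"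
      unfolding case_prod_unfold Complex_eq of_real_minus by (intro continuous_intros)+
    from this[THEN cI] show "continuous_on {R..?L} S1" "continuous_on {R..?L} (\<lambda>r. S1 (-r))"
      "continuous_on {R..?L} S3" "continuous_on {R..?L} (\<lambda>r. S3 (-r))"
      unfolding S1_def S3_def .
  qed
  have refl: "(LINT r:{R..?L}|lborel. g (-r)) = (LINT r:{-?L..-R}|lborel. g r)" for g :: "real \<Rightarrow> real"
    unfolding set_lebesgue_integral_def
    by (subst (2) lborel_integral_real_affine[of "-1" _ 0]) (auto intro!: Bochner_Integration.integral_cong simp: indicator_def)
  have b1: "(LINT r:{R..?L}|lborel. S1 r) \<le> J"
    unfolding S1_def by (subst LINT_rect(2)[symmetric, OF Ec]) (rule sub, use R in \<open>auto simp: in_cbox_complex_iff in_sq\<close>)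
  have b2: "(LINT r:{R..?L}|lborel. S1 (-r)) \<le> J"
    unfolding refl[of S1] unfolding S1_def
    by (subst LINT_rect(2)[symmetric, OF Ec]) (rule sub, use R in \<open>auto simp: in_cbox_complex_iff in_sq\<close>)
  have b3: "(LINT r:{R..?L}|lborel. S3 r) \<le> J"
    unfolding S3_def by (subst LINT_rect(1)[symmetric, OF Ec]) (rule sub, use R in \<open>auto simp: in_cbox_complex_iff in_sq\<close>)
  have b4: "(LINT r:{R..?L}|lborel. S3 (-r)) \<le> J"
    unfolding refl[of S3] unfolding S3_def
    by (subst LINT_rect(1)[symmetric, OF Ec]) (rule sub, use R in \<open>auto simp: in_cbox_complex_iff in_sq\<close>)
  have pt: "m \<le> 2 * (S1 r + S1 (-r) + S3 r + S3 (-r))" if r: "r \<in> {R..?L}" for r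
  proof -
    obtain p q where pq: "p \<in> path_image (sqpath r)" "q \<in> path_image (sqpath r)" "m \<le> Theta A B (f q) - Theta A B (f p)"
      using cr[of r] r by auto
    show ?thesis using square_oscillation[OF AB _ _ pq(1,2), of ?L] pq(3) r R unfolding S1_def S3_def by auto
  qed
  have "m * R = (LINT r:{R..?L}|lborel. m)"
    using R by (simp add: set_lebesgue_integral_def)
  also have "\<dots> \<le> (LINT r:{R..?L}|lborel. 2 * (S1 r + S1 (-r) + S3 r + S3 (-r)))"
    by (rule set_integral_mono) (use c1 pt in \<open>auto intro!: iI continuous_intros\<close>)
  also have "\<dots> = 2 * ((LINT r:{R..?L}|lborel. S1 r) + (LINT r:{R..?L}|lborel. S1 (-r))
      + (LINT r:{R..?L}|lborel. S3 r) + (LINT r:{R..?L}|lborel. S3 (-r)))"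
    using c1 by (simp add: set_integral_add(2) iI continuous_on_add)
  also have "\<dots> \<le> 2 * (J + J + J + J)" by (intro mult_left_mono add_mono b1 b2 b3 b4) simp
  finally show ?thesis by (simp add: J_def)
qed

end

section \<open>From distributional to smooth derivatives\<close>

text \<open>Dominated convergence for the factor \<open>c n\<close> against the fixed integrable
  \<open>h\<close>, and convergence in \<open>L1\<close> for the remaining part.\<close>

lemma L1_mult_limit:
  fixes c hn :: "nat \<Rightarrow> complex \<Rightarrow> 'b::{real_normed_field, banach, second_countable_topology}"
  assumes S [measurable]: "S \<in> sets borel"
    and cm [measurable]: "\<And>n. c n \<in> borel_measurable borel" "c' \<in> borel_measurable borel"
    and hn: "\<And>n. set_integrable lborel S (hn n)" and h: "set_integrable lborel S h"
    and L1: "(\<lambda>n. LINT z:S|lborel. norm (hn n z - h z)) \<longlonglongrightarrow> 0"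
    and bd: "\<forall>\<^sub>F n in sequentially. \<forall>z\<in>S. norm (c n z) \<le> M"
    and lim: "\<And>z. z \<in> S \<Longrightarrow> (\<lambda>n. c n z) \<longlonglongrightarrow> c' z"
  shows "(\<lambda>n. LINT z:S|lborel. c n z * hn n z) \<longlonglongrightarrow> (LINT z:S|lborel. c' z * h z)"
    and "set_integrable lborel S (\<lambda>z. c' z * h z)"
    and "\<forall>\<^sub>F n in sequentially. set_integrable lborel S (\<lambda>z. c n z * hn n z)"
proof -
  obtain N where N: "\<And>n z. n \<ge> N \<Longrightarrow> z \<in> S \<Longrightarrow> norm (c n z) \<le> M"
    using bd by (auto simp: eventually_sequentially)
  have bd': "norm (c' z) \<le> M" if "z \<in> S" for z
    by (rule LIMSEQ_le_const2[OF tendsto_norm[OF lim[OF that]]]) (use N that in blast)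
  have mult_int: "set_integrable lborel S (\<lambda>z. k z * u z)"
    if [measurable]: "k \<in> borel_measurable borel" and k: "\<And>z. z \<in> S \<Longrightarrow> norm (k z) \<le> C" and u: "set_integrable lborel S u"
    for k u :: "complex \<Rightarrow> 'b" and C
  proof -
    have ui: "integrable lborel (\<lambda>z. indicat_real S z *\<^sub>R u z)" using u by (simp add: set_integrable_def)
    then have [measurable]: "(\<lambda>z. indicat_real S z *\<^sub>R u z) \<in> borel_measurable borel" by simp
    have eq: "indicat_real S z *\<^sub>R (k z * u z) = k z * (indicat_real S z *\<^sub>R u z)" for z by simp
    show ?thesis unfolding set_integrable_def
    proof (rule Bochner_Integration.integrable_bound[OF integrable_mult_right[OF integrable_norm[OF ui], of "C"]])
      show "(\<lambda>z. indicat_real S z *\<^sub>R (k z * u z)) \<in> borel_measurable lborel" unfolding eq by measurable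
      show "AE z in lborel. norm (indicat_real S z *\<^sub>R (k z * u z)) \<le> norm (C * norm (indicat_real S z *\<^sub>R u z))"
        using k by (auto intro!: AE_I2 mult_right_mono order_trans[OF _ abs_ge_self] simp: indicator_def norm_mult abs_mult)
    qed
  qed
  show i': "set_integrable lborel S (\<lambda>z. c' z * h z)" by (rule mult_int[OF cm(2) bd' h])
  have inn: "set_integrable lborel S (\<lambda>z. c n z * hn n z)" if "n \<ge> N" for n
    by (rule mult_int[OF cm(1) N[OF that] hn])
  then show "\<forall>\<^sub>F n in sequentially. set_integrable lborel S (\<lambda>z. c n z * hn n z)"
    unfolding eventually_sequentially by blast
  have hd: "set_integrable lborel S (\<lambda>z. hn n z - h z)" for n using hn h by (rule set_integral_diff(1))
  have M0: "S = {} \<or> M \<ge> 0" using bd' norm_ge_zero order_trans by blast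
  have t1: "(\<lambda>n. LINT z:S|lborel. c (n + N) z * (hn (n + N) z - h z)) \<longlonglongrightarrow> 0"
  proof (rule Lim_null_comparison)
    show "(\<lambda>n. \<bar>M\<bar> * (LINT z:S|lborel. norm (hn (n + N) z - h z))) \<longlonglongrightarrow> 0"
      using tendsto_mult_right_zero[OF LIMSEQ_ignore_initial_segment[OF L1, of N]] by simp
    show "\<forall>\<^sub>F n in sequentially. norm (LINT z:S|lborel. c (n + N) z * (hn (n + N) z - h z))
        \<le> \<bar>M\<bar> * (LINT z:S|lborel. norm (hn (n + N) z - h z))"
    proof (rule always_eventually, rule allI)
      fix n
      have i: "set_integrable lborel S (\<lambda>z. c (n + N) z * (hn (n + N) z - h z))"
        by (rule mult_int[OF cm(1) N hd]) auto
      have "norm (LINT z:S|lborel. c (n + N) z * (hn (n + N) z - h z))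
          \<le> (LINT z:S|lborel. norm (c (n + N) z * (hn (n + N) z - h z)))"
        by (rule set_integral_norm_bound[OF i])
      also have "\<dots> \<le> (LINT z:S|lborel. \<bar>M\<bar> * norm (hn (n + N) z - h z))"
      proof (rule set_integral_mono)
        show "set_integrable lborel S (\<lambda>z. norm (c (n + N) z * (hn (n + N) z - h z)))"
          by (rule set_integrable_norm[OF i])
        show "set_integrable lborel S (\<lambda>z. \<bar>M\<bar> * norm (hn (n + N) z - h z))"
          using set_integrable_norm[OF hd] by simp
      qed (use N in \<open>auto simp: norm_mult intro!: mult_right_mono order_trans[OF _ abs_ge_self]\<close>)
      finally show "norm (LINT z:S|lborel. c (n + N) z * (hn (n + N) z - h z))
          \<le> \<bar>M\<bar> * (LINT z:S|lborel. norm (hn (n + N) z - h z))" by simp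
    qed
  qed
  have t2: "(\<lambda>n. LINT z:S|lborel. c (n + N) z * h z) \<longlonglongrightarrow> (LINT z:S|lborel. c' z * h z)"
    unfolding set_lebesgue_integral_def
  proof (rule integral_dominated_convergence[where w = "\<lambda>z. \<bar>M\<bar> * norm (indicat_real S z *\<^sub>R h z)"])
    show "(\<lambda>z. indicat_real S z *\<^sub>R (c' z * h z)) \<in> borel_measurable lborel"
      using i' by (simp add: set_integrable_def)
    show "(\<lambda>z. indicat_real S z *\<^sub>R (c (n + N) z * h z)) \<in> borel_measurable lborel" for n
      using mult_int[OF cm(1)[of "n + N"] N h] by (auto simp: set_integrable_def)
    show "integrable lborel (\<lambda>z. \<bar>M\<bar> * norm (indicat_real S z *\<^sub>R h z))"
      using h by (intro integrable_mult_right integrable_norm) (simp add: set_integrable_def)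
    show "AE z in lborel. (\<lambda>n. indicat_real S z *\<^sub>R (c (n + N) z * h z)) \<longlonglongrightarrow> indicat_real S z *\<^sub>R (c' z * h z)"
    proof (rule AE_I2)
      fix z show "(\<lambda>n. indicat_real S z *\<^sub>R (c (n + N) z * h z)) \<longlonglongrightarrow> indicat_real S z *\<^sub>R (c' z * h z)"
        using LIMSEQ_ignore_initial_segment[OF lim, of z N] by (cases "z \<in> S") (auto intro!: tendsto_intros)
    qed
    show "AE z in lborel. norm (indicat_real S z *\<^sub>R (c (n + N) z * h z)) \<le> \<bar>M\<bar> * norm (indicat_real S z *\<^sub>R h z)" for n
      using N[of "n + N"] by (auto intro!: AE_I2 mult_right_mono order_trans[OF _ abs_ge_self] simp: indicator_def norm_mult)
  qed
  have "(LINT z:S|lborel. c (n + N) z * hn (n + N) z)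
      = (LINT z:S|lborel. c (n + N) z * (hn (n + N) z - h z)) + (LINT z:S|lborel. c (n + N) z * h z)" for n
  proof -
    have "(\<lambda>z. c (n + N) z * hn (n + N) z) = (\<lambda>z. c (n + N) z * (hn (n + N) z - h z) + c (n + N) z * h z)"
      by (auto simp: algebra_simps)
    then show ?thesis
      using set_integral_add(2)[OF mult_int[OF cm(1) N hd] mult_int[OF cm(1) N h], of "n + N" "n + N" "n + N"] by simp
  qed
  with tendsto_add[OF t1 t2] have "(\<lambda>n. LINT z:S|lborel. c (n + N) z * hn (n + N) z) \<longlonglongrightarrow> (LINT z:S|lborel. c' z * h z)"
    by simp
  then show "(\<lambda>n. LINT z:S|lborel. c n z * hn n z) \<longlonglongrightarrow> (LINT z:S|lborel. c' z * h z)"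
    by (rule LIMSEQ_offset)
qed

text \<open>The arithmetic-geometric mean inequality with a small weight on the fixed factor
  \<open>w\<close> serves as Cauchy-Schwarz inequality.\<close>

lemma L2_mult_small:
  fixes u :: "nat \<Rightarrow> complex \<Rightarrow> real" and w :: "complex \<Rightarrow> real"
  assumes i: "\<And>n. set_integrable lborel S (\<lambda>z. (u n z)\<^sup>2)" "set_integrable lborel S (\<lambda>z. (w z)\<^sup>2)"
    and l: "(\<lambda>n. LINT z:S|lborel. (u n z)\<^sup>2) \<longlonglongrightarrow> 0"
    and nn: "\<And>n z. u n z \<ge> 0" "\<And>z. w z \<ge> 0"
    and ui: "\<And>n. set_integrable lborel S (\<lambda>z. u n z * w z)"
  shows "(\<lambda>n. LINT z:S|lborel. u n z * w z) \<longlonglongrightarrow> 0"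
proof (rule LIMSEQ_I)
  fix e :: real assume e: "e > 0"
  define W where "W = (LINT z:S|lborel. (w z)\<^sup>2)"
  have W: "W \<ge> 0" unfolding W_def set_lebesgue_integral_def by (intro integral_nonneg_AE AE_I2) auto
  define t where "t = e / (2 * (W + 1))"
  have t: "t > 0" using e W by (simp add: t_def)
  have tW: "t * W \<le> e / 2" using e W by (simp add: t_def field_simps)
  have "\<forall>\<^sub>F n in sequentially. (LINT z:S|lborel. (u n z)\<^sup>2) < 4 * t * (e / 2)"
    using l e t by (intro order_tendstoD(2)) auto
  then obtain N where N: "\<And>n. n \<ge> N \<Longrightarrow> (LINT z:S|lborel. (u n z)\<^sup>2) < 4 * t * (e / 2)"
    by (auto simp: eventually_sequentially)
  show "\<exists>no. \<forall>n\<ge>no. norm ((LINT z:S|lborel. u n z * w z) - 0) < e"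
  proof (intro exI allI impI)
    fix n assume n: "n \<ge> N"
    have le: "u n z * w z \<le> t * (w z)\<^sup>2 + 1 / (4 * t) * (u n z)\<^sup>2" for z
    proof -
      have "0 \<le> (2 * t * w z - u n z)\<^sup>2 / (4 * t)" using t by simp
      also have "\<dots> = t * (w z)\<^sup>2 + 1 / (4 * t) * (u n z)\<^sup>2 - u n z * w z"
        using t by (simp add: field_simps power2_eq_square)
      finally show ?thesis by simp
    qed
    have "(LINT z:S|lborel. u n z * w z) \<le> (LINT z:S|lborel. t * (w z)\<^sup>2 + 1 / (4 * t) * (u n z)\<^sup>2)"
      by (rule set_integral_mono[OF ui set_integral_add(1)[OF set_integrable_mult_right set_integrable_mult_right] le])
         (use i in auto)
    also have "\<dots> = t * W + 1 / (4 * t) * (LINT z:S|lborel. (u n z)\<^sup>2)"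
      using i by (subst set_integral_add(2)) (auto simp: W_def)
    also have "\<dots> < e / 2 + 1 / (4 * t) * (4 * t * (e / 2))"
      using tW N[OF n] t by (intro add_le_less_mono mult_strict_left_mono) auto
    also have "\<dots> = e" using t by simp
    finally have "(LINT z:S|lborel. u n z * w z) < e" .
    moreover have "(LINT z:S|lborel. u n z * w z) \<ge> 0"
      unfolding set_lebesgue_integral_def using nn by (intro integral_nonneg_AE AE_I2) auto
    ultimately show "norm ((LINT z:S|lborel. u n z * w z) - 0) < e" by simp
  qed
qed

lemma AE_Im_nonzero: "AE z in lborel. Im z \<noteq> 0"
proof -
  have "negligible {z::complex. z \<bullet> \<i> = 0}"
    by (rule negligible_standard_hyperplane) (simp add: Basis_complex_def)
  then have "{z::complex. Im z = 0} \<in> null_sets lebesgue" by (simp add: negligible_iff_null_sets inner_complex_def)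
  then have "AE z in lebesgue. z \<notin> {z::complex. Im z = 0}" by (rule AE_not_in)
  then show ?thesis by (simp add: AE_completion_iff)
qed

text \<open>The left-hand side is the squared norm of the derivative of \<open>g\<close> applied to the
  vector \<open>s + i t\<close>. In terms of the complex derivatives \<open>a\<close> and
  \<open>b\<close> it is at most \<open>(|a| + |b|)\<^sup>2\<close> times the squared length, the
  Jacobian is \<open>|a|\<^sup>2 - |b|\<^sup>2\<close>, and the hypothesis is
  \<open>|a| + |b| \<le> K (|a| - |b|)\<close>.\<close>

lemma distortion_algebra:
  fixes p q :: complex
  assumes K: "K \<ge> 1" and b: "norm ((p + \<i> * q) / 2) \<le> (K - 1) / (K + 1) * norm ((p - \<i> * q) / 2)"
  shows "(norm (of_real s * p + of_real t * q))\<^sup>2 \<le> K * (s\<^sup>2 + t\<^sup>2) * Im (cnj p * q)"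
proof -
  define a where "a = (p - \<i> * q) / 2"
  define b where "b = (p + \<i> * q) / 2"
  have p: "p = a + b" and q: "q = \<i> * (a - b)" by (simp_all add: a_def b_def field_simps)
  have J: "Im (cnj p * q) = (norm a)\<^sup>2 - (norm b)\<^sup>2"
    unfolding cmod_power2 p q by (simp add: power2_eq_square algebra_simps)
  have "(K + 1) * norm b \<le> (K - 1) * norm a"
    using assms by (simp add: a_def b_def field_simps)
  then have ab: "norm a + norm b \<le> K * (norm a - norm b)" by (simp add: algebra_simps)
  have "of_real s * p + of_real t * q = a * Complex s t + b * Complex s (-t)"
    unfolding p q by (simp add: complex_eq_iff algebra_simps)
  then have "norm (of_real s * p + of_real t * q) \<le> norm a * norm (Complex s t) + norm b * norm (Complex s (-t))"
    by (metis norm_mult norm_triangle_ineq)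
  also have "\<dots> = (norm a + norm b) * sqrt (s\<^sup>2 + t\<^sup>2)" by (simp add: complex_norm algebra_simps)
  finally have "(norm (of_real s * p + of_real t * q))\<^sup>2 \<le> ((norm a + norm b) * sqrt (s\<^sup>2 + t\<^sup>2))\<^sup>2"
    by (intro power_mono) auto
  also have "\<dots> = (norm a + norm b) * (norm a + norm b) * (s\<^sup>2 + t\<^sup>2)"
    by (simp add: power_mult_distrib power2_eq_square)
  also have "\<dots> \<le> (norm a + norm b) * (K * (norm a - norm b)) * (s\<^sup>2 + t\<^sup>2)"
    using ab by (intro mult_right_mono mult_left_mono) auto
  also have "\<dots> = K * (s\<^sup>2 + t\<^sup>2) * Im (cnj p * q)" unfolding J by (simp add: power2_eq_square algebra_simps)
  finally show ?thesis .
qed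

lemma borel_version:
  fixes w :: "complex \<Rightarrow> complex"
  assumes "w \<in> borel_measurable lebesgue"
  obtains w' where "w' \<in> borel_measurable borel" "AE z in lebesgue. w z = w' z"
proof -
  have "(\<lambda>z. Re (w z)) \<in> borel_measurable (completion lborel)" "(\<lambda>z. Im (w z)) \<in> borel_measurable (completion lborel)"
    using assms by measurable
  from this[THEN completion_ex_borel_measurable_real]
  obtain u v where u: "u \<in> borel_measurable lborel" "AE z in lborel. Re (w z) = u z"
    and v: "v \<in> borel_measurable lborel" "AE z in lborel. Im (w z) = v z" by blast
  show thesis
  proof (rule that[of "\<lambda>z. Complex (u z) (v z)"])
    show "(\<lambda>z. Complex (u z) (v z)) \<in> borel_measurable borel" using u(1) v(1) by simp
    have "AE z in lborel. w z = Complex (u z) (v z)"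
      using u(2) v(2) by eventually_elim (simp add: complex_eq_iff)
    then show "AE z in lebesgue. w z = Complex (u z) (v z)" by (rule AE_completion)
  qed
qed

lemma test_function_cont:
  assumes "test_function_on D \<phi>"
  shows "continuous_on UNIV \<phi>" "continuous_on UNIV (dir_deriv v \<phi>)"
proof -
  have "Ck_on 0 \<phi> UNIV" "Ck_on 1 \<phi> UNIV" using assms by (auto simp: test_function_on_def)
  then show "continuous_on UNIV \<phi>" "continuous_on UNIV (dir_deriv v \<phi>)" by auto
qed

text \<open>A quasiconformal map normalised by \<open>G 0 = 0\<close>, Borel versions \<open>p\<close>,
  \<open>q\<close> of its partial derivatives, and an approximating sequence of smooth maps.
  Quasiconformality enters only through \<open>dist\<close>, the inequality between directional
  derivatives and the Jacobian, and conformality through \<open>distH\<close>, the same inequality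
  without the factor \<open>K\<close>.\<close>

locale qc_data =
  fixes K :: real and G h p q :: "complex \<Rightarrow> complex" and f fx fy fxy :: "nat \<Rightarrow> complex \<Rightarrow> complex"
  assumes K: "K \<ge> 1" and homeo: "homeomorphism UNIV UNIV G h" and G0: "G 0 = 0"
    and pm [measurable]: "p \<in> borel_measurable borel" and qm [measurable]: "q \<in> borel_measurable borel"
    and p2: "\<And>R. set_integrable lborel (cball 0 R) (\<lambda>z. (norm (p z))\<^sup>2)"
    and q2: "\<And>R. set_integrable lborel (cball 0 R) (\<lambda>z. (norm (q z))\<^sup>2)"
    and c2: "\<And>n. c2map (f n) (fx n) (fy n) (fxy n)"
    and unif: "\<And>R. uniform_limit (cball 0 R) f G sequentially"
    and xi: "\<And>R n. set_integrable lborel (cball 0 R) (\<lambda>z. (norm (fx n z - p z))\<^sup>2)"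
    and xl: "\<And>R. (\<lambda>n. LINT z:cball 0 R|lborel. (norm (fx n z - p z))\<^sup>2) \<longlonglongrightarrow> 0"
    and yi: "\<And>R n. set_integrable lborel (cball 0 R) (\<lambda>z. (norm (fy n z - q z))\<^sup>2)"
    and yl: "\<And>R. (\<lambda>n. LINT z:cball 0 R|lborel. (norm (fy n z - q z))\<^sup>2) \<longlonglongrightarrow> 0"
    and dist: "AE z in lborel. \<forall>s t. (norm (of_real s * p z + of_real t * q z))\<^sup>2
        \<le> K * (s\<^sup>2 + t\<^sup>2) * Im (cnj (p z) * q z)"
    and distH: "AE z in lborel. Im z > 0 \<longrightarrow> (\<forall>s t. (norm (of_real s * p z + of_real t * q z))\<^sup>2
        \<le> (s\<^sup>2 + t\<^sup>2) * Im (cnj (p z) * q z))"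

text \<open>The Cauchy-Riemann equation passes to the limit in \<open>L2\<close> on every compact subset of
  the half-plane; countably many of these exhaust it.\<close>

lemma Cauchy_Riemann_limit:
  fixes p q :: "complex \<Rightarrow> complex"
  assumes [measurable]: "p \<in> borel_measurable borel" "q \<in> borel_measurable borel"
    and xi: "\<And>R n. set_integrable lborel (cball 0 R) (\<lambda>z. (norm (fx n z - p z))\<^sup>2)"
    and xl: "\<And>R. (\<lambda>n. LINT z:cball 0 R|lborel. (norm (fx n z - p z))\<^sup>2) \<longlonglongrightarrow> 0"
    and yi: "\<And>R n. set_integrable lborel (cball 0 R) (\<lambda>z. (norm (fy n z - q z))\<^sup>2)"
    and yl: "\<And>R. (\<lambda>n. LINT z:cball 0 R|lborel. (norm (fy n z - q z))\<^sup>2) \<longlonglongrightarrow> 0"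
    and cr: "\<And>n z. Im z > 1 / real (Suc n) \<Longrightarrow> fx n z + \<i> * fy n z = 0"
  shows "AE z in lborel. Im z > 0 \<longrightarrow> p z + \<i> * q z = 0"
proof -
  have *: "AE z in lborel. norm z \<le> real m \<and> Im z > 1 / real (Suc m) \<longrightarrow> p z + \<i> * q z = 0" for m
  proof -
    define I where "I z = indicat_real (cball 0 (real m) \<inter> {z. Im z > 1 / real (Suc m)}) z * (norm (p z + \<i> * q z))\<^sup>2" for z
    have [measurable]: "{z. Im z > 1 / real (Suc m)} \<in> sets borel"
      by (rule borel_open[OF open_halfspace_Im_gt])
    have Im: "I \<in> borel_measurable borel" unfolding I_def
      by (intro borel_measurable_times borel_measurable_indicator borel_measurable_power borel_measurable_norm
          borel_measurable_add borel_measurable_const sets.Int assms(1,2)) auto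
    define b where "b n = 2 * (LINT z:cball 0 (real m)|lborel. (norm (fx n z - p z))\<^sup>2)
        + 2 * (LINT z:cball 0 (real m)|lborel. (norm (fy n z - q z))\<^sup>2)" for n
    have bl: "b \<longlonglongrightarrow> 0"
      unfolding b_def using tendsto_add[OF tendsto_mult_right_zero[OF xl] tendsto_mult_right_zero[OF yl]] by simp
    define D where "D n z = 2 * (indicat_real (cball 0 (real m)) z *\<^sub>R (norm (fx n z - p z))\<^sup>2)
        + 2 * (indicat_real (cball 0 (real m)) z *\<^sub>R (norm (fy n z - q z))\<^sup>2)" for n z
    have Di: "integrable lborel (D n)" for n
      unfolding D_def using xi yi by (auto simp: set_integrable_def)
    have DI: "integral\<^sup>L lborel (D n) = b n" for n
      unfolding D_def b_def using xi[of "real m" n] yi[of "real m" n]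
      by (simp add: set_integrable_def set_lebesgue_integral_def)
    have le: "I z \<le> D n z" if n: "n \<ge> m" for n z
    proof (cases "norm z \<le> real m \<and> Im z > 1 / real (Suc m)")
      case True
      have "1 / real (Suc n) \<le> 1 / real (Suc m)" using n by (simp add: field_simps)
      then have "fx n z + \<i> * fy n z = 0" using True by (intro cr) linarith
      then have e: "p z + \<i> * q z = (p z - fx n z) + \<i> * (q z - fy n z)" by (simp add: algebra_simps)
      have "(norm (p z + \<i> * q z))\<^sup>2 \<le> 2 * (norm (p z - fx n z))\<^sup>2 + 2 * (norm (\<i> * (q z - fy n z)))\<^sup>2"
        unfolding e by (rule norm_sq_add2)
      then have "(norm (p z + \<i> * q z))\<^sup>2 \<le> 2 * (norm (fx n z - p z))\<^sup>2 + 2 * (norm (fy n z - q z))\<^sup>2"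
        by (simp add: norm_mult norm_minus_commute)
      then show ?thesis using True by (simp add: I_def D_def)
    qed (auto simp: I_def D_def)
    have I0: "I z \<ge> 0" for z by (simp add: I_def)
    have Ii: "integrable lborel I"
      by (rule Bochner_Integration.integrable_bound[OF Di[of m]])
         (use Im I0 le[of m] in \<open>auto intro!: AE_I2 order_trans[OF _ abs_ge_self]\<close>)
    have "integral\<^sup>L lborel I \<le> 0"
    proof (rule LIMSEQ_le_const[OF bl])
      show "\<exists>N. \<forall>n\<ge>N. integral\<^sup>L lborel I \<le> b n"
        unfolding DI[symmetric] using le by (intro exI[of _ m] allI impI integral_mono Ii Di) auto
    qed
    moreover have "integral\<^sup>L lborel I \<ge> 0" by (intro integral_nonneg_AE AE_I2 I0)
    ultimately have "integral\<^sup>L lborel I = 0" by simp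
    then have "AE z in lborel. I z = 0" using integral_nonneg_eq_0_iff_AE[OF Ii] I0 by auto
    then show ?thesis by eventually_elim (auto simp: I_def)
  qed
  have "AE z in lborel. \<forall>m. norm z \<le> real m \<and> Im z > 1 / real (Suc m) \<longrightarrow> p z + \<i> * q z = 0"
    by (subst AE_all_countable) (intro allI *)
  then show ?thesis
  proof eventually_elim
    fix z :: complex
    assume a: "\<forall>m. norm z \<le> real m \<and> 1 / real (Suc m) < Im z \<longrightarrow> p z + \<i> * q z = 0"
    show "0 < Im z \<longrightarrow> p z + \<i> * q z = 0"
    proof
      assume im: "0 < Im z"
      obtain m where m: "real m > max (norm z) (1 / Im z)" using reals_Archimedean2 by blast
      then have "1 / Im z < real (Suc m)" by simp
      then have "1 / real (Suc m) < Im z" using im by (simp add: field_simps)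
      then show "p z + \<i> * q z = 0" using a m by auto
    qed
  qed
qed

lemma qc_data_exists:
  assumes K: "K \<ge> 1" and g: "g \<in> qc_conformal_maps K"
  shows "\<exists>h p q f fx fy fxy. qc_data K (\<lambda>z. g z - g 0) h p q f fx fy fxy"
proof -
  obtain h0 gx gy where hm: "homeomorphism UNIV UNIV g h0"
    and l2: "locally_square_integrable_on gx UNIV" "locally_square_integrable_on gy UNIV"
    and Dx: "distr_deriv_on UNIV 1 g gx" and Dy: "distr_deriv_on UNIV \<i> g gy"
    and ae: "AE z in lebesgue. norm ((gx z + \<i> * gy z) / 2) \<le> (K - 1) / (K + 1) * norm ((gx z - \<i> * gy z) / 2)"
    and cf: "conformal_on g upper_half_plane"
    using g by (auto simp: qc_conformal_maps_def quasiconformal_def)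
  have hol: "g holomorphic_on {z. Im z > 0}" using cf by (simp add: conformal_on_def upper_half_plane_def)
  have gc: "continuous_on UNIV g" using hm by (simp add: homeomorphism_def)
  have [measurable]: "g \<in> borel_measurable borel" using gc by (rule borel_measurable_continuous_onI)
  have "gx \<in> borel_measurable lebesgue" "gy \<in> borel_measurable lebesgue"
    using l2 by (auto simp: locally_square_integrable_on_def set_borel_measurable_def)
  then obtain p q where pm [measurable]: "p \<in> borel_measurable borel" and pae: "AE z in lebesgue. gx z = p z"
    and qm [measurable]: "q \<in> borel_measurable borel" and qae: "AE z in lebesgue. gy z = q z"
    using borel_version by metis
  have sqi: "set_integrable lborel (cball 0 R) (\<lambda>z. (norm (w' z))\<^sup>2)"
    if [measurable]: "w' \<in> borel_measurable borel" and ae: "AE z in lebesgue. w z = w' z"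
      and l: "locally_square_integrable_on w UNIV" for R and w w' :: "complex \<Rightarrow> complex"
  proof -
    have m: "(\<lambda>z. indicat_real (cball 0 R) z *\<^sub>R (norm (w' z))\<^sup>2) \<in> borel_measurable lborel"
      using that(1) by (intro borel_measurable_scaleR borel_measurable_indicator borel_measurable_power borel_measurable_norm) auto
    have i: "integrable lebesgue (\<lambda>z. indicat_real (cball 0 R) z *\<^sub>R (norm (w z))\<^sup>2)"
      using l by (auto simp: locally_square_integrable_on_def set_integrable_def)
    have "integrable lebesgue (\<lambda>z. indicat_real (cball 0 R) z *\<^sub>R (norm (w' z))\<^sup>2)"
      by (rule integrable_cong_AE_imp[OF i measurable_completion[OF m]]) (use ae in eventually_elim, simp)
    then show ?thesis using integrable_completion[OF m] by (simp add: set_integrable_def)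
  qed
  have p2: "set_integrable lborel (cball 0 R) (\<lambda>z. (norm (p z))\<^sup>2)" for R by (rule sqi[OF pm pae l2(1)])
  have q2: "set_integrable lborel (cball 0 R) (\<lambda>z. (norm (q z))\<^sup>2)" for R by (rule sqi[OF qm qae l2(2)])
  have DD: "(LINT z|lborel. dir_deriv v \<phi> z *\<^sub>R g z) = - (LINT z|lborel. \<phi> z *\<^sub>R w' z)"
    if D: "distr_deriv_on UNIV v g w" and [measurable]: "w' \<in> borel_measurable borel" and ae: "AE z in lebesgue. w z = w' z"
      and wm [measurable]: "w \<in> borel_measurable lebesgue" and t: "test_function_on UNIV \<phi>" for v \<phi> w w'
  proof -
    have [measurable]: "\<phi> \<in> borel_measurable borel" "dir_deriv v \<phi> \<in> borel_measurable borel"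
      using test_function_cont[OF t] by (auto intro: borel_measurable_continuous_onI)
    have m1: "(\<lambda>z. dir_deriv v \<phi> z *\<^sub>R g z) \<in> borel_measurable lborel" and m2: "(\<lambda>z. \<phi> z *\<^sub>R w' z) \<in> borel_measurable lborel"
      by measurable
    have m\<phi>: "\<phi> \<in> borel_measurable lebesgue" by (rule measurable_completion) simp
    have "(LINT z|lborel. dir_deriv v \<phi> z *\<^sub>R g z) = (LINT z|lebesgue. dir_deriv v \<phi> z *\<^sub>R g z)"
      by (rule integral_completion[OF m1, symmetric])
    also have "\<dots> = - (LINT z|lebesgue. \<phi> z *\<^sub>R w z)"
      using D t by (simp add: distr_deriv_on_def set_lebesgue_integral_def)
    also have "(LINT z|lebesgue. \<phi> z *\<^sub>R w z) = (LINT z|lebesgue. \<phi> z *\<^sub>R w' z)"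
      by (rule integral_cong_AE) (use m\<phi> wm measurable_completion[OF m2] ae in auto)
    also have "\<dots> = (LINT z|lborel. \<phi> z *\<^sub>R w' z)" by (rule integral_completion[OF m2])
    finally show ?thesis .
  qed
  have gxm: "gx \<in> borel_measurable lebesgue" and gym: "gy \<in> borel_measurable lebesgue"
    using l2 by (auto simp: locally_square_integrable_on_def set_borel_measurable_def)
  obtain f fx fy fxy where F:
    "\<And>n. continuous_on UNIV (f n)" "\<And>n. continuous_on UNIV (fx n)" "\<And>n. continuous_on UNIV (fy n)"
    "\<And>n. continuous_on UNIV (fxy n)"
    "\<And>n x y. ((\<lambda>s. f n (Complex s y)) has_vector_derivative fx n (Complex x y)) (at x)"
    "\<And>n x y. ((\<lambda>s. f n (Complex x s)) has_vector_derivative fy n (Complex x y)) (at y)"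
    "\<And>n x y. ((\<lambda>s. fy n (Complex s y)) has_vector_derivative fxy n (Complex x y)) (at x)"
    "\<And>n x y. ((\<lambda>s. fx n (Complex x s)) has_vector_derivative fxy n (Complex x y)) (at y)"
    "\<And>R. uniform_limit (cball 0 R) f g sequentially"
    "\<And>R n. set_integrable lborel (cball 0 R) (\<lambda>z. (norm (fx n z - p z))\<^sup>2)"
    "\<And>R. (\<lambda>n. LINT z:cball 0 R|lborel. (norm (fx n z - p z))\<^sup>2) \<longlonglongrightarrow> 0"
    "\<And>R n. set_integrable lborel (cball 0 R) (\<lambda>z. (norm (fy n z - q z))\<^sup>2)"
    "\<And>R. (\<lambda>n. LINT z:cball 0 R|lborel. (norm (fy n z - q z))\<^sup>2) \<longlonglongrightarrow> 0"
    "\<And>n z. Im z > 1 / real (Suc n) \<Longrightarrow> fx n z + \<i> * fy n z = 0"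
    using smooth_approximation[OF gc pm qm p2 q2 DD[OF Dx pm pae gxm] DD[OF Dy qm qae gym] hol] by blast
  have aepq: "AE z in lborel. norm ((p z + \<i> * q z) / 2) \<le> (K - 1) / (K + 1) * norm ((p z - \<i> * q z) / 2)"
  proof -
    have "AE z in lebesgue. norm ((p z + \<i> * q z) / 2) \<le> (K - 1) / (K + 1) * norm ((p z - \<i> * q z) / 2)"
      using ae pae qae by eventually_elim simp
    then show ?thesis by (simp only: AE_completion_iff)
  qed
  have crH: "AE z in lborel. Im z > 0 \<longrightarrow> p z + \<i> * q z = 0"
    by (rule Cauchy_Riemann_limit[OF pm qm F(10-14)])
  define h where "h w = h0 (w + g 0)" for w
  have c2: "c2map (\<lambda>z. f n z - g 0) (fx n) (fy n) (fxy n)" for n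
  proof (rule c2map.intro)
    show "continuous_on UNIV (\<lambda>z. f n z - g 0)" by (intro continuous_on_diff F(1) continuous_on_const)
    fix x y
    show "((\<lambda>s. f n (Complex s y) - g 0) has_vector_derivative fx n (Complex x y)) (at x)"
      using has_vector_derivative_diff[OF F(5)[of n y x] has_vector_derivative_const[of "g 0"]] by simp
    show "((\<lambda>s. f n (Complex x s) - g 0) has_vector_derivative fy n (Complex x y)) (at y)"
      using has_vector_derivative_diff[OF F(6)[of n x y] has_vector_derivative_const[of "g 0"]] by simp
  qed (rule F)+
  have hm': "homeomorphism UNIV UNIV (\<lambda>z. g z - g 0) h"
  proof -
    have h0: "continuous_on UNIV h0" "\<And>z. h0 (g z) = z" "\<And>z. g (h0 z) = z"
      using hm by (auto simp: homeomorphism_def)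
    have "continuous_on UNIV (\<lambda>w. w + g 0)" by (intro continuous_intros)
    then have "continuous_on UNIV h" unfolding h_def by (rule continuous_on_compose2[OF h0(1)]) simp
    moreover have "continuous_on UNIV (\<lambda>z. g z - g 0)" by (intro continuous_on_diff gc continuous_on_const)
    ultimately show ?thesis by (intro homeomorphismI) (auto simp: h_def h0)
  qed
  have unif: "uniform_limit (cball 0 R) (\<lambda>n z. f n z - g 0) (\<lambda>z. g z - g 0) sequentially" for R
    by (rule uniform_limit_minus[OF F(9) uniform_limit_const])
  have d: "AE z in lborel. \<forall>s t. (norm (of_real s * p z + of_real t * q z))\<^sup>2
      \<le> K * (s\<^sup>2 + t\<^sup>2) * Im (cnj (p z) * q z)"
    using aepq
  proof eventually_elim
    case (elim z)
    then show ?case using distortion_algebra[OF K] by blast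
  qed
  have dH: "AE z in lborel. Im z > 0 \<longrightarrow> (\<forall>s t. (norm (of_real s * p z + of_real t * q z))\<^sup>2
        \<le> (s\<^sup>2 + t\<^sup>2) * Im (cnj (p z) * q z))"
    using crH
  proof eventually_elim
    case (elim z)
    show ?case
    proof (intro impI allI)
      fix s t assume "0 < Im z"
      then have "norm ((p z + \<i> * q z) / 2) \<le> (1 - 1) / (1 + 1) * norm ((p z - \<i> * q z) / 2)" using elim by simp
      from distortion_algebra[OF order_refl this, of s t]
      show "(norm (of_real s * p z + of_real t * q z))\<^sup>2 \<le> (s\<^sup>2 + t\<^sup>2) * Im (cnj (p z) * q z)" by simp
    qed
  qed
  have "qc_data K (\<lambda>z. g z - g 0) h p q (\<lambda>n z. f n z - g 0) fx fy fxy"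
    by (rule qc_data.intro[OF K hm' _ pm qm p2 q2 c2 unif F(10-13) d dH]) simp
  then show ?thesis by blast
qed

section \<open>The length-area identities for quasiconformal maps\<close>

lemma sq_sub_cball: "sq R \<subseteq> cball 0 (2 * R)"
proof
  fix z assume "z \<in> sq R"
  then show "z \<in> cball 0 (2 * R)" using cmod_le[of z] by (auto simp: in_sq)
qed

lemma set_LINT_Im:
  assumes "set_integrable lborel S (X :: complex \<Rightarrow> complex)"
  shows "(LINT z:S|lborel. Im (X z)) = Im (LINT z:S|lborel. X z)"
    "(LINT z:S|lborel. Re (X z)) = Re (LINT z:S|lborel. X z)"
    "set_integrable lborel S (\<lambda>z. Im (X z))" "set_integrable lborel S (\<lambda>z. Re (X z))"
  using integral_Im[OF assms[unfolded set_integrable_def]] integral_Re[OF assms[unfolded set_integrable_def]]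
    integrable_Im[OF assms[unfolded set_integrable_def]] integrable_Re[OF assms[unfolded set_integrable_def]]
  by (simp_all add: set_lebesgue_integral_def set_integrable_def)

lemma L1_subset:
  fixes k :: "nat \<Rightarrow> complex \<Rightarrow> real"
  assumes S: "S \<in> sets borel" "S \<subseteq> cball 0 R" and i: "\<And>n. set_integrable lborel (cball 0 R) (k n)"
    and nn: "\<And>n z. k n z \<ge> 0" and l: "(\<lambda>n. LINT z:cball 0 R|lborel. k n z) \<longlonglongrightarrow> 0"
  shows "(\<lambda>n. LINT z:S|lborel. k n z) \<longlonglongrightarrow> 0"
proof (rule tendsto_sandwich[OF _ _ tendsto_const l])
  show "\<forall>\<^sub>F n in sequentially. 0 \<le> (LINT z:S|lborel. k n z)"
    unfolding set_lebesgue_integral_def using nn by (auto intro!: always_eventually integral_nonneg_AE)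
  show "\<forall>\<^sub>F n in sequentially. (LINT z:S|lborel. k n z) \<le> (LINT z:cball 0 R|lborel. k n z)"
  proof (rule always_eventually, rule allI)
    fix n
    have iS: "set_integrable lborel S (k n)" by (rule set_integrable_subset[OF i]) (use S in auto)
    show "(LINT z:S|lborel. k n z) \<le> (LINT z:cball 0 R|lborel. k n z)"
      unfolding set_lebesgue_integral_def
      by (rule integral_mono[OF iS[unfolded set_integrable_def] i[unfolded set_integrable_def]])
         (use S nn in \<open>auto simp: indicator_def\<close>)
  qed
qed

lemma set_integrable_of_square:
  fixes w :: "complex \<Rightarrow> complex"
  assumes [measurable]: "w \<in> borel_measurable borel" and i: "set_integrable lborel (cball 0 R) (\<lambda>z. (norm (w z))\<^sup>2)"
  shows "set_integrable lborel (cball 0 R) w"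
  unfolding set_integrable_def
proof (rule L2_bounded_support_integrable[where R = R])
  show "(\<lambda>z. indicat_real (cball 0 R) z *\<^sub>R w z) \<in> borel_measurable borel"
    by (intro borel_measurable_scaleR borel_measurable_indicator assms(1)) auto
  have "(\<lambda>z. (norm (indicat_real (cball 0 R) z *\<^sub>R w z))\<^sup>2) = (\<lambda>z. indicat_real (cball 0 R) z *\<^sub>R (norm (w z))\<^sup>2)"
    by (auto simp: indicator_def)
  then show "integrable lborel (\<lambda>z. (norm (indicat_real (cball 0 R) z *\<^sub>R w z))\<^sup>2)"
    using i by (simp add: set_integrable_def)
qed auto

lemma set_integrable_product:
  fixes u w :: "complex \<Rightarrow> complex"
  assumes m: "u \<in> borel_measurable borel" "w \<in> borel_measurable borel"
    and i: "set_integrable lborel (cball 0 R) (\<lambda>z. (norm (u z))\<^sup>2)" "set_integrable lborel (cball 0 R) (\<lambda>z. (norm (w z))\<^sup>2)"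
  shows "set_integrable lborel (cball 0 R) (\<lambda>z. norm (u z) * norm (w z))"
  unfolding set_integrable_def
proof (rule Bochner_Integration.integrable_bound[OF set_integral_add(1)[OF i, unfolded set_integrable_def]])
  show "(\<lambda>z. indicat_real (cball 0 R) z *\<^sub>R (norm (u z) * norm (w z))) \<in> borel_measurable lborel"
    using m by (intro borel_measurable_scaleR borel_measurable_indicator borel_measurable_times borel_measurable_norm) auto
  have "x * y \<le> x\<^sup>2 + y\<^sup>2" if "x \<ge> 0" "y \<ge> 0" for x y :: real
    using zero_le_power2[of "x - y"] mult_nonneg_nonneg[OF that] unfolding power2_diff by linarith
  then show "AE z in lborel. norm (indicat_real (cball 0 R) z *\<^sub>R (norm (u z) * norm (w z)))
      \<le> norm (indicat_real (cball 0 R) z *\<^sub>R ((norm (u z))\<^sup>2 + (norm (w z))\<^sup>2))"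
    by (auto intro!: AE_I2 mult_left_mono)
qed

context qc_data
begin

lemma Gc: "continuous_on S G" and hc: "continuous_on S h" and hG: "h (G z) = z" and Gh: "G (h z) = z"
  using homeo continuous_on_subset by (auto simp: homeomorphism_def)

lemma G_eq_0: "G z = 0 \<longleftrightarrow> z = 0"
  using hG G0 by metis

lemma Gm [measurable]: "G \<in> borel_measurable borel"
  using Gc by (rule borel_measurable_continuous_onI)

lemma fcont: "continuous_on S (f n)" "continuous_on S (fx n)" "continuous_on S (fy n)"
  using c2map.cf[OF c2] continuous_on_subset by blast+

lemma fmeas [measurable]: "f n \<in> borel_measurable borel" "fx n \<in> borel_measurable borel" "fy n \<in> borel_measurable borel"
  using fcont by (auto intro: borel_measurable_continuous_onI)

lemma f_pointwise: "(\<lambda>n. f n z) \<longlonglongrightarrow> G z"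
  using tendsto_uniform_limitI[OF unif[of "norm z"]] by simp

lemma f_close:
  assumes "e > 0" shows "\<forall>\<^sub>F n in sequentially. \<forall>z\<in>sq R. norm (f n z - G z) < e"
  using uniform_limitD[OF unif[of "2 * R"] assms]
  by eventually_elim (use sq_sub_cball in \<open>force simp: dist_norm\<close>)

text \<open>The Jacobian determinants of \<open>G\<close> and of its approximations.\<close>

definition J :: "complex \<Rightarrow> real" where "J z = Im (cnj (p z) * q z)"
definition Jn :: "nat \<Rightarrow> complex \<Rightarrow> real" where "Jn n z = Im (cnj (fx n z) * fy n z)"

lemma J_meas [measurable]: "J \<in> borel_measurable borel"
proof -
  have "J = (\<lambda>z. Re (p z) * Im (q z) - Im (p z) * Re (q z))" by (auto simp: J_def)
  then show ?thesis using pm qm by simp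
qed

lemma J_nonneg: "AE z in lborel. J z \<ge> 0"
  using dist
proof eventually_elim
  case (elim z)
  then have "(norm (p z))\<^sup>2 \<le> K * J z" using spec[OF spec[OF elim, of 1], of 0] by (simp add: J_def)
  then have "0 \<le> K * J z" using zero_le_power2 order_trans by blast
  then show ?case using K by (simp add: zero_le_mult_iff)
qed

lemma L1x: "(\<lambda>n. LINT z:cball 0 R|lborel. norm (fx n z - p z)) \<longlonglongrightarrow> 0"
  and L1y: "(\<lambda>n. LINT z:cball 0 R|lborel. norm (fy n z - q z)) \<longlonglongrightarrow> 0"
proof -
  have 1: "set_integrable lborel (cball 0 R) (\<lambda>z::complex. (1::real)\<^sup>2)"
    unfolding set_integrable_def by (rule borel_integrable_compact) auto
  have ix: "set_integrable lborel (cball 0 R) (\<lambda>z. norm (fx n z - p z) * 1)" for n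
    using set_integrable_norm[OF set_integrable_of_square[OF _ xi]] by simp
  have iy: "set_integrable lborel (cball 0 R) (\<lambda>z. norm (fy n z - q z) * 1)" for n
    using set_integrable_norm[OF set_integrable_of_square[OF _ yi]] by simp
  show "(\<lambda>n. LINT z:cball 0 R|lborel. norm (fx n z - p z)) \<longlonglongrightarrow> 0"
    using L2_mult_small[OF xi 1 xl _ _ ix] by simp
  show "(\<lambda>n. LINT z:cball 0 R|lborel. norm (fy n z - q z)) \<longlonglongrightarrow> 0"
    using L2_mult_small[OF yi 1 yl _ _ iy] by simp
qed

lemma J_int: "set_integrable lborel (cball 0 R) J"
  unfolding set_integrable_def
proof (rule Bochner_Integration.integrable_bound[OF set_integrable_product[OF pm qm p2 q2, unfolded set_integrable_def]])
  show "(\<lambda>z. indicat_real (cball 0 R) z *\<^sub>R J z) \<in> borel_measurable lborel"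
    by (intro borel_measurable_scaleR borel_measurable_indicator) auto
  have "\<bar>J z\<bar> \<le> norm (p z) * norm (q z)" for z
    using abs_Im_le_cmod[of "cnj (p z) * q z"] by (simp add: J_def norm_mult)
  then show "AE z in lborel. norm (indicat_real (cball 0 R) z *\<^sub>R J z)
      \<le> norm (indicat_real (cball 0 R) z *\<^sub>R (norm (p z) * norm (q z)))"
    by (intro AE_I2) (auto simp: indicator_def)
qed

lemma Jn_int: "set_integrable lborel (cball 0 R) (Jn n)"
  unfolding set_integrable_def Jn_def
  by (rule borel_integrable_compact) (auto intro!: continuous_intros fcont)

text \<open>The Jacobian is quadratic in the derivatives, so convergence in \<open>L2\<close> of the
  derivatives gives convergence in \<open>L1\<close> of the Jacobians. This is the reason for
  requiring square integrability.\<close>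

lemma L1J: "(\<lambda>n. LINT z:cball 0 R|lborel. norm (Jn n z - J z)) \<longlonglongrightarrow> 0"
proof -
  define u where "u n z = norm (fx n z - p z) * norm (q z)" for n z
  define v where "v n z = norm (fy n z - q z) * norm (p z)" for n z
  define w where "w n z = (norm (fx n z - p z))\<^sup>2 + (norm (fy n z - q z))\<^sup>2" for n z
  have ui: "set_integrable lborel (cball 0 R) (u n)" for n
    unfolding u_def by (rule set_integrable_product[OF _ _ xi q2]) auto
  have vi: "set_integrable lborel (cball 0 R) (v n)" for n
    unfolding v_def by (rule set_integrable_product[OF _ _ yi p2]) auto
  have wi: "set_integrable lborel (cball 0 R) (w n)" for n
    unfolding w_def by (intro set_integral_add xi yi)
  have ul: "(\<lambda>n. LINT z:cball 0 R|lborel. u n z) \<longlonglongrightarrow> 0"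
    using L2_mult_small[OF xi q2 xl _ _ ui[unfolded u_def]] by (simp add: u_def)
  have vl: "(\<lambda>n. LINT z:cball 0 R|lborel. v n z) \<longlonglongrightarrow> 0"
    using L2_mult_small[OF yi p2 yl _ _ vi[unfolded v_def]] by (simp add: v_def)
  have wl: "(\<lambda>n. LINT z:cball 0 R|lborel. w n z) \<longlonglongrightarrow> 0"
    using tendsto_add[OF xl yl] unfolding w_def by (subst set_integral_add(2)[OF xi yi]) simp
  have tot: "(\<lambda>n. LINT z:cball 0 R|lborel. u n z + v n z + w n z) \<longlonglongrightarrow> 0"
    using tendsto_add[OF tendsto_add[OF ul vl] wl]
    by (subst set_integral_add(2)[OF set_integral_add(1)[OF ui vi] wi], subst set_integral_add(2)[OF ui vi]) simp
  have ti: "set_integrable lborel (cball 0 R) (\<lambda>z. u n z + v n z + w n z)" for n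
    by (intro set_integral_add ui vi wi)
  have le: "norm (Jn n z - J z) \<le> u n z + v n z + w n z" for n z
  proof -
    have "Jn n z - J z = Im (cnj (fx n z - p z) * q z + cnj (p z) * (fy n z - q z) + cnj (fx n z - p z) * (fy n z - q z))"
      by (simp add: Jn_def J_def algebra_simps)
    then have "norm (Jn n z - J z) \<le> norm (cnj (fx n z - p z) * q z + cnj (p z) * (fy n z - q z) + cnj (fx n z - p z) * (fy n z - q z))"
      by (simp only: real_norm_def abs_Im_le_cmod)
    also have "\<dots> \<le> norm (cnj (fx n z - p z) * q z) + norm (cnj (p z) * (fy n z - q z)) + norm (cnj (fx n z - p z) * (fy n z - q z))"
      by (intro order_trans[OF norm_triangle_ineq] add_right_mono norm_triangle_ineq)
    also have "\<dots> = u n z + v n z + norm (fx n z - p z) * norm (fy n z - q z)"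
      by (simp add: u_def v_def norm_mult mult.commute del: complex_cnj_diff)
    also have "\<dots> \<le> u n z + v n z + w n z"
    proof -
      have "x * y \<le> x\<^sup>2 + y\<^sup>2" if "x \<ge> 0" "y \<ge> 0" for x y :: real
        using zero_le_power2[of "x - y"] mult_nonneg_nonneg[OF that] unfolding power2_diff by linarith
      then show ?thesis by (simp add: w_def)
    qed
    finally show ?thesis .
  qed
  show ?thesis
  proof (rule tendsto_sandwich[OF _ _ tendsto_const tot])
    show "\<forall>\<^sub>F n in sequentially. 0 \<le> (LINT z:cball 0 R|lborel. norm (Jn n z - J z))"
      unfolding set_lebesgue_integral_def by (auto intro!: always_eventually integral_nonneg_AE)
    show "\<forall>\<^sub>F n in sequentially. (LINT z:cball 0 R|lborel. norm (Jn n z - J z))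
        \<le> (LINT z:cball 0 R|lborel. u n z + v n z + w n z)"
      by (intro always_eventually allI set_integral_mono ti le set_integrable_norm set_integral_diff(1) Jn_int J_int)
  qed
qed

lemma box_limits:
  assumes "S \<in> sets borel" "S \<subseteq> sq R"
  shows "\<And>n. set_integrable lborel S (fx n)" "\<And>n. set_integrable lborel S (fy n)" "\<And>n. set_integrable lborel S (Jn n)"
    "set_integrable lborel S p" "set_integrable lborel S q" "set_integrable lborel S J"
    "(\<lambda>n. LINT z:S|lborel. norm (fx n z - p z)) \<longlonglongrightarrow> 0" "(\<lambda>n. LINT z:S|lborel. norm (fy n z - q z)) \<longlonglongrightarrow> 0"
    "(\<lambda>n. LINT z:S|lborel. norm (Jn n z - J z)) \<longlonglongrightarrow> 0"
proof -
  have S: "S \<subseteq> cball 0 (2 * R)" using assms(2) sq_sub_cball by blast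
  have sub: "set_integrable lborel S k" if "set_integrable lborel (cball 0 (2 * R)) k" for k :: "complex \<Rightarrow> 'c::{banach, second_countable_topology}"
    by (rule set_integrable_subset[OF that]) (use assms(1) S in auto)
  have cx: "set_integrable lborel (cball 0 (2 * R)) (fx n)" "set_integrable lborel (cball 0 (2 * R)) (fy n)" for n
    unfolding set_integrable_def by (rule borel_integrable_compact; simp add: fcont)+
  show "\<And>n. set_integrable lborel S (fx n)" "\<And>n. set_integrable lborel S (fy n)" "\<And>n. set_integrable lborel S (Jn n)"
    "set_integrable lborel S p" "set_integrable lborel S q" "set_integrable lborel S J"
    by (intro sub cx Jn_int J_int set_integrable_of_square[OF pm p2] set_integrable_of_square[OF qm q2])+
  note sq = set_integrable_of_square[OF pm p2] set_integrable_of_square[OF qm q2]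
  show "(\<lambda>n. LINT z:S|lborel. norm (fx n z - p z)) \<longlonglongrightarrow> 0"
    by (rule L1_subset[OF assms(1) S _ norm_ge_zero L1x]) (intro set_integrable_norm set_integral_diff(1) cx sq)
  show "(\<lambda>n. LINT z:S|lborel. norm (fy n z - q z)) \<longlonglongrightarrow> 0"
    by (rule L1_subset[OF assms(1) S _ norm_ge_zero L1y]) (intro set_integrable_norm set_integral_diff(1) cx sq)
  show "(\<lambda>n. LINT z:S|lborel. norm (Jn n z - J z)) \<longlonglongrightarrow> 0"
    by (rule L1_subset[OF assms(1) S _ norm_ge_zero L1J]) (intro set_integrable_norm set_integral_diff(1) Jn_int J_int)
qed

text \<open>Provides the bounds that dominated convergence and the stability of winding numbers require on
  compact sets that avoid the only zero of \<open>G\<close>.\<close>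

lemma compact_away:
  assumes "compact S" "S \<subseteq> sq R" "0 \<notin> S"
  obtains m where "m > 0" "\<forall>z\<in>S. norm (G z) \<ge> 2 * m"
    "\<forall>\<^sub>F n in sequentially. \<forall>z\<in>S. norm (f n z) \<ge> m \<and> norm (f n z - G z) < norm (G z)"
proof -
  obtain m where m: "m > 0" "\<forall>z\<in>S. norm (G z) \<ge> 2 * m"
  proof (cases "S = {}")
    case True
    show ?thesis by (rule that[of 1]) (simp_all add: True)
  next
    case False
    have "continuous_on S (\<lambda>z. norm (G z))" by (rule continuous_on_norm[OF Gc])
    from continuous_attains_inf[OF assms(1) False this]
    obtain x where x: "x \<in> S" "\<forall>z\<in>S. norm (G x) \<le> norm (G z)" by (rule bexE)
    have "G x \<noteq> 0" using x(1) assms(3) G_eq_0[of x] by metis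
    show ?thesis
    proof (rule that[of "norm (G x) / 2"])
      show "0 < norm (G x) / 2" using \<open>G x \<noteq> 0\<close> by simp
      show "\<forall>z\<in>S. 2 * (norm (G x) / 2) \<le> norm (G z)" using x(2) by simp
    qed
  qed
  have "\<forall>\<^sub>F n in sequentially. \<forall>z\<in>S. norm (f n z) \<ge> m \<and> norm (f n z - G z) < norm (G z)"
    using f_close[OF m(1), of R]
  proof eventually_elim
    case (elim n)
    show ?case
    proof
      fix z assume z: "z \<in> S"
      have "norm (f n z - G z) < m" using elim z assms(2) by blast
      moreover have "norm (G z) \<ge> 2 * m" using m(2) z by blast
      moreover have "norm (G z) \<le> norm (f n z) + norm (f n z - G z)"
        using norm_triangle_ineq4[of "f n z" "f n z - G z"] by simp
      ultimately show "norm (f n z) \<ge> m \<and> norm (f n z - G z) < norm (G z)" using m(1) by linarith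
    qed
  qed
  from that[OF m this] show thesis .
qed

lemma sqpath_compact: "compact (path_image (sqpath R))"
  by (simp add: sqpath_def compact_path_image simple_path_imp_path)

lemma sqpath_subset_sq:
  assumes "R > 0"
  shows "path_image (sqpath R) \<subseteq> sq R" "0 \<notin> path_image (sqpath R)"
  using path_image_sqpath[of R] in_sqpath[OF assms, of 0] assms by simp_all

text \<open>Winding numbers are stable under small perturbations, and for the homeomorphism \<open>G\<close>
  itself the winding number is known.\<close>

lemma winding_limit:
  assumes R: "R > 0"
  obtains w :: real where "w = 1 \<or> w = -1"
    "\<forall>\<^sub>F n in sequentially. Re (winding_number (f n \<circ> sqpath R) 0) = w"
proof -
  obtain m where m: "m > 0" "\<forall>z\<in>path_image (sqpath R). norm (G z) \<ge> 2 * m"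
    "\<forall>\<^sub>F n in sequentially. \<forall>z\<in>path_image (sqpath R). norm (f n z) \<ge> m \<and> norm (f n z - G z) < norm (G z)"
    by (rule compact_away[OF sqpath_compact sqpath_subset_sq[OF R]])
  define w where "w = Re (winding_number (G \<circ> sqpath R) 0)"
  have "\<forall>\<^sub>F n in sequentially. Re (winding_number (f n \<circ> sqpath R) 0) = w"
    using m(3)
  proof eventually_elim
    case (elim n)
    have "winding_number (f n \<circ> sqpath R) 0 = winding_number (G \<circ> sqpath R) 0"
    proof (rule winding_number_nearby_loops_eq)
      show "path (G \<circ> sqpath R)" "path (f n \<circ> sqpath R)"
        by (auto intro!: path_continuous_image Gc fcont simp: sqpath_def)
      show "pathfinish (G \<circ> sqpath R) = pathstart (G \<circ> sqpath R)" "pathfinish (f n \<circ> sqpath R) = pathstart (f n \<circ> sqpath R)"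
        by (simp_all add: pathfinish_compose pathstart_compose sqpath_def)
      show "norm ((f n \<circ> sqpath R) t - (G \<circ> sqpath R) t) < norm ((G \<circ> sqpath R) t - 0)" if "t \<in> {0..1}" for t
        using elim that by (auto simp: path_image_def)
    qed
    then show ?case by (simp add: w_def)
  qed
  moreover have "w = 1 \<or> w = -1" using winding_number_homeo_square[OF homeo G0 R] by (auto simp: w_def)
  ultimately show thesis by (intro that)
qed

text \<open>The density of the logarithmic area of the image, cut off to an annulus.\<close>

definition log_jacobian :: "real \<Rightarrow> real \<Rightarrow> complex \<Rightarrow> real" where "log_jacobian A B z = Phi A B (G z) / (norm (G z))\<^sup>2 * J z"

lemma Phi_meas [measurable]: "A \<le> B \<Longrightarrow> Phi A B \<in> borel_measurable borel"
  by (rule borel_measurable_continuous_onI[OF Phi_cont])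

lemma Phi_lim: "A \<le> B \<Longrightarrow> (\<lambda>n. Phi A B (f n z)) \<longlonglongrightarrow> Phi A B (G z)"
  using continuous_on_tendsto_compose[OF Phi_cont[of A B UNIV] f_pointwise] by simp

text \<open>The integral is \<open>2 \<pi> (B - A + 1)\<close> times a winding number, which is
  \<open>1\<close> or \<open>-1\<close>.\<close>

lemma area_bound:
  assumes AB: "A \<le> B" and R: "R > 0"
    and large: "\<And>z. z \<in> path_image (sqpath R) \<Longrightarrow> norm (G z) \<ge> exp (B + 1) + 1"
  shows "set_integrable lborel (sq R) (log_jacobian A B)" "(LINT z:sq R|lborel. log_jacobian A B z) \<le> 2 * pi * (B - A + 1)"
proof -
  have Sm: "sq R \<in> sets borel" by (simp add: sq_def)
  note bl = box_limits[OF Sm order_refl]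
  have bound: "norm (Phi A B w / (norm w)\<^sup>2) \<le> exp (1 - A) * exp (1 - A)" for w
  proof (cases "norm w \<le> exp (A - 1)")
    case True
    then show ?thesis using Phi_small[OF AB True] by simp
  next
    case False
    then have w: "norm w > 0" using exp_gt_zero[of "A - 1"] by linarith
    have i: "1 / norm w \<le> exp (1 - A)"
    proof -
      have "1 / norm w \<le> 1 / exp (A - 1)" using False w by (intro divide_left_mono) auto
      also have "\<dots> = exp (1 - A)" by (simp add: exp_diff)
      finally show ?thesis .
    qed
    have "norm (Phi A B w / (norm w)\<^sup>2) = (\<bar>Phi A B w\<bar> * (1 / norm w)) * (1 / norm w)"
      by (simp add: power2_eq_square)
    also have "\<dots> \<le> exp (1 - A) * exp (1 - A)" by (intro mult_mono Phi_div_bound AB i) auto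
    finally show ?thesis .
  qed
  have lim: "(\<lambda>n. Phi A B (f n z) / (norm (f n z))\<^sup>2) \<longlonglongrightarrow> Phi A B (G z) / (norm (G z))\<^sup>2" for z
  proof (cases "G z = 0")
    case False
    then show ?thesis by (intro tendsto_intros Phi_lim AB f_pointwise) auto
  next
    case True
    have "\<forall>\<^sub>F n in sequentially. norm (f n z) < exp (A - 1)"
      using tendsto_norm[OF f_pointwise, of z] True by (intro order_tendstoD(2)) auto
    then have "\<forall>\<^sub>F n in sequentially. Phi A B (f n z) / (norm (f n z))\<^sup>2 = 0"
      by eventually_elim (simp add: Phi_small[OF AB])
    then show ?thesis using True by (simp add: tendsto_eventually)
  qed
  have m1: "(\<lambda>z. Phi A B (f n z) / (norm (f n z))\<^sup>2) \<in> borel_measurable borel" for n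
    using Phi_meas[OF AB] by measurable
  have m2: "(\<lambda>z. Phi A B (G z) / (norm (G z))\<^sup>2) \<in> borel_measurable borel"
    using Phi_meas[OF AB] by measurable
  note L = L1_mult_limit[OF Sm m1 m2 bl(3,6,9) always_eventually[OF allI[OF ballI[OF bound]]] lim]
  show "set_integrable lborel (sq R) (log_jacobian A B)" unfolding log_jacobian_def by (rule L(2))
  obtain w where w: "w = 1 \<or> w = -1" "\<forall>\<^sub>F n in sequentially. Re (winding_number (f n \<circ> sqpath R) 0) = w"
    by (rule winding_limit[OF R])
  have "\<forall>\<^sub>F n in sequentially. (LINT z:sq R|lborel. Phi A B (f n z) / (norm (f n z))\<^sup>2 * Jn n z)
      = (B - A + 1) * (2 * pi * w)"
    using w(2) f_close[OF zero_less_one, of R]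
  proof eventually_elim
    case (elim n)
    show ?case unfolding Jn_def
    proof (subst c2map.stokes_area[OF c2 AB R])
      fix z assume z: "z \<in> path_image (sqpath R)"
      have "norm (f n z - G z) < 1" using elim(2) z sqpath_subset_sq[OF R] by blast
      moreover have "norm (G z) \<le> norm (f n z) + norm (f n z - G z)"
        using norm_triangle_ineq4[of "f n z" "f n z - G z"] by simp
      ultimately show "exp (B + 1) \<le> norm (f n z)" using large[OF z] by linarith
    qed (simp add: elim(1))
  qed
  then have "(\<lambda>n. LINT z:sq R|lborel. Phi A B (f n z) / (norm (f n z))\<^sup>2 * Jn n z) \<longlonglongrightarrow> (B - A + 1) * (2 * pi * w)"
    by (rule tendsto_eventually)
  from LIMSEQ_unique[OF L(1) this]
  have "(LINT z:sq R|lborel. log_jacobian A B z) = (B - A + 1) * (2 * pi * w)" by (simp add: log_jacobian_def)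
  then show "(LINT z:sq R|lborel. log_jacobian A B z) \<le> 2 * pi * (B - A + 1)"
    using w(1) AB by (auto simp: mult.commute intro: order_trans[of _ 0])
qed

text \<open>The factors in front of the derivatives converge boundedly, because \<open>f n\<close> stays
  away from \<open>0\<close> on the support of the cut-off.\<close>

lemma angle_limit:
  assumes AB: "A \<le> B" and R: "R \<ge> exp (B + 1)"
  defines "I \<equiv> \<lambda>z. Phi A B z * (Re (1 / z) * Im (q z / G z) - Re (\<i> / z) * Im (p z / G z))"
  shows "set_integrable lborel (sq R) I" "\<bar>LINT z:sq R|lborel. I z\<bar> = 2 * pi * (B - A + 1)"
proof -
  have R0: "R > 0" using R exp_gt_zero[of "B+1"] by linarith
  have Sm: "sq R \<in> sets borel" by (simp add: sq_def)
  note bl = box_limits[OF Sm order_refl]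
  define T where "T = sq R \<inter> {z. norm z \<ge> exp (A - 1)}"
  have T: "compact T" "T \<subseteq> sq R" "0 \<notin> T"
    unfolding T_def by (auto simp: sq_def intro!: compact_Int_closed closed_Collect_le continuous_intros)
  obtain m where m: "m > 0" and mG: "\<forall>z\<in>T. norm (G z) \<ge> 2 * m"
    and mf: "\<forall>\<^sub>F n in sequentially. \<forall>z\<in>T. norm (f n z) \<ge> m \<and> norm (f n z - G z) < norm (G z)"
    by (rule compact_away[OF T])
  define c where "c k F z = complex_of_real (Phi A B z * Re (k / z)) / F z" for k :: complex and F :: "complex \<Rightarrow> complex" and z
  have cm: "c k F \<in> borel_measurable borel" if [measurable]: "F \<in> borel_measurable borel" for k F
    unfolding c_def using Phi_meas[OF AB] by measurable
  have bd: "\<forall>\<^sub>F n in sequentially. \<forall>z\<in>sq R. norm (c k (f n) z) \<le> norm k * exp (1 - A) * (1 / m)" for k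
    using mf
  proof eventually_elim
    case (elim n)
    show ?case
    proof
      fix z assume z: "z \<in> sq R"
      show "norm (c k (f n) z) \<le> norm k * exp (1 - A) * (1 / m)"
      proof (cases "z \<in> T")
        case True
        have 1: "\<bar>Phi A B z * Re (k / z)\<bar> \<le> norm k * exp (1 - A)"
        proof -
          have "\<bar>Phi A B z * Re (k / z)\<bar> \<le> \<bar>Phi A B z\<bar> * norm (k / z)"
            by (simp add: abs_mult mult_left_mono abs_Re_le_cmod)
          also have "\<dots> = norm k * (\<bar>Phi A B z\<bar> * (1 / norm z))" by (simp add: norm_divide)
          also have "\<dots> \<le> norm k * exp (1 - A)" by (intro mult_left_mono Phi_div_bound AB) auto
          finally show ?thesis .
        qed
        have "1 / norm (f n z) \<le> 1 / m" using elim True m by (intro divide_left_mono mult_pos_pos) (auto intro: order.strict_trans2[OF m])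
        with 1 have "\<bar>Phi A B z * Re (k / z)\<bar> * (1 / norm (f n z)) \<le> norm k * exp (1 - A) * (1 / m)"
          by (intro mult_mono) auto
        then show ?thesis by (simp add: c_def norm_divide norm_mult abs_mult)
      next
        case False
        then have "norm z \<le> exp (A - 1)" using z by (auto simp: T_def)
        then have "Phi A B z = 0" by (rule Phi_small[OF AB])
        then show ?thesis using m by (simp add: c_def)
      qed
    qed
  qed
  have lim: "(\<lambda>n. c k (f n) z) \<longlonglongrightarrow> c k G z" for k z
  proof (cases "z = 0")
    case False
    then show ?thesis unfolding c_def by (intro tendsto_intros f_pointwise) (simp add: G_eq_0)
  next
    case True
    then show ?thesis by (simp add: c_def Phi_def)
  qed
  note L1 = L1_mult_limit[OF Sm cm[OF fmeas(1)] cm[OF Gm] bl(2,5,8) bd lim, of 1]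
  note L2 = L1_mult_limit[OF Sm cm[OF fmeas(1)] cm[OF Gm] bl(1,4,7) bd lim, of \<i>]
  have eq: "Phi A B z * (Re (1 / z) * Im (u / F z) - Re (\<i> / z) * Im (v / F z)) = Im (c 1 F z * u - c \<i> F z * v)" for u v F z
  proof -
    have "c k F z * u = of_real (Phi A B z * Re (k / z)) * (u / F z)" for k u by (simp add: c_def)
    then show ?thesis by (simp only: minus_complex.sel Im_complex_of_real Re_complex_of_real times_complex.sel) (simp add: algebra_simps)
  qed
  have iG: "set_integrable lborel (sq R) (\<lambda>z. c 1 G z * q z - c \<i> G z * p z)"
    using L1(2) L2(2) by (rule set_integral_diff(1))
  show "set_integrable lborel (sq R) I" unfolding I_def eq by (rule set_LINT_Im(3)[OF iG])
  have IG: "(LINT z:sq R|lborel. I z) = Im ((LINT z:sq R|lborel. c 1 G z * q z) - (LINT z:sq R|lborel. c \<i> G z * p z))"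
    unfolding I_def eq set_LINT_Im(1)[OF iG] set_integral_diff(2)[OF L1(2) L2(2)] ..
  have t: "(\<lambda>n. Im ((LINT z:sq R|lborel. c 1 (f n) z * fy n z) - (LINT z:sq R|lborel. c \<i> (f n) z * fx n z)))
      \<longlonglongrightarrow> (LINT z:sq R|lborel. I z)"
    unfolding IG by (intro tendsto_intros L1(1) L2(1))
  obtain w where w: "w = 1 \<or> w = -1" "\<forall>\<^sub>F n in sequentially. Re (winding_number (f n \<circ> sqpath R) 0) = w"
    by (rule winding_limit[OF R0])
  have "\<forall>\<^sub>F n in sequentially. Im ((LINT z:sq R|lborel. c 1 (f n) z * fy n z) - (LINT z:sq R|lborel. c \<i> (f n) z * fx n z))
      = (B - A + 1) * (2 * pi * w)"
    using w(2) mf L1(3) L2(3)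
  proof eventually_elim
    case (elim n)
    have "Im ((LINT z:sq R|lborel. c 1 (f n) z * fy n z) - (LINT z:sq R|lborel. c \<i> (f n) z * fx n z))
        = (LINT z:sq R|lborel. Im (c 1 (f n) z * fy n z - c \<i> (f n) z * fx n z))"
      unfolding set_LINT_Im(1)[OF set_integral_diff(1)[OF elim(3,4)]] set_integral_diff(2)[OF elim(3,4)] ..
    also have "\<dots> = (B - A + 1) * (2 * pi * Re (winding_number (f n \<circ> sqpath R) 0))"
      unfolding eq[symmetric]
      by (rule c2map.stokes_angle[OF c2 AB R]) (use elim(2) m in \<open>force simp: T_def\<close>)
    finally show ?case using elim(1) by simp
  qed
  from LIMSEQ_unique[OF t tendsto_eventually[OF this]]
  have "(LINT z:sq R|lborel. I z) = (B - A + 1) * (2 * pi * w)" .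
  then show "\<bar>LINT z:sq R|lborel. I z\<bar> = 2 * pi * (B - A + 1)"
    using w(1) AB by (auto simp: abs_mult)
qed

text \<open>Here the cut-off depends on the approximations. Near \<open>0\<close>, where
  \<open>1 / z\<close> is unbounded, it vanishes for all large \<open>n\<close>, by uniform
  convergence and continuity of \<open>G\<close> at \<open>0\<close>.\<close>

lemma half_square_limit:
  assumes AB: "A \<le> B" and R: "R > 0" and y: "y0 = 0 \<and> y1 = R \<or> y0 = -R \<and> y1 = 0"
    and large: "\<And>z. z \<in> path_image (sqpath R) \<Longrightarrow> norm (G z) \<ge> exp (B + 1) + 1"
  defines "S \<equiv> cbox (Complex (-R) y0) (Complex R y1)"
  defines "I \<equiv> \<lambda>z. Phi A B (G z) * (Re (p z / G z) * Im (\<i> / z) - Re (q z / G z) * Im (1 / z))"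
  shows "set_integrable lborel S I" "(LINT z:S|lborel. I z) = (B - A + 1) * pi"
proof -
  have Sm: "S \<in> sets borel" "S \<subseteq> sq R" using y R by (auto simp: S_def in_cbox_complex_iff in_sq)
  note bl = box_limits[OF Sm]
  have ev0: "\<exists>\<delta>>0. \<forall>z. norm z < \<delta> \<longrightarrow> norm (G z) < exp (A - 1) / 2"
  proof -
    have "isCont G 0" using Gc[of UNIV] by (simp add: continuous_on_eq_continuous_at)
    then have "\<exists>\<delta>>0. \<forall>z. dist z 0 < \<delta> \<longrightarrow> dist (G z) (G 0) < exp (A - 1) / 2"
      unfolding continuous_at_eps_delta dist_norm by (meson exp_gt_zero half_gt_zero)
    then show ?thesis by (simp add: G0)
  qed
  then obtain \<delta>0 where \<delta>0: "\<delta>0 > 0" "\<And>z. norm z < \<delta>0 \<Longrightarrow> norm (G z) < exp (A - 1) / 2" by blast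
  define \<delta> where "\<delta> = min \<delta>0 R"
  have \<delta>: "\<delta> > 0" "\<delta> \<le> R" "\<And>z. norm z < \<delta> \<Longrightarrow> norm (G z) < exp (A - 1) / 2" using \<delta>0 R by (auto simp: \<delta>_def)
  have small: "\<forall>\<^sub>F n in sequentially. \<forall>z. norm z < \<delta> \<longrightarrow> norm (f n z) < exp (A - 1)"
  proof -
    have "exp (A - 1) / 2 > 0" by simp
    from f_close[OF this, of R] show ?thesis
    proof eventually_elim
      case (elim n)
      show ?case
      proof (intro allI impI)
        fix z :: complex assume z: "norm z < \<delta>"
        then have "z \<in> sq R" using \<delta>(2) abs_Re_le_cmod[of z] abs_Im_le_cmod[of z] by (auto simp: in_sq)
        then have "norm (f n z - G z) < exp (A - 1) / 2" using elim by blast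
        moreover have "norm (f n z) \<le> norm (G z) + norm (f n z - G z)" using norm_triangle_ineq[of "G z" "f n z - G z"] by simp
        ultimately show "norm (f n z) < exp (A - 1)" using \<delta>(3)[OF z] by linarith
      qed
    qed
  qed
  define c where "c k F z = complex_of_real (Phi A B (F z) * Im (k / z)) / F z" for k :: complex and F :: "complex \<Rightarrow> complex" and z
  have cm: "c k F \<in> borel_measurable borel" if [measurable]: "F \<in> borel_measurable borel" for k F
    unfolding c_def using Phi_meas[OF AB] by measurable
  have bd: "\<forall>\<^sub>F n in sequentially. \<forall>z\<in>S. norm (c k (f n) z) \<le> exp (1 - A) * (norm k * (1 / \<delta>))" for k
    using small
  proof eventually_elim
    case (elim n)
    show ?case
    proof
      fix z
      show "norm (c k (f n) z) \<le> exp (1 - A) * (norm k * (1 / \<delta>))"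
      proof (cases "norm z < \<delta>")
        case True
        then have "norm (f n z) \<le> exp (A - 1)" using elim by (simp add: less_imp_le)
        then have "Phi A B (f n z) = 0" by (rule Phi_small[OF AB])
        then show ?thesis using \<delta> by (simp add: c_def)
      next
        case False
        have "\<bar>Im (k / z)\<bar> \<le> norm k * (1 / norm z)" using abs_Im_le_cmod[of "k / z"] by (simp add: norm_divide)
        also have "\<dots> \<le> norm k * (1 / \<delta>)" using False \<delta>(1) by (intro mult_left_mono divide_left_mono mult_pos_pos) auto
        finally have "(\<bar>Phi A B (f n z)\<bar> * (1 / norm (f n z))) * \<bar>Im (k / z)\<bar> \<le> exp (1 - A) * (norm k * (1 / \<delta>))"
          by (intro mult_mono Phi_div_bound AB) auto
        then show ?thesis by (simp add: c_def norm_divide norm_mult abs_mult)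
      qed
    qed
  qed
  have lim: "(\<lambda>n. c k (f n) z) \<longlonglongrightarrow> c k G z" for k z
  proof (cases "z = 0")
    case False
    then show ?thesis unfolding c_def by (intro tendsto_intros f_pointwise Phi_lim AB) (simp add: G_eq_0)
  next
    case True
    then show ?thesis by (simp add: c_def)
  qed
  note L1 = L1_mult_limit[OF Sm(1) cm[OF fmeas(1)] cm[OF Gm] bl(1,4,7) bd lim, of \<i>]
  note L2 = L1_mult_limit[OF Sm(1) cm[OF fmeas(1)] cm[OF Gm] bl(2,5,8) bd lim, of 1]
  have eq: "Phi A B (F z) * (Re (u / F z) * Im (\<i> / z) - Re (v / F z) * Im (1 / z)) = Re (c \<i> F z * u - c 1 F z * v)" for u v F z
  proof -
    have "c k F z * u = of_real (Phi A B (F z) * Im (k / z)) * (u / F z)" for k u by (simp add: c_def)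
    then show ?thesis by (simp only: minus_complex.sel Im_complex_of_real Re_complex_of_real times_complex.sel) (simp add: algebra_simps)
  qed
  have iG: "set_integrable lborel S (\<lambda>z. c \<i> G z * p z - c 1 G z * q z)"
    using L1(2) L2(2) by (rule set_integral_diff(1))
  show "set_integrable lborel S I" unfolding I_def eq by (rule set_LINT_Im(4)[OF iG])
  have IG: "(LINT z:S|lborel. I z) = Re ((LINT z:S|lborel. c \<i> G z * p z) - (LINT z:S|lborel. c 1 G z * q z))"
    unfolding I_def eq set_LINT_Im(2)[OF iG] set_integral_diff(2)[OF L1(2) L2(2)] ..
  have t: "(\<lambda>n. Re ((LINT z:S|lborel. c \<i> (f n) z * fx n z) - (LINT z:S|lborel. c 1 (f n) z * fy n z)))
      \<longlonglongrightarrow> (LINT z:S|lborel. I z)"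
    unfolding IG by (intro tendsto_intros L1(1) L2(1))
  have "\<forall>\<^sub>F n in sequentially. Re ((LINT z:S|lborel. c \<i> (f n) z * fx n z) - (LINT z:S|lborel. c 1 (f n) z * fy n z))
      = (B - A + 1) * pi"
    using f_close[OF zero_less_one, of R] small L1(3) L2(3)
  proof eventually_elim
    case (elim n)
    have "Re ((LINT z:S|lborel. c \<i> (f n) z * fx n z) - (LINT z:S|lborel. c 1 (f n) z * fy n z))
        = (LINT z:S|lborel. Re (c \<i> (f n) z * fx n z - c 1 (f n) z * fy n z))"
      unfolding set_LINT_Im(2)[OF set_integral_diff(1)[OF elim(3,4)]] set_integral_diff(2)[OF elim(3,4)] ..
    also have "\<dots> = (B - A + 1) * pi"
      unfolding eq[symmetric] S_def
    proof (rule c2map.stokes_half_square[OF c2 AB R y _ \<delta>(1)])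
      fix z assume z: "z \<in> path_image (sqpath R)"
      have "norm (f n z - G z) < 1" using elim(1) z sqpath_subset_sq[OF R] by blast
      moreover have "norm (G z) \<le> norm (f n z) + norm (f n z - G z)"
        using norm_triangle_ineq4[of "f n z" "f n z - G z"] by simp
      ultimately show "exp (B + 1) \<le> norm (f n z)" using large[OF z] by linarith
    qed (use elim(2) in blast)
    finally show ?case .
  qed
  from LIMSEQ_unique[OF t tendsto_eventually[OF this]]
  show "(LINT z:S|lborel. I z) = (B - A + 1) * pi" .
qed

text \<open>The limit of \<open>log_gradient\<close> along the approximating sequence.\<close>

definition log_gradient_lim :: "real \<Rightarrow> real \<Rightarrow> complex \<Rightarrow> real"
  where "log_gradient_lim A B z = Phi A B (G z) / norm (G z) * norm (p z) + Phi A B (G z) / norm (G z) * norm (q z)"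

lemma crossing_limit:
  assumes AB: "A \<le> B" and R: "R > 0"
    and cr: "\<And>r. R \<le> r \<Longrightarrow> r \<le> 2 * R \<Longrightarrow> \<exists>u\<in>path_image (sqpath r). \<exists>v\<in>path_image (sqpath r).
        m \<le> Theta A B (G v) - Theta A B (G u)"
  shows "set_integrable lborel (sq (2 * R)) (log_gradient_lim A B)" "m * R \<le> 8 * (LINT z:sq (2 * R)|lborel. log_gradient_lim A B z)"
proof -
  let ?S = "sq (2 * R)"
  have Sm: "?S \<in> sets borel" by (simp add: sq_def)
  note bl = box_limits[OF Sm order_refl]
  define c where "c F z = Phi A B (F z) / norm (F z)" for F :: "complex \<Rightarrow> complex" and z
  have cm: "c F \<in> borel_measurable borel" if [measurable]: "F \<in> borel_measurable borel" for F
    unfolding c_def using Phi_meas[OF AB] by measurable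
  have bd: "\<forall>\<^sub>F n in sequentially. \<forall>z\<in>?S. norm (c (f n) z) \<le> exp (1 - A)"
    using Phi_div_bound[OF AB] by (intro always_eventually allI ballI) (simp add: c_def)
  have lim: "(\<lambda>n. c (f n) z) \<longlonglongrightarrow> c G z" for z
  proof (cases "G z = 0")
    case False
    then show ?thesis unfolding c_def by (intro tendsto_intros f_pointwise Phi_lim AB) simp
  next
    case True
    have "\<forall>\<^sub>F n in sequentially. norm (f n z) < exp (A - 1)"
      using tendsto_norm[OF f_pointwise, of z] True by (intro order_tendstoD(2)) auto
    then have "\<forall>\<^sub>F n in sequentially. c (f n) z = 0"
      by eventually_elim (simp add: Phi_small[OF AB] c_def)
    then show ?thesis using True by (simp add: tendsto_eventually c_def)
  qed
  have nl: "(\<lambda>n. LINT z:?S|lborel. norm (norm (F n z) - norm (w z))) \<longlonglongrightarrow> 0"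
    if F: "\<And>n. set_integrable lborel ?S (F n)" and w: "set_integrable lborel ?S w"
      and l: "(\<lambda>n. LINT z:?S|lborel. norm (F n z - w z)) \<longlonglongrightarrow> 0" for F :: "nat \<Rightarrow> complex \<Rightarrow> complex" and w
  proof (rule tendsto_sandwich[OF _ _ tendsto_const l])
    show "\<forall>\<^sub>F n in sequentially. 0 \<le> (LINT z:?S|lborel. norm (norm (F n z) - norm (w z)))"
      unfolding set_lebesgue_integral_def by (auto intro!: always_eventually integral_nonneg_AE)
    show "\<forall>\<^sub>F n in sequentially. (LINT z:?S|lborel. norm (norm (F n z) - norm (w z))) \<le> (LINT z:?S|lborel. norm (F n z - w z))"
      by (intro always_eventually allI set_integral_mono set_integrable_norm set_integral_diff(1) F w)
         (simp add: norm_triangle_ineq3)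
  qed
  note L1 = L1_mult_limit[OF Sm cm[OF fmeas(1)] cm[OF Gm] set_integrable_norm[OF bl(1)] set_integrable_norm[OF bl(4)] nl[OF bl(1,4,7)] bd lim]
  note L2 = L1_mult_limit[OF Sm cm[OF fmeas(1)] cm[OF Gm] set_integrable_norm[OF bl(2)] set_integrable_norm[OF bl(5)] nl[OF bl(2,5,8)] bd lim]
  have log_gradient_lim_eq: "log_gradient_lim A B = (\<lambda>z. c G z * norm (p z) + c G z * norm (q z))" by (auto simp: log_gradient_lim_def c_def)
  show "set_integrable lborel ?S (log_gradient_lim A B)" unfolding log_gradient_lim_eq using L1(2) L2(2) by (rule set_integral_add(1))
  have IG: "(LINT z:?S|lborel. log_gradient_lim A B z) = (LINT z:?S|lborel. c G z * norm (p z)) + (LINT z:?S|lborel. c G z * norm (q z))"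
    unfolding log_gradient_lim_eq using L1(2) L2(2) by (rule set_integral_add(2))
  have t: "(\<lambda>n. 8 * ((LINT z:?S|lborel. c (f n) z * norm (fx n z)) + (LINT z:?S|lborel. c (f n) z * norm (fy n z))))
      \<longlonglongrightarrow> 8 * (LINT z:?S|lborel. log_gradient_lim A B z)"
    unfolding IG by (intro tendsto_intros L1(1) L2(1))
  (* Replacing G by its approximation costs e at each of the two points; e is sent to 0 at the
     end. *)
  have ev: "\<forall>\<^sub>F n in sequentially. (m - 2 * e) * R
      \<le> 8 * ((LINT z:?S|lborel. c (f n) z * norm (fx n z)) + (LINT z:?S|lborel. c (f n) z * norm (fy n z)))"
    if e: "e > 0" for e
  proof -
    have "e / exp (1 - A) > 0" using e by simp
    from f_close[OF this, of "2 * R"] L1(3) L2(3) show ?thesis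
    proof eventually_elim
      case (elim n)
      have cl: "\<bar>Theta A B (f n z) - Theta A B (G z)\<bar> \<le> e" if "z \<in> ?S" for z
      proof -
        have "\<bar>Theta A B (f n z) - Theta A B (G z)\<bar> \<le> exp (1 - A) * norm (f n z - G z)"
          by (rule Theta_Lipschitz[OF AB])
        also have "\<dots> \<le> exp (1 - A) * (e / exp (1 - A))"
          using elim(1) that by (intro mult_left_mono) (auto simp: less_imp_le)
        finally show ?thesis by simp
      qed
      have "(m - 2 * e) * R \<le> 8 * (LINT z:?S|lborel. c2map.log_gradient (f n) (fx n) (fy n) A B z)"
      proof (rule c2map.crossing[OF c2 AB R])
        fix r assume r: "R \<le> r" "r \<le> 2 * R"
        then obtain u v where uv: "u \<in> path_image (sqpath r)" "v \<in> path_image (sqpath r)"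
          "m \<le> Theta A B (G v) - Theta A B (G u)" using cr by blast
        have "path_image (sqpath r) \<subseteq> sq r" using r R by (intro sqpath_subset_sq) simp
        moreover have "sq r \<subseteq> ?S" using r by (auto simp: in_sq)
        ultimately have "path_image (sqpath r) \<subseteq> ?S" by simp
        then have "\<bar>Theta A B (f n u) - Theta A B (G u)\<bar> \<le> e" "\<bar>Theta A B (f n v) - Theta A B (G v)\<bar> \<le> e"
          using cl uv by auto
        then have "m - 2 * e \<le> Theta A B (f n v) - Theta A B (f n u)" using uv(3) by linarith
        then show "\<exists>p\<in>path_image (sqpath r). \<exists>q\<in>path_image (sqpath r). m - 2 * e \<le> Theta A B (f n q) - Theta A B (f n p)"
          using uv by blast
      qed
      also have "(LINT z:?S|lborel. c2map.log_gradient (f n) (fx n) (fy n) A B z)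
          = (LINT z:?S|lborel. c (f n) z * norm (fx n z) + c (f n) z * norm (fy n z))"
        unfolding c2map.log_gradient_def[OF c2] c_def by simp
      also have "\<dots> = (LINT z:?S|lborel. c (f n) z * norm (fx n z)) + (LINT z:?S|lborel. c (f n) z * norm (fy n z))"
        using elim(2,3) by (rule set_integral_add(2))
      finally show ?case .
    qed
  qed
  have le0: "(m - 2 * e) * R \<le> 8 * (LINT z:?S|lborel. log_gradient_lim A B z)" if "e > 0" for e
    using tendsto_lowerbound[OF t ev[OF that]] by simp
  have le: "m * R \<le> 8 * (LINT z:?S|lborel. log_gradient_lim A B z) + e" if "e > 0" for e
  proof -
    have "(m - 2 * (e / (2 * R))) * R = m * R - e" using R by (simp add: field_simps)
    then show ?thesis using le0[of "e / (2 * R)"] that R by simp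
  qed
  show "m * R \<le> 8 * (LINT z:?S|lborel. log_gradient_lim A B z)"
    by (rule field_le_epsilon) (rule le)
qed

end

section \<open>Growth of the map\<close>

lemma am_gm_sq:
  fixes x a b l :: real
  assumes "x\<^sup>2 \<le> a * b" "a \<ge> 0" "b \<ge> 0" "l > 0"
  shows "\<bar>x\<bar> \<le> l / 2 * a + b / (2 * l)"
proof (rule power2_le_imp_le)
  have "(l / 2 * a + b / (2 * l))\<^sup>2 - a * b = (l / 2 * a - b / (2 * l))\<^sup>2"
    using assms(4) by (simp add: power2_eq_square field_simps)
  then have "a * b \<le> (l / 2 * a + b / (2 * l))\<^sup>2" by (smt (verit) zero_le_power2)
  then show "\<bar>x\<bar>\<^sup>2 \<le> (l / 2 * a + b / (2 * l))\<^sup>2" using assms(1) by simp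
  show "0 \<le> l / 2 * a + b / (2 * l)" using assms by simp
qed

definition upper_sq :: "real \<Rightarrow> complex set" where "upper_sq R = cbox (Complex (-R) 0) (Complex R R)"
definition lower_sq :: "real \<Rightarrow> complex set" where "lower_sq R = cbox (Complex (-R) (-R)) (Complex R 0)"

lemma half_sq_sub: "R \<ge> 0 \<Longrightarrow> upper_sq R \<subseteq> sq R" "R \<ge> 0 \<Longrightarrow> lower_sq R \<subseteq> sq R"
  by (auto simp: upper_sq_def lower_sq_def in_cbox_complex_iff in_sq)

lemma half_sq_sets [simp]: "upper_sq R \<in> sets borel" "lower_sq R \<in> sets borel" "sq R \<in> sets borel"
  by (simp_all add: upper_sq_def lower_sq_def sq_def)

lemma half_sq_split:
  fixes k :: "complex \<Rightarrow> real"
  assumes R: "R \<ge> 0" and i: "set_integrable lborel (sq R) k"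
  shows "(LINT z:upper_sq R|lborel. k z) + (LINT z:lower_sq R|lborel. k z) = (LINT z:sq R|lborel. k z)"
    "set_integrable lborel (upper_sq R) k" "set_integrable lborel (lower_sq R) k"
proof -
  show u: "set_integrable lborel (upper_sq R) k" by (rule set_integrable_subset[OF i]) (use half_sq_sub[OF R] in auto)
  show l: "set_integrable lborel (lower_sq R) k" by (rule set_integrable_subset[OF i]) (use half_sq_sub[OF R] in auto)
  have "(LINT z:upper_sq R|lborel. k z) + (LINT z:lower_sq R|lborel. k z)
      = (LINT z|lborel. indicat_real (upper_sq R) z *\<^sub>R k z + indicat_real (lower_sq R) z *\<^sub>R k z)"
    using u l by (simp add: set_lebesgue_integral_def set_integrable_def)
  also have "\<dots> = (LINT z|lborel. indicat_real (sq R) z *\<^sub>R k z)"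
  proof (rule integral_cong_AE)
    show "AE z in lborel. indicat_real (upper_sq R) z *\<^sub>R k z + indicat_real (lower_sq R) z *\<^sub>R k z = indicat_real (sq R) z *\<^sub>R k z"
      using AE_Im_nonzero
    proof eventually_elim
      case (elim z)
      then show ?case using R by (auto simp: indicator_def upper_sq_def lower_sq_def in_sq in_cbox_complex_iff)
    qed
  qed (use u l i in \<open>auto simp: set_integrable_def\<close>)
  finally show "(LINT z:upper_sq R|lborel. k z) + (LINT z:lower_sq R|lborel. k z) = (LINT z:sq R|lborel. k z)"
    by (simp add: set_lebesgue_integral_def)
qed

lemma sqpath_norm: "R > 0 \<Longrightarrow> z \<in> path_image (sqpath R) \<Longrightarrow> norm z \<ge> R"
  using abs_Re_le_cmod[of z] abs_Im_le_cmod[of z] in_sqpath[of R z] by auto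

text \<open>The identity for half squares, applied to the identity map, where
  \<open>d ln |z| \<and> d arg z\<close> is the logarithmic area.\<close>

lemma annulus_area:
  assumes AB: "A \<le> B" and R: "R \<ge> exp (B + 1)"
  shows "(LINT z:upper_sq R|lborel. Phi A B z / (norm z)\<^sup>2) = (B - A + 1) * pi"
    "(LINT z:lower_sq R|lborel. Phi A B z / (norm z)\<^sup>2) = (B - A + 1) * pi"
    "set_integrable lborel (sq R) (\<lambda>z. Phi A B z / (norm z)\<^sup>2)"
proof -
  have R0: "R > 0" using R exp_gt_zero[of "B+1"] by linarith
  have eq: "Phi A B z * (Re (1 / z) * Im (\<i> / z) - Re (\<i> / z) * Im (1 / z)) = Phi A B z / (norm z)\<^sup>2" for z
  proof -
    have "Re (1 / z) * Im (\<i> / z) - Re (\<i> / z) * Im (1 / z) = Im (cnj (1 / z) * (\<i> / z))"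
      by (rule Re_Im_cross)
    also have "cnj (1 / z) * (\<i> / z) = \<i> / of_real ((norm z)\<^sup>2)"
      by (simp add: complex_norm_square mult.commute del: of_real_power)
    finally show ?thesis by (simp only: Im_divide_of_real) simp
  qed
  have large: "exp (B + 1) \<le> norm z" if "z \<in> path_image (sqpath R)" for z
    using sqpath_norm[OF R0 that] R by linarith
  show "(LINT z:upper_sq R|lborel. Phi A B z / (norm z)\<^sup>2) = (B - A + 1) * pi"
    using idm.stokes_half_square[OF AB R0 _ large exp_gt_zero[of "A - 1"], of 0 R] unfolding eq upper_sq_def by simp
  show "(LINT z:lower_sq R|lborel. Phi A B z / (norm z)\<^sup>2) = (B - A + 1) * pi"
    using idm.stokes_half_square[OF AB R0 _ large exp_gt_zero[of "A - 1"], of "-R" 0] unfolding eq lower_sq_def by simp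
  have "isCont (\<lambda>z. Phi A B z / (norm z)\<^sup>2) z" for z
  proof (cases "z = 0")
    case True
    show ?thesis
      by (rule isCont_locally_zero[OF idm.open_small[of "exp (A - 1)"]]) (use True AB in \<open>auto simp: Phi_small\<close>)
  next
    case False
    have "isCont (Phi A B) z" using Phi_cont[OF AB, of UNIV] by (simp add: continuous_on_eq_continuous_at)
    then show ?thesis using False by (intro continuous_intros) auto
  qed
  then have "continuous_on (sq R) (\<lambda>z. Phi A B z / (norm z)\<^sup>2)" by (simp add: continuous_at_imp_continuous_on)
  then show "set_integrable lborel (sq R) (\<lambda>z. Phi A B z / (norm z)\<^sup>2)"
    unfolding sq_def by (rule integrable_cont_cbox)
qed

lemma set_integral_mono_AE':
  fixes f g :: "complex \<Rightarrow> real"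
  assumes "set_integrable lborel S f" "set_integrable lborel S g" "AE z in lborel. z \<in> S \<longrightarrow> f z \<le> g z"
  shows "(LINT z:S|lborel. f z) \<le> (LINT z:S|lborel. g z)"
  unfolding set_lebesgue_integral_def
proof (rule integral_mono_AE)
  show "AE z in lborel. indicat_real S z *\<^sub>R f z \<le> indicat_real S z *\<^sub>R g z"
    using assms(3) by eventually_elim (auto simp: indicator_def)
qed (use assms in \<open>auto simp: set_integrable_def\<close>)

context qc_data
begin

text \<open>The preimage of a disc under the homeomorphism is bounded.\<close>

lemma proper: "\<exists>R0. \<forall>z. norm z \<ge> R0 \<longrightarrow> norm (G z) \<ge> M"
proof -
  have "bounded (h ` cball 0 M)" by (intro compact_imp_bounded compact_continuous_image hc) simp
  then obtain b where b: "\<forall>x\<in>h ` cball 0 M. norm x \<le> b" by (auto simp: bounded_iff)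
  show ?thesis
  proof (intro exI[of _ "b + 1"] allI impI)
    fix z :: complex assume z: "norm z \<ge> b + 1"
    show "norm (G z) \<ge> M"
    proof (rule ccontr)
      assume "\<not> norm (G z) \<ge> M"
      then have "h (G z) \<in> h ` cball 0 M" by (intro imageI) simp
      then show False using b z by (force simp: hG)
    qed
  qed
qed

lemma log_jacobian_nonneg: assumes "A \<le> B" shows "AE z in lborel. log_jacobian A B z \<ge> 0"
  using J_nonneg by eventually_elim (simp add: log_jacobian_def Phi_bounds[OF assms])

text \<open>The bound for large squares suffices, since the density is nonnegative.\<close>

lemma area_bound_all_squares:
  assumes AB: "A \<le> B" and R: "R > 0"
  shows "set_integrable lborel (sq R) (log_jacobian A B)" "(LINT z:sq R|lborel. log_jacobian A B z) \<le> 2 * pi * (B - A + 1)"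
proof -
  obtain R0 where R0: "\<And>z. norm z \<ge> R0 \<Longrightarrow> norm (G z) \<ge> exp (B + 1) + 1" using proper by blast
  define R' where "R' = max R R0"
  have R': "R' > 0" "R \<le> R'" "R0 \<le> R'" using R by (auto simp: R'_def)
  have large: "norm (G z) \<ge> exp (B + 1) + 1" if "z \<in> path_image (sqpath R')" for z
    using R0 sqpath_norm[OF R'(1) that] R'(3) by auto
  note a = area_bound[OF AB R'(1) large]
  have sub: "sq R \<subseteq> sq R'" using R' by (auto simp: in_sq)
  show i: "set_integrable lborel (sq R) (log_jacobian A B)"
    by (rule set_integrable_subset[OF a(1)]) (use sub in auto)
  have "(LINT z:sq R|lborel. log_jacobian A B z) \<le> (LINT z:sq R'|lborel. log_jacobian A B z)"
    unfolding set_lebesgue_integral_def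
  proof (rule integral_mono_AE)
    show "AE z in lborel. indicat_real (sq R) z *\<^sub>R log_jacobian A B z \<le> indicat_real (sq R') z *\<^sub>R log_jacobian A B z"
      using log_jacobian_nonneg[OF AB] by eventually_elim (use sub in \<open>auto simp: indicator_def\<close>)
  qed (use i a(1) in \<open>auto simp: set_integrable_def\<close>)
  then show "(LINT z:sq R|lborel. log_jacobian A B z) \<le> 2 * pi * (B - A + 1)" using a(2) by linarith
qed

text \<open>The preimage of the segment from \<open>0\<close> to \<open>G w\<close> connects
  \<open>0\<close> to \<open>w\<close> and so crosses the boundary of the square at a point with a
  small image. The preimage of the ray from \<open>G z\<close> to infinity connects
  \<open>z\<close> to infinity and crosses it at a point with a large image.\<close>

lemma crossing_points:
  assumes z: "z \<in> sq r" "z \<noteq> 0" and w: "w \<notin> sq r" and r: "r > 0"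
  shows "\<exists>u\<in>path_image (sqpath r). \<exists>v\<in>path_image (sqpath r). norm (G u) \<le> norm (G w) \<and> norm (G v) \<ge> norm (G z)"
proof -
  have fr: "frontier (sq r) = path_image (sqpath r)" using r by (intro frontier_sq) simp
  have h0: "h 0 = 0" using hG[of 0] G0 by simp
  define T where "T = h ` closed_segment 0 (G w)"
  have cT: "connected T" unfolding T_def by (intro connected_continuous_image hc connected_segment)
  have "0 \<in> T \<inter> sq r" using h0 r by (force simp: T_def in_sq)
  moreover have "w \<in> T - sq r" using w hG[of w] by (force simp: T_def)
  ultimately have "T \<inter> frontier (sq r) \<noteq> {}" using connected_Int_frontier[OF cT, of "sq r"] by blast
  then obtain s where s: "s \<in> closed_segment 0 (G w)" "h s \<in> path_image (sqpath r)" by (auto simp: T_def fr)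
  have u: "norm (G (h s)) \<le> norm (G w)"
    using segment_bound1[OF s(1)] by (simp add: Gh)
  define Ry where "Ry = (\<lambda>t. t *\<^sub>R G z) ` {1..}"
  define T' where "T' = h ` Ry"
  have cR: "connected Ry" unfolding Ry_def by (intro connected_continuous_image continuous_intros connected_Ici)
  have cT': "connected T'" unfolding T'_def by (intro connected_continuous_image hc cR)
  have Gz: "norm (G z) > 0" using z(2) G_eq_0[of z] by simp
  have "z \<in> T' \<inter> sq r"
  proof -
    have "G z \<in> Ry" unfolding Ry_def by (rule image_eqI[of _ _ 1]) auto
    then show ?thesis using z(1) hG[of z] by (force simp: T'_def)
  qed
  moreover have "\<not> T' \<subseteq> sq r"
  proof
    assume "T' \<subseteq> sq r"
    then have "G ` T' \<subseteq> G ` sq r" by (rule image_mono)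
    moreover have "G ` T' = Ry" by (auto simp: T'_def image_image Gh)
    ultimately have "Ry \<subseteq> G ` sq r" by simp
    moreover have "bounded (G ` sq r)" by (intro compact_imp_bounded compact_continuous_image Gc) (simp add: sq_def)
    ultimately have "bounded Ry" using bounded_subset by blast
    then obtain b where b: "\<forall>x\<in>Ry. norm x \<le> b" by (auto simp: bounded_iff)
    define t where "t = max 1 ((b + 1) / norm (G z))"
    have "t *\<^sub>R G z \<in> Ry" unfolding Ry_def by (rule imageI) (simp add: t_def)
    then have "t * norm (G z) \<le> b" using b by (force simp: t_def)
    moreover have "(b + 1) / norm (G z) * norm (G z) \<le> t * norm (G z)" by (intro mult_right_mono) (auto simp: t_def)
    ultimately show False using Gz by simp
  qed
  ultimately have "T' \<inter> frontier (sq r) \<noteq> {}" using connected_Int_frontier[OF cT', of "sq r"] by blast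
  then obtain t where t: "t \<ge> 1" "h (t *\<^sub>R G z) \<in> path_image (sqpath r)" by (auto simp: T'_def Ry_def fr)
  have "norm (G z) \<le> norm (G (h (t *\<^sub>R G z)))"
    using t(1) Gz mult_right_mono[of 1 t "norm (G z)"] by (simp add: Gh)
  then show ?thesis using s(2) u t(2) by blast
qed

definition qs_const :: real where "qs_const = 8192 * pi * K + 1"

lemma qs_pos: "qs_const > 0" using K by (simp add: qs_const_def add_pos_pos)

text \<open>If \<open>ln |G z|\<close> exceeds \<open>ln |G w|\<close> by \<open>m\<close>, then
  \<open>ln |G|\<close> oscillates by \<open>m\<close> on the boundary of every square between
  \<open>|z|\<close> and \<open>2 |z|\<close>. By the crossing estimate and the
  arithmetic-geometric mean inequality, \<open>m\<close> is at most a constant plus a small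
  multiple of the logarithmic area of the annulus between the two image values, which is at most
  \<open>2 \<pi> (m + 1)\<close>; so \<open>m\<close> is bounded.\<close>

lemma quasi_symmetry:
  assumes z: "z \<noteq> 0" and w: "norm w \<ge> 5 * norm z"
  shows "ln (norm (G z)) \<le> ln (norm (G w)) + qs_const"
proof (cases "ln (norm (G w)) \<le> ln (norm (G z))")
  case False
  then show ?thesis using qs_pos by linarith
next
  case AB: True
  define A where "A = ln (norm (G w))"
  define B where "B = ln (norm (G z))"
  define R where "R = norm z"
  have AB: "A \<le> B" using AB by (simp add: A_def B_def)
  have R: "R > 0" using z by (simp add: R_def)
  have w0: "w \<noteq> 0" using w R by (auto simp: R_def)
  have eA: "exp A = norm (G w)" and eB: "exp B = norm (G z)"
    using z w0 G_eq_0 by (simp_all add: A_def B_def)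
  have cr: "\<exists>u\<in>path_image (sqpath r). \<exists>v\<in>path_image (sqpath r). B - A \<le> Theta A B (G v) - Theta A B (G u)"
    if r: "R \<le> r" "r \<le> 2 * R" for r
  proof -
    have "z \<in> sq r" using r abs_Re_le_cmod[of z] abs_Im_le_cmod[of z] by (auto simp: in_sq R_def)
    moreover have "w \<notin> sq r"
    proof
      assume "w \<in> sq r"
      then have "norm w \<le> 2 * r" using sq_sub_cball[of r] by auto
      then show False using w r R unfolding R_def by linarith
    qed
    ultimately obtain u v where uv: "u \<in> path_image (sqpath r)" "v \<in> path_image (sqpath r)"
      "norm (G u) \<le> norm (G w)" "norm (G v) \<ge> norm (G z)" using crossing_points[of z r w] z r R by auto
    have "Theta A B (G u) \<le> 1 / 2" by (rule Theta_A[OF AB]) (use uv eA in simp)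
    moreover have "Theta A B (G v) \<ge> B - A + 1 / 2" by (rule Theta_B[OF AB]) (use uv eB in simp)
    ultimately show ?thesis using uv by (intro bexI[of _ u] bexI[of _ v]) auto
  qed
  have c: "set_integrable lborel (sq (2 * R)) (log_gradient_lim A B)" "(B - A) * R \<le> 8 * (LINT z:sq (2 * R)|lborel. log_gradient_lim A B z)"
    by (rule crossing_limit[OF AB R], rule cr, assumption+)+
  (* With this weight the term with the logarithmic area contributes half of B - A + 1 and can be
     absorbed. *)
  define l where "l = 32 * pi / R"
  have l: "l > 0" using R by (simp add: l_def)
  have ar: "set_integrable lborel (sq (2 * R)) (log_jacobian A B)" "(LINT z:sq (2 * R)|lborel. log_jacobian A B z) \<le> 2 * pi * (B - A + 1)"
    using area_bound_all_squares[OF AB, of "2 * R"] R by auto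
  have ci: "set_integrable lborel (sq (2 * R)) (\<lambda>z. l * K)"
    unfolding sq_def by (rule integrable_cont_cbox) simp
  have pt: "AE z in lborel. z \<in> sq (2 * R) \<longrightarrow> log_gradient_lim A B z \<le> l * K + 1 / l * log_jacobian A B z"
    using dist log_jacobian_nonneg[OF AB]
  proof eventually_elim
    case (elim z)
    have J: "(norm (p z))\<^sup>2 \<le> K * J z" "(norm (q z))\<^sup>2 \<le> K * J z"
      using spec[OF spec[OF elim(1), of 1], of 0] spec[OF spec[OF elim(1), of 0], of 1] by (simp_all add: J_def)
    have b: "Phi A B (G z) / norm (G z) * norm k \<le> l / 2 * K + log_jacobian A B z / (2 * l)" if k: "(norm k)\<^sup>2 \<le> K * J z" for k :: complex
    proof -
      have P: "0 \<le> Phi A B (G z)" "(Phi A B (G z))\<^sup>2 \<le> Phi A B (G z)"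
        using Phi_bounds[OF AB] mult_left_mono[OF Phi_bounds(2)[OF AB] Phi_bounds(1)[OF AB]] by (auto simp: power2_eq_square)
      have KJ: "K * J z \<ge> 0" using k zero_le_power2 order_trans by blast
      have "(Phi A B (G z) / norm (G z) * norm k)\<^sup>2 = (Phi A B (G z))\<^sup>2 * (norm k)\<^sup>2 / (norm (G z))\<^sup>2"
        by (simp add: power_mult_distrib power_divide)
      also have "\<dots> \<le> Phi A B (G z) * (K * J z) / (norm (G z))\<^sup>2"
        using P k KJ by (intro divide_right_mono mult_mono) auto
      also have "\<dots> = K * log_jacobian A B z" by (simp add: log_jacobian_def)
      finally have "\<bar>Phi A B (G z) / norm (G z) * norm k\<bar> \<le> l / 2 * K + log_jacobian A B z / (2 * l)"
        by (rule am_gm_sq) (use K elim l in auto)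
      then show ?thesis by linarith
    qed
    have "log_gradient_lim A B z \<le> (l / 2 * K + log_jacobian A B z / (2 * l)) + (l / 2 * K + log_jacobian A B z / (2 * l))"
      unfolding log_gradient_lim_def using b[OF J(1)] b[OF J(2)] by linarith
    also have "\<dots> = l * K + 1 / l * log_jacobian A B z" using l by (simp add: field_simps)
    finally show ?case by simp
  qed
  have "(LINT z:sq (2 * R)|lborel. log_gradient_lim A B z) \<le> (LINT z:sq (2 * R)|lborel. l * K + 1 / l * log_jacobian A B z)"
    using pt by (intro set_integral_mono_AE' c(1) set_integral_add(1) ci set_integrable_mult_right ar(1)) auto
  also have "\<dots> = l * K * (4 * R)\<^sup>2 + 1 / l * (LINT z:sq (2 * R)|lborel. log_jacobian A B z)"
  proof -
    have "measure lborel (sq (2 * R)) = (4 * R)\<^sup>2"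
      using R unfolding sq_def by (subst measure_lborel_cbox_eq) (auto simp: Basis_complex_def power2_eq_square)
    moreover have "emeasure lborel (sq (2 * R)) < \<infinity>" unfolding sq_def by (rule emeasure_lborel_cbox_finite)
    ultimately show ?thesis using ar(1) ci
      by (subst set_integral_add(2)) (auto simp: set_lebesgue_integral_def mult.commute)
  qed
  also have "\<dots> \<le> l * K * (4 * R)\<^sup>2 + 1 / l * (2 * pi * (B - A + 1))"
    using ar(2) l by (intro add_left_mono mult_left_mono) auto
  finally have "(LINT z:sq (2 * R)|lborel. log_gradient_lim A B z) \<le> l * K * (4 * R)\<^sup>2 + 1 / l * (2 * pi * (B - A + 1))" .
  from order_trans[OF c(2) mult_left_mono[OF this, of 8]]
  have "(B - A) * R \<le> 8 * (l * K * (4 * R)\<^sup>2 + 1 / l * (2 * pi * (B - A + 1)))" by simp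
  also have "\<dots> = (4096 * pi * K + (B - A + 1) / 2) * R"
    using R by (simp add: l_def field_simps power2_eq_square)
  finally have "B - A \<le> 4096 * pi * K + (B - A + 1) / 2" using R by simp
  then have "B - A \<le> 8192 * pi * K + 1" by (simp add: field_simps)
  then show ?thesis by (simp add: A_def B_def qs_const_def)
qed

text \<open>Each half of the plane contributes \<open>\<pi> c\<close> to the integral of
  \<open>Phi (G) d ln |G| \<and> d arg z\<close>. Its integrand is, up to the cut-off, the radial
  derivative of \<open>ln |G|\<close> divided by \<open>|z|\<close>, hence its square is at most
  \<open>D k log_jacobian\<close>, where \<open>k\<close> is the density of logarithmic area in
  the domain, \<open>D = 1\<close> in the upper and \<open>D = K\<close> in the lower half-plane.
  The lower half is weighted by \<open>1 / K\<close>, so that both halves use the same multiple of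
  \<open>log_jacobian\<close> and only its total integral matters.\<close>

lemma annulus_width_upper:
  assumes AB: "A \<le> B" and AB': "A' \<le> B'" and sup: "\<And>z. Phi A B (G z) \<noteq> 0 \<Longrightarrow> Phi A' B' z = 1"
  shows "(1 + 1 / K) * (B - A + 1) \<le> 2 * (B' - A' + 1)"
proof -
  obtain R0 where R0: "\<And>z. norm z \<ge> R0 \<Longrightarrow> norm (G z) \<ge> exp (B + 1) + 1" using proper by blast
  define R where "R = max R0 (exp (B' + 1))"
  have R': "R \<ge> exp (B' + 1)" "R \<ge> R0" by (auto simp: R_def)
  have R: "R > 0" using R'(1) exp_gt_zero[of "B' + 1"] by linarith
  have large: "norm (G z) \<ge> exp (B + 1) + 1" if "z \<in> path_image (sqpath R)" for z
    using R0 sqpath_norm[OF R that] R'(2) by auto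
  define c where "c = B - A + 1"
  define c' where "c' = B' - A' + 1"
  define I where "I z = Phi A B (G z) * (Re (p z / G z) * Im (\<i> / z) - Re (q z / G z) * Im (1 / z))" for z
  have IU: "set_integrable lborel (upper_sq R) I" "(LINT z:upper_sq R|lborel. I z) = c * pi"
    using half_square_limit[OF AB R _ large, of 0 R] unfolding I_def upper_sq_def c_def by auto
  have IL: "set_integrable lborel (lower_sq R) I" "(LINT z:lower_sq R|lborel. I z) = c * pi"
    using half_square_limit[OF AB R _ large, of "-R" 0] unfolding I_def lower_sq_def c_def by auto
  note ja = area_bound_all_squares[OF AB R]
  have js: "(LINT z:upper_sq R|lborel. log_jacobian A B z) + (LINT z:lower_sq R|lborel. log_jacobian A B z) \<le> 2 * pi * c"
    "set_integrable lborel (upper_sq R) (log_jacobian A B)" "set_integrable lborel (lower_sq R) (log_jacobian A B)"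
    using half_sq_split[OF less_imp_le[OF R] ja(1)] ja(2) by (auto simp: c_def)
  note an = annulus_area[OF AB' R'(1), folded c'_def]
  note ai = half_sq_split(2,3)[OF less_imp_le[OF R] an(3)]
  define k where "k z = Phi A' B' z / (norm z)\<^sup>2" for z
  have k0: "k z \<ge> 0" for z using Phi_bounds(1)[OF AB'] by (simp add: k_def)
  (* The vector with coordinates Re z and Im z points in the radial direction. *)
  have Isq: "(I z)\<^sup>2 \<le> D * k z * log_jacobian A B z"
    if d: "(norm (of_real (Re z) * p z + of_real (Im z) * q z))\<^sup>2 \<le> D * ((Re z)\<^sup>2 + (Im z)\<^sup>2) * J z" and D: "D \<ge> 0"
      and J: "J z \<ge> 0" for D z
  proof (cases "z = 0")
    case True
    then show ?thesis by (simp add: I_def k_def)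
  next
    case False
    have P: "0 \<le> Phi A B (G z)" "Phi A B (G z) \<le> Phi A' B' z"
      using Phi_bounds[OF AB] Phi_bounds(1)[OF AB'] sup[of z] by (cases "Phi A B (G z) = 0"; auto)+
    define X where "X = of_real (Re z) * p z + of_real (Im z) * q z"
    have I: "I z = Phi A B (G z) / (norm z)\<^sup>2 * Re (X / G z)"
    proof -
      have "Im (\<i> / z) = Re z / (norm z)\<^sup>2" "Im (1 / z) = - Im z / (norm z)\<^sup>2"
        by (simp_all add: Im_divide cmod_power2)
      moreover have "X / G z = of_real (Re z) * (p z / G z) + of_real (Im z) * (q z / G z)"
        by (simp add: X_def add_divide_distrib)
      then have "Re (X / G z) = Re z * Re (p z / G z) + Im z * Re (q z / G z)"
        by (simp only: plus_complex.sel times_complex.sel Re_complex_of_real Im_complex_of_real)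
      ultimately show ?thesis unfolding I_def by (simp only:) (simp add: algebra_simps add_divide_distrib)
    qed
    have "(Re (X / G z))\<^sup>2 \<le> (norm (X / G z))\<^sup>2" by (rule abs_le_square_iff[THEN iffD1]) (simp add: abs_Re_le_cmod)
    also have "\<dots> \<le> D * (norm z)\<^sup>2 * J z / (norm (G z))\<^sup>2"
      using d by (simp add: norm_divide power_divide X_def cmod_power2[of z] divide_right_mono)
    finally have r: "(Re (X / G z))\<^sup>2 \<le> D * (norm z)\<^sup>2 * J z / (norm (G z))\<^sup>2" .
    have "(I z)\<^sup>2 \<le> (Phi A B (G z) / (norm z)\<^sup>2)\<^sup>2 * (D * (norm z)\<^sup>2 * J z / (norm (G z))\<^sup>2)"
      unfolding I power_mult_distrib by (intro mult_left_mono r) auto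
    also have "\<dots> = (D * (Phi A B (G z) / (norm (G z))\<^sup>2 * J z) / (norm z)\<^sup>2) * Phi A B (G z)"
      using False by (simp add: power2_eq_square field_simps)
    also have "\<dots> \<le> (D * (Phi A B (G z) / (norm (G z))\<^sup>2 * J z) / (norm z)\<^sup>2) * Phi A' B' z"
      using P D J by (intro mult_left_mono) auto
    also have "\<dots> = D * k z * log_jacobian A B z" by (simp add: k_def log_jacobian_def mult_ac)
    finally show ?thesis .
  qed
  (* The weight that is optimal in the case of equality. *)
  define m where "m = 2 / (1 + 1 / K)"
  have K1: "1 + 1 / K > 0" using K by (simp add: add_pos_pos)
  have m: "m > 0" using K1 by (simp add: m_def)
  have ptU: "AE z in lborel. z \<in> upper_sq R \<longrightarrow> I z \<le> m / 2 * k z + 1 / (2 * m) * log_jacobian A B z"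
    using distH AE_Im_nonzero J_nonneg log_jacobian_nonneg[OF AB]
  proof eventually_elim
    case (elim z)
    show ?case
    proof
      assume "z \<in> upper_sq R"
      then have "Im z > 0" using elim(2) by (auto simp: upper_sq_def in_cbox_complex_iff)
      then have "(I z)\<^sup>2 \<le> 1 * k z * log_jacobian A B z"
        using elim(1,3) by (intro Isq) (auto simp: J_def)
      then have "\<bar>I z\<bar> \<le> m / 2 * k z + log_jacobian A B z / (2 * m)"
        by (intro am_gm_sq) (use m elim k0 in auto)
      then show "I z \<le> m / 2 * k z + 1 / (2 * m) * log_jacobian A B z" by simp
    qed
  qed
  have ptL: "AE z in lborel. z \<in> lower_sq R \<longrightarrow> 1 / K * I z \<le> m / 2 * (1 / K) * k z + 1 / (2 * m) * log_jacobian A B z"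
    using dist J_nonneg log_jacobian_nonneg[OF AB]
  proof eventually_elim
    case (elim z)
    have "(I z)\<^sup>2 \<le> K * k z * log_jacobian A B z"
      using elim(1,2) K by (intro Isq) (auto simp: J_def)
    then have "(1 / K * I z)\<^sup>2 \<le> (1 / K * k z) * log_jacobian A B z"
      using K by (simp add: power2_eq_square field_simps)
    then have "\<bar>1 / K * I z\<bar> \<le> m / 2 * (1 / K * k z) + log_jacobian A B z / (2 * m)"
      by (rule am_gm_sq) (use m elim k0 K in auto)
    then have "1 / K * I z \<le> m / 2 * (1 / K * k z) + log_jacobian A B z / (2 * m)" by (rule abs_le_D1)
    then show ?case by simp
  qed
  have eU: "c * pi \<le> m / 2 * (c' * pi) + 1 / (2 * m) * (LINT z:upper_sq R|lborel. log_jacobian A B z)"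
  proof -
    have "c * pi \<le> (LINT z:upper_sq R|lborel. m / 2 * k z + 1 / (2 * m) * log_jacobian A B z)"
      unfolding IU(2)[symmetric]
      using ptU IU(1) ai(1) js(2) by (intro set_integral_mono_AE' set_integral_add(1) set_integrable_mult_right) (auto simp: k_def)
    also have "\<dots> = m / 2 * (LINT z:upper_sq R|lborel. k z) + 1 / (2 * m) * (LINT z:upper_sq R|lborel. log_jacobian A B z)"
      using ai(1) js(2) unfolding k_def
      by (subst set_integral_add(2)) (auto simp only: set_integral_mult_right intro!: set_integrable_mult_right)
    also have "(LINT z:upper_sq R|lborel. k z) = c' * pi" unfolding k_def by (rule an(1))
    finally show ?thesis .
  qed
  have eL: "1 / K * (c * pi) \<le> m / 2 * (1 / K) * (c' * pi) + 1 / (2 * m) * (LINT z:lower_sq R|lborel. log_jacobian A B z)"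
  proof -
    have "1 / K * (c * pi) = (LINT z:lower_sq R|lborel. 1 / K * I z)"
      unfolding set_integral_mult_right IL(2) ..
    also have "\<dots> \<le> (LINT z:lower_sq R|lborel. m / 2 * (1 / K) * k z + 1 / (2 * m) * log_jacobian A B z)"
      using ptL IL(1) ai(2) js(3) by (intro set_integral_mono_AE' set_integral_add(1) set_integrable_mult_right) (auto simp: k_def)
    also have "\<dots> = m / 2 * (1 / K) * (LINT z:lower_sq R|lborel. k z) + 1 / (2 * m) * (LINT z:lower_sq R|lborel. log_jacobian A B z)"
      using ai(2) js(3) unfolding k_def
      by (subst set_integral_add(2)) (auto simp only: set_integral_mult_right intro!: set_integrable_mult_right)
    also have "(LINT z:lower_sq R|lborel. k z) = c' * pi" unfolding k_def by (rule an(2))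
    finally show ?thesis .
  qed
  have "(1 + 1 / K) * (c * pi) \<le> m / 2 * (1 + 1 / K) * (c' * pi) + 1 / (2 * m) * (2 * pi * c)"
  proof -
    have "1 / (2 * m) * ((LINT z:upper_sq R|lborel. log_jacobian A B z) + (LINT z:lower_sq R|lborel. log_jacobian A B z)) \<le> 1 / (2 * m) * (2 * pi * c)"
      using js(1) m by (intro mult_left_mono) auto
    moreover have "c * pi + 1 / K * (c * pi) \<le> (m / 2 * (c' * pi) + m / 2 * (1 / K) * (c' * pi)) + 1 / (2 * m) *
        ((LINT z:upper_sq R|lborel. log_jacobian A B z) + (LINT z:lower_sq R|lborel. log_jacobian A B z))"
      unfolding distrib_left using add_mono[OF eU eL] by (simp only: add_ac)
    moreover have "m / 2 * (1 + 1 / K) * (c' * pi) = m / 2 * (c' * pi) + m / 2 * (1 / K) * (c' * pi)"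
      "(1 + 1 / K) * (c * pi) = c * pi + 1 / K * (c * pi)"
      by (simp_all only: distrib_left distrib_right mult_1_right mult_1)
    ultimately show ?thesis by linarith
  qed
  also have "m / 2 * (1 + 1 / K) = 1" using K1 by (simp add: m_def)
  also have "1 / (2 * m) * (2 * pi * c) = (1 + 1 / K) / 2 * (c * pi)" using K1 by (simp add: m_def)
  finally have F: "(1 + 1 / K) * (c * pi) \<le> c' * pi + (1 + 1 / K) / 2 * (c * pi)" by simp
  have "(1 + 1 / K) * (c * pi) = 2 * ((1 + 1 / K) / 2 * (c * pi))" by simp
  with F have "(1 + 1 / K) / 2 * (c * pi) \<le> c' * pi" by linarith
  then have "((1 + 1 / K) / 2 * c) * pi \<le> c' * pi" by (simp only: mult.assoc)
  then have "(1 + 1 / K) / 2 * c \<le> c'" by (rule mult_right_le_imp_le) simp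
  then show ?thesis by (simp add: c_def c'_def)
qed

text \<open>The same argument for \<open>Phi (z) d ln |z| \<and> d arg G\<close>, whose integrand is, up to
  the cut-off, the tangential derivative of \<open>arg G\<close> divided by \<open>|z|\<close>.
  This integral is known only over both halves together, so they enter with equal weights.\<close>

lemma annulus_width_lower:
  assumes AB: "A \<le> B" and AB': "A' \<le> B'" and sup: "\<And>z. Phi A' B' z \<le> Phi A B (G z)"
  shows "2 * (B' - A' + 1) \<le> (1 + K) * (B - A + 1)"
proof -
  define R where "R = exp (B' + 1)"
  have R: "R > 0" and R': "R \<ge> exp (B' + 1)" by (auto simp: R_def)
  define c where "c = B - A + 1"
  define c' where "c' = B' - A' + 1"
  define I where "I z = Phi A' B' z * (Re (1 / z) * Im (q z / G z) - Re (\<i> / z) * Im (p z / G z))" for z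
  have II: "set_integrable lborel (sq R) I" "\<bar>LINT z:sq R|lborel. I z\<bar> = 2 * pi * c'"
    using angle_limit[OF AB' R'] unfolding I_def c'_def by auto
  have Ia: "set_integrable lborel (sq R) (\<lambda>z. \<bar>I z\<bar>)" using set_integrable_abs[OF II(1)] by simp
  note Is = half_sq_split[OF less_imp_le[OF R] Ia]
  note ja = area_bound_all_squares[OF AB R]
  have js: "(LINT z:upper_sq R|lborel. log_jacobian A B z) + (LINT z:lower_sq R|lborel. log_jacobian A B z) \<le> 2 * pi * c"
    "set_integrable lborel (upper_sq R) (log_jacobian A B)" "set_integrable lborel (lower_sq R) (log_jacobian A B)"
    using half_sq_split[OF less_imp_le[OF R] ja(1)] ja(2) by (auto simp: c_def)
  note an = annulus_area[OF AB' R', folded c'_def]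
  note ai = half_sq_split(2,3)[OF less_imp_le[OF R] an(3)]
  define k where "k z = Phi A' B' z / (norm z)\<^sup>2" for z
  have k0: "k z \<ge> 0" for z using Phi_bounds(1)[OF AB'] by (simp add: k_def)
  (* The vector with coordinates - Im z and Re z points in the tangential direction. *)
  have Isq: "(I z)\<^sup>2 \<le> D * k z * log_jacobian A B z"
    if d: "(norm (of_real (- Im z) * p z + of_real (Re z) * q z))\<^sup>2 \<le> D * ((- Im z)\<^sup>2 + (Re z)\<^sup>2) * J z" and D: "D \<ge> 0"
      and J: "J z \<ge> 0" for D z
  proof (cases "z = 0")
    case True
    then show ?thesis by (simp add: I_def k_def)
  next
    case False
    have P: "0 \<le> Phi A' B' z" "Phi A' B' z \<le> Phi A B (G z)" using Phi_bounds(1)[OF AB'] sup by auto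
    define X where "X = of_real (- Im z) * p z + of_real (Re z) * q z"
    have I: "I z = Phi A' B' z / (norm z)\<^sup>2 * Im (X / G z)"
    proof -
      have "Re (1 / z) = Re z / (norm z)\<^sup>2" "Re (\<i> / z) = Im z / (norm z)\<^sup>2"
        by (simp_all add: Re_divide cmod_power2)
      moreover have "X / G z = of_real (- Im z) * (p z / G z) + of_real (Re z) * (q z / G z)"
        by (simp add: X_def add_divide_distrib diff_divide_distrib)
      then have "Im (X / G z) = - Im z * Im (p z / G z) + Re z * Im (q z / G z)"
        by (simp only: plus_complex.sel times_complex.sel Re_complex_of_real Im_complex_of_real)
      ultimately show ?thesis unfolding I_def by (simp only:) (simp add: algebra_simps add_divide_distrib)
    qed
    have "(Im (X / G z))\<^sup>2 \<le> (norm (X / G z))\<^sup>2" by (rule abs_le_square_iff[THEN iffD1]) (simp add: abs_Im_le_cmod)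
    also have "\<dots> \<le> D * (norm z)\<^sup>2 * J z / (norm (G z))\<^sup>2"
      using d by (simp add: norm_divide power_divide X_def cmod_power2[of z] divide_right_mono add.commute)
    finally have r: "(Im (X / G z))\<^sup>2 \<le> D * (norm z)\<^sup>2 * J z / (norm (G z))\<^sup>2" .
    have "(I z)\<^sup>2 \<le> (Phi A' B' z / (norm z)\<^sup>2)\<^sup>2 * (D * (norm z)\<^sup>2 * J z / (norm (G z))\<^sup>2)"
      unfolding I power_mult_distrib by (intro mult_left_mono r) auto
    also have "\<dots> = (D * (Phi A' B' z / (norm z)\<^sup>2) * (J z / (norm (G z))\<^sup>2)) * Phi A' B' z"
      using False by (simp add: power2_eq_square field_simps)
    also have "\<dots> \<le> (D * (Phi A' B' z / (norm z)\<^sup>2) * (J z / (norm (G z))\<^sup>2)) * Phi A B (G z)"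
      using P D J by (intro mult_left_mono) auto
    also have "\<dots> = D * k z * log_jacobian A B z" by (simp add: k_def log_jacobian_def mult_ac)
    finally show ?thesis .
  qed
  (* The weight that is optimal in the case of equality. *)
  define m where "m = 2 / (1 + K)"
  have m: "m > 0" using K by (simp add: m_def)
  have ptU: "AE z in lborel. z \<in> upper_sq R \<longrightarrow> \<bar>I z\<bar> \<le> m / 2 * k z + 1 / (2 * m) * log_jacobian A B z"
    using distH AE_Im_nonzero J_nonneg log_jacobian_nonneg[OF AB]
  proof eventually_elim
    case (elim z)
    show ?case
    proof
      assume "z \<in> upper_sq R"
      then have im: "Im z > 0" using elim(2) by (auto simp: upper_sq_def in_cbox_complex_iff)
      have "(I z)\<^sup>2 \<le> 1 * k z * log_jacobian A B z"
      proof (rule Isq)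
        show "(norm (of_real (- Im z) * p z + of_real (Re z) * q z))\<^sup>2 \<le> 1 * ((- Im z)\<^sup>2 + (Re z)\<^sup>2) * J z"
          using spec[OF spec[OF mp[OF elim(1) im], of "- Im z"], of "Re z"] by (simp only: J_def mult_1)
      qed (use elim(3) in auto)
      then have "\<bar>I z\<bar> \<le> m / 2 * k z + log_jacobian A B z / (2 * m)"
        by (intro am_gm_sq) (use m elim k0 in auto)
      then show "\<bar>I z\<bar> \<le> m / 2 * k z + 1 / (2 * m) * log_jacobian A B z" by simp
    qed
  qed
  have ptL: "AE z in lborel. z \<in> lower_sq R \<longrightarrow> \<bar>I z\<bar> \<le> m / 2 * K * k z + 1 / (2 * m) * log_jacobian A B z"
    using dist J_nonneg log_jacobian_nonneg[OF AB]
  proof eventually_elim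
    case (elim z)
    have "(I z)\<^sup>2 \<le> K * k z * log_jacobian A B z"
    proof (rule Isq)
      show "(norm (of_real (- Im z) * p z + of_real (Re z) * q z))\<^sup>2 \<le> K * ((- Im z)\<^sup>2 + (Re z)\<^sup>2) * J z"
        using spec[OF spec[OF elim(1), of "- Im z"], of "Re z"] by (simp only: J_def)
    qed (use elim(2) K in auto)
    then have "\<bar>I z\<bar> \<le> m / 2 * (K * k z) + log_jacobian A B z / (2 * m)"
      by (rule am_gm_sq) (use m elim k0 K in auto)
    then show ?case by simp
  qed
  have eU: "(LINT z:upper_sq R|lborel. \<bar>I z\<bar>) \<le> m / 2 * (c' * pi) + 1 / (2 * m) * (LINT z:upper_sq R|lborel. log_jacobian A B z)"
  proof -
    have "(LINT z:upper_sq R|lborel. \<bar>I z\<bar>) \<le> (LINT z:upper_sq R|lborel. m / 2 * k z + 1 / (2 * m) * log_jacobian A B z)"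
      using ptU Is(2) ai(1) js(2) by (intro set_integral_mono_AE' set_integral_add(1) set_integrable_mult_right) (auto simp: k_def)
    also have "\<dots> = m / 2 * (LINT z:upper_sq R|lborel. k z) + 1 / (2 * m) * (LINT z:upper_sq R|lborel. log_jacobian A B z)"
      using ai(1) js(2) unfolding k_def
      by (subst set_integral_add(2)) (auto simp only: set_integral_mult_right intro!: set_integrable_mult_right)
    also have "(LINT z:upper_sq R|lborel. k z) = c' * pi" unfolding k_def by (rule an(1))
    finally show ?thesis .
  qed
  have eL: "(LINT z:lower_sq R|lborel. \<bar>I z\<bar>) \<le> m / 2 * K * (c' * pi) + 1 / (2 * m) * (LINT z:lower_sq R|lborel. log_jacobian A B z)"
  proof -
    have "(LINT z:lower_sq R|lborel. \<bar>I z\<bar>) \<le> (LINT z:lower_sq R|lborel. m / 2 * K * k z + 1 / (2 * m) * log_jacobian A B z)"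
      using ptL Is(3) ai(2) js(3) by (intro set_integral_mono_AE' set_integral_add(1) set_integrable_mult_right) (auto simp: k_def)
    also have "\<dots> = m / 2 * K * (LINT z:lower_sq R|lborel. k z) + 1 / (2 * m) * (LINT z:lower_sq R|lborel. log_jacobian A B z)"
      using ai(2) js(3) unfolding k_def
      by (subst set_integral_add(2)) (auto simp only: set_integral_mult_right intro!: set_integrable_mult_right)
    also have "(LINT z:lower_sq R|lborel. k z) = c' * pi" unfolding k_def by (rule an(2))
    finally show ?thesis .
  qed
  have "2 * pi * c' \<le> (LINT z:sq R|lborel. \<bar>I z\<bar>)"
    using set_integral_norm_bound[OF II(1)] unfolding II(2)[symmetric] by simp
  also have "\<dots> \<le> m / 2 * (1 + K) * (c' * pi) + 1 / (2 * m) * (2 * pi * c)"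
  proof -
    have "1 / (2 * m) * ((LINT z:upper_sq R|lborel. log_jacobian A B z) + (LINT z:lower_sq R|lborel. log_jacobian A B z)) \<le> 1 / (2 * m) * (2 * pi * c)"
      using js(1) m by (intro mult_left_mono) auto
    moreover have "(LINT z:sq R|lborel. \<bar>I z\<bar>) \<le> (m / 2 * (c' * pi) + m / 2 * K * (c' * pi)) + 1 / (2 * m) *
        ((LINT z:upper_sq R|lborel. log_jacobian A B z) + (LINT z:lower_sq R|lborel. log_jacobian A B z))"
      unfolding Is(1)[symmetric] distrib_left using add_mono[OF eU eL] by (simp only: add_ac)
    moreover have "m / 2 * (1 + K) * (c' * pi) = m / 2 * (c' * pi) + m / 2 * K * (c' * pi)"
      by (simp only: distrib_left distrib_right mult_1_right mult_1)
    ultimately show ?thesis by linarith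
  qed
  also have "m / 2 * (1 + K) = 1" using K by (simp add: m_def)
  also have "1 / (2 * m) * (2 * pi * c) = (1 + K) / 2 * c * pi" using K by (simp add: m_def)
  finally have "c' * pi \<le> (1 + K) / 2 * c * pi" by simp
  then have "c' \<le> (1 + K) / 2 * c" by simp
  then show ?thesis by (simp add: c_def c'_def)
qed

text \<open>Where the image cut-off from \<open>A\<close> to \<open>B\<close> does not vanish,
  \<open>|w|\<close> is at least \<open>1\<close> by the choice of \<open>A\<close> and at most
  \<open>5 |z|\<close> by quasi-symmetry. So the image annulus pulls back into the domain annulus
  with logarithmic bounds \<open>0\<close> and \<open>ln (5 |z|)\<close>.\<close>

lemma growth_upper: "\<exists>C. \<forall>z. norm z \<ge> 1 \<longrightarrow> ln (norm (G z)) \<le> 2 * K / (K + 1) * ln (norm z) + C"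
proof -
  have "bounded (G ` cball 0 1)" by (intro compact_imp_bounded compact_continuous_image Gc) simp
  then obtain b where b: "\<forall>x\<in>G ` cball 0 1. norm x \<le> b" by (auto simp: bounded_iff)
  define A where "A = ln (max 1 b) + 1"
  have A: "norm (G w) \<le> exp (A - 1)" if "norm w \<le> 1" for w
  proof -
    have "norm (G w) \<le> b" using b that by auto
    also have "b \<le> exp (A - 1)" by (simp add: A_def)
    finally show ?thesis .
  qed
  have A0: "A \<ge> 0" by (simp add: A_def add_nonneg_nonneg)
  have KK: "2 * K / (K + 1) > 0" using K by simp
  define C where "C = 2 * K / (K + 1) * (ln 5 + 1) + A + qs_const + 1"
  show ?thesis
  proof (intro exI[of _ C] allI impI)
    fix z :: complex assume z: "norm z \<ge> 1"
    then have z0: "z \<noteq> 0" by auto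
    have lz: "ln (norm z) \<ge> 0" using z by simp
    define B where "B = ln (norm (G z)) - qs_const - 1"
    define B' where "B' = ln 5 + ln (norm z)"
    have l5: "ln 5 \<ge> (0::real)" by simp
    have B': "exp B' = 5 * norm z" "0 \<le> B'" using z0 lz l5 by (auto simp: B'_def exp_add)
    show "ln (norm (G z)) \<le> 2 * K / (K + 1) * ln (norm z) + C"
    proof (cases "A \<le> B")
      case False
      have "0 \<le> 2 * K / (K + 1) * ln (norm z)" "0 \<le> 2 * K / (K + 1) * (ln 5 + 1)" using KK lz l5 by (auto intro!: mult_nonneg_nonneg simp del: times_divide_eq_left)
      then show ?thesis using False by (simp only: B_def C_def)
    next
      case True
      have "(1 + 1 / K) * (B - A + 1) \<le> 2 * (B' - 0 + 1)"
      proof (rule annulus_width_upper[OF True B'(2)])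
        fix w assume nz: "Phi A B (G w) \<noteq> 0"
        have 1: "norm w \<ge> exp 0"
        proof (rule ccontr)
          assume "\<not> exp 0 \<le> norm w"
          then have "norm (G w) \<le> exp (A - 1)" by (intro A) simp
          then show False using nz Phi_small[OF True] by blast
        qed
        have 2: "norm w \<le> exp B'"
        proof (rule ccontr)
          assume "\<not> norm w \<le> exp B'"
          then have "norm w \<ge> 5 * norm z" using B' by simp
          from quasi_symmetry[OF z0 this] have "B + 1 \<le> ln (norm (G w))" by (simp add: B_def)
          moreover have "G w \<noteq> 0" using 1 G_eq_0[of w] by auto
          ultimately have "norm (G w) \<ge> exp (B + 1)" by (simp add: ln_norm_ge_iff)
          then show False using nz Phi_large[OF True] by blast
        qed
        show "Phi 0 B' w = 1" using 1 2 by (rule Phi_one)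
      qed
      then have "(K + 1) / K * (B - A + 1) \<le> 2 * (B' + 1)" using K by (simp add: field_simps)
      then have "B - A + 1 \<le> 2 * K / (K + 1) * (B' + 1)" using K by (simp add: field_simps)
      then have "ln (norm (G z)) \<le> 2 * K / (K + 1) * (B' + 1) + A + qs_const" by (simp add: B_def)
      also have "2 * K / (K + 1) * (B' + 1) = 2 * K / (K + 1) * ln (norm z) + 2 * K / (K + 1) * (ln 5 + 1)"
        unfolding B'_def by (simp only: distrib_left[symmetric]) (simp add: add_ac)
      finally show ?thesis unfolding C_def by linarith
    qed
  qed
qed

text \<open>Quasi-symmetry gives the opposite nesting: the domain annulus up to \<open>|z| / 5\<close> is
  mapped into the image annulus that ends a bounded amount above \<open>ln |G z|\<close>.\<close>

lemma growth_lower: "\<exists>C. \<forall>z. norm z \<ge> 5 * exp 1 \<longrightarrow> 2 / (K + 1) * ln (norm z) - C \<le> ln (norm (G z))"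
proof -
  (* The domain cut-off with A' = 0 is supported in norm w >= exp (-1), and such points are at
     least five times as far out as w0. *)
  define w0 where "w0 = complex_of_real (exp (-1) / 5)"
  have w0: "w0 \<noteq> 0" "norm w0 = exp (-1) / 5" by (auto simp: w0_def norm_divide simp del: of_real_divide)
  define A where "A = ln (norm (G w0)) - qs_const"
  have A: "A \<le> ln (norm (G w))" if "norm w \<ge> exp (-1)" for w
  proof -
    have "norm w \<ge> 5 * norm w0" using that w0 by simp
    from quasi_symmetry[OF w0(1) this] show ?thesis by (simp add: A_def)
  qed
  define C where "C = 2 / (K + 1) * ln 5 + qs_const - A + 1"
  show ?thesis
  proof (intro exI[of _ C] allI impI)
    fix z :: complex assume z: "norm z \<ge> 5 * exp 1"
    have z0: "z \<noteq> 0" using z by (auto simp: not_le)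
    define B where "B = ln (norm (G z)) + qs_const"
    define B' where "B' = ln (norm z) - ln 5 - 1"
    have eB': "exp (B' + 1) = norm z / 5" using z0 by (simp add: B'_def exp_diff)
    have B'0: "0 \<le> B'"
    proof -
      have "exp (1::real) \<le> exp (B' + 1)" using z unfolding eB' by linarith
      then show ?thesis by simp
    qed
    have B: "ln (norm (G w)) \<le> B" if "w \<noteq> 0" "norm w \<le> norm z / 5" for w
      using quasi_symmetry[OF that(1), of z] that(2) by (simp add: B_def)
    have AB: "A \<le> B"
    proof -
      have "A \<le> ln (norm (G 1))" by (rule A) simp
      moreover have "1 \<le> norm z / 5" using z exp_ge_add_one_self[of 1] by linarith
      then have "ln (norm (G 1)) \<le> B" by (intro B) auto
      ultimately show ?thesis by linarith
    qed
    have "2 * (B' - 0 + 1) \<le> (1 + K) * (B - A + 1)"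
    proof (rule annulus_width_lower[OF AB B'0])
      fix w
      show "Phi 0 B' w \<le> Phi A B (G w)"
      proof (cases "norm w \<le> exp (0 - 1) \<or> norm w \<ge> exp (B' + 1)")
        case True
        then have "Phi 0 B' w = 0" using Phi_small[OF B'0, of w] Phi_large[OF B'0, of w] by blast
        then show ?thesis using Phi_bounds(1)[OF AB] by simp
      next
        case False
        then have w: "norm w \<ge> exp (-1)" "norm w \<le> norm z / 5" using eB' by auto
        then have "w \<noteq> 0" by (auto simp: not_le)
        then have "G w \<noteq> 0" using G_eq_0 by simp
        then have "Phi A B (G w) = 1"
          using A[OF w(1)] B[OF \<open>w \<noteq> 0\<close> w(2)] by (intro Phi_one) (auto simp: ln_norm_ge_iff ln_norm_le_iff)
        then show ?thesis using Phi_bounds(2)[OF B'0] by simp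
      qed
    qed
    then have "2 / (K + 1) * (B' + 1) \<le> B - A + 1" using K by (simp add: field_simps)
    moreover have "2 / (K + 1) * (B' + 1) = 2 / (K + 1) * ln (norm z) - 2 / (K + 1) * ln 5"
      unfolding B'_def by (simp only: right_diff_distrib[symmetric]) simp
    ultimately show "2 / (K + 1) * ln (norm z) - C \<le> ln (norm (G z))" unfolding B_def C_def by linarith
  qed
qed

end

lemma qc_growth:
  assumes "K \<ge> 1" "g \<in> qc_conformal_maps K"
  obtains C r where "r > 0"
    "\<And>z. norm z \<ge> r \<Longrightarrow> ln (norm (g z - g 0)) \<le> 2 * K / (K + 1) * ln (norm z) + C"
    "\<And>z. norm z \<ge> r \<Longrightarrow> 2 / (K + 1) * ln (norm z) - C \<le> ln (norm (g z - g 0))"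
proof -
  obtain h p q f fx fy fxy where "qc_data K (\<lambda>z. g z - g 0) h p q f fx fy fxy"
    using qc_data_exists[OF assms] by blast
  then interpret qc_data K "\<lambda>z. g z - g 0" h p q f fx fy fxy .
  obtain C1 where C1: "\<forall>z. norm z \<ge> 1 \<longrightarrow> ln (norm (g z - g 0)) \<le> 2 * K / (K + 1) * ln (norm z) + C1"
    using growth_upper by blast
  obtain C2 where C2: "\<forall>z. norm z \<ge> 5 * exp 1 \<longrightarrow> 2 / (K + 1) * ln (norm z) - C2 \<le> ln (norm (g z - g 0))"
    using growth_lower by blast
  have e: "(1::real) \<le> 5 * exp 1" using exp_ge_add_one_self[of "1::real"] by linarith
  show thesis
  proof (rule that[of "5 * exp 1" "max C1 C2"])
    fix z :: complex assume z: "norm z \<ge> 5 * exp 1"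
    then have "norm z \<ge> 1" using e by linarith
    then show "ln (norm (g z - g 0)) \<le> 2 * K / (K + 1) * ln (norm z) + max C1 C2" using C1 by fastforce
    show "2 / (K + 1) * ln (norm z) - max C1 C2 \<le> ln (norm (g z - g 0))" using C2 z by fastforce
  qed simp
qed

section \<open>Harmonic functions and Hardy numbers of conformal images\<close>

lemma dir_deriv_cong_open:
  assumes "open S" "x \<in> S" "\<And>y. y \<in> S \<Longrightarrow> f y = g y" "g differentiable (at x)"
  shows "dir_deriv v f x = dir_deriv v g x"
proof -
  have "(f has_derivative (\<lambda>v. dir_deriv v g x)) (at x)"
    by (rule has_derivative_transform_within_open[OF has_derivative_dir_deriv[OF assms(4)] assms(1,2)]) (simp add: assms(3))
  then show ?thesis by (rule dir_deriv_eq)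
qed

lemma Re_holomorphic_deriv:
  assumes "F holomorphic_on S" "open S" "z \<in> S"
  shows "((\<lambda>z. Re (F z)) has_derivative (\<lambda>h. Re (deriv F z * h))) (at z)"
proof -
  have "(F has_derivative (\<lambda>h. deriv F z * h)) (at z)"
    using holomorphic_derivI[OF assms] by (simp add: has_field_derivative_def)
  then show ?thesis by (rule has_derivative_Re)
qed

lemma Ck_on_Re_holomorphic:
  assumes "F holomorphic_on S" "open S"
  shows "Ck_on n (\<lambda>z. Re (F z)) S"
  using assms(1)
proof (induction n arbitrary: F)
  case 0
  then show ?case by (auto intro!: continuous_intros holomorphic_on_imp_continuous_on)
next
  case (Suc n)
  note d = Re_holomorphic_deriv[OF Suc.prems assms(2)]
  have "Ck_on n (dir_deriv v (\<lambda>z. Re (F z))) S" for v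
  proof (rule Ck_on_cong[OF assms(2)])
    show "Ck_on n (\<lambda>z. Re (deriv F z * v)) S"
      by (intro Suc.IH holomorphic_intros holomorphic_deriv Suc.prems assms(2))
    show "Re (deriv F z * v) = dir_deriv v (\<lambda>z. Re (F z)) z" if "z \<in> S" for z
      using dir_deriv_eq[OF d[OF that]] by simp
  qed
  moreover have "\<forall>x\<in>S. (\<lambda>z. Re (F z)) differentiable (at x)" using d by (auto simp: differentiable_def)
  ultimately show ?case by simp
qed

lemma Re_holomorphic_harmonic:
  assumes F: "F holomorphic_on S" and S: "open S"
  shows "harmonic_on (\<lambda>z. Re (F z)) S"
  unfolding harmonic_on_def
proof (intro conjI ballI)
  show "Ck_on 2 (\<lambda>z. Re (F z)) S" by (rule Ck_on_Re_holomorphic[OF F S])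
  fix z assume z: "z \<in> S"
  have "dir_deriv v (dir_deriv v (\<lambda>z. Re (F z))) z = Re (deriv (deriv F) z * v * v)" for v
  proof -
    have h: "(\<lambda>z. deriv F z * v) holomorphic_on S" by (intro holomorphic_intros holomorphic_deriv F S)
    have e: "dir_deriv v (\<lambda>z. Re (F z)) y = Re (deriv F y * v)" if "y \<in> S" for y
      by (rule dir_deriv_eq[OF Re_holomorphic_deriv[OF F S that]])
    have "dir_deriv v (dir_deriv v (\<lambda>z. Re (F z))) z = dir_deriv v (\<lambda>z. Re (deriv F z * v)) z"
      by (rule dir_deriv_cong_open[OF S z e]) (use Re_holomorphic_deriv[OF h S z] in \<open>auto simp: differentiable_def\<close>)
    also have "\<dots> = Re (deriv (\<lambda>z. deriv F z * v) z * v)"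
      by (rule dir_deriv_eq[OF Re_holomorphic_deriv[OF h S z]])
    also have "deriv (\<lambda>z. deriv F z * v) z = deriv (deriv F) z * v"
      by (rule deriv_cmult_right) (use holomorphic_deriv[OF F S] S z holomorphic_on_imp_differentiable_at in blast)
    finally show ?thesis .
  qed
  then show "dir_deriv 1 (dir_deriv 1 (\<lambda>z. Re (F z))) z + dir_deriv \<i> (dir_deriv \<i> (\<lambda>z. Re (F z))) z = 0" by simp
qed

lemma dir_deriv_lines:
  assumes "u differentiable (at (Complex x y))"
  shows "((\<lambda>s. u (Complex s y)) has_real_derivative dir_deriv 1 u (Complex x y)) (at x)"
    "((\<lambda>s. u (Complex x s)) has_real_derivative dir_deriv \<i> u (Complex x y)) (at y)"
proof -
  note d = has_derivative_dir_deriv[OF assms]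
  have l: "linear (\<lambda>v. dir_deriv v u (Complex x y))" using d has_derivative_linear by blast
  have 1: "((\<lambda>s. Complex s y) has_derivative (\<lambda>h. h *\<^sub>R 1)) (at x)"
    using idm.df(1) by (simp add: has_vector_derivative_def)
  have 2: "((\<lambda>s. Complex x s) has_derivative (\<lambda>h. h *\<^sub>R \<i>)) (at y)"
    using idm.df(2) by (simp add: has_vector_derivative_def)
  show "((\<lambda>s. u (Complex s y)) has_real_derivative dir_deriv 1 u (Complex x y)) (at x)"
    unfolding has_field_derivative_def
    by (rule has_derivative_eq_rhs[OF has_derivative_compose[OF 1 d]]) (simp add: linear_scale[OF l] fun_eq_iff mult.commute)
  show "((\<lambda>s. u (Complex x s)) has_real_derivative dir_deriv \<i> u (Complex x y)) (at y)"
    unfolding has_field_derivative_def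
    by (rule has_derivative_eq_rhs[OF has_derivative_compose[OF 2 d]]) (simp add: linear_scale[OF l] fun_eq_iff mult.commute)
qed

text \<open>The integrals of the two mixed derivatives over any rectangle are the same alternating sum of
  corner values, so a continuous difference cannot be positive anywhere.\<close>

lemma mixed_partials:
  fixes u :: "complex \<Rightarrow> real"
  assumes u: "Ck_on 2 u S" and S: "open S" and z: "z \<in> S"
  shows "dir_deriv 1 (dir_deriv \<i> u) z = dir_deriv \<i> (dir_deriv 1 u) z"
proof -
  define d12 where "d12 = dir_deriv 1 (dir_deriv \<i> u)"
  define d21 where "d21 = dir_deriv \<i> (dir_deriv 1 u)"
  have u': "\<forall>x\<in>S. u differentiable (at x)" "\<And>v. \<forall>x\<in>S. dir_deriv v u differentiable (at x)"
    "\<And>v w. continuous_on S (dir_deriv v (dir_deriv w u))"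
    using u by (auto simp: numeral_2_eq_2)
  have *: "\<not> (\<forall>w\<in>cbox a b. D w \<ge> e)" if ab: "cbox a b \<subseteq> S" "Re a < Re b" "Im a < Im b" and e: "e > 0"
    and D: "D = (\<lambda>w. d12 w - d21 w) \<or> D = (\<lambda>w. d21 w - d12 w)" for a b D e
  proof
    assume ge: "\<forall>w\<in>cbox a b. D w \<ge> e"
    define x0 y0 x1 y1 where "x0 = Re a" and "y0 = Im a" and "x1 = Re b" and "y1 = Im b"
    have ab': "a = Complex x0 y0" "b = Complex x1 y1" "x0 < x1" "y0 < y1" using ab by (auto simp: x0_def x1_def y0_def y1_def)
    have inS: "Complex x y \<in> S" if "x \<in> {x0..x1}" "y \<in> {y0..y1}" for x y
      using ab(1) that by (auto simp: ab' in_cbox_complex_iff subset_iff)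
    have c12: "continuous_on (cbox a b) d12" "continuous_on (cbox a b) d21"
      unfolding d12_def d21_def using u'(3) ab(1) continuous_on_subset by blast+
    have ii: "set_integrable lborel {p..q} f" if "continuous_on {p..q} f" for p q and f :: "real \<Rightarrow> real"
      unfolding set_integrable_def by (rule borel_integrable_compact[OF _ that]) simp
    have cl: "continuous_on {y0..y1} (\<lambda>y. dir_deriv \<i> u (Complex x y))" if "x \<in> {x0..x1}" for x
    proof (rule continuous_at_imp_continuous_on, rule ballI)
      fix y assume "y \<in> {y0..y1}"
      from dir_deriv_lines(2)[OF u'(2)[rule_format, OF inS[OF that this]]]
      show "isCont (\<lambda>y. dir_deriv \<i> u (Complex x y)) y" by (rule DERIV_isCont)
    qed
    have cl': "continuous_on {x0..x1} (\<lambda>x. dir_deriv 1 u (Complex x y))" if "y \<in> {y0..y1}" for y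
    proof (rule continuous_at_imp_continuous_on, rule ballI)
      fix x assume "x \<in> {x0..x1}"
      from dir_deriv_lines(1)[OF u'(2)[rule_format, OF inS[OF this that]]]
      show "isCont (\<lambda>x. dir_deriv 1 u (Complex x y)) x" by (rule DERIV_isCont)
    qed
    have F: "(LINT y:{y0..y1}|lborel. dir_deriv \<i> u (Complex x y)) = u (Complex x y1) - u (Complex x y0)"
      if "x \<in> {x0..x1}" for x
      unfolding set_lebesgue_integral_def
      by (rule integral_FTC_Icc)
        (use ab'(4) cl[OF that] dir_deriv_lines(2)[OF u'(1)[rule_format, OF inS[OF that]]]
          in \<open>auto simp: has_real_derivative_iff_has_vector_derivative intro: has_vector_derivative_at_within\<close>)
    have F': "(LINT x:{x0..x1}|lborel. dir_deriv 1 u (Complex x y)) = u (Complex x1 y) - u (Complex x0 y)"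
      if "y \<in> {y0..y1}" for y
      unfolding set_lebesgue_integral_def
      by (rule integral_FTC_Icc)
        (use ab'(3) cl'[OF that] dir_deriv_lines(1)[OF u'(1)[rule_format, OF inS[OF _ that]]]
          in \<open>auto simp: has_real_derivative_iff_has_vector_derivative intro: has_vector_derivative_at_within\<close>)
    have "(LINT z:cbox a b|lborel. d12 z) = (LINT y:{y0..y1}|lborel. dir_deriv \<i> u (Complex x1 y) - dir_deriv \<i> u (Complex x0 y))"
      unfolding ab' by (rule LINT_rect_dx)
        (use c12 ab' dir_deriv_lines(1)[OF u'(2)[rule_format, OF inS]] in \<open>auto simp: d12_def\<close>)
    also have "\<dots> = u (Complex x1 y1) - u (Complex x1 y0) - (u (Complex x0 y1) - u (Complex x0 y0))"
      using ab' by (subst set_integral_diff(2)) (auto intro!: ii cl simp: F)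
    finally have I12: "(LINT z:cbox a b|lborel. d12 z) = u (Complex x1 y1) - u (Complex x1 y0) - (u (Complex x0 y1) - u (Complex x0 y0))" .
    have "(LINT z:cbox a b|lborel. d21 z) = (LINT x:{x0..x1}|lborel. dir_deriv 1 u (Complex x y1) - dir_deriv 1 u (Complex x y0))"
      unfolding ab' by (rule LINT_rect_dy)
        (use c12 ab' dir_deriv_lines(2)[OF u'(2)[rule_format, OF inS]] in \<open>auto simp: d21_def\<close>)
    also have "\<dots> = u (Complex x1 y1) - u (Complex x0 y1) - (u (Complex x1 y0) - u (Complex x0 y0))"
      using ab' by (subst set_integral_diff(2)) (auto intro!: ii cl' simp: F')
    finally have I21: "(LINT z:cbox a b|lborel. d21 z) = u (Complex x1 y1) - u (Complex x0 y1) - (u (Complex x1 y0) - u (Complex x0 y0))" .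
    note si = integrable_cont_cbox[OF c12(1)] integrable_cont_cbox[OF c12(2)]
    have Di: "set_integrable lborel (cbox a b) D" "(LINT z:cbox a b|lborel. D z) = 0"
      using D I12 I21 si by (auto simp: set_integral_diff)
    have ci: "set_integrable lborel (cbox a b) (\<lambda>w. e)" by (rule integrable_cont_cbox) simp
    have "(LINT z:cbox a b|lborel. e) \<le> (LINT z:cbox a b|lborel. D z)"
      by (rule set_integral_mono[OF ci Di(1)]) (use ge in auto)
    moreover have "(LINT z:cbox a b|lborel. e) = e * ((x1 - x0) * (y1 - y0))"
      using ab' by (simp add: set_lebesgue_integral_def measure_lborel_cbox_eq Basis_complex_def mult_ac)
    moreover have "e * ((x1 - x0) * (y1 - y0)) > 0" using e ab' by simp
    ultimately show False using Di(2) by simp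
  qed
  have **: "\<not> D z > 0" if D: "D = (\<lambda>w. d12 w - d21 w) \<or> D = (\<lambda>w. d21 w - d12 w)" for D
  proof
    assume pos: "D z > 0"
    have "continuous_on S D" using D u'(3) by (auto simp: d12_def d21_def intro!: continuous_intros)
    then have "isCont D z" using S z by (simp add: continuous_on_eq_continuous_at)
    then have "\<forall>\<^sub>F w in nhds z. D w > D z / 2"
      using pos by (intro order_tendstoD(1)) (auto simp: isCont_def tendsto_at_iff_tendsto_nhds)
    moreover have "\<forall>\<^sub>F w in nhds z. w \<in> S" using S z by (rule eventually_nhds_in_open)
    ultimately have "\<forall>\<^sub>F w in nhds z. D w > D z / 2 \<and> w \<in> S" by (rule eventually_conj)
    then obtain r where r: "r > 0" "\<And>w. dist w z < r \<Longrightarrow> D w > D z / 2 \<and> w \<in> S"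
      by (auto simp: eventually_nhds_metric)
    define a where "a = z - Complex (r / 4) (r / 4)"
    define b where "b = z + Complex (r / 4) (r / 4)"
    have sub: "dist w z < r" if "w \<in> cbox a b" for w
      using that cmod_le[of "w - z"] r(1) by (auto simp: a_def b_def in_cbox_complex_iff dist_norm)
    have "\<not> (\<forall>w\<in>cbox a b. D w \<ge> D z / 2)"
      by (rule *[OF _ _ _ _ D]) (use sub r pos in \<open>auto simp: a_def b_def\<close>)
    then show False using sub r(2) less_imp_le by blast
  qed
  show ?thesis
    using **[of "\<lambda>w. d12 w - d21 w"] **[of "\<lambda>w. d21 w - d12 w"] by (simp add: d12_def d21_def)
qed

text \<open>The harmonicity of \<open>u\<close> and the symmetry of the second derivatives are the two
  Cauchy-Riemann equations.\<close>

lemma harmonic_gradient_holomorphic: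
  fixes u :: "complex \<Rightarrow> real"
  assumes u: "harmonic_on u S" and S: "open S"
  shows "(\<lambda>z. Complex (dir_deriv 1 u z) (- dir_deriv \<i> u z)) holomorphic_on S"
  unfolding holomorphic_on_def
proof
  fix z assume z: "z \<in> S"
  have C2: "Ck_on 2 u S" and lap: "dir_deriv 1 (dir_deriv 1 u) z + dir_deriv \<i> (dir_deriv \<i> u) z = 0"
    using u z by (auto simp: harmonic_on_def)
  have df: "dir_deriv v u differentiable (at z)" for v using C2 z by (auto simp: numeral_2_eq_2)
  note d1 = has_derivative_dir_deriv[OF df[of 1]]
  note d2 = has_derivative_dir_deriv[OF df[of \<i>]]
  have lin: "dir_deriv h (dir_deriv v u) z = Re h * dir_deriv 1 (dir_deriv v u) z + Im h * dir_deriv \<i> (dir_deriv v u) z" for h v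
  proof -
    have l: "linear (\<lambda>h. dir_deriv h (dir_deriv v u) z)"
      using has_derivative_linear[OF has_derivative_dir_deriv[OF df[of v]]] .
    have "h = Re h *\<^sub>R 1 + Im h *\<^sub>R \<i>" by (simp add: complex_eq_iff)
    then have "dir_deriv h (dir_deriv v u) z = dir_deriv (Re h *\<^sub>R 1 + Im h *\<^sub>R \<i>) (dir_deriv v u) z" by simp
    also have "\<dots> = Re h * dir_deriv 1 (dir_deriv v u) z + Im h * dir_deriv \<i> (dir_deriv v u) z"
      unfolding linear_add[OF l] linear_scale[OF l] by simp
    finally show ?thesis .
  qed
  define a where "a = dir_deriv 1 (dir_deriv 1 u) z"
  define b where "b = dir_deriv \<i> (dir_deriv 1 u) z"
  have m: "dir_deriv 1 (dir_deriv \<i> u) z = b" "dir_deriv \<i> (dir_deriv \<i> u) z = - a"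
    using mixed_partials[OF C2 S z] lap by (auto simp: a_def b_def)
  have "((\<lambda>z. of_real (dir_deriv 1 u z) - \<i> * of_real (dir_deriv \<i> u z)) has_derivative
      (\<lambda>h. of_real (dir_deriv h (dir_deriv 1 u) z) - \<i> * of_real (dir_deriv h (dir_deriv \<i> u) z))) (at z)"
    by (intro has_derivative_diff has_derivative_mult_right has_derivative_of_real d1 d2)
  moreover have "of_real (dir_deriv h (dir_deriv 1 u) z) - \<i> * of_real (dir_deriv h (dir_deriv \<i> u) z) = Complex a (- b) * h" for h
    unfolding lin[of h] m a_def[symmetric] b_def[symmetric] by (simp add: complex_eq_iff algebra_simps)
  moreover have "(\<lambda>z. of_real (dir_deriv 1 u z) - \<i> * of_real (dir_deriv \<i> u z)) = (\<lambda>z. Complex (dir_deriv 1 u z) (- dir_deriv \<i> u z))"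
    by (auto simp: complex_eq_iff)
  ultimately have "((\<lambda>z. Complex (dir_deriv 1 u z) (- dir_deriv \<i> u z)) has_field_derivative Complex a (- b)) (at z)"
    by (simp add: has_field_derivative_def)
  then show "(\<lambda>z. Complex (dir_deriv 1 u z) (- dir_deriv \<i> u z)) field_differentiable at z within S"
    using field_differentiable_def has_field_derivative_at_within by blast
qed

text \<open>The pulled back gradient \<open>W (g z) g' z\<close> is holomorphic on the convex set
  \<open>H\<close>, so it has a primitive there, whose real part differs from
  \<open>u (g z)\<close> by a constant. Working on \<open>H\<close> avoids any question about the
  topology of the image.\<close>

lemma harmonic_pullback_conjugate:
  assumes u: "harmonic_on u (g ` H)" and g: "g holomorphic_on H" "inj_on g H" and H: "open H" "convex H" "H \<noteq> {}"
  obtains F where "F holomorphic_on H" "\<And>z. z \<in> H \<Longrightarrow> Re (F z) = u (g z)"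
proof -
  have og: "open (g ` H)" by (rule open_mapping_thm3[OF g(1) H(1) g(2)])
  define W where "W z = Complex (dir_deriv 1 u z) (- dir_deriv \<i> u z)" for z
  have Wh: "W holomorphic_on g ` H" unfolding W_def by (rule harmonic_gradient_holomorphic[OF u og])
  have "(\<lambda>z. W (g z) * deriv g z) holomorphic_on H"
    using holomorphic_on_compose[OF g(1) Wh] by (intro holomorphic_intros holomorphic_deriv g H) (simp add: o_def)
  from holomorphic_convex_primitive'[OF H(2,1) this]
  obtain P where P: "\<And>z. z \<in> H \<Longrightarrow> (P has_field_derivative W (g z) * deriv g z) (at z within H)" by blast
  have P': "(P has_field_derivative W (g z) * deriv g z) (at z)" if "z \<in> H" for z
    using P[OF that] at_within_open[OF that H(1)] by simp
  have ug: "((\<lambda>z. u (g z)) has_derivative (\<lambda>h. Re (W (g z) * deriv g z * h))) (at z)" if z: "z \<in> H" for z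
  proof -
    have gd: "(g has_derivative (\<lambda>h. deriv g z * h)) (at z)"
      using holomorphic_derivI[OF g(1) H(1) z] by (simp add: has_field_derivative_def)
    have "u differentiable (at (g z))" using u z by (auto simp: harmonic_on_def numeral_2_eq_2)
    note ud = has_derivative_dir_deriv[OF this]
    have l: "linear (\<lambda>v. dir_deriv v u (g z))" using has_derivative_linear[OF ud] .
    have "dir_deriv h u (g z) = Re (W (g z) * h)" for h
    proof -
      have "h = Re h *\<^sub>R 1 + Im h *\<^sub>R \<i>" by (simp add: complex_eq_iff)
      then have "dir_deriv h u (g z) = dir_deriv (Re h *\<^sub>R 1 + Im h *\<^sub>R \<i>) u (g z)" by simp
      also have "\<dots> = Re (W (g z) * h)"
        unfolding linear_add[OF l] linear_scale[OF l] by (simp add: W_def)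
      finally show ?thesis .
    qed
    then show ?thesis using has_derivative_compose[OF gd ud] by (simp add: mult.assoc)
  qed
  have "\<exists>c. \<forall>z\<in>H. u (g z) - Re (P z) = c"
  proof (rule has_derivative_zero_constant[OF H(2)])
    fix z assume z: "z \<in> H"
    have "((\<lambda>z. Re (P z)) has_derivative (\<lambda>h. Re (W (g z) * deriv g z * h))) (at z)"
      using P'[OF z] by (intro has_derivative_Re) (simp add: has_field_derivative_def)
    from has_derivative_diff[OF ug[OF z] this]
    show "((\<lambda>z. u (g z) - Re (P z)) has_derivative (\<lambda>h. 0)) (at z within H)"
      by (simp add: has_derivative_at_withinI)
  qed
  then obtain c where c: "\<And>z. z \<in> H \<Longrightarrow> u (g z) - Re (P z) = c" by blast
  have "P holomorphic_on H" using P by (auto simp: holomorphic_on_def field_differentiable_def)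
  then have "(\<lambda>z. P z + of_real c) holomorphic_on H" by (intro holomorphic_intros)
  moreover have "Re (P z + of_real c) = u (g z)" if "z \<in> H" for z using c[OF that] by simp
  ultimately show thesis using that by blast
qed

lemma half_plane_props:
  "open upper_half_plane" "convex upper_half_plane" "upper_half_plane \<noteq> {}" "\<i> \<in> upper_half_plane"
  by (auto simp: upper_half_plane_def open_halfspace_Im_gt convex_halfspace_Im_gt intro!: exI[of _ \<i>])

text \<open>Harnack's inequality along the imaginary axis: map the disc to the half-plane by a Cayley
  transform \<open>C\<close>, and the right half-plane to the disc by the one that takes
  \<open>F i\<close> to \<open>0\<close>; then apply the Schwarz lemma at the point
  \<open>t\<close> with \<open>C t = i y\<close>.\<close>

lemma positive_harmonic_linear_growth:
  assumes F: "F holomorphic_on upper_half_plane" and pos: "\<And>z. z \<in> upper_half_plane \<Longrightarrow> Re (F z) > 0"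
    and y: "y \<ge> 1"
  shows "norm (F (\<i> * of_real y)) \<le> norm (F \<i>) * y"
proof -
  define a where "a = F \<i>"
  have a: "Re a > 0" using pos[OF half_plane_props(4)] by (simp add: a_def)
  define C where "C \<zeta> = \<i> * ((1 + \<zeta>) / (1 - \<zeta>))" for \<zeta> :: complex
  have CH: "C \<zeta> \<in> upper_half_plane" if z: "norm \<zeta> < 1" for \<zeta>
  proof -
    have n: "1 - \<zeta> \<noteq> 0" using z by auto
    have cn: "cnj (1 - \<zeta>) \<noteq> 0" using n by (metis complex_cnj_zero_iff)
    have "(1 + \<zeta>) / (1 - \<zeta>) = (1 + \<zeta>) * cnj (1 - \<zeta>) / ((1 - \<zeta>) * cnj (1 - \<zeta>))"
      by (rule mult_divide_mult_cancel_right[OF cn, symmetric])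
    also have "(1 - \<zeta>) * cnj (1 - \<zeta>) = of_real ((norm (1 - \<zeta>))\<^sup>2)" by (rule complex_norm_square[symmetric])
    finally have "(1 + \<zeta>) / (1 - \<zeta>) = (1 + \<zeta>) * cnj (1 - \<zeta>) / of_real ((norm (1 - \<zeta>))\<^sup>2)" .
    then have "Re ((1 + \<zeta>) / (1 - \<zeta>)) = Re ((1 + \<zeta>) * cnj (1 - \<zeta>)) / (norm (1 - \<zeta>))\<^sup>2"
      by (simp only: Re_divide_of_real)
    moreover have "Re ((1 + \<zeta>) * cnj (1 - \<zeta>)) = 1 - (norm \<zeta>)\<^sup>2"
      unfolding cmod_power2 by (simp add: power2_eq_square algebra_simps)
    moreover have "(norm \<zeta>)\<^sup>2 < 1" using z by (simp add: power_less_one_iff abs_square_less_1)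
    ultimately have "Re ((1 + \<zeta>) / (1 - \<zeta>)) > 0" using n by simp
    then show ?thesis by (simp add: C_def upper_half_plane_def del: times_divide_eq_right)
  qed
  define \<phi> where "\<phi> \<zeta> = (F (C \<zeta>) - a) / (F (C \<zeta>) + cnj a)" for \<zeta>
  have nz: "F (C \<zeta>) + cnj a \<noteq> 0" if "norm \<zeta> < 1" for \<zeta>
    using pos[OF CH[OF that]] a by (auto simp: complex_eq_iff)
  have Ch: "C holomorphic_on ball 0 1" unfolding C_def by (intro holomorphic_intros) auto
  have FC: "(\<lambda>\<zeta>. F (C \<zeta>)) holomorphic_on ball 0 1"
  proof -
    have "C ` ball 0 1 \<subseteq> upper_half_plane" using CH by auto
    from holomorphic_on_compose_gen[OF Ch F this] show ?thesis by (simp add: o_def)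
  qed
  have "\<phi> holomorphic_on ball 0 1" unfolding \<phi>_def
    using nz by (intro holomorphic_intros FC) auto
  moreover have "\<phi> 0 = 0" by (simp add: \<phi>_def C_def a_def)
  moreover have "norm (\<phi> \<zeta>) < 1" if z: "norm \<zeta> < 1" for \<zeta>
  proof -
    define w where "w = F (C \<zeta>)"
    have w: "Re w > 0" using pos[OF CH[OF z]] by (simp add: w_def)
    have "(norm (w - a))\<^sup>2 < (norm (w + cnj a))\<^sup>2"
      unfolding cmod_power2 using mult_pos_pos[OF w a] by (simp add: power2_eq_square algebra_simps)
    then have "norm (w - a) < norm (w + cnj a)" by (rule power_less_imp_less_base) simp
    then show ?thesis using nz[OF z] by (simp add: \<phi>_def w_def norm_divide)
  qed
  moreover define t where "t = (y - 1) / (y + 1)"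
  have t: "0 \<le> t" "t < 1" using y by (auto simp: t_def)
  moreover have "norm (complex_of_real t) < 1" using t by simp
  ultimately have "norm (\<phi> (of_real t)) \<le> norm (complex_of_real t)" using Schwarz_Lemma(1) by blast
  moreover have "C (of_real t) = \<i> * of_real y"
  proof -
    have "(1 + t) / (1 - t) = y" using y by (simp add: t_def field_simps)
    then have "of_real y = (1 + complex_of_real t) / (1 - complex_of_real t)" by (metis of_real_1 of_real_add of_real_diff of_real_divide)
    then show ?thesis by (simp add: C_def)
  qed
  ultimately have le: "norm (F (\<i> * of_real y) - a) \<le> t * norm (F (\<i> * of_real y) + cnj a)"
    using nz[of "of_real t"] t by (simp add: \<phi>_def norm_divide divide_le_eq)
  define w where "w = F (\<i> * of_real y)"
  have "norm w - norm a \<le> norm (w - a)" by (rule norm_triangle_ineq2)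
  also have "\<dots> \<le> t * (norm w + norm a)"
    using le mult_left_mono[OF norm_triangle_ineq[of w "cnj a"] t(1)] unfolding w_def by simp
  finally have "norm w * (1 - t) \<le> norm a * (1 + t)" by (simp add: algebra_simps)
  moreover have "1 + t = y * (1 - t)" using y by (simp add: t_def field_simps)
  ultimately have "norm w * (1 - t) \<le> norm a * y * (1 - t)" by (simp add: mult_ac)
  then show ?thesis using t by (simp add: w_def a_def)
qed

text \<open>A majorant pulled back to the half-plane is the real part of a holomorphic function; the lower
  bound on \<open>g\<close> along the imaginary axis contradicts its linear growth as soon as
  \<open>e p > 1\<close>.\<close>

lemma hardy_number_upper:
  assumes g: "conformal_on g upper_half_plane" and c: "c > 0" and e: "e > 0"
    and low: "\<And>y. y \<ge> r \<Longrightarrow> c * y powr e \<le> norm (g (\<i> * of_real y))"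
  shows "hardy_number (g ` upper_half_plane) \<le> ennreal (1 / e)"
  unfolding hardy_number_def
proof (rule Sup_least, clarify)
  fix p :: real and u assume p: "p > 0" and u: "harmonic_majorant u (\<lambda>z. norm z powr p) (g ` upper_half_plane)"
  have gh: "g holomorphic_on upper_half_plane" "inj_on g upper_half_plane" using g by (auto simp: conformal_on_def)
  have hu: "harmonic_on u (g ` upper_half_plane)" using u by (simp add: harmonic_majorant_def)
  obtain F where F: "F holomorphic_on upper_half_plane" "\<And>z. z \<in> upper_half_plane \<Longrightarrow> Re (F z) = u (g z)"
    using harmonic_pullback_conjugate[OF hu gh half_plane_props(1-3)] by blast
  have maj: "norm (g z) powr p \<le> Re (F z)" if "z \<in> upper_half_plane" for z
    using u that by (simp add: harmonic_majorant_def F(2))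
  (* The majorant is only nonnegative; adding 1 makes it positive. *)
  define F1 where "F1 z = F z + 1" for z
  have F1: "F1 holomorphic_on upper_half_plane" unfolding F1_def by (intro holomorphic_intros F)
  have pos: "Re (F1 z) > 0" if "z \<in> upper_half_plane" for z
    using maj[OF that] order_trans[OF powr_ge_zero maj[OF that]] by (simp add: F1_def)
  define M where "M = norm (F1 \<i>)"
  have bound: "c powr p * y powr (e * p) \<le> M * y" if y: "y \<ge> max r 1" for y
  proof -
    have iy: "\<i> * of_real y \<in> upper_half_plane" using y by (simp add: upper_half_plane_def)
    have "c powr p * y powr (e * p) = (c * y powr e) powr p" using c y by (simp add: powr_mult powr_powr)
    also have "\<dots> \<le> norm (g (\<i> * of_real y)) powr p" using c p y low[of y] by (intro powr_mono2) auto
    also have "\<dots> \<le> Re (F1 (\<i> * of_real y))" using maj[OF iy] by (simp add: F1_def)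
    also have "\<dots> \<le> norm (F1 (\<i> * of_real y))" by (rule complex_Re_le_cmod)
    also have "\<dots> \<le> M * y" unfolding M_def by (rule positive_harmonic_linear_growth[OF F1 pos]) (use y in auto)
    finally show ?thesis .
  qed
  have "e * p \<le> 1"
  proof (rule ccontr)
    assume "\<not> e * p \<le> 1"
    define s where "s = e * p - 1"
    have s: "s > 0" using \<open>\<not> e * p \<le> 1\<close> by (simp add: s_def)
    define N where "N = M / c powr p"
    have N: "N \<ge> 0" by (simp add: N_def M_def)
    define y where "y = max (max r 1) ((N + 1) powr (1 / s))"
    have y: "y \<ge> max r 1" "y > 0" by (auto simp: y_def)
    have "c powr p * y powr (e * p) \<le> M * y" by (rule bound[OF y(1)])
    moreover have "y powr (e * p) = y powr s * y" using y(2) by (simp add: s_def powr_diff)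
    ultimately have "c powr p * y powr s \<le> M" using y(2) by simp
    then have "y powr s \<le> N" using c by (simp add: N_def field_simps)
    moreover have "((N + 1) powr (1 / s)) powr s \<le> y powr s" using s by (intro powr_mono2) (auto simp: y_def)
    then have "N + 1 \<le> y powr s" using s N by (simp add: powr_powr)
    ultimately show False by simp
  qed
  then have "p \<le> 1 / e" using e by (simp add: field_simps)
  then show "ennreal p \<le> ennreal (1 / e)" by (rule ennreal_leI)
qed

text \<open>For \<open>q = p e < 1\<close> the function \<open>(1 - i z) powr q\<close> maps the half-plane
  into a sector of half-opening \<open>q \<pi> / 2\<close>, where the real part is comparable to
  the modulus. Composed with the inverse of \<open>g\<close> it gives a harmonic majorant. The
  shift by \<open>1\<close> keeps the modulus bounded below near \<open>z = 0\<close>.\<close>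

lemma hardy_number_lower:
  assumes g: "conformal_on g upper_half_plane" and e: "e > 0" and M: "M > 0"
    and up: "\<And>z. z \<in> upper_half_plane \<Longrightarrow> norm (g z) \<le> M * (1 + norm z) powr e"
  shows "ennreal (1 / e) \<le> hardy_number (g ` upper_half_plane)"
proof (rule dense_le)
  fix x assume x: "x < ennreal (1 / e)"
  then obtain p where p: "x = ennreal p" "p \<ge> 0" by (cases x) auto
  have pe: "p < 1 / e" using x p e by (simp add: ennreal_less_iff)
  show "x \<le> hardy_number (g ` upper_half_plane)"
  proof (cases "p = 0")
    case True
    then show ?thesis using p by simp
  next
    case False
    then have p0: "p > 0" using p by simp
    define q where "q = p * e"
    have q: "0 < q" "q < 1" using p0 e pe by (auto simp: q_def field_simps)
    have gh: "g holomorphic_on upper_half_plane" "inj_on g upper_half_plane" using g by (auto simp: conformal_on_def)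
    obtain k where k: "k holomorphic_on g ` upper_half_plane" "\<And>z. z \<in> upper_half_plane \<Longrightarrow> k (g z) = z"
      using holomorphic_has_inverse[OF gh(1) half_plane_props(1) gh(2)] by metis
    have og: "open (g ` upper_half_plane)" by (rule open_mapping_thm3[OF gh(1) half_plane_props(1) gh(2)])
    define c where "c = M powr p * 2 powr q / cos (q * (pi / 2))"
    have cq: "cos (q * (pi / 2)) > 0" using q by (intro cos_gt_zero_pi) (auto intro: mult_strict_right_mono[of q 1 "pi/2", simplified] order.strict_trans[of _ 0])
    define U where "U w = of_real c * exp (of_real q * Ln (1 - \<i> * k w))" for w
    have Re1: "Re (1 - \<i> * k w) > 0" if "w \<in> g ` upper_half_plane" for w
      using that k(2) by (auto simp: upper_half_plane_def add_pos_pos)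
    have Uh: "U holomorphic_on g ` upper_half_plane" unfolding U_def
    proof (intro holomorphic_intros k)
      fix w assume "w \<in> g ` upper_half_plane"
      from Re1[OF this] show "1 - \<i> * k w \<notin> \<real>\<^sub>\<le>\<^sub>0" by (auto simp: complex_nonpos_Reals_iff)
    qed
    have maj: "norm (g z) powr p \<le> Re (U (g z))" if z: "z \<in> upper_half_plane" for z
    proof -
      define \<xi> where "\<xi> = 1 - \<i> * z"
      have iz: "Im z > 0" using z by (simp add: upper_half_plane_def)
      have \<xi>: "Re \<xi> > 0" "\<xi> \<noteq> 0" using iz by (auto simp: \<xi>_def complex_eq_iff)
      have n1: "1 \<le> norm \<xi>" using complex_Re_le_cmod[of \<xi>] iz by (simp add: \<xi>_def)
      have n2: "norm z \<le> norm \<xi>"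
      proof (rule power2_le_imp_le)
        show "(norm z)\<^sup>2 \<le> (norm \<xi>)\<^sup>2" unfolding cmod_power2 \<xi>_def using iz by (simp add: power2_eq_square algebra_simps)
      qed simp
      have im: "\<bar>Im (Ln \<xi>)\<bar> < pi / 2" using Re_Ln_pos_lt[OF \<xi>(2)] \<xi>(1) by simp
      have "norm (g z) powr p \<le> (M * (1 + norm z) powr e) powr p" using up[OF z] p0 by (intro powr_mono2) auto
      also have "\<dots> = M powr p * (1 + norm z) powr q" using M by (simp add: powr_mult powr_powr q_def mult.commute)
      also have "\<dots> \<le> M powr p * (2 * norm \<xi>) powr q" using n1 n2 q by (intro mult_left_mono powr_mono2) auto
      also have "\<dots> = c * (norm \<xi> powr q * cos (q * (pi / 2)))" using cq by (simp add: c_def powr_mult)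
      also have "\<dots> \<le> c * (norm \<xi> powr q * cos (q * Im (Ln \<xi>)))"
      proof -
        have "\<bar>q * Im (Ln \<xi>)\<bar> \<le> q * (pi / 2)" using im q by (simp add: abs_mult mult_left_mono)
        moreover have "q * (pi / 2) \<le> pi" using q by (simp add: field_simps)
        ultimately have "cos (q * (pi / 2)) \<le> cos \<bar>q * Im (Ln \<xi>)\<bar>" by (intro cos_monotone_0_pi_le) auto
        then have "cos (q * (pi / 2)) \<le> cos (q * Im (Ln \<xi>))" by (simp only: cos_abs_real)
        moreover have "c \<ge> 0" using cq by (simp add: c_def)
        ultimately show ?thesis by (intro mult_left_mono) auto
      qed
      also have "norm \<xi> powr q = exp (Re (of_real q * Ln \<xi>))" using \<xi>(2) by (simp add: powr_def)
      also have "c * (exp (Re (of_real q * Ln \<xi>)) * cos (q * Im (Ln \<xi>))) = Re (U (g z))"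
        using k(2)[OF z] by (simp add: U_def Re_exp \<xi>_def[symmetric])
      finally show ?thesis .
    qed
    have "harmonic_majorant (\<lambda>w. Re (U w)) (\<lambda>z. norm z powr p) (g ` upper_half_plane)"
      unfolding harmonic_majorant_def using Re_holomorphic_harmonic[OF Uh og] maj by auto
    then show ?thesis unfolding hardy_number_def p(1) using p0 by (intro Sup_upper) blast
  qed
qed

section \<open>Extremal maps\<close>

text \<open>The map \<open>- i (Re z + i |Im z|)\<close>: the plane is folded onto the closed upper
  half-plane and rotated to the closed right half-plane, where \<open>Ln\<close> is continuous
  except at \<open>0\<close>. Rotating back by \<open>i \<pi> / 2\<close> inside the exponential
  makes \<open>fold_pow \<kappa>\<close> the power \<open>(Re z + i |Im z|) powr \<kappa>\<close>
  with argument in \<open>[0, \<pi>]\<close>.\<close>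

definition fold_rot :: "complex \<Rightarrow> complex"
  where "fold_rot z = Complex \<bar>Im z\<bar> (- Re z)"

definition fold_pow :: "real \<Rightarrow> complex \<Rightarrow> complex"
  where "fold_pow \<kappa> z = exp (of_real \<kappa> * (Ln (fold_rot z) + \<i> * of_real (pi / 2)))"

text \<open>In the upper half-plane this is \<open>z powr (1 + \<kappa>)\<close>, which opens the half-plane
  to a sector of angle \<open>(1 + \<kappa>) \<pi>\<close>; in the lower half-plane it is
  \<open>z (cnj z) powr \<kappa>\<close>, so that the two definitions agree on the real axis and
  the complex dilatation has modulus \<open>|\<kappa>|\<close>.\<close>

definition sector_map :: "real \<Rightarrow> complex \<Rightarrow> complex"
  where "sector_map \<kappa> z = z * fold_pow \<kappa> z"

lemma fold_rot_nonpos: "z \<noteq> 0 \<Longrightarrow> fold_rot z \<notin> \<real>\<^sub>\<le>\<^sub>0"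
  by (auto simp: fold_rot_def complex_nonpos_Reals_iff complex_eq_iff)

lemma fold_rot_norm: "norm (fold_rot z) = norm z"
  by (simp add: fold_rot_def cmod_def add.commute)

lemma fold_rot_cont: "continuous_on S fold_rot"
  unfolding fold_rot_def Complex_eq by (intro continuous_intros)

lemma fold_pow_cont: "continuous_on (- {0}) (fold_pow \<kappa>)"
  unfolding fold_pow_def
  by (intro continuous_intros fold_rot_cont) (auto simp: fold_rot_nonpos)

lemma fold_pow_norm:
  assumes "z \<noteq> 0" shows "norm (fold_pow \<kappa> z) = norm z powr \<kappa>"
proof -
  have "fold_rot z \<noteq> 0" using fold_rot_norm[of z] assms by (metis norm_eq_zero)
  then show ?thesis using assms by (simp add: fold_pow_def fold_rot_norm powr_def)
qed

lemma sector_map_norm: "z \<noteq> 0 \<Longrightarrow> norm (sector_map \<kappa> z) = norm z powr (1 + \<kappa>)"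
  by (simp add: sector_map_def norm_mult fold_pow_norm powr_add)

lemma sector_map_0 [simp]: "sector_map \<kappa> 0 = 0"
  by (simp add: sector_map_def)

lemma sector_map_cont:
  assumes "\<kappa> > -1" shows "continuous_on UNIV (sector_map \<kappa>)"
proof -
  have "isCont (sector_map \<kappa>) z" for z
  proof (cases "z = 0")
    case False
    have "continuous_on (- {0}) (sector_map \<kappa>)"
      unfolding sector_map_def by (intro continuous_intros fold_pow_cont)
    then show ?thesis using False by (simp add: continuous_on_eq_continuous_at open_Compl)
  next
    case True
    have "((\<lambda>z. norm z powr (1 + \<kappa>)) \<longlongrightarrow> 0) (at (0::complex))"
      using assms by (intro tendsto_zero_powrI[where b = "1 + \<kappa>"] tendsto_norm_zero tendsto_ident_at tendsto_const) auto
    then have "((\<lambda>z. norm (sector_map \<kappa> z)) \<longlongrightarrow> 0) (at 0)"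
      by (rule Lim_transform_eventually) (auto simp: eventually_at_filter sector_map_norm)
    then show ?thesis using True by (simp add: isCont_def tendsto_norm_zero_cancel)
  qed
  then show ?thesis by (simp add: continuous_at_imp_continuous_on)
qed

text \<open>Folding and rotating turns the angles \<open>\<alpha>\<close> and \<open>- \<alpha>\<close> both
  into \<open>\<alpha> - \<pi> / 2\<close>, which is within the range of the principal logarithm,
  so \<open>fold_pow \<kappa>\<close> adds \<open>\<kappa> \<alpha>\<close> to the angle on either
  side of the real axis.\<close>

lemma sector_map_polar:
  assumes "R > 0" "0 \<le> \<alpha>" "\<alpha> \<le> pi"
  shows "sector_map \<kappa> (of_real R * cis \<alpha>) = of_real (R powr (1 + \<kappa>)) * cis ((1 + \<kappa>) * \<alpha>)"
    and "0 < \<alpha> \<Longrightarrow> \<alpha> < pi \<Longrightarrow> sector_map \<kappa> (of_real R * cis (- \<alpha>)) = of_real (R powr (1 + \<kappa>)) * cis (- ((1 - \<kappa>) * \<alpha>))"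
proof -
  have s: "sin \<alpha> \<ge> 0" using assms by (simp add: sin_ge_zero)
  have f: "fold_rot (of_real R * cis \<alpha>) = exp (Complex (ln R) (\<alpha> - pi / 2))"
    "fold_rot (of_real R * cis (- \<alpha>)) = exp (Complex (ln R) (\<alpha> - pi / 2))"
    using assms(1) s
    by (simp_all add: fold_rot_def complex_eq_iff exp_eq_polar cis.ctr abs_mult cos_diff sin_diff)
  have L: "Ln (exp (Complex (ln R) (\<alpha> - pi / 2))) = Complex (ln R) (\<alpha> - pi / 2)"
    using assms pi_gt_zero by (intro Ln_exp) (auto simp del: pi_gt_zero)
  have E: "exp (of_real \<kappa> * (Complex (ln R) (\<alpha> - pi / 2) + \<i> * of_real (pi / 2))) = of_real (R powr \<kappa>) * cis (\<kappa> * \<alpha>)"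
  proof -
    have "of_real \<kappa> * (Complex (ln R) (\<alpha> - pi / 2) + \<i> * of_real (pi / 2)) = Complex (\<kappa> * ln R) (\<kappa> * \<alpha>)"
      by (simp add: complex_eq_iff)
    then show ?thesis using assms(1) by (simp add: exp_eq_polar powr_def)
  qed
  have e: "fold_pow \<kappa> (of_real R * cis \<alpha>) = of_real (R powr \<kappa>) * cis (\<kappa> * \<alpha>)"
    "fold_pow \<kappa> (of_real R * cis (- \<alpha>)) = of_real (R powr \<kappa>) * cis (\<kappa> * \<alpha>)"
    unfolding fold_pow_def f L E by auto
  have "of_real R * cis \<alpha> * (of_real (R powr \<kappa>) * cis (\<kappa> * \<alpha>)) = of_real (R * R powr \<kappa>) * (cis \<alpha> * cis (\<kappa> * \<alpha>))"
    by simp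
  then show "sector_map \<kappa> (of_real R * cis \<alpha>) = of_real (R powr (1 + \<kappa>)) * cis ((1 + \<kappa>) * \<alpha>)"
    using assms(1) by (simp add: sector_map_def e cis_mult powr_add distrib_right)
  have "of_real R * cis (- \<alpha>) * (of_real (R powr \<kappa>) * cis (\<kappa> * \<alpha>)) = of_real (R * R powr \<kappa>) * (cis (- \<alpha>) * cis (\<kappa> * \<alpha>))"
    by simp
  then show "sector_map \<kappa> (of_real R * cis (- \<alpha>)) = of_real (R powr (1 + \<kappa>)) * cis (- ((1 - \<kappa>) * \<alpha>))"
    using assms(1) by (simp add: sector_map_def e cis_mult powr_add algebra_simps)
qed

lemma polar_cases:
  assumes "z \<noteq> 0"
  obtains (upper) \<alpha> where "0 \<le> \<alpha>" "\<alpha> \<le> pi" "z = of_real (norm z) * cis \<alpha>"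
  | (lower) \<alpha> where "0 < \<alpha>" "\<alpha> < pi" "z = of_real (norm z) * cis (- \<alpha>)"
proof -
  have z: "z = of_real (norm z) * cis (Arg z)" using rcis_cmod_Arg[of z] by (simp add: rcis_def)
  show thesis
  proof (cases "Arg z \<ge> 0")
    case True
    then show ?thesis using upper[of "Arg z"] z Arg_bounded[of z] by simp
  next
    case False
    then show ?thesis using lower[of "- Arg z"] z Arg_bounded[of z] by simp
  qed
qed

lemma cis_eq_small:
  assumes "cis a = cis b" "\<bar>a - b\<bar> < 2 * pi" shows "a = b"
proof -
  have "cis (a - b) = 1" using assms(1) by (metis cis_divide cis_neq_zero divide_self)
  then have "cos (a - b) = 1" by (metis cis.sel(1) one_complex.sel(1))
  then obtain n :: int where n: "a - b = of_int n * 2 * pi" by (auto simp: cos_one_2pi_int)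
  have "\<bar>of_int n\<bar> * (2 * pi) < 1 * (2 * pi)" using assms(2) unfolding n by (simp add: abs_mult)
  then have "\<bar>of_int n :: real\<bar> < 1" by (rule mult_right_less_imp_less) simp
  then have "n = 0" by linarith
  then show ?thesis using n by simp
qed

text \<open>The two angular ranges \<open>[0, (1 + \<kappa>) \<pi>]\<close> and
  \<open>(- (1 - \<kappa>) \<pi>, 0)\<close> together have length \<open>2 \<pi>\<close>, so equal
  values have equal arguments.\<close>

lemma sector_map_inj:
  assumes "\<bar>\<kappa>\<bar> < 1" shows "inj (sector_map \<kappa>)"
proof (rule injI)
  fix z w assume eq: "sector_map \<kappa> z = sector_map \<kappa> w"
  have zero: "sector_map \<kappa> u = 0 \<longleftrightarrow> u = 0" for u
    using sector_map_norm[of u \<kappa>] by (metis norm_eq_zero powr_eq_0_iff sector_map_0)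
  show "z = w"
  proof (cases "z = 0 \<or> w = 0")
    case True
    then show ?thesis using eq zero by metis
  next
    case False
    then have z: "z \<noteq> 0" and w: "w \<noteq> 0" by auto
    define R where "R = norm z"
    have "norm z powr (1 + \<kappa>) = norm w powr (1 + \<kappa>)"
      using eq sector_map_norm[OF z] sector_map_norm[OF w] by metis
    then have "(norm z powr (1 + \<kappa>)) powr (1 / (1 + \<kappa>)) = (norm w powr (1 + \<kappa>)) powr (1 / (1 + \<kappa>))" by simp
    then have nw: "norm w = R"
    proof -
      have "1 + \<kappa> \<noteq> 0" using assms by auto
      then show ?thesis using \<open>(norm z powr (1 + \<kappa>)) powr (1 / (1 + \<kappa>)) = (norm w powr (1 + \<kappa>)) powr (1 / (1 + \<kappa>))\<close>
        by (simp add: powr_powr R_def)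
    qed
    have R: "R > 0" using z by (simp add: R_def)
    have Rk: "of_real (R powr (1 + \<kappa>)) \<noteq> (0::complex)" using R by simp
    have k: "1 + \<kappa> > 0" "1 - \<kappa> > 0" using assms by auto
    have pr: "(1 + \<kappa>) * pi + (1 - \<kappa>) * pi = 2 * pi" by (simp add: algebra_simps)
    show ?thesis
    proof (cases rule: polar_cases[OF z])
      case (1 \<alpha>)
      note z1 = 1[folded R_def]
      note vz = sector_map_polar(1)[OF R z1(1,2), of \<kappa>, folded z1(3)]
      show ?thesis
      proof (cases rule: polar_cases[OF w])
        case (1 \<beta>)
        note w1 = 1[unfolded nw]
        note vw = sector_map_polar(1)[OF R w1(1,2), of \<kappa>, folded w1(3)]
        have "cis ((1 + \<kappa>) * \<alpha>) = cis ((1 + \<kappa>) * \<beta>)" using eq Rk unfolding vz vw by simp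
        moreover have "\<bar>(1 + \<kappa>) * \<alpha> - (1 + \<kappa>) * \<beta>\<bar> < 2 * pi"
        proof -
          have "0 \<le> (1 + \<kappa>) * \<alpha>" "(1 + \<kappa>) * \<alpha> \<le> (1 + \<kappa>) * pi" "0 \<le> (1 + \<kappa>) * \<beta>" "(1 + \<kappa>) * \<beta> \<le> (1 + \<kappa>) * pi"
            using k z1 w1 by (auto intro!: mult_left_mono)
          moreover have "(1 + \<kappa>) * pi < 2 * pi" using k by (intro mult_strict_right_mono) auto
          ultimately show ?thesis by linarith
        qed
        ultimately have "(1 + \<kappa>) * \<alpha> = (1 + \<kappa>) * \<beta>" by (rule cis_eq_small)
        then have "\<alpha> = \<beta>" using k by simp
        then show ?thesis using z1(3) w1(3) by simp
      next
        case (2 \<beta>)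
        note w1 = 2[unfolded nw]
        note vw = sector_map_polar(2)[OF R less_imp_le[OF w1(1)] less_imp_le[OF w1(2)] w1(1,2), of \<kappa>, folded w1(3)]
        have c: "cis ((1 + \<kappa>) * \<alpha>) = cis (- ((1 - \<kappa>) * \<beta>))" using eq Rk unfolding vz vw by simp
        have b: "0 \<le> (1 + \<kappa>) * \<alpha>" "(1 + \<kappa>) * \<alpha> \<le> (1 + \<kappa>) * pi" "0 < (1 - \<kappa>) * \<beta>" "(1 - \<kappa>) * \<beta> < (1 - \<kappa>) * pi"
          using k z1 w1 by (auto intro!: mult_left_mono)
        have "(1 + \<kappa>) * \<alpha> = - ((1 - \<kappa>) * \<beta>)" by (rule cis_eq_small[OF c]) (use b pr in linarith)
        then show ?thesis using b by linarith
      qed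
    next
      case (2 \<alpha>)
      note z1 = 2[folded R_def]
      note vz = sector_map_polar(2)[OF R less_imp_le[OF z1(1)] less_imp_le[OF z1(2)] z1(1,2), of \<kappa>, folded z1(3)]
      show ?thesis
      proof (cases rule: polar_cases[OF w])
        case (1 \<beta>)
        note w1 = 1[unfolded nw]
        note vw = sector_map_polar(1)[OF R w1(1,2), of \<kappa>, folded w1(3)]
        have c: "cis (- ((1 - \<kappa>) * \<alpha>)) = cis ((1 + \<kappa>) * \<beta>)" using eq Rk unfolding vz vw by simp
        have b: "0 < (1 - \<kappa>) * \<alpha>" "(1 - \<kappa>) * \<alpha> < (1 - \<kappa>) * pi" "0 \<le> (1 + \<kappa>) * \<beta>" "(1 + \<kappa>) * \<beta> \<le> (1 + \<kappa>) * pi"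
          using k z1 w1 by (auto intro!: mult_left_mono)
        have "- ((1 - \<kappa>) * \<alpha>) = (1 + \<kappa>) * \<beta>" by (rule cis_eq_small[OF c]) (use b pr in linarith)
        then show ?thesis using b by linarith
      next
        case (2 \<beta>)
        note w1 = 2[unfolded nw]
        note vw = sector_map_polar(2)[OF R less_imp_le[OF w1(1)] less_imp_le[OF w1(2)] w1(1,2), of \<kappa>, folded w1(3)]
        have c: "cis (- ((1 - \<kappa>) * \<alpha>)) = cis (- ((1 - \<kappa>) * \<beta>))" using eq Rk unfolding vz vw by simp
        have b: "0 < (1 - \<kappa>) * \<alpha>" "(1 - \<kappa>) * \<alpha> < (1 - \<kappa>) * pi" "0 < (1 - \<kappa>) * \<beta>" "(1 - \<kappa>) * \<beta> < (1 - \<kappa>) * pi"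
          using k z1 w1 by auto
        have "(1 - \<kappa>) * pi < 2 * pi" using k by (intro mult_strict_right_mono) auto
        then have "- ((1 - \<kappa>) * \<alpha>) = - ((1 - \<kappa>) * \<beta>)" by (intro cis_eq_small[OF c]) (use b in linarith)
        then have "\<alpha> = \<beta>" using k by simp
        then show ?thesis using z1(3) w1(3) by simp
      qed
    qed
  qed
qed

text \<open>Every argument has a representative \<open>\<tau>\<close> in the half-open interval of length
  \<open>2 \<pi>\<close> that the angles of the image fill.\<close>

lemma sector_map_surj:
  assumes "\<bar>\<kappa>\<bar> < 1" shows "surj (sector_map \<kappa>)"
  unfolding surj_def
proof
  fix w :: complex
  have k: "1 + \<kappa> > 0" "1 - \<kappa> > 0" using assms by auto
  have pr: "(1 + \<kappa>) * pi + (1 - \<kappa>) * pi = 2 * pi" by (simp add: algebra_simps)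
  show "\<exists>z. w = sector_map \<kappa> z"
  proof (cases "w = 0")
    case True
    then show ?thesis by (intro exI[of _ 0]) simp
  next
    case False
    define R where "R = norm w powr (1 / (1 + \<kappa>))"
    have R: "R > 0" using False by (simp add: R_def)
    have Rw: "R powr (1 + \<kappa>) = norm w" using k by (simp add: R_def powr_powr)
    have w: "w = of_real (norm w) * cis (Arg w)" using rcis_cmod_Arg[of w] by (simp add: rcis_def)
    obtain \<tau> where \<tau>: "cis \<tau> = cis (Arg w)" "- ((1 - \<kappa>) * pi) < \<tau>" "\<tau> \<le> (1 + \<kappa>) * pi"
    proof -
      have A: "- pi < Arg w" "Arg w \<le> pi" using Arg_bounded by auto
      have c2: "cis (Arg w + 2 * pi) = cis (Arg w)" "cis (Arg w - 2 * pi) = cis (Arg w)"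
        by (simp_all add: complex_eq_iff cos_diff sin_diff)
      have kp: "0 < (1 + \<kappa>) * pi" "0 < (1 - \<kappa>) * pi" using k by auto
      consider "Arg w \<le> - ((1 - \<kappa>) * pi)" | "Arg w > (1 + \<kappa>) * pi"
        | "- ((1 - \<kappa>) * pi) < Arg w" "Arg w \<le> (1 + \<kappa>) * pi" by linarith
      then show ?thesis
      proof cases
        case 1
        show ?thesis
        proof (rule that[of "Arg w + 2 * pi", OF c2(1)])
          show "- ((1 - \<kappa>) * pi) < Arg w + 2 * pi" using A kp pi_gt_zero by linarith
          show "Arg w + 2 * pi \<le> (1 + \<kappa>) * pi" using 1 pr by linarith
        qed
      next
        case 2
        show ?thesis
        proof (rule that[of "Arg w - 2 * pi", OF c2(2)])
          show "- ((1 - \<kappa>) * pi) < Arg w - 2 * pi" using 2 pr by linarith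
          show "Arg w - 2 * pi \<le> (1 + \<kappa>) * pi" using A kp pi_gt_zero by linarith
        qed
      next
        case 3 show ?thesis by (rule that[of "Arg w"]) (use 3 in simp_all)
      qed
    qed
    show ?thesis
    proof (cases "\<tau> \<ge> 0")
      case True
      define \<alpha> where "\<alpha> = \<tau> / (1 + \<kappa>)"
      have \<alpha>: "0 \<le> \<alpha>" "\<alpha> \<le> pi" "(1 + \<kappa>) * \<alpha> = \<tau>" using True \<tau>(3) k by (auto simp: \<alpha>_def field_simps)
      show ?thesis
        using sector_map_polar(1)[OF R \<alpha>(1,2), of \<kappa>] w by (intro exI[of _ "of_real R * cis \<alpha>"]) (simp add: \<alpha>(3) \<tau>(1) Rw)
    next
      case False
      define \<alpha> where "\<alpha> = - \<tau> / (1 - \<kappa>)"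
      have \<alpha>: "0 < \<alpha>" "\<alpha> < pi" "- ((1 - \<kappa>) * \<alpha>) = \<tau>" using False \<tau>(2) k by (auto simp: \<alpha>_def field_simps)
      show ?thesis
        using sector_map_polar(2)[OF R less_imp_le[OF \<alpha>(1)] less_imp_le[OF \<alpha>(2)] \<alpha>(1,2), of \<kappa>] w
        by (intro exI[of _ "of_real R * cis (- \<alpha>)"]) (simp add: \<alpha>(3) \<tau>(1) Rw)
    qed
  qed
qed

lemma sector_map_homeomorphism:
  assumes "\<bar>\<kappa>\<bar> < 1" shows "\<exists>h. homeomorphism UNIV UNIV (sector_map \<kappa>) h"
proof -
  have "continuous_on UNIV (sector_map \<kappa>)" using assms by (intro sector_map_cont) auto
  then obtain h where "homeomorphism UNIV (sector_map \<kappa> ` UNIV) (sector_map \<kappa>) h"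
    using invariance_of_domain_homeomorphism[OF open_UNIV _ _ sector_map_inj[OF assms]] by auto
  then show ?thesis using sector_map_surj[OF assms] by auto
qed

text \<open>The partial derivatives off the real axis, from differentiating
  \<open>z powr (1 + \<kappa>)\<close> and \<open>z (cnj z) powr \<kappa>\<close>. The real axis,
  a null set, is put into the upper case.\<close>

definition sector_dx :: "real \<Rightarrow> complex \<Rightarrow> complex"
  where "sector_dx \<kappa> z = fold_pow \<kappa> z * (if Im z \<ge> 0 then 1 + of_real \<kappa> else 1 + of_real \<kappa> * z / cnj z)"

definition sector_dy :: "real \<Rightarrow> complex \<Rightarrow> complex"
  where "sector_dy \<kappa> z = \<i> * fold_pow \<kappa> z * (if Im z \<ge> 0 then 1 + of_real \<kappa> else 1 - of_real \<kappa> * z / cnj z)"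

lemma fold_pow_upper_deriv:
  assumes "Im z > 0"
  shows "(fold_pow \<kappa> has_field_derivative of_real \<kappa> * fold_pow \<kappa> z / z) (at z)"
proof -
  have z: "- \<i> * z \<notin> \<real>\<^sub>\<le>\<^sub>0" "z \<noteq> 0" using assms by (auto simp: complex_nonpos_Reals_iff)
  have fr: "fold_rot w = - \<i> * w" if "Im w > 0" for w using that by (simp add: fold_rot_def complex_eq_iff)
  have "((\<lambda>w. exp (of_real \<kappa> * (Ln (- \<i> * w) + \<i> * of_real (pi / 2)))) has_field_derivative
      of_real \<kappa> * exp (of_real \<kappa> * (Ln (- \<i> * z) + \<i> * of_real (pi / 2))) / z) (at z)"
    using z by (auto intro!: derivative_eq_intros simp: field_simps)
  then have "(fold_pow \<kappa> has_field_derivative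
      of_real \<kappa> * exp (of_real \<kappa> * (Ln (- \<i> * z) + \<i> * of_real (pi / 2))) / z) (at z)"
    by (rule has_field_derivative_transform_within_open[OF _ open_halfspace_Im_gt[of 0]])
       (use assms fr in \<open>auto simp: fold_pow_def\<close>)
  then show ?thesis using fr[OF assms] by (simp add: fold_pow_def)
qed

lemma sector_map_upper_deriv:
  assumes "Im z > 0"
  shows "(sector_map \<kappa> has_field_derivative fold_pow \<kappa> z * (1 + of_real \<kappa>)) (at z)"
proof -
  have z: "z \<noteq> 0" using assms by auto
  have "((\<lambda>w. w * fold_pow \<kappa> w) has_field_derivative fold_pow \<kappa> z * (1 + of_real \<kappa>)) (at z)"
    by (rule DERIV_cong[OF DERIV_mult[OF DERIV_ident fold_pow_upper_deriv[OF assms]]]) (use z in \<open>simp add: algebra_simps\<close>)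
  then show ?thesis by (simp add: sector_map_def[abs_def])
qed

lemma sector_map_has_derivative:
  assumes "Im z \<noteq> 0"
  shows "(sector_map \<kappa> has_derivative (\<lambda>h. of_real (Re h) * sector_dx \<kappa> z + of_real (Im h) * sector_dy \<kappa> z)) (at z)"
proof (cases "Im z > 0")
  case True
  have "(sector_map \<kappa> has_derivative (\<lambda>h. fold_pow \<kappa> z * (1 + of_real \<kappa>) * h)) (at z)"
    using sector_map_upper_deriv[OF True] by (simp add: has_field_derivative_def)
  moreover have "fold_pow \<kappa> z * (1 + of_real \<kappa>) * h = of_real (Re h) * sector_dx \<kappa> z + of_real (Im h) * sector_dy \<kappa> z" for h
  proof -
    have "fold_pow \<kappa> z * (1 + of_real \<kappa>) * (of_real (Re h) + \<i> * of_real (Im h))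
        = of_real (Re h) * sector_dx \<kappa> z + of_real (Im h) * sector_dy \<kappa> z"
      using True by (simp add: sector_dx_def sector_dy_def algebra_simps)
    then show ?thesis by (simp only: complex_eq[symmetric])
  qed
  ultimately show ?thesis by simp
next
  case False
  then have im: "Im (cnj z) > 0" using assms by simp
  have z: "z \<noteq> 0" using assms by auto
  have fc: "fold_pow \<kappa> (cnj w) = fold_pow \<kappa> w" for w by (simp add: fold_pow_def fold_rot_def)
  have c: "(cnj has_derivative cnj) (at z)" by (rule bounded_linear_imp_has_derivative) (rule bounded_linear_cnj)
  have "(fold_pow \<kappa> has_derivative (\<lambda>h. of_real \<kappa> * fold_pow \<kappa> (cnj z) / cnj z * h)) (at (cnj z))"
    using fold_pow_upper_deriv[OF im] by (simp only: has_field_derivative_def)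
  from has_derivative_compose[OF c this]
  have "(fold_pow \<kappa> has_derivative (\<lambda>h. of_real \<kappa> * fold_pow \<kappa> z / cnj z * cnj h)) (at z)" by (simp add: fc)
  from has_derivative_mult[OF has_derivative_ident this]
  have "(sector_map \<kappa> has_derivative (\<lambda>h. z * (of_real \<kappa> * fold_pow \<kappa> z / cnj z * cnj h) + h * fold_pow \<kappa> z)) (at z)"
    by (simp add: sector_map_def[abs_def])
  moreover have "z * (of_real \<kappa> * fold_pow \<kappa> z / cnj z * cnj h) + h * fold_pow \<kappa> z
      = of_real (Re h) * sector_dx \<kappa> z + of_real (Im h) * sector_dy \<kappa> z" for h
  proof -
    define u where "u = z / cnj z"
    have "z * (of_real \<kappa> * fold_pow \<kappa> z / cnj z * cnj h) + h * fold_pow \<kappa> z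
        = fold_pow \<kappa> z * (of_real \<kappa> * u * cnj h + h)" by (simp add: u_def algebra_simps)
    also have "\<dots> = fold_pow \<kappa> z * (of_real \<kappa> * u * (of_real (Re h) - \<i> * of_real (Im h)) + (of_real (Re h) + \<i> * of_real (Im h)))"
      by (simp add: complex_eq_iff)
    also have "\<dots> = of_real (Re h) * sector_dx \<kappa> z + of_real (Im h) * sector_dy \<kappa> z"
      using False assms by (simp add: sector_dx_def sector_dy_def u_def algebra_simps)
    finally show ?thesis .
  qed
  ultimately show ?thesis by simp
qed

lemma norm_div_cnj_le_1: "norm (z / cnj z) \<le> 1"
  by (cases "z = 0") (auto simp: norm_divide)

lemma sector_partials_norm:
  assumes "\<bar>\<kappa>\<bar> < 1" "z \<noteq> 0"
  shows "norm (sector_dx \<kappa> z) \<le> 2 * norm z powr \<kappa>" "norm (sector_dy \<kappa> z) \<le> 2 * norm z powr \<kappa>"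
proof -
  have b: "norm (1 + of_real \<kappa> :: complex) \<le> 2" "norm (1 + of_real \<kappa> * z / cnj z) \<le> 2" "norm (1 - of_real \<kappa> * z / cnj z) \<le> 2"
  proof -
    have k: "norm (of_real \<kappa> :: complex) \<le> 1" using assms(1) by simp
    have "norm (of_real \<kappa> * (z / cnj z)) \<le> 1 * 1"
      unfolding norm_mult by (intro mult_mono k norm_div_cnj_le_1) auto
    then have q: "norm (of_real \<kappa> * z / cnj z) \<le> 1" by simp
    show "norm (1 + of_real \<kappa> :: complex) \<le> 2" using norm_triangle_ineq[of 1 "of_real \<kappa> :: complex"] k by simp
    show "norm (1 + of_real \<kappa> * z / cnj z) \<le> 2" using norm_triangle_ineq[of 1 "of_real \<kappa> * z / cnj z"] q by simp
    show "norm (1 - of_real \<kappa> * z / cnj z) \<le> 2" using norm_triangle_ineq4[of 1 "of_real \<kappa> * z / cnj z"] q by simp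
  qed
  have f: "norm (fold_pow \<kappa> z) = norm z powr \<kappa>" by (rule fold_pow_norm[OF assms(2)])
  have m: "norm z powr \<kappa> * norm c \<le> 2 * norm z powr \<kappa>" if "norm c \<le> 2" for c :: complex
    using mult_left_mono[OF that, of "norm z powr \<kappa>"] by (simp add: mult.commute)
  show "norm (sector_dx \<kappa> z) \<le> 2 * norm z powr \<kappa>"
    unfolding sector_dx_def norm_mult f by (rule m) (simp only: b split: if_split, simp)
  show "norm (sector_dy \<kappa> z) \<le> 2 * norm z powr \<kappa>"
    unfolding sector_dy_def norm_mult f norm_ii mult_1 by (rule m) (simp only: b split: if_split, simp)
qed

lemma sector_meas [measurable]:
  "fold_pow \<kappa> \<in> borel_measurable borel" "sector_dx \<kappa> \<in> borel_measurable borel" "sector_dy \<kappa> \<in> borel_measurable borel"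
proof -
  show [measurable]: "fold_pow \<kappa> \<in> borel_measurable borel"
    by (rule borel_measurable_continuous_countable_exceptions[of "{0}"]) (use fold_pow_cont in auto)
  have [measurable]: "cnj \<in> borel_measurable borel" by (intro borel_measurable_continuous_onI continuous_intros)
  show "sector_dx \<kappa> \<in> borel_measurable borel" "sector_dy \<kappa> \<in> borel_measurable borel"
    unfolding sector_dx_def[abs_def] sector_dy_def[abs_def] by measurable
qed

lemma powr_integrable_0:
  fixes b :: real assumes b: "b > -1" and R: "R > 0"
  shows "integrable lborel (\<lambda>x. indicat_real {-R..R} x * \<bar>x\<bar> powr b)"
proof -
  have "((\<lambda>x. x powr b) has_integral (R powr (b + 1) / (b + 1) - 0 powr (b + 1) / (b + 1))) {0..R}"
  proof (rule fundamental_theorem_of_calculus_interior)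
    show "continuous_on {0..R} (\<lambda>x. x powr (b + 1) / (b + 1))"
      using b by (intro continuous_intros continuous_on_powr') auto
    fix x assume x: "x \<in> {0<..<R}"
    have "((\<lambda>x. x powr (b + 1) / (b + 1)) has_real_derivative x powr b) (at x)"
    proof -
      have "((\<lambda>x. x powr (b + 1) / (b + 1)) has_real_derivative (b + 1) * x powr (b + 1 - 1) / (b + 1)) (at x)"
        by (rule DERIV_cdivide, rule has_real_derivative_powr) (use x in simp)
      then show ?thesis using b by simp
    qed
    then show "((\<lambda>x. x powr (b + 1) / (b + 1)) has_vector_derivative x powr b) (at x)"
      by (simp add: has_real_derivative_iff_has_vector_derivative)
  qed (use R in auto)
  then have "(\<lambda>x. x powr b) absolutely_integrable_on {0..R}"
    by (intro nonnegative_absolutely_integrable_1) (auto simp: integrable_on_def)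
  then have "integrable lebesgue (\<lambda>x. indicat_real {0..R} x * x powr b)"
    by (simp add: set_integrable_def)
  then have i: "integrable lborel (\<lambda>x. indicat_real {0..R} x * x powr b)"
    by (subst (asm) integrable_completion) auto
  have i': "integrable lborel (\<lambda>x. indicat_real {0..R} (0 + -1 * x) * (0 + -1 * x) powr b)"
    by (rule lborel_integrable_real_affine[OF i]) simp
  have "integrable lborel (\<lambda>x. indicat_real {0..R} x * x powr b + indicat_real {0..R} (0 + -1 * x) * (0 + -1 * x) powr b)"
    by (rule Bochner_Integration.integrable_add[OF i i'])
  moreover have "(\<lambda>x. indicat_real {0..R} x * x powr b + indicat_real {0..R} (0 + -1 * x) * (0 + -1 * x) powr b)
      = (\<lambda>x. indicat_real {-R..R} x * \<bar>x\<bar> powr b)"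
    by (auto simp: indicator_def fun_eq_iff abs_if)
  ultimately show ?thesis by simp
qed

lemma product_integrable:
  fixes a b :: "real \<Rightarrow> real"
  assumes a: "integrable lborel a" and b: "integrable lborel b"
  shows "integrable lborel (\<lambda>z. a (Re z) * b (Im z))"
proof -
  have [measurable]: "a \<in> borel_measurable borel" "b \<in> borel_measurable borel" using a b by auto
  have "integrable (lborel \<Otimes>\<^sub>M lborel) (\<lambda>(x, y). a x * b y)"
  proof (rule lborel_pair.Fubini_integrable)
    show "integrable lborel (\<lambda>x. LINT y|lborel. norm (case (x, y) of (x, y) \<Rightarrow> a x * b y))"
      using a b by (simp add: abs_mult)
    show "AE x in lborel. integrable lborel (\<lambda>y. case (x, y) of (x, y) \<Rightarrow> a x * b y)"
      using b by simp
  qed measurable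
  then show ?thesis
    by (subst lborel_complex, subst integrable_distr_eq) (auto simp: case_prod_unfold)
qed

text \<open>For negative \<open>\<kappa>\<close> the function \<open>|z| powr (2 \<kappa>)\<close> is
  bounded by \<open>|x| powr \<kappa> |y| powr \<kappa>\<close>, a product of integrable functions
  of one variable. This avoids polar coordinates.\<close>

lemma norm_powr_local_integrable:
  assumes k: "\<bar>\<kappa>\<bar> < 1"
  shows "integrable lborel (\<lambda>z. indicat_real (cball (0::complex) R) z * (norm z powr \<kappa>)\<^sup>2)"
proof -
  define R' where "R' = max R 1"
  have R': "R' > 0" "R \<le> R'" by (auto simp: R'_def)
  define a where "a x = indicat_real {-R'..R'} x * \<bar>x\<bar> powr \<kappa>" for x
  have ai: "integrable lborel a" unfolding a_def using k R' by (intro powr_integrable_0) auto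
  have bd: "integrable lborel (\<lambda>z. a (Re z) * a (Im z))" by (rule product_integrable[OF ai ai])
  have ci: "integrable lborel (\<lambda>z::complex. indicat_real (cball 0 R) z *\<^sub>R (R' powr \<kappa>)\<^sup>2)"
    by (rule borel_integrable_compact) auto
  have Re0: "AE z in lborel. Re z \<noteq> 0"
  proof -
    have "negligible {z::complex. z \<bullet> 1 = 0}"
      by (rule negligible_standard_hyperplane) (simp add: Basis_complex_def)
    then have "{z::complex. Re z = 0} \<in> null_sets lebesgue" by (simp add: negligible_iff_null_sets inner_complex_def)
    then have "AE z in lebesgue. z \<notin> {z::complex. Re z = 0}" by (rule AE_not_in)
    then show ?thesis by (simp add: AE_completion_iff)
  qed
  show ?thesis
  proof (rule Bochner_Integration.integrable_bound[OF Bochner_Integration.integrable_add[OF bd ci]])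
    show "(\<lambda>z. indicat_real (cball (0::complex) R) z * (norm z powr \<kappa>)\<^sup>2) \<in> borel_measurable lborel"
      by (intro borel_measurable_times borel_measurable_indicator borel_measurable_power) auto
    show "AE z in lborel. norm (indicat_real (cball (0::complex) R) z * (norm z powr \<kappa>)\<^sup>2)
        \<le> norm (a (Re z) * a (Im z) + indicat_real (cball 0 R) z *\<^sub>R (R' powr \<kappa>)\<^sup>2)"
      using Re0 AE_Im_nonzero
    proof eventually_elim
      case (elim z)
      have a0: "a x \<ge> 0" for x by (simp add: a_def)
      show ?case
      proof (cases "norm z \<le> R")
        case False
        then show ?thesis using a0 by simp
      next
        case True
        have "(norm z powr \<kappa>)\<^sup>2 \<le> a (Re z) * a (Im z) + (R' powr \<kappa>)\<^sup>2"
        proof (cases "\<kappa> \<ge> 0")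
          case True
          then have "norm z powr \<kappa> \<le> R' powr \<kappa>" using \<open>norm z \<le> R\<close> R' by (intro powr_mono2) auto
          then have "(norm z powr \<kappa>)\<^sup>2 \<le> (R' powr \<kappa>)\<^sup>2" by (intro power_mono) auto
          then show ?thesis using mult_nonneg_nonneg[OF a0 a0, of "Re z" "Im z"] by linarith
        next
          case False
          have n: "\<bar>Re z\<bar> \<le> norm z" "\<bar>Im z\<bar> \<le> norm z" by (rule abs_Re_le_cmod, rule abs_Im_le_cmod)
          have "norm z powr \<kappa> \<le> \<bar>Re z\<bar> powr \<kappa>" "norm z powr \<kappa> \<le> \<bar>Im z\<bar> powr \<kappa>"
            using elim n False by (auto intro!: powr_mono2')
          then have "(norm z powr \<kappa>)\<^sup>2 \<le> \<bar>Re z\<bar> powr \<kappa> * \<bar>Im z\<bar> powr \<kappa>"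
            unfolding power2_eq_square by (intro mult_mono) auto
          also have "\<dots> = a (Re z) * a (Im z)" using True n R' by (simp add: a_def indicator_def abs_le_iff)
          finally show ?thesis by (simp add: add_increasing2)
        qed
        then show ?thesis using True by simp
      qed
    qed
  qed
qed

lemma sector_sq_integrable:
  fixes w :: "complex \<Rightarrow> complex"
  assumes k: "\<bar>\<kappa>\<bar> < 1" and [measurable]: "w \<in> borel_measurable borel"
    and bd: "\<And>z. z \<noteq> 0 \<Longrightarrow> norm (w z) \<le> 2 * norm z powr \<kappa>"
  shows "set_integrable lborel (cball 0 R) (\<lambda>z. (norm (w z))\<^sup>2)"
  unfolding set_integrable_def
proof (rule Bochner_Integration.integrable_bound)
  show "integrable lborel (\<lambda>z. 4 * (indicat_real (cball (0::complex) R) z * (norm z powr \<kappa>)\<^sup>2))"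
    by (rule integrable_mult_right[OF norm_powr_local_integrable[OF k]])
  show "(\<lambda>z. indicat_real (cball 0 R) z *\<^sub>R (norm (w z))\<^sup>2) \<in> borel_measurable lborel"
    using assms(2) by (intro borel_measurable_scaleR borel_measurable_indicator borel_measurable_power borel_measurable_norm) auto
  show "AE z in lborel. norm (indicat_real (cball 0 R) z *\<^sub>R (norm (w z))\<^sup>2)
      \<le> norm (4 * (indicat_real (cball 0 R) z * (norm z powr \<kappa>)\<^sup>2))"
    using AE_Im_nonzero
  proof eventually_elim
    case (elim z)
    then have "norm (w z) \<le> 2 * norm z powr \<kappa>" by (intro bd) auto
    then have "(norm (w z))\<^sup>2 \<le> (2 * norm z powr \<kappa>)\<^sup>2" by (intro power_mono) auto
    then show ?case by (simp add: indicator_def power_mult_distrib)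
  qed
qed

lemma locally_square_integrable_lborel:
  assumes [measurable]: "w \<in> borel_measurable borel"
    and i: "\<And>R. set_integrable lborel (cball 0 R) (\<lambda>z. (norm (w z))\<^sup>2)"
  shows "locally_square_integrable_on w UNIV"
  unfolding locally_square_integrable_on_def
proof (intro conjI allI impI)
  have "w \<in> borel_measurable lebesgue" by (rule measurable_completion) simp
  then show "set_borel_measurable lebesgue UNIV w" by (simp add: set_borel_measurable_def)
  fix C :: "complex set" assume C: "compact C \<and> C \<subseteq> UNIV"
  then have "bounded C" by (simp add: compact_imp_bounded)
  from bounded_subset_ballD[OF this, of 0] obtain R where "C \<subseteq> ball 0 R" by blast
  then have R: "C \<subseteq> cball 0 R" using ball_subset_cball by (rule subset_trans)
  have Cb: "C \<in> sets borel" using C by (simp add: borel_compact)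
  have "set_integrable lborel C (\<lambda>z. (norm (w z))\<^sup>2)"
    by (rule set_integrable_subset[OF i[of R]]) (use Cb R in auto)
  then show "set_integrable lebesgue C (\<lambda>z. (norm (w z))\<^sup>2)"
    unfolding set_integrable_def by (subst integrable_completion) auto
qed

text \<open>A continuous function of bounded support may fail to be differentiable at one point, which on
  every vertical line is where it crosses the real axis.\<close>

lemma line_integral_zero:
  fixes F h :: "real \<Rightarrow> complex"
  assumes c: "continuous_on UNIV F" and d: "\<And>t. t \<noteq> 0 \<Longrightarrow> (F has_vector_derivative h t) (at t)"
    and z: "\<And>t. \<bar>t\<bar> > R \<Longrightarrow> F t = 0" "\<And>t. \<bar>t\<bar> > R \<Longrightarrow> h t = 0" and i: "integrable lborel h"
  shows "(LINT t|lborel. h t) = 0"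
proof -
  define r where "r = \<bar>R\<bar> + 1"
  have "(h has_integral F r - F (-r)) {-r..r}"
    by (rule fundamental_theorem_of_calculus_interior_strong[of "{0}"])
       (use continuous_on_subset[OF c] d in \<open>auto simp: r_def\<close>)
  moreover have "F r = 0" "F (-r) = 0" using z(1)[of r] z(1)[of "-r"] by (auto simp: r_def)
  ultimately have "(h has_integral 0) {-r..r}" by simp
  then have "(h has_integral 0) UNIV"
    by (rule has_integral_on_superset) (use z(2) in \<open>auto simp: r_def\<close>)
  then show ?thesis using has_integral_integral_lborel[OF i] has_integral_unique by blast
qed

text \<open>By Fubini it suffices that the integral over almost every horizontal or vertical line vanishes.
  The real and the imaginary axis can be left out, and a line on which \<open>h\<close> is not
  integrable has integral \<open>0\<close> by convention.\<close>

lemma integral_zero_by_lines: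
  fixes h :: "complex \<Rightarrow> complex"
  assumes i: "integrable lborel h"
  shows "(\<And>y. y \<noteq> 0 \<Longrightarrow> integrable lborel (\<lambda>x. h (Complex x y)) \<Longrightarrow> (LINT x|lborel. h (Complex x y)) = 0)
      \<Longrightarrow> (LINT z|lborel. h z) = 0"
    "(\<And>x. x \<noteq> 0 \<Longrightarrow> integrable lborel (\<lambda>y. h (Complex x y)) \<Longrightarrow> (LINT y|lborel. h (Complex x y)) = 0)
      \<Longrightarrow> (LINT z|lborel. h z) = 0"
proof -
  have hm [measurable]: "h \<in> borel_measurable borel" using i by auto
  have nz: "AE x in lborel. x \<noteq> (0::real)" by (rule AE_lborel_singleton)
  {
    assume *: "\<And>y. y \<noteq> 0 \<Longrightarrow> integrable lborel (\<lambda>x. h (Complex x y)) \<Longrightarrow> (LINT x|lborel. h (Complex x y)) = 0"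
    have "(LINT x|lborel. h (Complex x y)) = 0" if "y \<noteq> 0" for y
      using *[OF that] not_integrable_integral_eq by blast
    then have "AE y in lborel. (LINT x|lborel. h (Complex x y)) = 0" using nz by auto
    then have "(LINT y|lborel. LINT x|lborel. h (Complex x y)) = 0" by (rule integral_eq_zero_AE)
    then show "(LINT z|lborel. h z) = 0" using complex_integral_iterated_yx[OF i] by simp
  next
    assume *: "\<And>x. x \<noteq> 0 \<Longrightarrow> integrable lborel (\<lambda>y. h (Complex x y)) \<Longrightarrow> (LINT y|lborel. h (Complex x y)) = 0"
    have "(LINT y|lborel. h (Complex x y)) = 0" if "x \<noteq> 0" for x
      using *[OF that] not_integrable_integral_eq by blast
    then have "AE x in lborel. (LINT y|lborel. h (Complex x y)) = 0" using nz by auto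
    then have "(LINT x|lborel. LINT y|lborel. h (Complex x y)) = 0" by (rule integral_eq_zero_AE)
    then show "(LINT z|lborel. h z) = 0" using complex_integral_iterated_xy[OF i] by simp
  }
qed

text \<open>The map is absolutely continuous on lines: on every horizontal line but the real axis it is
  smooth, on every vertical line but the imaginary axis it is continuous and smooth except at one
  point. So \<open>\<phi> w\<close> plus the derivative of \<open>\<phi>\<close> times the map is
  the derivative along the line of a function of bounded support.\<close>

lemma sector_distr_deriv:
  assumes k: "\<bar>\<kappa>\<bar> < 1"
  shows "distr_deriv_on UNIV 1 (sector_map \<kappa>) (sector_dx \<kappa>)" "distr_deriv_on UNIV \<i> (sector_map \<kappa>) (sector_dy \<kappa>)"
proof -
  let ?g = "sector_map \<kappa>"
  have gc: "continuous_on UNIV ?g" using k by (intro sector_map_cont) auto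
  have [measurable]: "?g \<in> borel_measurable borel" using gc by (rule borel_measurable_continuous_onI)
  have main: "(LINT z:UNIV|lebesgue. dir_deriv v \<phi> z *\<^sub>R ?g z) = - (LINT z:UNIV|lebesgue. \<phi> z *\<^sub>R w z)"
    if t: "test_function_on UNIV \<phi>" and v: "v = 1 \<and> w = sector_dx \<kappa> \<or> v = \<i> \<and> w = sector_dy \<kappa>" for \<phi> v w
  proof -
    note tc = test_function_cont[OF t]
    have \<phi>d: "\<phi> differentiable (at z)" for z
    proof -
      have "Ck_on 1 \<phi> UNIV" using t by (auto simp: test_function_on_def)
      then show ?thesis by simp
    qed
    have [measurable]: "\<phi> \<in> borel_measurable borel" "dir_deriv v \<phi> \<in> borel_measurable borel"
      using tc by (auto intro: borel_measurable_continuous_onI)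
    have wm [measurable]: "w \<in> borel_measurable borel" using v by auto
    have "compact (closure {z. \<phi> z \<noteq> 0})" using t by (simp add: test_function_on_def)
    then have "bounded (closure {z. \<phi> z \<noteq> 0})" by (rule compact_imp_bounded)
    from bounded_subset_ballD[OF this, of 0] obtain R where "closure {z. \<phi> z \<noteq> 0} \<subseteq> ball 0 R" by blast
    then have R: "closure {z. \<phi> z \<noteq> 0} \<subseteq> cball 0 R" using ball_subset_cball by (rule subset_trans)
    have \<phi>0: "\<phi> z = 0" if "norm z > R" for z
    proof (rule ccontr)
      assume "\<phi> z \<noteq> 0"
      then have "z \<in> closure {z. \<phi> z \<noteq> 0}" using closure_subset by fastforce
      then show False using R that by auto
    qed
    have d\<phi>0: "dir_deriv u \<phi> z = 0" if "norm z > R" for z u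
    proof -
      have "((\<lambda>z. 0::real) has_derivative (\<lambda>h. 0)) (at z)" by simp
      then have "(\<phi> has_derivative (\<lambda>h. 0)) (at z)"
        by (rule has_derivative_transform_within_open[of _ _ _ _ "- cball 0 R"]) (use that \<phi>0 in auto)
      then show ?thesis by (rule dir_deriv_eq)
    qed
    have i1: "integrable lborel (\<lambda>z. dir_deriv v \<phi> z *\<^sub>R ?g z)"
      by (rule integrable_cont_supp[OF _ compact_cball[of 0 R]]) (auto intro!: continuous_intros tc gc d\<phi>0)
    have wb: "norm (w z) \<le> 2 * norm z powr \<kappa>" if "z \<noteq> 0" for z
      using v sector_partials_norm[OF k that] by auto
    have wi: "set_integrable lborel (cball 0 R) w"
      by (rule set_integrable_of_square[OF wm sector_sq_integrable[OF k wm wb]])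
    have i2: "integrable lborel (\<lambda>z. \<phi> z *\<^sub>R w z)"
    proof -
      have "bounded (\<phi> ` cball 0 R)"
        by (intro compact_imp_bounded compact_continuous_image continuous_on_subset[OF tc(1)]) auto
      then obtain M where "\<forall>x\<in>\<phi> ` cball 0 R. norm x \<le> M" unfolding bounded_iff by blast
      then have M: "\<And>z. norm z \<le> R \<Longrightarrow> \<bar>\<phi> z\<bar> \<le> M" by simp
      show ?thesis
      proof (rule Bochner_Integration.integrable_bound[OF integrable_mult_right[OF integrable_norm[OF wi[unfolded set_integrable_def]], of M]])
        show "AE z in lborel. norm (\<phi> z *\<^sub>R w z) \<le> norm (M * norm (indicat_real (cball 0 R) z *\<^sub>R w z))"
        proof (rule AE_I2)
          fix z
          show "norm (\<phi> z *\<^sub>R w z) \<le> norm (M * norm (indicat_real (cball 0 R) z *\<^sub>R w z))"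
          proof (cases "norm z \<le> R")
            case True
            then have "\<bar>\<phi> z\<bar> * norm (w z) \<le> \<bar>M\<bar> * norm (w z)" using M[OF True] by (intro mult_right_mono) auto
            then show ?thesis using True by (simp add: abs_mult)
          qed (use \<phi>0 in auto)
        qed
      qed measurable
    qed
    (* The derivative of the product of the test function and the map. *)
    define h where "h z = dir_deriv v \<phi> z *\<^sub>R ?g z + \<phi> z *\<^sub>R w z" for z
    have hi: "integrable lborel h" unfolding h_def by (rule Bochner_Integration.integrable_add[OF i1 i2])
    have h0: "h z = 0" if "norm z > R" for z using that by (simp add: h_def \<phi>0 d\<phi>0)
    have cx: "continuous_on UNIV (\<lambda>s. Complex s y)" and cy: "continuous_on UNIV (\<lambda>s. Complex y s)" for y
      by (auto simp: Complex_eq intro!: continuous_intros)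
    have gx: "((\<lambda>s. ?g (Complex s y)) has_vector_derivative sector_dx \<kappa> (Complex x y)) (at x)"
      and gy: "((\<lambda>s. ?g (Complex x s)) has_vector_derivative sector_dy \<kappa> (Complex x y)) (at y)" if "y \<noteq> 0" for x y
    proof -
      have D: "(?g has_derivative (\<lambda>h. of_real (Re h) * sector_dx \<kappa> (Complex x y) + of_real (Im h) * sector_dy \<kappa> (Complex x y))) (at (Complex x y))"
        using that by (intro sector_map_has_derivative) simp
      show "((\<lambda>s. ?g (Complex s y)) has_vector_derivative sector_dx \<kappa> (Complex x y)) (at x)"
        using has_derivative_compose[OF idm.df(1)[unfolded has_vector_derivative_def] D]
        by (simp add: has_vector_derivative_def scaleR_conv_of_real)
      show "((\<lambda>s. ?g (Complex x s)) has_vector_derivative sector_dy \<kappa> (Complex x y)) (at y)"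
        using has_derivative_compose[OF idm.df(2)[unfolded has_vector_derivative_def] D]
        by (simp add: has_vector_derivative_def scaleR_conv_of_real)
    qed
    have cF: "continuous_on UNIV (\<lambda>z. \<phi> z *\<^sub>R ?g z)" by (intro continuous_intros tc gc)
    have nx: "\<bar>x\<bar> \<le> norm (Complex x y)" and ny: "\<bar>y\<bar> \<le> norm (Complex x y)" for x y
      using abs_Re_le_cmod[of "Complex x y"] abs_Im_le_cmod[of "Complex x y"] by simp_all
    have "(LINT z|lborel. h z) = 0"
    proof (cases "v = 1")
      case True
      then have w: "w = sector_dx \<kappa>" using v by (auto simp: complex_eq_iff)
      show ?thesis
      proof (rule integral_zero_by_lines(1)[OF hi])
        fix y :: real assume y: "y \<noteq> 0" and il: "integrable lborel (\<lambda>x. h (Complex x y))"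
        show "(LINT x|lborel. h (Complex x y)) = 0"
        proof (rule line_integral_zero[where F = "\<lambda>x. \<phi> (Complex x y) *\<^sub>R ?g (Complex x y)" and R = R, OF continuous_on_compose2[OF cF cx] _ _ _ il])
          fix x
          show "((\<lambda>x. \<phi> (Complex x y) *\<^sub>R ?g (Complex x y)) has_vector_derivative h (Complex x y)) (at x)"
            using has_vector_derivative_scaleR[OF dir_deriv_lines(1)[OF \<phi>d] gx[OF y]]
            by (simp add: h_def True w add.commute)
        next
          fix x assume "\<bar>x\<bar> > R"
          then have "norm (Complex x y) > R" using nx[of x y] by linarith
          then show "\<phi> (Complex x y) *\<^sub>R ?g (Complex x y) = 0" "h (Complex x y) = 0" using \<phi>0 h0 by auto
        qed auto
      qed
    next
      case False
      then have w: "v = \<i>" "w = sector_dy \<kappa>" using v by auto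
      show ?thesis
      proof (rule integral_zero_by_lines(2)[OF hi])
        fix x :: real assume x: "x \<noteq> 0" and il: "integrable lborel (\<lambda>y. h (Complex x y))"
        show "(LINT y|lborel. h (Complex x y)) = 0"
        proof (rule line_integral_zero[where F = "\<lambda>y. \<phi> (Complex x y) *\<^sub>R ?g (Complex x y)" and R = R, OF continuous_on_compose2[OF cF cy] _ _ _ il])
          fix y :: real assume "y \<noteq> 0"
          then show "((\<lambda>y. \<phi> (Complex x y) *\<^sub>R ?g (Complex x y)) has_vector_derivative h (Complex x y)) (at y)"
            using has_vector_derivative_scaleR[OF dir_deriv_lines(2)[OF \<phi>d] gy]
            by (simp add: h_def w add.commute)
        next
          fix y assume "\<bar>y\<bar> > R"
          then have "norm (Complex x y) > R" using ny[of y x] by linarith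
          then show "\<phi> (Complex x y) *\<^sub>R ?g (Complex x y) = 0" "h (Complex x y) = 0" using \<phi>0 h0 by auto
        qed auto
      qed
    qed
    then have "(LINT z|lborel. dir_deriv v \<phi> z *\<^sub>R ?g z) = - (LINT z|lborel. \<phi> z *\<^sub>R w z)"
      unfolding h_def using i1 i2 by (simp add: add_eq_0_iff)
    moreover have "(LINT z|lebesgue. dir_deriv v \<phi> z *\<^sub>R ?g z) = (LINT z|lborel. dir_deriv v \<phi> z *\<^sub>R ?g z)"
      "(LINT z|lebesgue. \<phi> z *\<^sub>R w z) = (LINT z|lborel. \<phi> z *\<^sub>R w z)"
      by (rule integral_completion, measurable)+
    ultimately show ?thesis by (simp add: set_lebesgue_integral_def)
  qed
  show "distr_deriv_on UNIV 1 ?g (sector_dx \<kappa>)" "distr_deriv_on UNIV \<i> ?g (sector_dy \<kappa>)"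
    unfolding distr_deriv_on_def using main by blast+
qed

lemma sector_map_qc:
  assumes K: "K \<ge> 1" and k: "\<bar>\<kappa>\<bar> \<le> (K - 1) / (K + 1)"
  shows "sector_map \<kappa> \<in> qc_conformal_maps K"
proof -
  have "(K - 1) / (K + 1) < 1" using K by (simp add: field_simps)
  then have k1: "\<bar>\<kappa>\<bar> < 1" using k by linarith
  have pd: "planar_domain (UNIV :: complex set)" by (simp add: planar_domain_def convex_connected)
  have lx: "locally_square_integrable_on (sector_dx \<kappa>) UNIV" and ly: "locally_square_integrable_on (sector_dy \<kappa>) UNIV"
    using sector_partials_norm[OF k1] sector_meas
    by (auto intro!: locally_square_integrable_lborel sector_sq_integrable[OF k1])
  have dil: "norm ((sector_dx \<kappa> z + \<i> * sector_dy \<kappa> z) / 2) \<le> (K - 1) / (K + 1) * norm ((sector_dx \<kappa> z - \<i> * sector_dy \<kappa> z) / 2)" for z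
  proof (cases "Im z \<ge> 0")
    case True
    have "sector_dx \<kappa> z + \<i> * sector_dy \<kappa> z = 0" using True by (simp add: sector_dx_def sector_dy_def algebra_simps)
    then show ?thesis using K by simp
  next
    case False
    have 1: "(sector_dx \<kappa> z + \<i> * sector_dy \<kappa> z) / 2 = fold_pow \<kappa> z * (of_real \<kappa> * (z / cnj z))"
      "(sector_dx \<kappa> z - \<i> * sector_dy \<kappa> z) / 2 = fold_pow \<kappa> z"
      using False by (simp_all add: sector_dx_def sector_dy_def algebra_simps)
    have "norm (fold_pow \<kappa> z * (of_real \<kappa> * (z / cnj z))) = norm (fold_pow \<kappa> z) * (\<bar>\<kappa>\<bar> * norm (z / cnj z))"
      unfolding norm_mult by simp
    also have "\<dots> \<le> norm (fold_pow \<kappa> z) * ((K - 1) / (K + 1) * 1)"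
      using k K by (intro mult_left_mono mult_mono norm_div_cnj_le_1) auto
    finally show ?thesis unfolding 1 by (simp add: mult.commute)
  qed
  have qc: "quasiconformal K UNIV UNIV (sector_map \<kappa>)"
    unfolding quasiconformal_def
  proof (intro conjI pd sector_map_homeomorphism[OF k1])
    have ae: "AE z in lebesgue. z \<in> UNIV \<longrightarrow> norm ((sector_dx \<kappa> z + \<i> * sector_dy \<kappa> z) / 2)
        \<le> (K - 1) / (K + 1) * norm ((sector_dx \<kappa> z - \<i> * sector_dy \<kappa> z) / 2)"
      by (intro AE_I2 impI dil)
    show "\<exists>gx gy. locally_square_integrable_on gx UNIV \<and> locally_square_integrable_on gy UNIV \<and>
      distr_deriv_on UNIV 1 (sector_map \<kappa>) gx \<and> distr_deriv_on UNIV \<i> (sector_map \<kappa>) gy \<and>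
      (AE z in lebesgue. z \<in> UNIV \<longrightarrow>
        norm ((gx z + \<i> * gy z) / 2) \<le> (K - 1) / (K + 1) * norm ((gx z - \<i> * gy z) / 2))"
      by (rule exI[of _ "sector_dx \<kappa>"], rule exI[of _ "sector_dy \<kappa>"])
         (intro conjI lx ly sector_distr_deriv[OF k1] ae)
  qed
  have "sector_map \<kappa> holomorphic_on upper_half_plane"
    unfolding holomorphic_on_def field_differentiable_def upper_half_plane_def
    using sector_map_upper_deriv has_field_derivative_at_within by blast
  then have "conformal_on (sector_map \<kappa>) upper_half_plane"
    using sector_map_inj[OF k1] by (auto simp: conformal_on_def intro: inj_on_subset)
  with qc show ?thesis by (simp add: qc_conformal_maps_def)
qed

lemma qc_dilatation_exponents:
  fixes K :: real assumes "K \<ge> 1"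
  shows "1 + (K - 1) / (K + 1) = 2 * K / (K + 1)" "1 - (K - 1) / (K + 1) = 2 / (K + 1)"
  using assms by (simp_all add: field_simps)

section \<open>The bounds for the Hardy number and their sharpness\<close>

text \<open>The growth of \<open>g z - g 0\<close> passes to \<open>g\<close> itself at the cost of
  constants, and the exponents \<open>2 K / (K + 1)\<close> and \<open>2 / (K + 1)\<close> are the
  reciprocals of the claimed bounds.\<close>

lemma hardy_bounds:
  assumes K: "K \<ge> 1" and g: "g \<in> qc_conformal_maps K"
  shows "ennreal ((K + 1) / (2 * K)) \<le> hardy_number (g ` upper_half_plane)"
    "hardy_number (g ` upper_half_plane) \<le> ennreal ((K + 1) / 2)"
proof -
  obtain C r0 where r0: "r0 > 0"
    and up0: "\<And>z. norm z \<ge> r0 \<Longrightarrow> ln (norm (g z - g 0)) \<le> 2 * K / (K + 1) * ln (norm z) + C"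
    and lo0: "\<And>z. norm z \<ge> r0 \<Longrightarrow> 2 / (K + 1) * ln (norm z) - C \<le> ln (norm (g z - g 0))"
    using qc_growth[OF K g] by metis
  have cf: "conformal_on g upper_half_plane" using g by (simp add: qc_conformal_maps_def)
  obtain h where hm: "homeomorphism UNIV UNIV g h" using g by (auto simp: qc_conformal_maps_def quasiconformal_def)
  have gc: "continuous_on S g" for S using hm continuous_on_subset by (auto simp: homeomorphism_def)
  have gz: "norm (g z - g 0) > 0" if "z \<noteq> 0" for z
    using hm that by (auto simp: homeomorphism_def) metis
  define e where "e = 2 * K / (K + 1)"
  define e' where "e' = 2 / (K + 1)"
  have e: "e > 0" "e' > 0" using K by (auto simp: e_def e'_def)
  have up: "norm (g z - g 0) \<le> exp C * norm z powr e" if z: "norm z \<ge> r0" for z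
  proof -
    have z0: "z \<noteq> 0" using z r0 by auto
    have "norm (g z - g 0) = exp (ln (norm (g z - g 0)))" using gz[OF z0] by simp
    also have "\<dots> \<le> exp (e * ln (norm z) + C)" using up0[OF z] by (simp add: e_def)
    also have "\<dots> = exp C * norm z powr e" using z0 by (simp add: exp_add powr_def)
    finally show ?thesis .
  qed
  have lo: "exp (- C) * norm z powr e' \<le> norm (g z - g 0)" if z: "norm z \<ge> r0" for z
  proof -
    have z0: "z \<noteq> 0" using z r0 by auto
    have "exp (- C) * norm z powr e' = exp (e' * ln (norm z) - C)" using z0 by (simp add: exp_diff exp_minus powr_def field_simps)
    also have "\<dots> \<le> exp (ln (norm (g z - g 0)))" using lo0[OF z] by (simp add: e'_def)
    also have "\<dots> = norm (g z - g 0)" using gz[OF z0] by simp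
    finally show ?thesis .
  qed
  have "bounded (g ` cball 0 r0)" by (intro compact_imp_bounded compact_continuous_image gc) simp
  then obtain b where "\<forall>x\<in>g ` cball 0 r0. norm x \<le> b" unfolding bounded_iff by blast
  then have b: "\<And>z. norm z \<le> r0 \<Longrightarrow> norm (g z) \<le> b" by simp
  define M where "M = max b 0 + norm (g 0) + exp C"
  have M: "M > 0" by (simp add: M_def add_nonneg_pos)
  have "norm (g z) \<le> M * (1 + norm z) powr e" for z
  proof -
    have p1: "1 \<le> (1 + norm z) powr e" using e by (intro ge_one_powr_ge_zero) auto
    show ?thesis
    proof (cases "norm z \<le> r0")
      case True
      have "norm (g z) \<le> M * 1" using b[OF True] by (auto simp: M_def add_increasing2)
      also have "\<dots> \<le> M * (1 + norm z) powr e" using M p1 by (intro mult_left_mono) auto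
      finally show ?thesis .
    next
      case False
      have "norm (g z) \<le> norm (g 0) + norm (g z - g 0)" using norm_triangle_ineq[of "g 0" "g z - g 0"] by simp
      also have "\<dots> \<le> norm (g 0) * 1 + exp C * norm z powr e" using up[of z] False by simp
      also have "\<dots> \<le> norm (g 0) * (1 + norm z) powr e + exp C * (1 + norm z) powr e"
        using p1 e by (intro add_mono mult_left_mono powr_mono2) auto
      also have "\<dots> = (norm (g 0) + exp C) * (1 + norm z) powr e" by (simp add: distrib_right)
      also have "\<dots> \<le> M * (1 + norm z) powr e" by (intro mult_right_mono) (auto simp: M_def)
      finally show ?thesis .
    qed
  qed
  from hardy_number_lower[OF cf e(1) M this]
  show "ennreal ((K + 1) / (2 * K)) \<le> hardy_number (g ` upper_half_plane)" using K by (simp add: e_def)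
  define N where "N = 2 * norm (g 0) * exp C"
  define r where "r = max r0 ((N + 1) powr (1 / e'))"
  have "exp (- C) / 2 * y powr e' \<le> norm (g (\<i> * of_real y))" if y: "y \<ge> r" for y
  proof -
    have y0: "y \<ge> r0" "y > 0" using y r0 by (auto simp: r_def)
    have N0: "N \<ge> 0" by (simp add: N_def)
    have "((N + 1) powr (1 / e')) powr e' \<le> y powr e'" using y e by (intro powr_mono2) (auto simp: r_def)
    then have "N \<le> y powr e'" using e N0 by (simp add: powr_powr)
    then have "exp (- C) / 2 * N \<le> exp (- C) / 2 * y powr e'" by (intro mult_left_mono) auto
    moreover have "exp (- C) / 2 * N = norm (g 0)" by (simp add: N_def exp_minus field_simps)
    moreover have "exp (- C) * norm (\<i> * of_real y) powr e' \<le> norm (g (\<i> * of_real y) - g 0)"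
      by (rule lo) (use y0 in \<open>simp add: norm_mult\<close>)
    then have "exp (- C) * y powr e' \<le> norm (g (\<i> * of_real y) - g 0)" using y0 by (simp add: norm_mult)
    moreover have "norm (g (\<i> * of_real y) - g 0) \<le> norm (g (\<i> * of_real y)) + norm (g 0)" by (rule norm_triangle_ineq4)
    ultimately show ?thesis by linarith
  qed
  from hardy_number_upper[OF cf _ e(2) this]
  show "hardy_number (g ` upper_half_plane) \<le> ennreal ((K + 1) / 2)" by (simp add: e'_def)
qed

text \<open>The exponent \<open>\<kappa> = (K - 1) / (K + 1)\<close> opens the half-plane to a sector of
  angle \<open>2 K \<pi> / (K + 1)\<close>.\<close>

lemma hardy_number_wide_sector:
  assumes K: "K \<ge> 1"
  obtains g where "g \<in> qc_conformal_maps K" "hardy_number (g ` upper_half_plane) \<le> ennreal ((K + 1) / (2 * K))"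
proof -
  define \<kappa> where "\<kappa> = (K - 1) / (K + 1)"
  have k: "\<kappa> \<ge> 0" using K by (simp add: \<kappa>_def)
  have q: "sector_map \<kappa> \<in> qc_conformal_maps K" 
    by (rule sector_map_qc[OF K]) (simp only: abs_of_nonneg[OF k], simp add: \<kappa>_def)
  then have cf: "conformal_on (sector_map \<kappa>) upper_half_plane" by (simp add: qc_conformal_maps_def)
  have "hardy_number (sector_map \<kappa> ` upper_half_plane) \<le> ennreal (1 / (1 + \<kappa>))"
  proof (rule hardy_number_upper[OF cf zero_less_one])
    fix y :: real assume "y \<ge> 1"
    then show "1 * y powr (1 + \<kappa>) \<le> norm (sector_map \<kappa> (\<i> * of_real y))"
      using sector_map_norm[of "\<i> * of_real y" \<kappa>] by (simp add: norm_mult)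
  qed (use k in simp)
  moreover have "1 / (1 + \<kappa>) = (K + 1) / (2 * K)" unfolding \<kappa>_def qc_dilatation_exponents[OF K] by simp
  ultimately show thesis using that q by simp
qed

text \<open>The exponent \<open>\<kappa> = - (K - 1) / (K + 1)\<close> closes the half-plane to a sector of
  angle \<open>2 \<pi> / (K + 1)\<close>.\<close>

lemma hardy_number_narrow_sector:
  assumes K: "K \<ge> 1"
  obtains g where "g \<in> qc_conformal_maps K" "ennreal ((K + 1) / 2) \<le> hardy_number (g ` upper_half_plane)"
proof -
  define \<kappa> where "\<kappa> = - ((K - 1) / (K + 1))"
  have k: "\<bar>\<kappa>\<bar> = (K - 1) / (K + 1)" using K by (simp add: \<kappa>_def)
  have e: "1 + \<kappa> = 2 / (K + 1)" using qc_dilatation_exponents(2)[OF K] by (simp add: \<kappa>_def)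
  have e0: "1 + \<kappa> > 0" using K by (simp add: e)
  have q: "sector_map \<kappa> \<in> qc_conformal_maps K" using k by (intro sector_map_qc[OF K]) simp
  then have cf: "conformal_on (sector_map \<kappa>) upper_half_plane" by (simp add: qc_conformal_maps_def)
  have "ennreal (1 / (1 + \<kappa>)) \<le> hardy_number (sector_map \<kappa> ` upper_half_plane)"
  proof (rule hardy_number_lower[OF cf e0 zero_less_one])
    fix z assume "z \<in> upper_half_plane"
    then have "z \<noteq> 0" by (auto simp: upper_half_plane_def)
    then show "norm (sector_map \<kappa> z) \<le> 1 * (1 + norm z) powr (1 + \<kappa>)"
      using e0 by (simp add: sector_map_norm powr_mono2)
  qed
  then show thesis using that q by (simp add: e)
qed

theorem theorem4p4:
  fixes K :: real
  assumes "K \<ge> 1"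
  shows "(\<forall>g \<in> qc_conformal_maps K.
            ennreal ((K + 1) / (2 * K)) \<le> hardy_number (g ` upper_half_plane) \<and>
            hardy_number (g ` upper_half_plane) \<le> ennreal ((K + 1) / 2)) \<and>
         (\<forall>c > ennreal ((K + 1) / (2 * K)).
            \<not> (\<forall>g \<in> qc_conformal_maps K. c \<le> hardy_number (g ` upper_half_plane))) \<and>
         (\<forall>c < ennreal ((K + 1) / 2).
            \<not> (\<forall>g \<in> qc_conformal_maps K. hardy_number (g ` upper_half_plane) \<le> c))"
proof (intro conjI ballI allI impI)
  fix g assume "g \<in> qc_conformal_maps K"
  then show "ennreal ((K + 1) / (2 * K)) \<le> hardy_number (g ` upper_half_plane)"
    "hardy_number (g ` upper_half_plane) \<le> ennreal ((K + 1) / 2)"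
    by (rule hardy_bounds[OF assms])+
next
  fix c assume c: "ennreal ((K + 1) / (2 * K)) < c"
  obtain g where "g \<in> qc_conformal_maps K" "hardy_number (g ` upper_half_plane) \<le> ennreal ((K + 1) / (2 * K))"
    by (rule hardy_number_wide_sector[OF assms])
  with c show "\<not> (\<forall>g \<in> qc_conformal_maps K. c \<le> hardy_number (g ` upper_half_plane))"
    by (meson leD order_trans)
next
  fix c assume c: "c < ennreal ((K + 1) / 2)"
  obtain g where "g \<in> qc_conformal_maps K" "ennreal ((K + 1) / 2) \<le> hardy_number (g ` upper_half_plane)"
    by (rule hardy_number_narrow_sector[OF assms])
  with c show "\<not> (\<forall>g \<in> qc_conformal_maps K. hardy_number (g ` upper_half_plane) \<le> c)"
    by (meson leD order_trans)
qed

end
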